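(* Let $n\ge2$, let $F_n$ be the free group with free basis $A=\{a_1,\ldots,a_n\}$, let $S$ be a finite symmetric generating set of $F_n$, and let $s\in S$. Assume that either (a) $\#^{\pm}_a(s)=2$ for all $a\in A$, or (b) $n=2$. Then $\mathrm{Cay}(F_n;\{s,s^{-1}\})$ is a hamiltonian circle in $\mathrm{Cay}(F_n;S)$ if and only if some automorphism of $F_n$ carries $s$ to $a_1^2a_2^2\cdots a_n^2$ or (when $n$ is even) to $[a_1,a_2][a_3,a_4]\cdots[a_{n-1},a_n]$.
   Context: $[x,y]=xyx^{-1}y^{-1}$. For $a\in A$ and $g\in F_n$, $\#^{\pm}_a(g)$ is the number of occurrences of $a$ plus the number of occurrences of $a^{-1}$ in the reduced word representing $g$. For symmetric $S\subseteq G$, $\mathrm{Cay}(G;S)$ has vertex set $G$, with $x$ adjacent to $y$ iff $x^{-1}y\in S$. For a connected locally finite graph $X$, $|X|$ is its Freudenthal compactification (add one point per end), and a hamiltonian circle is a subspace of $|X|$ homeomorphic to $S^1$ containing all vertices; a spanning subgraph is called a hamiltonian circle if its closure in $|X|$ is one. *)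

theory Defs
  imports "HOL-Analysis.Analysis" "HOL-Algebra.Generated_Groups"
begin

section \<open>Free groups\<close>

text \<open>A letter \<open>(a, True)\<close> stands for the generator \<open>a\<close>, and \<open>(a, False)\<close> for its formal inverse.
  The free group on \<open>A\<close> consists of the reduced words over \<open>A\<close>.\<close>

type_synonym 'a word = "('a \<times> bool) list"

definition inv_letter :: "'a \<times> bool \<Rightarrow> 'a \<times> bool" where
  "inv_letter x = (fst x, \<not> snd x)"

definition reduced :: "'a word \<Rightarrow> bool" where
  "reduced w \<longleftrightarrow> successively (\<lambda>x y. y \<noteq> inv_letter x) w"

fun red_cons :: "'a \<times> bool \<Rightarrow> 'a word \<Rightarrow> 'a word" where
  "red_cons x [] = [x]"
| "red_cons x (y # w) = (if y = inv_letter x then w else x # y # w)"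

definition reduce :: "'a word \<Rightarrow> 'a word" where
  "reduce w = foldr red_cons w []"

definition free_group :: "'a set \<Rightarrow> 'a word monoid" where
  "free_group A =
     \<lparr>carrier = {w. reduced w \<and> fst ` set w \<subseteq> A}, mult = (\<lambda>u v. reduce (u @ v)), one = []\<rparr>"

definition free_gen :: "'a \<Rightarrow> 'a word" where
  "free_gen a = [(a, True)]"

definition letter_occ :: "'a \<Rightarrow> 'a word \<Rightarrow> nat" where
  "letter_occ a w = count_list w (a, True) + count_list w (a, False)"

lemma inv_letter_invol [simp]: "inv_letter (inv_letter x) = x"
  by (simp add: inv_letter_def)

lemma fst_inv_letter [simp]: "fst (inv_letter x) = fst x"
  by (simp add: inv_letter_def)

lemma inv_letter_neq [simp]: "inv_letter x \<noteq> x" "x \<noteq> inv_letter x"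
  by (simp_all add: inv_letter_def prod_eq_iff)

lemma reduced_Nil [simp]: "reduced []"
  by (simp add: reduced_def)

lemma reduced_Cons:
  "reduced (x # w) \<longleftrightarrow> reduced w \<and> (w = [] \<or> hd w \<noteq> inv_letter x)"
  by (cases w) (auto simp: reduced_def)

lemma reduced_red_cons: "reduced w \<Longrightarrow> reduced (red_cons x w)"
  by (cases w) (auto simp: reduced_Cons)

lemma set_red_cons: "set (red_cons x w) \<subseteq> insert x (set w)"
  by (cases w) auto

lemma red_cons_inv:
  assumes "reduced w"
  shows "red_cons (inv_letter x) (red_cons x w) = w"
proof (cases w)
  case (Cons y ys)
  with assms show ?thesis
    by (cases ys) (auto simp: reduced_Cons)
qed simp

lemma reduced_foldr: "reduced v \<Longrightarrow> reduced (foldr red_cons u v)"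
  by (induction u) (auto simp: reduced_red_cons)

lemma set_foldr_red_cons: "set (foldr red_cons u v) \<subseteq> set u \<union> set v"
proof (induction u)
  case (Cons x u)
  then show ?case using set_red_cons[of x "foldr red_cons u v"] by auto
qed simp

lemma reduce_reduced: "reduced w \<Longrightarrow> reduce w = w"
proof (induction w)
  case (Cons x w)
  then show ?case by (cases w) (auto simp: reduced_Cons reduce_def)
qed (simp add: reduce_def)

lemma foldr_red_cons_red_cons:
  assumes "reduced v"
  shows "foldr red_cons (red_cons x u) v = red_cons x (foldr red_cons u v)"
proof (cases u)
  case (Cons y ys)
  then show ?thesis
    using red_cons_inv[OF reduced_foldr[OF assms, of ys], of "inv_letter x"] by auto
qed simp

lemma foldr_red_cons_assoc:
  assumes "reduced w"
  shows "foldr red_cons (foldr red_cons u v) w = foldr red_cons u (foldr red_cons v w)"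
  by (induction u) (auto simp: foldr_red_cons_red_cons[OF assms])

lemma reduce_append: "reduced v \<Longrightarrow> reduce (u @ v) = foldr red_cons u v"
  using reduce_reduced[of v] by (simp add: reduce_def)

lemma foldr_red_cons_inverse:
  "reduced v \<Longrightarrow> foldr red_cons (rev (map inv_letter u)) (foldr red_cons u v) = v"
  by (induction u arbitrary: v) (auto simp: red_cons_inv reduced_foldr)

lemma reduced_inverse: "reduced w \<Longrightarrow> reduced (rev (map inv_letter w))"
  unfolding reduced_def
  by (simp add: successively_rev successively_map)
     (erule successively_mono, auto)

lemma group_free_group: "group (free_group A)"
proof (rule groupI)
  fix u v assume "u \<in> carrier (free_group A)" "v \<in> carrier (free_group A)"
  then show "u \<otimes>\<^bsub>free_group A\<^esub> v \<in> carrier (free_group A)"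
    using set_foldr_red_cons[of u v]
    by (fastforce simp: free_group_def reduce_append reduced_foldr)
next
  fix u v w
  assume "u \<in> carrier (free_group A)" "v \<in> carrier (free_group A)" "w \<in> carrier (free_group A)"
  then show "u \<otimes>\<^bsub>free_group A\<^esub> v \<otimes>\<^bsub>free_group A\<^esub> w
           = u \<otimes>\<^bsub>free_group A\<^esub> (v \<otimes>\<^bsub>free_group A\<^esub> w)"
    by (simp add: free_group_def reduce_append reduced_foldr foldr_red_cons_assoc)
next
  fix u assume "u \<in> carrier (free_group A)"
  then show "\<exists>v\<in>carrier (free_group A). v \<otimes>\<^bsub>free_group A\<^esub> u = \<one>\<^bsub>free_group A\<^esub>"
    using foldr_red_cons_inverse[of "[]" u] reduce_reduced[of u]
    by (intro bexI[of _ "rev (map inv_letter u)"])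
       (auto simp: free_group_def reduce_append reduced_inverse image_image reduce_def[of u])
qed (auto simp: free_group_def reduce_reduced)

definition commutator :: "('g, 'm) monoid_scheme \<Rightarrow> 'g \<Rightarrow> 'g \<Rightarrow> 'g" where
  "commutator G x y = x \<otimes>\<^bsub>G\<^esub> y \<otimes>\<^bsub>G\<^esub> inv\<^bsub>G\<^esub> x \<otimes>\<^bsub>G\<^esub> inv\<^bsub>G\<^esub> y"

definition list_product :: "('g, 'm) monoid_scheme \<Rightarrow> 'g list \<Rightarrow> 'g" where
  "list_product G xs = foldr (\<otimes>\<^bsub>G\<^esub>) xs \<one>\<^bsub>G\<^esub>"


section \<open>Graphs and Cayley graphs\<close>

text \<open>Undirected graphs, given by a symmetric adjacency relation on the vertices. Loops are
  immaterial: a reflexive adjacency adds no point to the geometric realization below.\<close>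

record 'v graph =
  verts :: "'v set"
  adj :: "'v \<Rightarrow> 'v \<Rightarrow> bool"

definition spanning_subgraph :: "'v graph \<Rightarrow> 'v graph \<Rightarrow> bool" where
  "spanning_subgraph Y X \<longleftrightarrow> verts Y = verts X \<and> (\<forall>x y. adj Y x y \<longrightarrow> adj X x y)"

definition cayley_graph :: "('g, 'm) monoid_scheme \<Rightarrow> 'g set \<Rightarrow> 'g graph" where
  "cayley_graph G S =
     \<lparr>verts = carrier G,
      adj = (\<lambda>x y. x \<in> carrier G \<and> y \<in> carrier G \<and> inv\<^bsub>G\<^esub> x \<otimes>\<^bsub>G\<^esub> y \<in> S)\<rparr>"


section \<open>Ends\<close>

definition connected_avoiding :: "'v graph \<Rightarrow> 'v set \<Rightarrow> 'v \<Rightarrow> 'v \<Rightarrow> bool" where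
  "connected_avoiding X K u v \<longleftrightarrow>
     u \<in> verts X - K \<and> v \<in> verts X - K \<and>
     (\<lambda>x y. adj X x y \<and> x \<in> verts X - K \<and> y \<in> verts X - K)\<^sup>*\<^sup>* u v"

definition ray :: "'v graph \<Rightarrow> (nat \<Rightarrow> 'v) \<Rightarrow> bool" where
  "ray X r \<longleftrightarrow> inj r \<and> range r \<subseteq> verts X \<and> (\<forall>i. adj X (r i) (r (Suc i)))"

text \<open>Two rays are equivalent if no finite set of vertices separates their tails.\<close>

definition ray_equiv :: "'v graph \<Rightarrow> ((nat \<Rightarrow> 'v) \<times> (nat \<Rightarrow> 'v)) set" where
  "ray_equiv X = {(r, r'). ray X r \<and> ray X r' \<and>
     (\<forall>K. finite K \<and> K \<subseteq> verts X \<longrightarrow>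
        (\<exists>N. \<forall>i\<ge>N. \<forall>j\<ge>N. connected_avoiding X K (r i) (r' j)))}"

definition ends :: "'v graph \<Rightarrow> (nat \<Rightarrow> 'v) set set" where
  "ends X = {r. ray X r} // ray_equiv X"

text \<open>The vertex set of the component of \<open>X - K\<close> in which all rays of the end \<open>\<omega>\<close> have a tail.\<close>

definition end_component :: "'v graph \<Rightarrow> 'v set \<Rightarrow> (nat \<Rightarrow> 'v) set \<Rightarrow> 'v set" where
  "end_component X K \<omega> = {v. \<exists>r\<in>\<omega>. \<exists>N. \<forall>i\<ge>N. connected_avoiding X K (r i) v}"


section \<open>The Freudenthal compactification\<close>

text \<open>Points of the geometric realization are given in barycentric coordinates:
  \<open>edge_point u v t\<close> is the point \<open>(1 - t) u + t v\<close> of the edge \<open>uv\<close>. It equals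
  \<open>edge_point v u (1 - t)\<close>, and \<open>edge_point v v t\<close> is the vertex \<open>v\<close>.\<close>

definition edge_point :: "'v \<Rightarrow> 'v \<Rightarrow> real \<Rightarrow> 'v \<Rightarrow> real" where
  "edge_point u v t = (\<lambda>w. (1 - t) * of_bool (w = u) + t * of_bool (w = v))"

definition vertex_point :: "'v \<Rightarrow> 'v \<Rightarrow> real" where
  "vertex_point v = (\<lambda>w. of_bool (w = v))"

definition realization :: "'v graph \<Rightarrow> ('v \<Rightarrow> real) set" where
  "realization X =
     vertex_point ` verts X \<union> {edge_point u v t | u v t. adj X u v \<and> t \<in> {0..1}}"

text \<open>The 1-complex carries the weak topology: a set is open iff its trace on every edge is.\<close>

definition open_in_realization :: "'v graph \<Rightarrow> ('v \<Rightarrow> real) set \<Rightarrow> bool" where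
  "open_in_realization X U \<longleftrightarrow> U \<subseteq> realization X \<and>
     (\<forall>u v. adj X u v \<longrightarrow> openin (top_of_set {0..1}) {t \<in> {0..1}. edge_point u v t \<in> U})"

datatype 'v fpoint = Point "'v \<Rightarrow> real" | End "(nat \<Rightarrow> 'v) set"

text \<open>The basic neighbourhood of the end \<open>\<omega>\<close> determined by a finite vertex set \<open>K\<close>: the component
  \<open>C\<close> of \<open>X - K\<close> in which \<open>\<omega>\<close> lives, the inner points of the edges between \<open>K\<close> and \<open>C\<close>, and all
  ends living in \<open>C\<close>. The first two together are the points having a positive coordinate at some
  vertex of \<open>C\<close>.\<close>

definition end_nbhd :: "'v graph \<Rightarrow> 'v set \<Rightarrow> (nat \<Rightarrow> 'v) set \<Rightarrow> 'v fpoint set" where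
  "end_nbhd X K \<omega> =
     Point ` {p \<in> realization X. \<exists>v\<in>end_component X K \<omega>. p v > 0} \<union>
     End ` {\<omega>' \<in> ends X. end_component X K \<omega>' = end_component X K \<omega>}"

definition freudenthal :: "'v graph \<Rightarrow> 'v fpoint topology" where
  "freudenthal X = topology_generated_by
     ({Point ` U | U. open_in_realization X U} \<union>
      {end_nbhd X K \<omega> | K \<omega>. finite K \<and> K \<subseteq> verts X \<and> \<omega> \<in> ends X})"

lemma topspace_freudenthal: "topspace (freudenthal X) = Point ` realization X \<union> End ` ends X"
proof -
  have "{t \<in> {0..1}. edge_point u v t \<in> realization X} = {0..1}" if "adj X u v" for u v
    using that by (auto simp: realization_def)
  then have "open_in_realization X (realization X)"
    by (auto simp: open_in_realization_def)
  moreover have "U \<subseteq> realization X" if "open_in_realization X U" for U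
    using that by (simp add: open_in_realization_def)
  moreover have "\<omega> \<in> ends X \<Longrightarrow> End \<omega> \<in> end_nbhd X {} \<omega>" for \<omega>
    by (simp add: end_nbhd_def)
  ultimately show ?thesis
    unfolding freudenthal_def topology_generated_by_topspace
    by (intro equalityI) (fastforce simp: end_nbhd_def, blast)
qed


section \<open>Hamiltonian circles\<close>

definition hamiltonian_circle :: "'v graph \<Rightarrow> 'v fpoint set \<Rightarrow> bool" where
  "hamiltonian_circle X C \<longleftrightarrow>
     C \<subseteq> topspace (freudenthal X) \<and> Point ` vertex_point ` verts X \<subseteq> C \<and>
     subtopology (freudenthal X) C homeomorphic_space top_of_set (sphere (0::complex) 1)"

definition hamiltonian_circle_subgraph :: "'v graph \<Rightarrow> 'v graph \<Rightarrow> bool" where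
  "hamiltonian_circle_subgraph Y X \<longleftrightarrow>
     spanning_subgraph Y X \<and>
     hamiltonian_circle X (freudenthal X closure_of (Point ` realization Y))"

end

theory Submission
  imports Defs
begin

text \<open>Transport the problem by an automorphism \<open>\<phi>\<close> and let \<open>t = \<phi> s\<close>. The cosets of \<open>\<langle>s\<rangle>\<close> are lines in
  the tree \<open>Cay(F; A)\<close> that spell powers of \<open>t\<close>. The lines through a vertex form a copy of the Whitehead
  graph of \<open>t\<close> on the letters of \<open>A\<close> and their inverses: each line joins the two directions in which
  it leaves the vertex.

  If every generator occurs twice in \<open>t\<close> and this graph is connected, then it is a cycle. Cutting an
  interval recursively along the tree, in the cyclic order of the links, gives a continuous bijection
  from the circle to the closure of the lines. The standard words \<open>a\<^sub>1\<^sup>2 \<cdots> a\<^sub>n\<^sup>2\<close> and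
  \<open>[a\<^sub>1, a\<^sub>2] \<cdots> [a\<^bsub>n-1\<^esub>, a\<^sub>n]\<close> have these properties.

  Conversely, if some generator is missing from \<open>t\<close>, then the closure is disconnected. A word in which
  every generator occurs twice is carried by an automorphism to a standard word or to a word missing a
  generator, as in the classification of closed surfaces. For \<open>n = 2\<close> choose \<open>\<phi>\<close> such that \<open>t\<close> has
  minimal length. Then \<open>t\<close> is cyclically reduced and its Whitehead graph has no cut vertex, since
  otherwise a Whitehead move would shorten \<open>t\<close>. If three lines left a vertex through the same letter,
  removing the vertices on two of them would leave the closure connected, because the absence of cut
  vertices keeps all ends together, whereas a circle falls apart. Hence every generator occurs exactly
  twice.\<close>

section \<open>Words and automorphisms of free groups\<close>

text \<open>The generating set \<open>S\<close> is arbitrary, while the arguments live on the tree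
  of the basis. The bridge: right multiplication by an element of \<open>S\<close> changes only
  boundedly many final letters of a reduced word. So the branch of the tree behind a word has finite
  boundary in \<open>Cay(F; S)\<close>, ends become infinite reduced words, and branches form
  neighbourhood bases of ends. An edge of a line passes several tree vertices. It is therefore cut
  into as many equal segments as \<open>t\<close> has letters, one for each tree vertex it passes,
  and a segment is an edge of the copy of the Whitehead graph there. At a vertex other than the root
  the direction back gets no piece, so the pieces begin and end with segments. Hence nested
  intervals shrink strictly on both sides, which gives continuity at the ends and lets the map reach
  them. For the converse, a separation of the closure minus some vertices is treated as a
  two-colouring of the ends. A line that avoids the removed vertices has equally coloured ends, and
  the absence of cut vertices carries a common colour from deep branches back towards the
  root.\<close>

definition winv :: "'a word \<Rightarrow> 'a word" where
  "winv w = rev (map inv_letter w)"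

lemma winv_Nil [simp]: "winv [] = []"
  and winv_append [simp]: "winv (u @ v) = winv v @ winv u"
  and winv_winv [simp]: "winv (winv w) = w"
  and length_winv [simp]: "length (winv w) = length w"
  and winv_single [simp]: "winv [x] = [inv_letter x]"
  by (simp_all add: winv_def rev_map o_def)

lemma winv_Cons: "winv (x # w) = winv w @ [inv_letter x]"
  by (simp add: winv_def)

lemma fst_set_winv [simp]: "fst ` set (winv w) = fst ` set w"
  by (simp add: winv_def image_image)

lemma inv_letter_eq_iff [simp]: "inv_letter x = inv_letter y \<longleftrightarrow> x = y"
  by (metis inv_letter_invol)

lemma fst_eq_letter: "fst x = fst y \<longleftrightarrow> x = y \<or> x = inv_letter y"
  by (cases x; cases y) (auto simp: inv_letter_def)

lemma reduced_winv: "reduced w \<Longrightarrow> reduced (winv w)"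
  unfolding winv_def by (rule reduced_inverse)

abbreviation act :: "'a word \<Rightarrow> 'a word \<Rightarrow> 'a word" where
  "act u v \<equiv> foldr red_cons u v"

lemma reduced_reduce [simp]: "reduced (reduce w)"
  by (simp add: reduce_def reduced_foldr)

lemma reduce_append_act: "reduce (u @ v) = act u (reduce v)"
  by (simp add: reduce_def)

lemma reduce_Cons: "reduce (x # v) = red_cons x (reduce v)"
  by (simp add: reduce_def)

lemma reduce_Nil [simp]: "reduce [] = []"
  by (simp add: reduce_def)

lemma reduce_reduce [simp]: "reduce (reduce u) = reduce u"
  by (simp add: reduce_reduced)

lemma reduce_append_right [simp]: "reduce (u @ reduce v) = reduce (u @ v)"
  by (simp add: reduce_append_act)

lemma reduce_append_left [simp]: "reduce (reduce u @ v) = reduce (u @ v)"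
  using foldr_red_cons_assoc[of "reduce v" u "[]"]
  by (simp add: reduce_append_act) (simp add: reduce_def)

lemma act_winv_act: "reduced v \<Longrightarrow> act (winv u) (act u v) = v"
  unfolding winv_def by (rule foldr_red_cons_inverse)

lemma act_act_winv: "reduced v \<Longrightarrow> act u (act (winv u) v) = v"
  using act_winv_act[of v "winv u"] by simp

lemma reduce_winv_cancel [simp]:
  "reduce (u @ winv x @ x @ v) = reduce (u @ v)" "reduce (u @ x @ winv x @ v) = reduce (u @ v)"
  "reduce (winv x @ x @ v) = reduce v" "reduce (x @ winv x @ v) = reduce v"
  "reduce (u @ winv x @ x) = reduce u" "reduce (u @ x @ winv x) = reduce u"
  "reduce (winv x @ x) = []" "reduce (x @ winv x) = []"
  by (simp_all add: reduce_append_act act_winv_act act_act_winv)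
     (simp_all add: act_winv_act act_act_winv reduce_def)

lemma set_reduce: "set (reduce w) \<subseteq> set w"
  using set_foldr_red_cons[of w "[]"] by (simp add: reduce_def)

lemma reduce_winv: "reduce (winv w) = winv (reduce w)"
proof -
  have "reduce (winv w) = reduce (winv (reduce w) @ reduce w @ winv w)"
    using reduce_winv_cancel(3)[of "reduce w" "winv w"] by simp
  also have "\<dots> = reduce (winv (reduce w) @ reduce (reduce w @ winv w))"
    by (simp only: reduce_append_right)
  also have "\<dots> = winv (reduce w)"
    by (simp add: reduce_reduced reduced_winv)
  finally show ?thesis .
qed

lemma carrier_free_group: "w \<in> carrier (free_group A) \<longleftrightarrow> reduced w \<and> fst ` set w \<subseteq> A"
  and mult_free_group [simp]: "u \<otimes>\<^bsub>free_group A\<^esub> v = reduce (u @ v)"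
  and one_free_group [simp]: "\<one>\<^bsub>free_group A\<^esub> = []"
  by (auto simp: free_group_def)

lemma reduce_in_carrier: "fst ` set w \<subseteq> A \<Longrightarrow> reduce w \<in> carrier (free_group A)"
  using set_reduce[of w] by (auto simp: carrier_free_group)

lemma inv_free_group:
  assumes "w \<in> carrier (free_group A)"
  shows "inv\<^bsub>free_group A\<^esub> w = winv w"
proof -
  interpret group "free_group A" by (rule group_free_group)
  show ?thesis
    by (rule inv_equality)
       (use assms in \<open>auto simp: carrier_free_group reduced_winv\<close>)
qed

section \<open>Substitutions of letters and the automorphisms they induce\<close>

definition subst :: "('a \<times> bool \<Rightarrow> 'a word) \<Rightarrow> 'a word \<Rightarrow> 'a word" where
  "subst h w = concat (map h w)"

lemma subst_Nil [simp]: "subst h [] = []"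
  and subst_append [simp]: "subst h (u @ v) = subst h u @ subst h v"
  and subst_Cons: "subst h (x # w) = h x @ subst h w"
  by (simp_all add: subst_def)

text \<open>Compatibility with inversion makes the images of a cancelling pair cancel, so the
  substitution descends to the free group.\<close>

lemma reduce_subst_reduce:
  assumes h: "\<And>x. h (inv_letter x) = winv (h x)"
  shows "reduce (subst h (reduce w)) = reduce (subst h w)"
proof (induction w)
  case (Cons x w)
  have *: "reduce (subst h (red_cons x v)) = reduce (subst h (x # v))" for v
    by (cases v) (auto simp: subst_Cons h)
  have "reduce (subst h (reduce (x # w))) = reduce (h x @ reduce (subst h (reduce w)))"
    unfolding reduce_Cons * by (simp add: subst_Cons)
  then show ?case
    unfolding Cons.IH by (simp add: subst_Cons)
qed simp

lemma subst_letters: "(\<And>x. x \<in> set w \<Longrightarrow> fst ` set (h x) \<subseteq> A) \<Longrightarrow> fst ` set (subst h w) \<subseteq> A"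
  by (induction w) (simp_all add: subst_Cons image_Un)

text \<open>Both substitutions are endomorphisms, so being mutually inverse on single letters is
  enough.\<close>

lemma subst_iso:
  assumes h: "\<And>x. h (inv_letter x) = winv (h x)" and k: "\<And>x. k (inv_letter x) = winv (k x)"
    and hA: "\<And>x. fst x \<in> A \<Longrightarrow> fst ` set (h x) \<subseteq> A" and kA: "\<And>x. fst x \<in> A \<Longrightarrow> fst ` set (k x) \<subseteq> A"
    and hk: "\<And>x. fst x \<in> A \<Longrightarrow> reduce (subst h (k x)) = [x]"
    and kh: "\<And>x. fst x \<in> A \<Longrightarrow> reduce (subst k (h x)) = [x]"
  shows "(\<lambda>w. reduce (subst h w)) \<in> iso (free_group A) (free_group A)"
proof -
  let ?F = "free_group A"
  have inverse: "reduce (subst f (reduce (subst g w))) = w"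
    if f: "\<And>x. f (inv_letter x) = winv (f x)"
      and fg: "\<And>x. fst x \<in> A \<Longrightarrow> reduce (subst f (g x)) = [x]" and w: "w \<in> carrier ?F" for f g w
  proof -
    have "reduce (subst f (subst g w)) = reduce w" if "fst ` set w \<subseteq> A"
      using that
    proof (induction w)
      case (Cons x w)
      have "reduce (subst f (subst g (x # w))) =
          reduce (reduce (subst f (g x)) @ reduce (subst f (subst g w)))"
        by (simp add: subst_Cons)
      also have "\<dots> = reduce ([x] @ w)"
        using Cons by (simp add: fg del: append_Cons)
      finally show ?case by simp
    qed simp
    then show ?thesis
      using w by (auto simp: reduce_subst_reduce[where h = f, OF f] carrier_free_group reduce_reduced)
  qed
  have carr: "reduce (subst f w) \<in> carrier ?F"
    if "\<And>x. fst x \<in> A \<Longrightarrow> fst ` set (f x) \<subseteq> A" "w \<in> carrier ?F" for f w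
    using that by (intro reduce_in_carrier subst_letters) (auto simp: carrier_free_group)
  have "(\<lambda>w. reduce (subst h w)) \<in> hom ?F ?F"
    using carr[of h] hA by (auto simp: hom_def reduce_subst_reduce[where h = h, OF h])
  moreover have "bij_betw (\<lambda>w. reduce (subst h w)) (carrier ?F) (carrier ?F)"
    by (rule bij_betw_byWitness[where f' = "\<lambda>w. reduce (subst k w)"])
       (use inverse[of h k] inverse[of k h] h k hk kh carr[of h] carr[of k] hA kA in auto)
  ultimately show ?thesis
    by (simp add: iso_def)
qed

text \<open>\<open>aut_equiv A B u v\<close>: an automorphism that fixes all generators outside \<open>B\<close> carries \<open>u\<close>
  to \<open>v\<close>. Fixing the other generators makes this relation a congruence in contexts avoiding
  \<open>B\<close>.\<close>

definition aut_equiv :: "'a set \<Rightarrow> 'a set \<Rightarrow> 'a word \<Rightarrow> 'a word \<Rightarrow> bool" where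
  "aut_equiv A B u v \<longleftrightarrow> (\<exists>\<phi>\<in>iso (free_group A) (free_group A).
     (\<forall>x. fst x \<in> A - B \<longrightarrow> \<phi> [x] = [x]) \<and> \<phi> (reduce u) = reduce v)"

lemma aut_equiv_refl: "reduce u = reduce v \<Longrightarrow> aut_equiv A B u v"
  unfolding aut_equiv_def by (rule bexI[of _ "\<lambda>x. x"]) (auto simp: iso_def hom_def bij_betw_def)

lemma aut_equiv_mono: "aut_equiv A B u v \<Longrightarrow> B \<subseteq> C \<Longrightarrow> aut_equiv A C u v"
  unfolding aut_equiv_def by blast

lemma aut_equiv_trans [trans]:
  assumes "aut_equiv A B u v" "aut_equiv A B v w"
  shows "aut_equiv A B u w"
proof -
  obtain \<phi> \<psi> where "\<phi> \<in> iso (free_group A) (free_group A)" "\<psi> \<in> iso (free_group A) (free_group A)"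
    "\<forall>x. fst x \<in> A - B \<longrightarrow> \<phi> [x] = [x]" "\<forall>x. fst x \<in> A - B \<longrightarrow> \<psi> [x] = [x]"
    "\<phi> (reduce u) = reduce v" "\<psi> (reduce v) = reduce w"
    using assms unfolding aut_equiv_def by blast
  then show ?thesis
    unfolding aut_equiv_def
    by (intro bexI[of _ "\<psi> \<circ> \<phi>"]) (auto intro: iso_set_trans[unfolded comp_def] simp: comp_def)
qed

text \<open>The inverse automorphism fixes the same generators. The letters of \<open>u\<close> have
  to lie in \<open>A\<close> because \<open>inv_into\<close> recovers only elements of the
  carrier.\<close>

lemma aut_equiv_sym:
  assumes "aut_equiv A B u v" "fst ` set u \<subseteq> A"
  shows "aut_equiv A B v u"
proof -
  interpret F: group "free_group A" by (rule group_free_group)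
  obtain \<phi> where \<phi>: "\<phi> \<in> iso (free_group A) (free_group A)"
    "\<forall>x. fst x \<in> A - B \<longrightarrow> \<phi> [x] = [x]" "\<phi> (reduce u) = reduce v"
    using assms(1) unfolding aut_equiv_def by blast
  have inj: "inj_on \<phi> (carrier (free_group A))"
    using \<phi>(1) by (auto simp: iso_def bij_betw_def)
  have u: "reduce u \<in> carrier (free_group A)"
    using assms(2) by (rule reduce_in_carrier)
  have x: "fst x \<in> A \<Longrightarrow> [x] \<in> carrier (free_group A)" for x
    by (simp add: carrier_free_group reduced_def)
  show ?thesis
    unfolding aut_equiv_def
  proof (intro bexI[of _ "inv_into (carrier (free_group A)) \<phi>"] conjI allI impI)
    fix y :: "'a \<times> bool" assume "fst y \<in> A - B"
    then show "inv_into (carrier (free_group A)) \<phi> [y] = [y]"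
      using inv_into_f_f[OF inj x[of y]] \<phi>(2) by simp
  next
    show "inv_into (carrier (free_group A)) \<phi> (reduce v) = reduce u"
      using inv_into_f_f[OF inj u] \<phi>(3) by simp
  next
    show "inv_into (carrier (free_group A)) \<phi> \<in> iso (free_group A) (free_group A)"
      by (rule F.iso_set_sym[OF \<phi>(1)])
  qed
qed

lemma aut_equiv_cong:
  assumes w: "aut_equiv A B w w'" "fst ` set w \<subseteq> A"
    and u: "fst ` set u \<subseteq> A - B" and v: "fst ` set v \<subseteq> A - B"
  shows "aut_equiv A B (u @ w @ v) (u @ w' @ v)"
proof -
  interpret F: group "free_group A" by (rule group_free_group)
  obtain \<phi> where \<phi>: "\<phi> \<in> iso (free_group A) (free_group A)"
    "\<forall>x. fst x \<in> A - B \<longrightarrow> \<phi> [x] = [x]" "\<phi> (reduce w) = reduce w'"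
    using w(1) unfolding aut_equiv_def by blast
  have hom: "\<phi> \<in> hom (free_group A) (free_group A)"
    using \<phi>(1) by (simp add: iso_def)
  have \<phi>_mult: "\<phi> (reduce (x @ y)) = reduce (\<phi> (reduce x) @ \<phi> (reduce y))"
    if "fst ` set x \<subseteq> A" "fst ` set y \<subseteq> A" for x y
    using hom_mult[OF hom reduce_in_carrier[OF that(1)] reduce_in_carrier[OF that(2)]] by simp
  have fixed: "\<phi> (reduce x) = reduce x" if "fst ` set x \<subseteq> A - B" for x
    using that
  proof (induction x)
    case Nil
    show ?case using hom_one[OF hom F.is_group F.is_group] by simp
  next
    case (Cons a x)
    have "\<phi> (reduce ([a] @ x)) = reduce (\<phi> (reduce [a]) @ \<phi> (reduce x))"
      using Cons.prems by (intro \<phi>_mult) auto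
    also have "\<dots> = reduce ([a] @ reduce x)"
      using Cons \<phi>(2)[rule_format, of a] by (simp add: reduce_reduced[of "[a]"] reduced_def)
    finally show ?case by (simp add: reduce_Cons)
  qed
  have "\<phi> (reduce (u @ w @ v)) = reduce (u @ w' @ v)"
    using u v w(2) by (subst \<phi>_mult, blast, force, subst \<phi>_mult) (auto simp: fixed \<phi>(3))
  then show ?thesis
    unfolding aut_equiv_def using \<phi> by blast
qed

text \<open>The building block of the moves below. The letter \<open>p\<close> may be a formal
  inverse. If \<open>x\<close> and \<open>y\<close> avoid the generator of \<open>p\<close>, this is
  a product of Nielsen transformations.\<close>

definition lsub :: "'a \<times> bool \<Rightarrow> 'a word \<Rightarrow> 'a word \<Rightarrow> 'a \<times> bool \<Rightarrow> 'a word" where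
  "lsub p x y c = (if c = p then x @ [p] @ y
     else if c = inv_letter p then winv y @ [inv_letter p] @ winv x else [c])"

lemma lsub_inv: "lsub p x y (inv_letter c) = winv (lsub p x y c)"
  using inv_letter_neq(1)[of p] by (auto simp: lsub_def winv_Cons)

lemma subst_lsub_other: "fst p \<notin> fst ` set w \<Longrightarrow> subst (lsub p x y) w = w"
  by (induction w) (auto simp: subst_Cons lsub_def)

lemma subst_lsub_letter:
  "subst (lsub p x y) [p] = x @ [p] @ y"
  "subst (lsub p x y) [inv_letter p] = winv y @ [inv_letter p] @ winv x"
  by (simp_all add: subst_Cons lsub_def)

text \<open>Multiplying by \<open>winv x\<close> and \<open>winv y\<close> undoes the change, since
  the substitution leaves \<open>x\<close> and \<open>y\<close> themselves untouched.\<close>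

lemma lsub_iso:
  assumes "fst p \<in> A" "fst ` set x \<subseteq> A - {fst p}" "fst ` set y \<subseteq> A - {fst p}"
  shows "(\<lambda>w. reduce (subst (lsub p x y) w)) \<in> iso (free_group A) (free_group A)"
proof (rule subst_iso[where k = "lsub p (winv x) (winv y)"])
  have *: "reduce (subst (lsub p u v) (lsub p (winv u) (winv v) c)) = [c]"
    if "fst p \<notin> fst ` set u" "fst p \<notin> fst ` set v" for u v c
  proof -
    have uv: "fst p \<notin> fst ` set (winv u)" "fst p \<notin> fst ` set (winv v)"
      using that by simp_all
    have r: "reduce (winv u @ u @ [p] @ v @ winv v) = [p]"
      "reduce (v @ winv v @ [inv_letter p] @ winv u @ u) = [inv_letter p]"
      using reduce_winv_cancel(3)[of u "[p] @ v @ winv v"] reduce_winv_cancel(6)[of "[p]" v]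
        reduce_winv_cancel(4)[of v "[inv_letter p] @ winv u @ u"]
        reduce_winv_cancel(5)[of "[inv_letter p]" u]
      by (simp_all add: reduce_reduced reduced_def)
    show ?thesis
      using r by (auto simp: lsub_def[of p "winv u"] subst_lsub_letter[of p u v, simplified] subst_lsub_other[OF that(1)]
          subst_lsub_other[OF that(2)] subst_lsub_other[OF uv(1)] subst_lsub_other[OF uv(2)] subst_Cons)
         (auto simp: lsub_def reduce_reduced reduced_def)
  qed
  show "reduce (subst (lsub p x y) (lsub p (winv x) (winv y) c)) = [c]"
    "reduce (subst (lsub p (winv x) (winv y)) (lsub p x y c)) = [c]" for c
    using assms *[of x y c] *[of "winv x" "winv y" c] by auto
  have "fst ` set (lsub p u v c) \<subseteq> A"
    if "fst ` set u \<subseteq> A - {fst p}" "fst ` set v \<subseteq> A - {fst p}" "fst c \<in> A" for u v c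
  proof -
    have "fst ` set u \<subseteq> A" "fst ` set v \<subseteq> A"
      using that by blast+
    then show ?thesis
      using assms(1) that(3) by (simp add: lsub_def image_Un)
  qed
  then show "fst c \<in> A \<Longrightarrow> fst ` set (lsub p x y c) \<subseteq> A"
    "fst c \<in> A \<Longrightarrow> fst ` set (lsub p (winv x) (winv y) c) \<subseteq> A" for c
    using assms by simp_all
qed (rule lsub_inv)+

lemma aut_equiv_lsub:
  assumes "fst p \<in> A" "fst ` set x \<subseteq> A - {fst p}" "fst ` set y \<subseteq> A - {fst p}"
    and "reduce (subst (lsub p x y) u) = reduce v"
  shows "aut_equiv A {fst p} u v"
  unfolding aut_equiv_def
proof (intro bexI[OF _ lsub_iso[OF assms(1-3)]] conjI allI impI)
  show "reduce (subst (lsub p x y) (reduce u)) = reduce v"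
    by (simp add: reduce_subst_reduce[where h = "lsub p x y", OF lsub_inv] assms(4))
qed (auto simp: subst_Cons lsub_def reduce_reduced reduced_def)

section \<open>Normal form of quadratic words\<close>

text \<open>The crosscap move for surface words: \<open>p\<close> is replaced by
  \<open>winv x @ [p] @ x @ winv y\<close>. The first occurrence then absorbs \<open>x\<close>, and
  all factors between the two occurrences cancel.\<close>

lemma collect_square:
  assumes "fst p \<in> A" "fst ` set (x @ y @ z) \<subseteq> A - {fst p}"
  shows "aut_equiv A {fst p} (x @ [p] @ y @ [p] @ z) ([p, p] @ x @ winv y @ z)"
proof (rule aut_equiv_lsub[where x = "winv x" and y = "x @ winv y"])
  have avoid: "fst p \<notin> fst ` set x" "fst p \<notin> fst ` set y" "fst p \<notin> fst ` set z"
    using assms by auto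
  have "reduce (subst (lsub p (winv x) (x @ winv y)) (x @ [p] @ y @ [p] @ z)) =
      act [p] (act [p] (reduce (x @ winv y @ z)))"
    unfolding subst_append subst_lsub_letter subst_lsub_other[OF avoid(1)] subst_lsub_other[OF avoid(2)]
      subst_lsub_other[OF avoid(3)]
    by (simp add: reduce_append_act act_winv_act act_act_winv reduced_foldr reduced_red_cons reduce_Cons)
  then show "reduce (subst (lsub p (winv x) (x @ winv y)) (x @ [p] @ y @ [p] @ z)) =
      reduce ([p, p] @ x @ winv y @ z)"
    by (simp add: reduce_append_act reduce_Cons)
  show "fst ` set (x @ winv y) \<subseteq> A - {fst p}"
    using assms unfolding set_append image_Un fst_set_winv by blast
qed (use assms in auto)

text \<open>The handle move for surface words. Three substitutions collect \<open>u\<close>,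
  \<open>z\<close> and \<open>y\<close> in front of the commutator. The last two conjugate
  \<open>p\<close> and then \<open>q\<close> by everything standing in front, which moves the
  commutator to the left end.\<close>

lemma collect_commutator:
  assumes "fst p \<in> A" "fst q \<in> A" "fst p \<noteq> fst q"
    "fst ` set (x @ y @ z @ u @ v) \<subseteq> A - {fst p, fst q}"
  shows "aut_equiv A {fst p, fst q}
     (x @ [p] @ y @ [q] @ z @ [inv_letter p] @ u @ [inv_letter q] @ v)
     ([p, q, inv_letter p, inv_letter q] @ x @ u @ z @ y @ v)"
proof -
  let ?P = "inv_letter p" and ?Q = "inv_letter q" and ?r = "u @ z @ y"
  have avoid: "fst p \<notin> fst ` set x" "fst p \<notin> fst ` set y" "fst p \<notin> fst ` set z"
    "fst p \<notin> fst ` set u" "fst p \<notin> fst ` set v" "fst q \<notin> fst ` set x" "fst q \<notin> fst ` set y"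
    "fst q \<notin> fst ` set z" "fst q \<notin> fst ` set u" "fst q \<notin> fst ` set v"
    using assms(4) by auto
  then have avoid': "fst p \<notin> fst ` set (winv x)" "fst p \<notin> fst ` set (winv y)"
    "fst p \<notin> fst ` set (winv z)" "fst p \<notin> fst ` set (winv u)" "fst q \<notin> fst ` set (winv x)"
    "fst q \<notin> fst ` set (winv y)" "fst q \<notin> fst ` set (winv z)" "fst q \<notin> fst ` set (winv u)"
    by (simp_all only: fst_set_winv not_False_eq_True)
  have pq: "fst p \<notin> fst ` set [q]" "fst p \<notin> fst ` set [?Q]" "fst q \<notin> fst ` set [p]" "fst q \<notin> fst ` set [?P]"
    using assms(3) by auto
  note other = avoid[THEN subst_lsub_other] pq[THEN subst_lsub_other]
    avoid'[THEN subst_lsub_other]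
  note letter = subst_lsub_letter
  note red = reduce_append_act act_winv_act act_act_winv reduced_foldr reduced_red_cons reduce_Cons
  have step: "aut_equiv A {fst p, fst q} s s'"
    if "fst o1 \<in> {fst p, fst q}" "set a \<union> set b \<subseteq> set (x @ y @ z @ u @ v) \<union> set (winv (x @ y @ z @ u @ v))"
      "reduce (subst (lsub o1 a b) s) = reduce s'" for o1 a b s s'
  proof -
    have "fst ` set (winv (x @ y @ z @ u @ v)) \<subseteq> A - {fst p, fst q}"
      using assms(4) by (simp only: fst_set_winv)
    then have "fst ` (set a \<union> set b) \<subseteq> A - {fst p, fst q}"
      using assms(4) that(2) by blast
    then show ?thesis
      using that assms(1,2) by (intro aut_equiv_mono[OF aut_equiv_lsub[of o1 A a b]]) auto
  qed
  have "aut_equiv A {fst p, fst q}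
     (x @ [p] @ y @ [q] @ z @ [?P] @ u @ [?Q] @ v) (x @ [p] @ [q] @ z @ y @ [?P] @ u @ [?Q] @ v)"
    by (rule step[of p "[]" "winv y"]) (simp_all only: letter other subst_append winv_append append_assoc, auto simp: red)
  also have "aut_equiv A {fst p, fst q} \<dots> (x @ [p] @ [q] @ [?P] @ ?r @ [?Q] @ v)"
    by (rule step[of q "[]" "winv y @ winv z"]) (simp_all only: letter other subst_append winv_append append_assoc, auto simp: red)
  also have "aut_equiv A {fst p, fst q} \<dots> (x @ ?r @ [p] @ [q] @ [?P] @ [?Q] @ v)"
    by (rule step[of p ?r "[]"]) (simp_all only: letter other subst_append winv_append append_assoc, auto simp: red)
  also have "aut_equiv A {fst p, fst q} \<dots> ([p] @ x @ ?r @ [q] @ winv (x @ ?r) @ [?P] @ x @ ?r @ [?Q] @ v)"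
    by (rule step[of p "winv (x @ ?r)" "x @ ?r"]) (simp_all only: letter other subst_append winv_append append_assoc, auto simp: red)
  also have "aut_equiv A {fst p, fst q} \<dots> ([p] @ [q] @ [?P] @ [?Q] @ x @ ?r @ v)"
    by (rule step[of q "winv (x @ ?r)" "x @ ?r"]) (simp_all only: letter other subst_append winv_append append_assoc, auto simp: red)
  finally show ?thesis
    by simp
qed

text \<open>The entries are signed letters, so these normal forms are standard only up to renaming
  and inverting generators; \<open>relabel_iso\<close> removes this freedom.\<close>

definition squares :: "('a \<times> bool) list \<Rightarrow> 'a word" where
  "squares cs = concat (map (\<lambda>p. [p, p]) cs)"

definition commutators :: "(('a \<times> bool) \<times> ('a \<times> bool)) list \<Rightarrow> 'a word" where
  "commutators ps = concat (map (\<lambda>(p, q). [p, q, inv_letter p, inv_letter q]) ps)"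

definition pair_letters :: "(('a \<times> bool) \<times> ('a \<times> bool)) list \<Rightarrow> ('a \<times> bool) list" where
  "pair_letters ps = concat (map (\<lambda>(p, q). [p, q]) ps)"

lemma squares_simps [simp]: "squares [] = []" "squares (p # cs) = [p, p] @ squares cs"
  and commutators_simps [simp]: "commutators [] = []"
    "commutators ((p, q) # ps) = [p, q, inv_letter p, inv_letter q] @ commutators ps"
  and pair_letters_simps [simp]: "pair_letters [] = []" "pair_letters ((p, q) # ps) = [p, q] @ pair_letters ps"
  by (simp_all add: squares_def commutators_def pair_letters_def)

lemma set_squares [simp]: "set (squares cs) = set cs"
  by (induction cs) auto

lemma fst_set_commutators [simp]: "fst ` set (commutators ps) = fst ` set (pair_letters ps)"
proof (induction ps)
  case (Cons pq ps)
  then show ?case by (cases pq) (simp add: image_Un, blast)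
qed simp

text \<open>The relation \<open>a\<^sup>2[b, c] = x\<^sup>2y\<^sup>2z\<^sup>2\<close> is read off from \<open>collect_square\<close>: it is applied
  backwards once and forwards twice.\<close>

lemma square_commutator:
  assumes "fst p \<in> A" "fst q \<in> A" "fst r \<in> A" "distinct [fst p, fst q, fst r]"
  shows "aut_equiv A {fst p, fst q, fst r} [p, p, q, r, inv_letter q, inv_letter r]
     [inv_letter r, inv_letter r, q, q, inv_letter p, inv_letter p]"
proof -
  let ?E = "aut_equiv A {fst p, fst q, fst r}" and ?P = "inv_letter p" and ?Q = "inv_letter q" and ?R = "inv_letter r"
  have "?E [p, p, q, r, ?Q, ?R] [q, p, ?R, p, ?Q, ?R]"
    by (rule aut_equiv_sym, rule aut_equiv_mono[OF collect_square[of p A "[q]" "[?R]" "[?Q, ?R]", simplified]])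
       (use assms in auto)
  also have "?E [q, p, ?R, p, ?Q, ?R] [?R, ?R, q, p, q, ?P]"
    by (rule aut_equiv_mono[OF collect_square[of ?R A "[q, p]" "[p, ?Q]" "[]", simplified winv_Cons, simplified]])
       (use assms in auto)
  also have "?E [?R, ?R, q, p, q, ?P] [?R, ?R, q, q, ?P, ?P]"
  proof -
    have "aut_equiv A {fst q} ([?R, ?R] @ [q, p, q, ?P] @ []) ([?R, ?R] @ [q, q, ?P, ?P] @ [])"
      by (rule aut_equiv_cong[OF collect_square[of q A "[]" "[p]" "[?P]", simplified]]) (use assms in auto)
    then show ?thesis
      by (simp add: aut_equiv_mono)
  qed
  finally show ?thesis .
qed

text \<open>One square turns each commutator into two further squares: of the three squares given by
  \<open>square_commutator\<close>, the last one stands next to the remaining commutators and plays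
  the role of \<open>p\<close> for them.\<close>

lemma square_commutators:
  assumes "fst p \<in> A" "fst ` set (pair_letters ps) \<subseteq> A" "distinct (map fst (p # pair_letters ps))"
  shows "\<exists>cs. aut_equiv A (fst ` set (p # pair_letters ps)) ([p, p] @ commutators ps) (squares cs) \<and>
     distinct (map fst cs) \<and> fst ` set cs = fst ` set (p # pair_letters ps)"
  using assms
proof (induction ps arbitrary: p)
  case Nil
  show ?case by (intro exI[of _ "[p]"]) (simp add: aut_equiv_refl)
next
  case (Cons qr ps)
  obtain q r where qr: "qr = (q, r)" by (cases qr)
  let ?E = "aut_equiv A (fst ` set (p # pair_letters (qr # ps)))"
  let ?P = "inv_letter p" and ?R = "inv_letter r"
  have A: "fst p \<in> A" "fst q \<in> A" "fst r \<in> A" "distinct [fst p, fst q, fst r]"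
    "fst ` set (pair_letters ps) \<subseteq> A - {fst p, fst q, fst r}" "distinct (map fst (pair_letters ps))"
    using Cons.prems by (simp_all add: qr, blast+)
  have avoid: "fst p \<notin> fst ` set (pair_letters ps)" "fst q \<notin> fst ` set (pair_letters ps)"
    "fst r \<notin> fst ` set (pair_letters ps)"
    using A(5) by blast+
  obtain cs where cs: "aut_equiv A (fst ` set (?P # pair_letters ps)) ([?P, ?P] @ commutators ps) (squares cs)"
    "distinct (map fst cs)" "fst ` set cs = fst ` set (?P # pair_letters ps)"
  proof -
    have 1: "fst ?P \<in> A" "fst ` set (pair_letters ps) \<subseteq> A"
      using A(1,5) by auto
    have 2: "fst p \<notin> fst ` set (pair_letters ps)"
      using A(5) by blast
    have 3: "distinct (map fst (?P # pair_letters ps))"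
      using 2 A(6) by simp
    show ?thesis
      using Cons.IH[OF 1 3] that by blast
  qed
  have "aut_equiv A {fst p, fst q, fst r} ([] @ [p, p, q, r, inv_letter q, inv_letter r] @ commutators ps)
      ([] @ [?R, ?R, q, q, ?P, ?P] @ commutators ps)"
    by (rule aut_equiv_cong[OF square_commutator[OF A(1-4)]]) (use A in simp_all)
  then have "?E ([p, p] @ commutators (qr # ps)) ([?R, ?R, q, q] @ ([?P, ?P] @ commutators ps) @ [])"
    by (simp add: aut_equiv_mono qr)
  also have "?E ([?R, ?R, q, q] @ ([?P, ?P] @ commutators ps) @ []) ([?R, ?R, q, q] @ squares cs @ [])"
  proof (rule aut_equiv_mono[OF aut_equiv_cong[OF cs(1)]])
    show "fst ` set ([?P, ?P] @ commutators ps) \<subseteq> A"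
      using A by (simp add: image_Un) blast
    show "fst ` set [?R, ?R, q, q] \<subseteq> A - fst ` set (?P # pair_letters ps)"
      using A(1-4) avoid by auto
    show "fst ` set (?P # pair_letters ps) \<subseteq> fst ` set (p # pair_letters (qr # ps))"
      by (simp add: qr) blast
  qed simp
  finally have "?E ([p, p] @ commutators (qr # ps)) (squares (?R # q # cs))"
    by simp
  moreover have "distinct (map fst (?R # q # cs))"
    using cs A(4) avoid by (simp, auto)
  moreover have "fst ` set (?R # q # cs) = fst ` set (p # pair_letters (qr # ps))"
    using cs(3) by (simp add: qr) blast
  ultimately show ?case
    by (intro exI[of _ "?R # q # cs"] conjI)
qed

lemma letter_occ_simps [simp]:
  "letter_occ a [] = 0"
  "letter_occ a (x # w) = (if fst x = a then 1 else 0) + letter_occ a w"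
  "letter_occ a (u @ v) = letter_occ a u + letter_occ a v"
  by (auto simp: letter_occ_def prod_eq_iff)

lemma letter_occ_inv_letter: "letter_occ a (winv w) = letter_occ a w"
  by (induction w) (simp_all add: winv_Cons)

lemma letter_occ_eq_0_iff: "letter_occ a w = 0 \<longleftrightarrow> a \<notin> fst ` set w"
  by (induction w) auto

text \<open>The orientable case: a generator that occurs does so once with either sign. Choose
  \<open>p\<close> with the shortest gap before its inverse. An empty gap cancels. Otherwise the
  first letter \<open>q\<close> of the gap has its inverse outside the gap, so \<open>p\<close> and
  \<open>q\<close> interlock and \<open>collect_commutator\<close> applies.\<close>

lemma oriented_normal_form:
  assumes "fst ` set w \<subseteq> A" "distinct w" "inv_letter ` set w \<subseteq> set w"
  shows "\<exists>ps. aut_equiv A (fst ` set w) w (commutators ps) \<and>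
     distinct (map fst (pair_letters ps)) \<and> fst ` set (pair_letters ps) \<subseteq> fst ` set w"
  using assms
proof (induction w rule: length_induct)
  case (1 w)
  note IH = 1(1)[rule_format] and wA = 1(2) and dist = 1(3) and closed = 1(4)
  have closedD: "inv_letter c \<in> set w" if "c \<in> set w" for c
    using closed that by blast
  show ?case
  proof (cases "w = []")
    case True
    show ?thesis by (rule exI[of _ "[]"]) (simp add: True aut_equiv_refl)
  next
    case False
    define P where "P \<equiv> \<lambda>(x, p, y, z). w = x @ [p] @ y @ [inv_letter p] @ z"
    obtain p w1 where w1: "w = p # w1"
      using False by (cases w) auto
    have "inv_letter p \<in> set w1"
      using closedD[of p] w1 by auto
    then obtain y0 z0 where "w1 = y0 @ inv_letter p # z0"
      by (auto dest: split_list)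
    then have "P ([], p, y0, z0)"
      by (simp add: P_def w1)
    then have "\<exists>m. P m \<and> (\<forall>m'. P m' \<longrightarrow> length (fst (snd (snd m))) \<le> length (fst (snd (snd m'))))"
      by (rule ex_has_least_nat)
    then obtain x p y z where w: "w = x @ [p] @ y @ [inv_letter p] @ z"
      and least: "\<And>x' p' y' z'. w = x' @ [p'] @ y' @ [inv_letter p'] @ z' \<Longrightarrow> length y \<le> length y'"
      unfolding P_def by (fastforce simp del: append_Cons)
    show ?thesis
    proof (cases y)
      case Nil
      have inv: "inv_letter ` set (x @ z) \<subseteq> set (x @ z)"
      proof
        fix c assume "c \<in> inv_letter ` set (x @ z)"
        then obtain d where d: "d \<in> set (x @ z)" "c = inv_letter d" by blast
        then have "d \<noteq> p" "d \<noteq> inv_letter p" "c \<in> set w"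
          using dist closedD[of d] by (auto simp: w)
        then show "c \<in> set (x @ z)"
          using d(2) by (auto simp: w Nil)
      qed
      obtain ps where ps: "aut_equiv A (fst ` set (x @ z)) (x @ z) (commutators ps)"
        "distinct (map fst (pair_letters ps))" "fst ` set (pair_letters ps) \<subseteq> fst ` set (x @ z)"
      proof -
        have "length (x @ z) < length w" "fst ` set (x @ z) \<subseteq> A" "distinct (x @ z)"
          using wA dist by (auto simp: w)
        from IH[OF this inv] show ?thesis using that by blast
      qed
      have "aut_equiv A (fst ` set w) w (x @ z)"
        using reduce_winv_cancel(2)[of x "[p]" z] by (intro aut_equiv_refl) (simp add: w Nil)
      also have "aut_equiv A (fst ` set w) (x @ z) (commutators ps)"
        by (rule aut_equiv_mono[OF ps(1)]) (auto simp: w)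
      finally show ?thesis
        using ps(2,3) by (intro exI[of _ ps]) (auto simp: w)
    next
      case (Cons q y')
      have qp: "q \<noteq> p" "q \<noteq> inv_letter p"
        using dist by (auto simp: w Cons)
      have fpq: "fst p \<noteq> fst q"
        using qp by (auto simp: fst_eq_letter)
      have Q: "inv_letter q \<in> set w" "inv_letter q \<noteq> p" "inv_letter q \<noteq> inv_letter p" "inv_letter q \<noteq> q"
        using closedD[of q] qp by (auto simp: w Cons)
      have "inv_letter q \<notin> set y'"
      proof
        assume "inv_letter q \<in> set y'"
        then obtain y1 y2 where "y' = y1 @ inv_letter q # y2"
          by (auto dest: split_list)
        then show False
          using least[of "x @ [p]" q y1 "y2 @ [inv_letter p] @ z"] by (simp add: w Cons)
      qed
      then have "inv_letter q \<in> set x \<or> inv_letter q \<in> set z"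
        using Q by (auto simp: w Cons)
      \<comment> \<open>Depending on the side on which the inverse of \<open>q\<close> lies, the
        interlocking pair is \<open>inv_letter q\<close>, \<open>p\<close> or \<open>p\<close>,
        \<open>q\<close>.\<close>
      moreover have "\<exists>p q x y z u v. w = x @ [p] @ y @ [q] @ z @ [inv_letter p] @ u @ [inv_letter q] @ v \<and> fst p \<noteq> fst q"
        if Qx: "inv_letter q \<in> set x"
      proof -
        obtain x1 x2 where x: "x = x1 @ inv_letter q # x2"
          using split_list[OF Qx] by blast
        have "w = x1 @ [inv_letter q] @ x2 @ [p] @ [] @ [inv_letter (inv_letter q)] @ y' @ [inv_letter p] @ z"
          by (simp add: w Cons x)
        moreover have "fst (inv_letter q) \<noteq> fst p"
          using fpq by simp
        ultimately show ?thesis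
          by blast
      qed
      moreover have "\<exists>p q x y z u v. w = x @ [p] @ y @ [q] @ z @ [inv_letter p] @ u @ [inv_letter q] @ v \<and> fst p \<noteq> fst q"
        if Qz: "inv_letter q \<in> set z"
      proof -
        obtain z1 z2 where z: "z = z1 @ inv_letter q # z2"
          using split_list[OF Qz] by blast
        have "w = x @ [p] @ [] @ [q] @ y' @ [inv_letter p] @ z1 @ [inv_letter q] @ z2"
          by (simp add: w Cons z)
        then show ?thesis
          using fpq by blast
      qed
      ultimately obtain p q x y z u v where
        w: "w = x @ [p] @ y @ [q] @ z @ [inv_letter p] @ u @ [inv_letter q] @ v" and pq: "fst p \<noteq> fst q"
        by blast
      define w0 where "w0 = x @ u @ z @ y @ v"
      have set_w: "set w = {p, inv_letter p, q, inv_letter q} \<union> set w0"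
        by (auto simp: w w0_def)
      have disj: "set w0 \<inter> {p, inv_letter p, q, inv_letter q} = {}"
        using dist unfolding w w0_def by simp
      have dist0: "distinct w0"
        using dist unfolding w w0_def by (simp; blast)
      have inv0: "inv_letter ` set w0 \<subseteq> set w0"
      proof
        fix c assume "c \<in> inv_letter ` set w0"
        then obtain d where d: "d \<in> set w0" "c = inv_letter d" by blast
        then have "d \<notin> {p, inv_letter p, q, inv_letter q}" "c \<in> set w"
          using disj closedD[of d] set_w by blast+
        then show "c \<in> set w0"
          using d(2) set_w by auto
      qed
      have avoid0: "fst p \<notin> fst ` set w0" "fst q \<notin> fst ` set w0"
      proof -
        have "fst c \<noteq> fst p" "fst c \<noteq> fst q" if "c \<in> set w0" for c
          using that disj by (auto simp: fst_eq_letter)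
        then show "fst p \<notin> fst ` set w0" "fst q \<notin> fst ` set w0"
          by (metis imageE)+
      qed
      have w0A: "fst ` set w0 \<subseteq> A - {fst p, fst q}"
        using wA avoid0 unfolding set_w by blast
      obtain ps where ps: "aut_equiv A (fst ` set w0) w0 (commutators ps)"
        "distinct (map fst (pair_letters ps))" "fst ` set (pair_letters ps) \<subseteq> fst ` set w0"
      proof -
        have "length w0 < length w" "fst ` set w0 \<subseteq> A"
          using w0A by (simp add: w w0_def, blast)
        from IH[OF this dist0 inv0] show ?thesis using that by blast
      qed
      have pqA: "fst p \<in> A" "fst q \<in> A"
        using wA by (auto simp: w)
      let ?c = "[p, q, inv_letter p, inv_letter q]"
      have "aut_equiv A {fst p, fst q} w (?c @ w0)"
        unfolding w w0_def
        by (rule collect_commutator[OF pqA pq]) (use w0A in \<open>auto simp: w0_def\<close>)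
      then have "aut_equiv A (fst ` set w) w (?c @ w0)"
        by (rule aut_equiv_mono) (auto simp: w)
      also have "aut_equiv A (fst ` set w0) (?c @ w0 @ []) (?c @ commutators ps @ [])"
        by (rule aut_equiv_cong[OF ps(1)]) (use w0A pqA avoid0 in auto)
      then have "aut_equiv A (fst ` set w0) (?c @ w0) (commutators ((p, q) # ps))"
        by simp
      then have "aut_equiv A (fst ` set w) (?c @ w0) (commutators ((p, q) # ps))"
        by (rule aut_equiv_mono) (simp add: set_w, blast)
      finally have "aut_equiv A (fst ` set w) w (commutators ((p, q) # ps))" .
      moreover have "distinct (map fst (pair_letters ((p, q) # ps)))"
        using ps avoid0 pq by auto
      moreover have "fst ` set (pair_letters ((p, q) # ps)) \<subseteq> fst ` set w"
        using ps(3) unfolding set_w by auto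
      ultimately show ?thesis
        by blast
    qed
  qed
qed

text \<open>A letter repeated with the same sign yields a square; without such a letter the word is
  orientable. If commutators remain behind a square, \<open>square_commutators\<close> converts
  them, so the two forms never mix. Cancellation may lose generators, hence only an inclusion of the
  letters.\<close>

lemma quadratic_normal_form:
  assumes "fst ` set w \<subseteq> A" "\<And>a. letter_occ a w \<in> {0, 2}"
  shows "\<exists>w'. aut_equiv A (fst ` set w) w w' \<and>
     ((\<exists>cs. w' = squares cs \<and> distinct (map fst cs) \<and> fst ` set cs \<subseteq> fst ` set w) \<or>
      (\<exists>ps. w' = commutators ps \<and> distinct (map fst (pair_letters ps)) \<and>
         fst ` set (pair_letters ps) \<subseteq> fst ` set w))"
  using assms
proof (induction w rule: length_induct)
  case (1 w)
  note IH = 1(1)[rule_format] and wA = 1(2) and occ = 1(3)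
  show ?case
  proof (cases "distinct w")
    case True
    have "inv_letter ` set w \<subseteq> set w"
    proof
      fix c assume "c \<in> inv_letter ` set w"
      then obtain d where d: "d \<in> set w" "c = inv_letter d" by blast
      then obtain x y where w: "w = x @ d # y" by (auto dest: split_list)
      have "letter_occ (fst d) (x @ y) \<noteq> 0"
        using occ[of "fst d"] by (auto simp: w)
      then obtain e where e: "e \<in> set (x @ y)" "fst e = fst d"
        unfolding letter_occ_eq_0_iff not_not image_iff by metis
      then have "e = inv_letter d"
        using True by (auto simp: w fst_eq_letter)
      then show "c \<in> set w"
        using e d by (auto simp: w)
    qed
    then show ?thesis
      using oriented_normal_form[OF wA True] by blast
  next
    case False
    then obtain x p y z where w: "w = x @ [p] @ y @ [p] @ z"
      using not_distinct_decomp by blast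
    define w0 where "w0 = x @ winv y @ z"
    have occ_w: "letter_occ a w = (if a = fst p then 2 else 0) + letter_occ a w0" for a
      by (simp add: w w0_def letter_occ_inv_letter)
    then have occ0: "letter_occ a w0 \<in> {0, 2}" and p0: "letter_occ (fst p) w0 = 0" for a
      using occ[of a] occ[of "fst p"] by (auto split: if_splits)
    have set_w: "fst ` set w = insert (fst p) (fst ` set w0)"
      by (simp add: w w0_def image_Un)
    have avoid0: "fst p \<notin> fst ` set w0"
      using p0 by (simp only: letter_occ_eq_0_iff not_False_eq_True)
    have w0A: "fst ` set w0 \<subseteq> A - {fst p}" "fst ` set w0 \<subseteq> A" and pA: "fst p \<in> A"
      using wA avoid0 unfolding set_w by blast+
    have "length w0 < length w"
      by (simp add: w w0_def)
    then obtain w' where w': "aut_equiv A (fst ` set w0) w0 w'"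
      "(\<exists>cs. w' = squares cs \<and> distinct (map fst cs) \<and> fst ` set cs \<subseteq> fst ` set w0) \<or>
      (\<exists>ps. w' = commutators ps \<and> distinct (map fst (pair_letters ps)) \<and>
         fst ` set (pair_letters ps) \<subseteq> fst ` set w0)"
      using IH[OF _ w0A(2) occ0] by blast
    have "fst ` set (x @ y @ z) \<subseteq> A - {fst p}"
      using w0A by (simp add: w0_def image_Un)
    then have "aut_equiv A {fst p} w ([p, p] @ w0)"
      unfolding w w0_def by (rule collect_square[OF pA])
    then have "aut_equiv A (fst ` set w) w ([p, p] @ w0)"
      by (rule aut_equiv_mono) (simp add: set_w)
    also have "aut_equiv A (fst ` set w0) ([p, p] @ w0 @ []) ([p, p] @ w' @ [])"
      by (rule aut_equiv_cong[OF w'(1)]) (use w0A pA avoid0 in simp_all)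
    then have "aut_equiv A (fst ` set w) ([p, p] @ w0) ([p, p] @ w')"
      by (simp add: aut_equiv_mono set_w subset_insertI)
    finally have step: "aut_equiv A (fst ` set w) w ([p, p] @ w')" .
    show ?thesis
      using w'(2)
    proof (elim disjE exE conjE)
      fix cs assume cs: "w' = squares cs" "distinct (map fst cs)" "fst ` set cs \<subseteq> fst ` set w0"
      then have "distinct (map fst (p # cs))" "fst ` set (p # cs) \<subseteq> fst ` set w"
        using avoid0 by (simp, blast, simp add: set_w, blast)
      then show ?thesis
        using step cs(1) by (metis squares_simps(2))
    next
      fix ps assume ps: "w' = commutators ps" "distinct (map fst (pair_letters ps))"
        "fst ` set (pair_letters ps) \<subseteq> fst ` set w0"
      have 1: "fst ` set (pair_letters ps) \<subseteq> A" "distinct (map fst (p # pair_letters ps))"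
        using ps avoid0 w0A by (blast, simp, blast)
      have sub: "fst ` set (p # pair_letters ps) \<subseteq> fst ` set w"
        using ps(3) by (simp add: set_w) blast
      obtain cs where cs: "aut_equiv A (fst ` set (p # pair_letters ps)) ([p, p] @ commutators ps) (squares cs)"
        "distinct (map fst cs)" "fst ` set cs = fst ` set (p # pair_letters ps)"
        using square_commutators[OF pA 1] by blast
      have "aut_equiv A (fst ` set w) w (squares cs)"
        using aut_equiv_trans[OF step] aut_equiv_mono[OF cs(1) sub] unfolding ps(1) by blast
      then show ?thesis
        using cs(2,3) sub by blast
    qed
  qed
qed

lemma relabel_iso:
  fixes cs :: "(nat \<times> bool) list"
  assumes dist: "distinct (map fst cs)" and cs: "fst ` set cs = {1..n}"
  obtains \<phi> m where "\<phi> \<in> iso (free_group {1..n}) (free_group {1..n})"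
    "\<And>x. m (inv_letter x) = inv_letter (m x)" "map m cs = map (\<lambda>i. (i, True)) [1..<Suc n]"
    "\<And>w. \<phi> (reduce w) = reduce (map m w)"
proof -
  define d where "d = (\<lambda>i. fst (cs ! (i - 1)))"
  define e where "e = (\<lambda>i. snd (cs ! (i - 1)))"
  have len: "length cs = n"
    using distinct_card[OF dist] cs by simp
  have "bij_betw (\<lambda>i. fst (cs ! i)) {..<n} {1..n}"
    using bij_betw_nth[OF dist refl] cs len by (simp add: bij_betw_def inj_on_def) 
  moreover have "bij_betw (\<lambda>i. i - 1) {1..n} {..<n}"
    by (rule bij_betw_byWitness[where f' = Suc]) auto
  ultimately have d: "bij_betw d {1..n} {1..n}"
    unfolding d_def by (rule bij_betw_trans[unfolded comp_def, rotated])
  let ?i = "inv_into {1..n} d"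
  \<comment> \<open>\<open>k\<close> sends the generator \<open>i\<close> to the \<open>i\<close>-th
    entry of \<open>cs\<close>, and \<open>m\<close> is its inverse on \<open>{1..n}\<close>.
    Comparing a sign with \<open>e\<close> multiplies the two signs.\<close>
  define k where "k = (\<lambda>(i, b). (d i, b = e i))"
  define m where "m = (\<lambda>(a, b). (?i a, b = e (?i a)))"
  have m_inv: "m (inv_letter x) = inv_letter (m x)" "k (inv_letter x) = inv_letter (k x)" for x
    by (auto simp: m_def k_def inv_letter_def split: prod.splits)
  have mk: "m (k x) = x" "k (m x) = x" "fst (k x) \<in> {1..n}" "fst (m x) \<in> {1..n}" if "fst x \<in> {1..n}" for x
  proof -
    obtain a b where x1: "x = (a, b)"
      by (cases x)
    then have x: "x = (a, b)" "a \<in> {1..n}"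
      using that by auto
    have "?i (d a) = a" "d (?i a) = a" "?i a \<in> {1..n}" "d a \<in> {1..n}"
      using d x(2) bij_betw_inv_into_left[OF d] bij_betw_inv_into_right[OF d]
        bij_betwE[OF d] bij_betwE[OF bij_betw_inv_into[OF d]] by blast+
    then show "m (k x) = x" "k (m x) = x" "fst (k x) \<in> {1..n}" "fst (m x) \<in> {1..n}"
      by (auto simp: x m_def k_def)
  qed
  have "map m cs = map (\<lambda>i. (i, True)) [1..<Suc n]"
  proof (rule nth_equalityI)
    fix j assume "j < length (map m cs)"
    then have j: "j < n" by (simp add: len)
    have "cs ! j = k (Suc j, True)"
      by (simp add: k_def d_def e_def)
    then show "map m cs ! j = map (\<lambda>i. (i, True)) [1..<Suc n] ! j"
      using mk(1)[of "(Suc j, True)"] j len by (simp del: upt_Suc)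
  qed (simp add: len)
  moreover have "(\<lambda>w. reduce (subst (\<lambda>x. [m x]) w)) \<in> iso (free_group {1..n}) (free_group {1..n})"
    by (rule subst_iso[where k = "\<lambda>x. [k x]"])
       (use mk in \<open>auto simp: m_inv subst_Cons reduce_reduced reduced_def\<close>)
  moreover have "reduce (subst (\<lambda>x. [m x]) (reduce w)) = reduce (map m w)" for w
    by (subst reduce_subst_reduce) (auto simp: m_inv subst_def)
  ultimately show thesis
    using that m_inv(1) by blast
qed

section \<open>The standard words and the reduction to them\<close>

definition standard_squares :: "nat \<Rightarrow> nat word" where
  "standard_squares n = squares (map (\<lambda>i. (i, True)) [1..<Suc n])"

definition standard_commutators :: "nat \<Rightarrow> nat word" where
  "standard_commutators g = commutators (map (\<lambda>k. ((2 * k + 1, True), (2 * k + 2, True))) [0..<g])"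

lemma pair_letters_standard:
  "pair_letters (map (\<lambda>k. ((2 * k + 1, True), (2 * k + 2, True))) [0..<g]) = map (\<lambda>i. (i, True)) [1..<Suc (2 * g)]"
  by (induction g) (simp_all add: pair_letters_def)

lemma commutators_eq_of_pair_letters:
  "map m (pair_letters ps) = pair_letters qs \<Longrightarrow> (\<And>x. m (inv_letter x) = inv_letter (m x)) \<Longrightarrow>
     map m (commutators ps) = commutators qs"
proof (induction ps arbitrary: qs)
  case Nil
  then show ?case by (cases qs) auto
next
  case (Cons p ps)
  then show ?case by (cases p; cases qs) auto
qed

lemma list_product_free_group:
  assumes "\<And>x. x \<in> set xs \<Longrightarrow> f x = reduce (g x)"
  shows "list_product (free_group A) (map f xs) = reduce (concat (map g xs))"
  using assms by (induction xs) (simp_all add: list_product_def)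

lemma list_product_squares:
  "list_product (free_group A) (map (\<lambda>i. free_gen i [^]\<^bsub>free_group A\<^esub> (2::nat)) [1..<Suc n]) =
     reduce (standard_squares n)"
proof -
  have "free_gen i [^]\<^bsub>free_group A\<^esub> (2::nat) = reduce [(i, True), (i, True)]" for i
    by (simp add: numeral_2_eq_2 nat_pow_def free_gen_def reduce_Cons)
  then show ?thesis
    by (subst list_product_free_group[where g = "\<lambda>i. [(i, True), (i, True)]"])
       (simp_all add: standard_squares_def squares_def comp_def del: upt_Suc)
qed

lemma list_product_commutators:
  assumes "2 * g \<le> n"
  shows "list_product (free_group {1..n})
     (map (\<lambda>k. commutator (free_group {1..n}) (free_gen (2 * k + 1)) (free_gen (2 * k + 2))) [0..<g]) =
     reduce (standard_commutators g)"
proof -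
  let ?w = "\<lambda>i j. [(i, True), (j, True), (i, False), (j, False)]"
  have "commutator (free_group {1..n}) (free_gen i) (free_gen j) = reduce (?w i j)" if "i \<in> {1..n}" "j \<in> {1..n}" for i j
  proof -
    have "free_gen i \<in> carrier (free_group {1..n})" "free_gen j \<in> carrier (free_group {1..n})"
      using that by (auto simp: carrier_free_group free_gen_def reduced_def)
    then show ?thesis
      by (simp add: commutator_def inv_free_group)
         (simp add: free_gen_def inv_letter_def)
  qed
  then show ?thesis
    using assms
    by (subst list_product_free_group[where g = "\<lambda>k. ?w (2 * k + 1) (2 * k + 2)"])
       (auto simp: standard_commutators_def commutators_def comp_def inv_letter_def)
qed

text \<open>The last alternative collects the normal forms with too few letters;
  \<open>missing_letter_not_circle\<close> rules it out for circles.\<close>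

lemma quadratic_cases:
  assumes s: "s \<in> carrier (free_group {1..n})" and occ: "\<forall>a\<in>{1..n}. letter_occ a s = 2"
  obtains \<phi> where "\<phi> \<in> iso (free_group {1..n}) (free_group {1..n})"
    "\<phi> s = reduce (standard_squares n) \<or> even n \<and> \<phi> s = reduce (standard_commutators (n div 2)) \<or>
     (\<exists>a\<in>{1..n}. a \<notin> fst ` set (\<phi> s))"
proof -
  let ?F = "free_group {1..n}"
  have sA: "fst ` set s \<subseteq> {1..n}" and red: "reduce s = s"
    using s by (auto simp: carrier_free_group reduce_reduced)
  have "letter_occ a s \<in> {0, 2}" for a
    using occ letter_occ_eq_0_iff[of a s] sA by blast
  then obtain w' where w': "aut_equiv {1..n} (fst ` set s) s w'"
     "(\<exists>cs. w' = squares cs \<and> distinct (map fst cs) \<and> fst ` set cs \<subseteq> fst ` set s) \<or>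
      (\<exists>ps. w' = commutators ps \<and> distinct (map fst (pair_letters ps)) \<and>
         fst ` set (pair_letters ps) \<subseteq> fst ` set s)"
    using quadratic_normal_form[OF sA] by blast
  obtain \<psi> where \<psi>: "\<psi> \<in> iso ?F ?F" "\<psi> s = reduce w'"
    using w'(1) unfolding aut_equiv_def red by blast
  show thesis
  proof (cases "{1..n} \<subseteq> fst ` set w'")
    case False
    then show thesis
      using that[OF \<psi>(1)] set_reduce[of w'] unfolding \<psi>(2) by blast
  next
    case True
    from w'(2) show thesis
    proof (elim disjE exE conjE)
      fix cs assume cs: "w' = squares cs" "distinct (map fst cs)" "fst ` set cs \<subseteq> fst ` set s"
      then have eq: "fst ` set cs = {1..n}"
        using True sA by auto
      obtain \<phi> m where \<phi>: "\<phi> \<in> iso ?F ?F" "map m cs = map (\<lambda>i. (i, True)) [1..<Suc n]"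
        "\<And>w. \<phi> (reduce w) = reduce (map m w)"
        by (rule relabel_iso[OF cs(2) eq], rule that)
      have "map m (squares cs) = squares (map m cs)"
        by (induction cs) simp_all
      then have "\<phi> (\<psi> s) = reduce (standard_squares n)"
        by (simp only: \<psi>(2) \<phi>(2,3) cs(1) standard_squares_def)
      then show thesis
        using that[of "\<lambda>x. \<phi> (\<psi> x)"] iso_set_trans[OF \<psi>(1) \<phi>(1)] by (simp add: comp_def)
    next
      fix ps assume ps: "w' = commutators ps" "distinct (map fst (pair_letters ps))"
        "fst ` set (pair_letters ps) \<subseteq> fst ` set s"
      then have eq: "fst ` set (pair_letters ps) = {1..n}"
        using True sA by auto
      obtain \<phi> m where \<phi>: "\<phi> \<in> iso ?F ?F" "map m (pair_letters ps) = map (\<lambda>i. (i, True)) [1..<Suc n]"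
        "\<And>w. \<phi> (reduce w) = reduce (map m w)" "\<And>x. m (inv_letter x) = inv_letter (m x)"
        by (rule relabel_iso[OF ps(2) eq], rule that)
      have "length (pair_letters ps) = 2 * length ps"
        by (induction ps) (auto simp: pair_letters_def)
      then have n: "n = 2 * length ps"
        using arg_cong[OF \<phi>(2), of length] by simp
      have "map m (commutators ps) = standard_commutators (n div 2)"
        unfolding standard_commutators_def
        by (rule commutators_eq_of_pair_letters[where m = m, OF _ \<phi>(4)])
           (use \<phi>(2) n in \<open>simp only: pair_letters_standard nonzero_mult_div_cancel_left zero_neq_numeral not_False_eq_True\<close>)
      then have "\<phi> (\<psi> s) = reduce (standard_commutators (n div 2))"
        by (simp only: \<psi>(2) \<phi>(3) ps(1))
      then show thesis
        using that[of "\<lambda>x. \<phi> (\<psi> x)"] iso_set_trans[OF \<psi>(1) \<phi>(1)] n by (simp add: comp_def)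
    qed
  qed
qed

section \<open>The Freudenthal compactification of a locally finite graph\<close>

locale locally_finite_graph =
  fixes X :: "'v graph"
  assumes adj_sym: "adj X u v \<Longrightarrow> adj X v u"
    and adj_verts: "adj X u v \<Longrightarrow> u \<in> verts X"
    and locally_finite: "finite {v. adj X u v}"
begin

text \<open>Both end points of each edge between \<open>B\<close> and its complement are taken, so a
  path that avoids the boundary cannot change sides, and complementary sets have the same
  boundary.\<close>

definition boundary :: "'v set \<Rightarrow> 'v set" where
  "boundary B = {u. \<exists>v. adj X u v \<and> (u \<in> B) \<noteq> (v \<in> B)}"

definition neighbours :: "'v set \<Rightarrow> 'v set" where
  "neighbours N = (\<Union>u\<in>N. {v. adj X u v})"

lemma finite_neighbours: "finite N \<Longrightarrow> finite (neighbours N)"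
  by (simp add: neighbours_def locally_finite)

lemma boundary_Compl [simp]: "boundary (- B) = boundary B"
  by (auto simp: boundary_def)

lemma boundary_Int: "boundary (B \<inter> C) \<subseteq> boundary B \<union> boundary C"
  by (auto simp: boundary_def)

lemma boundary_verts: "boundary B \<subseteq> verts X"
  using adj_verts by (auto simp: boundary_def)

lemma finite_boundary:
  assumes "finite N"
  shows "finite (boundary N)"
proof (rule finite_subset)
  show "boundary N \<subseteq> N \<union> neighbours N"
    using adj_sym by (fastforce simp: boundary_def neighbours_def)
qed (use assms finite_neighbours in blast)

lemma connected_avoiding_refl: "u \<in> verts X - K \<Longrightarrow> connected_avoiding X K u u"
  by (simp add: connected_avoiding_def)

lemma connected_avoiding_trans:
  "connected_avoiding X K u v \<Longrightarrow> connected_avoiding X K v w \<Longrightarrow> connected_avoiding X K u w"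
  by (auto simp: connected_avoiding_def)

lemma connected_avoiding_sym: "connected_avoiding X K u v \<Longrightarrow> connected_avoiding X K v u"
proof -
  have "symp (\<lambda>x y. adj X x y \<and> x \<in> verts X - K \<and> y \<in> verts X - K)"
    using adj_sym by (auto intro: sympI)
  then show "connected_avoiding X K u v \<Longrightarrow> connected_avoiding X K v u"
    unfolding connected_avoiding_def by (meson sympD symp_rtranclp)
qed

lemma connected_avoiding_step:
  "adj X u v \<Longrightarrow> u \<notin> K \<Longrightarrow> v \<notin> K \<Longrightarrow> connected_avoiding X K u v"
  using adj_verts adj_sym by (auto simp: connected_avoiding_def intro!: r_into_rtranclp)

lemma connected_avoiding_boundary:
  assumes "connected_avoiding X K u v" "boundary B \<subseteq> K"
  shows "u \<in> B \<longleftrightarrow> v \<in> B"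
proof -
  have "(\<lambda>x y. adj X x y \<and> x \<in> verts X - K \<and> y \<in> verts X - K)\<^sup>*\<^sup>* u v"
    using assms(1) by (simp add: connected_avoiding_def)
  then show ?thesis
    by (induction rule: rtranclp_induct) (use assms(2) in \<open>auto simp: boundary_def\<close>)
qed

lemma ray_avoids:
  assumes "ray X r" "finite K"
  obtains N where "\<And>i. i \<ge> N \<Longrightarrow> r i \<notin> K"
proof -
  have "finite (r -` K)"
    using assms by (intro finite_vimageI) (auto simp: ray_def)
  then obtain N where "r -` K \<subseteq> {..<N}"
    using finite_nat_iff_bounded by blast
  then show thesis
    using that[of N] by fastforce
qed

lemma ray_tail_connected:
  assumes "ray X r" "finite K"
  obtains N where "\<And>i j. i \<ge> N \<Longrightarrow> j \<ge> N \<Longrightarrow> connected_avoiding X K (r i) (r j)"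
proof -
  obtain N where N: "\<And>i. i \<ge> N \<Longrightarrow> r i \<notin> K"
    using ray_avoids assms by blast
  have "connected_avoiding X K (r N) (r i)" if "i \<ge> N" for i
    using that
  proof (induction rule: dec_induct)
    case base
    show ?case using N assms(1) by (intro connected_avoiding_refl) (auto simp: ray_def)
  next
    case (step i)
    have "connected_avoiding X K (r i) (r (Suc i))"
      using assms(1) N step by (intro connected_avoiding_step) (auto simp: ray_def)
    then show ?case using step connected_avoiding_trans by blast
  qed
  then show thesis
    using that connected_avoiding_trans connected_avoiding_sym by blast
qed

text \<open>A tail of the ray stays connected outside the finite boundary and therefore remains on
  one side.\<close>

lemma ray_side:
  assumes "ray X r" "finite (boundary B)"
  shows "(\<exists>N. \<forall>i\<ge>N. r i \<in> B) \<or> (\<exists>N. \<forall>i\<ge>N. r i \<notin> B)"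
proof -
  obtain N where "\<And>i j. i \<ge> N \<Longrightarrow> j \<ge> N \<Longrightarrow> connected_avoiding X (boundary B) (r i) (r j)"
    using ray_tail_connected assms by blast
  then have "\<forall>i\<ge>N. r i \<in> B \<longleftrightarrow> r N \<in> B"
    using connected_avoiding_boundary by blast
  then show ?thesis by blast
qed

lemma equiv_ray_equiv: "equiv {r. ray X r} (ray_equiv X)"
proof (rule equivI)
  show "ray_equiv X \<subseteq> {r. ray X r} \<times> {r. ray X r}"
    by (auto simp: ray_equiv_def)
  show "refl_on {r. ray X r} (ray_equiv X)"
  proof (rule refl_onI)
    fix r assume "r \<in> {r. ray X r}"
    then have r: "ray X r" by simp
    have "\<exists>N. \<forall>i\<ge>N. \<forall>j\<ge>N. connected_avoiding X K (r i) (r j)" if "finite K" for K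
      by (rule ray_tail_connected[OF r that]) blast
    then show "(r, r) \<in> ray_equiv X"
      using r by (simp add: ray_equiv_def)
  qed
  show "sym (ray_equiv X)"
  proof (rule symI)
    fix a b assume ab: "(a, b) \<in> ray_equiv X"
    have "\<exists>N. \<forall>i\<ge>N. \<forall>j\<ge>N. connected_avoiding X K (b i) (a j)" if K: "finite K \<and> K \<subseteq> verts X" for K
    proof -
      obtain N where "\<forall>i\<ge>N. \<forall>j\<ge>N. connected_avoiding X K (a i) (b j)"
        using ab K unfolding ray_equiv_def by blast
      then have "\<forall>i\<ge>N. \<forall>j\<ge>N. connected_avoiding X K (b i) (a j)"
        using connected_avoiding_sym by blast
      then show ?thesis ..
    qed
    then show "(b, a) \<in> ray_equiv X"
      using ab by (simp add: ray_equiv_def)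
  qed
  show "trans (ray_equiv X)"
  proof (rule transI)
    fix a b c assume ab: "(a, b) \<in> ray_equiv X" and bc: "(b, c) \<in> ray_equiv X"
    have "\<exists>N. \<forall>i\<ge>N. \<forall>j\<ge>N. connected_avoiding X K (a i) (c j)" if K: "finite K \<and> K \<subseteq> verts X" for K
    proof -
      obtain M where M: "\<forall>i\<ge>M. \<forall>j\<ge>M. connected_avoiding X K (a i) (b j)"
        using ab K unfolding ray_equiv_def by blast
      obtain N where N: "\<forall>i\<ge>N. \<forall>j\<ge>N. connected_avoiding X K (b i) (c j)"
        using bc K unfolding ray_equiv_def by blast
      have "connected_avoiding X K (a i) (c j)" if "i \<ge> max M N" "j \<ge> max M N" for i j
        using connected_avoiding_trans[of K "a i" "b (max M N)" "c j"] M N that by simp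
      then show ?thesis by blast
    qed
    then show "(a, c) \<in> ray_equiv X"
      using ab bc by (auto simp: ray_equiv_def)
  qed
qed

lemma end_ray_class: "ray X r \<Longrightarrow> ray_equiv X `` {r} \<in> ends X" "ray X r \<Longrightarrow> r \<in> ray_equiv X `` {r}"
  using equiv_ray_equiv by (auto simp: ends_def intro: quotientI equiv_class_self dest: equiv_class_self)

lemma end_eq_ray_class: "\<omega> \<in> ends X \<Longrightarrow> r \<in> \<omega> \<Longrightarrow> \<omega> = ray_equiv X `` {r}"
  unfolding ends_def using equiv_ray_equiv by (metis Image_singleton_iff equiv_class_eq quotientE)

lemma end_ray: "\<omega> \<in> ends X \<Longrightarrow> r \<in> \<omega> \<Longrightarrow> ray X r"
  using equiv_ray_equiv unfolding ends_def by (metis in_quotient_imp_subset mem_Collect_eq subsetD)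

lemma end_equiv: "\<omega> \<in> ends X \<Longrightarrow> r \<in> \<omega> \<Longrightarrow> r' \<in> \<omega> \<Longrightarrow> (r, r') \<in> ray_equiv X"
  using equiv_ray_equiv unfolding ends_def by (metis in_quotient_imp_in_rel insert_subset empty_subsetI)

lemma end_nonempty: "\<omega> \<in> ends X \<Longrightarrow> \<exists>r. r \<in> \<omega>"
  using equiv_ray_equiv unfolding ends_def by (metis in_quotient_imp_non_empty ex_in_conv)

lemma ray_equivD:
  assumes "(r, r') \<in> ray_equiv X" "finite K" "K \<subseteq> verts X"
  obtains N where "\<And>i j. i \<ge> N \<Longrightarrow> j \<ge> N \<Longrightarrow> connected_avoiding X K (r i) (r' j)"
proof -
  have "\<forall>K. finite K \<and> K \<subseteq> verts X \<longrightarrow> (\<exists>N. \<forall>i\<ge>N. \<forall>j\<ge>N. connected_avoiding X K (r i) (r' j))"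
    using assms(1) by (simp add: ray_equiv_def)
  then obtain N where "\<forall>i\<ge>N. \<forall>j\<ge>N. connected_avoiding X K (r i) (r' j)"
    using assms(2,3) by presburger
  then show thesis
    using that[of N] by simp
qed

lemma ray_equiv_side:
  assumes "(r, r') \<in> ray_equiv X" "finite (boundary B)" "\<exists>N. \<forall>i\<ge>N. r i \<in> B"
  shows "\<exists>N. \<forall>i\<ge>N. r' i \<in> B"
proof -
  obtain N where N: "\<And>i j. i \<ge> N \<Longrightarrow> j \<ge> N \<Longrightarrow> connected_avoiding X (boundary B) (r i) (r' j)"
    by (rule ray_equivD[OF assms(1,2) boundary_verts], rule that)
  obtain M where M: "\<forall>i\<ge>M. r i \<in> B"
    using assms(3) by blast
  have "r' j \<in> B" if "j \<ge> N" for j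
    using connected_avoiding_boundary[OF N[of "max M N" j], of B] M that by simp
  then show ?thesis by blast
qed

text \<open>If \<open>B\<close> has finite boundary, any ray of the end may replace the chosen one
  (\<open>lives_in_ray\<close>), so this is then a property of the end itself.\<close>

definition lives_in :: "(nat \<Rightarrow> 'v) set \<Rightarrow> 'v set \<Rightarrow> bool" where
  "lives_in \<omega> B \<longleftrightarrow> (\<exists>r\<in>\<omega>. \<exists>N. \<forall>i\<ge>N. r i \<in> B)"

text \<open>Neighbourhoods indexed by vertex sets instead of finite separators. Inner points of an
  edge between \<open>B\<close> and its complement belong to the regions of both sets.\<close>

definition region :: "'v set \<Rightarrow> 'v fpoint set" where
  "region B = Point ` {p \<in> realization X. \<exists>v\<in>B. p v > 0} \<union> End ` {\<omega> \<in> ends X. lives_in \<omega> B}"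

lemma lives_in_mono: "lives_in \<omega> B \<Longrightarrow> B \<subseteq> C \<Longrightarrow> lives_in \<omega> C"
  unfolding lives_in_def by (meson subsetD)

lemma region_mono: "B \<subseteq> C \<Longrightarrow> region B \<subseteq> region C"
  unfolding region_def by (intro Un_mono image_mono Collect_mono) (auto intro: lives_in_mono)

lemma End_in_region [simp]: "End \<omega> \<in> region B \<longleftrightarrow> \<omega> \<in> ends X \<and> lives_in \<omega> B"
  and Point_in_region [simp]: "Point p \<in> region B \<longleftrightarrow> p \<in> realization X \<and> (\<exists>v\<in>B. p v > 0)"
  by (auto simp: region_def)

lemma lives_in_ray:
  assumes "lives_in \<omega> B" "\<omega> \<in> ends X" "finite (boundary B)" "r \<in> \<omega>"
  shows "\<exists>N. \<forall>i\<ge>N. r i \<in> B"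
  using assms end_equiv ray_equiv_side unfolding lives_in_def by metis

lemma lives_in_Compl:
  assumes "\<omega> \<in> ends X" "finite (boundary B)"
  shows "lives_in \<omega> (- B) \<longleftrightarrow> \<not> lives_in \<omega> B"
proof -
  obtain r where r: "r \<in> \<omega>" "ray X r"
    using assms end_nonempty end_ray by metis
  have C: "lives_in \<omega> C \<longleftrightarrow> (\<exists>N. \<forall>i\<ge>N. r i \<in> C)" if "finite (boundary C)" for C
    using lives_in_ray[OF _ assms(1) that r(1)] r(1) lives_in_def by blast
  have "False" if "\<forall>i\<ge>N. r i \<in> - B" "\<forall>i\<ge>M. r i \<in> B" for M N
    using that(1)[rule_format, of "max M N"] that(2)[rule_format, of "max M N"] by simp
  then show ?thesis
    using ray_side[OF r(2) assms(2)] C[of B] C[of "- B"] assms(2) by auto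
qed

lemma lives_in_Int:
  assumes "lives_in \<omega> B" "lives_in \<omega> C" "\<omega> \<in> ends X" "finite (boundary B)" "finite (boundary C)"
  shows "lives_in \<omega> (B \<inter> C)"
proof -
  obtain r where r: "r \<in> \<omega>"
    using assms end_nonempty by metis
  obtain M N where "\<forall>i\<ge>M. r i \<in> B" "\<forall>i\<ge>N. r i \<in> C"
    using lives_in_ray r assms by metis
  then have "\<forall>i\<ge>max M N. r i \<in> B \<inter> C" by simp
  then show ?thesis using r unfolding lives_in_def by blast
qed

lemma lives_in_cofinite:
  assumes "\<omega> \<in> ends X" "finite N"
  shows "lives_in \<omega> (- N)"
proof -
  obtain r where r: "r \<in> \<omega>" "ray X r"
    using assms end_nonempty end_ray by metis
  show ?thesis
    using ray_avoids[OF r(2) assms(2)] r(1) unfolding lives_in_def by (metis ComplI)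
qed

lemma mem_end_component:
  assumes "\<omega> \<in> ends X" "r \<in> \<omega>" "finite K" "K \<subseteq> verts X"
  shows "v \<in> end_component X K \<omega> \<longleftrightarrow> (\<exists>N. \<forall>i\<ge>N. connected_avoiding X K (r i) v)"
proof
  assume "v \<in> end_component X K \<omega>"
  then obtain r' N where r': "r' \<in> \<omega>" "\<forall>i\<ge>N. connected_avoiding X K (r' i) v"
    unfolding end_component_def by blast
  obtain M where M: "\<And>i j. i \<ge> M \<Longrightarrow> j \<ge> M \<Longrightarrow> connected_avoiding X K (r i) (r' j)"
    by (rule ray_equivD[OF end_equiv[OF assms(1,2) r'(1)] assms(3,4)], rule that)
  have "connected_avoiding X K (r i) v" if "i \<ge> M" for i
    using connected_avoiding_trans[of K "r i" "r' (max M N)" v] M r'(2) that by simp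
  then show "\<exists>N. \<forall>i\<ge>N. connected_avoiding X K (r i) v" by blast
qed (use assms in \<open>auto simp: end_component_def\<close>)

lemma end_component_tail:
  assumes "\<omega> \<in> ends X" "finite K" "K \<subseteq> verts X"
  shows "lives_in \<omega> (end_component X K \<omega>)"
proof -
  obtain r where r: "r \<in> \<omega>" "ray X r"
    using assms end_nonempty end_ray by metis
  obtain N where "\<And>i j. i \<ge> N \<Longrightarrow> j \<ge> N \<Longrightarrow> connected_avoiding X K (r i) (r j)"
    using ray_tail_connected[OF r(2) assms(2)] by blast
  then show ?thesis
    using r mem_end_component[OF assms(1) r(1) assms(2,3)] unfolding lives_in_def by blast
qed

lemma end_component_connected:
  assumes "\<omega> \<in> ends X" "finite K" "K \<subseteq> verts X" "u \<in> end_component X K \<omega>"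
  shows "v \<in> end_component X K \<omega> \<longleftrightarrow> connected_avoiding X K u v"
proof -
  obtain r where r: "r \<in> \<omega>"
    using assms end_nonempty by metis
  note mem = mem_end_component[OF assms(1) r assms(2,3)]
  obtain N where N: "\<forall>i\<ge>N. connected_avoiding X K (r i) u"
    using assms(4) mem by blast
  show ?thesis
  proof
    assume "v \<in> end_component X K \<omega>"
    then obtain M where "\<forall>i\<ge>M. connected_avoiding X K (r i) v"
      using mem by blast
    then show "connected_avoiding X K u v"
      using N connected_avoiding_trans[OF connected_avoiding_sym, of K "r (max M N)" u v] by simp
  next
    assume "connected_avoiding X K u v"
    then show "v \<in> end_component X K \<omega>"
      using N mem connected_avoiding_trans by blast
  qed
qed

lemma finite_boundary_end_component:
  assumes "\<omega> \<in> ends X" "finite K" "K \<subseteq> verts X"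
  shows "finite (boundary (end_component X K \<omega>))"
proof (rule finite_subset)
  let ?C = "end_component X K \<omega>"
  have "v \<in> K" if "u \<in> ?C" "adj X u v" "v \<notin> ?C" for u v
  proof (rule ccontr)
    assume "v \<notin> K"
    moreover have "u \<notin> K"
      using end_component_connected[OF assms that(1), of u] that(1) by (simp add: connected_avoiding_def)
    ultimately show False
      using end_component_connected[OF assms that(1), of v] connected_avoiding_step that(2,3) by blast
  qed
  then show "boundary ?C \<subseteq> K \<union> neighbours K"
    using adj_sym unfolding boundary_def neighbours_def by blast
qed (use assms finite_neighbours in blast)

lemma end_component_eq:
  assumes "\<omega> \<in> ends X" "\<omega>' \<in> ends X" "finite K" "K \<subseteq> verts X" "lives_in \<omega>' (end_component X K \<omega>)"
  shows "end_component X K \<omega>' = end_component X K \<omega>"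
proof -
  let ?B = "end_component X K \<omega> \<inter> end_component X K \<omega>'"
  have "lives_in \<omega>' ?B"
    using assms end_component_tail finite_boundary_end_component by (intro lives_in_Int) auto
  then obtain u where "u \<in> ?B"
    unfolding lives_in_def by blast
  then show ?thesis
    using end_component_connected[of _ K u] assms by blast
qed

lemma end_nbhd_eq_region:
  assumes "\<omega> \<in> ends X" "finite K" "K \<subseteq> verts X"
  shows "end_nbhd X K \<omega> = region (end_component X K \<omega>)"
proof -
  have "end_component X K \<omega>' = end_component X K \<omega> \<longleftrightarrow> lives_in \<omega>' (end_component X K \<omega>)"
    if "\<omega>' \<in> ends X" for \<omega>'
    using end_component_tail[OF that assms(2,3)] end_component_eq[OF assms(1) that assms(2,3)] by auto
  then show ?thesis
    unfolding end_nbhd_def region_def by (auto cong: conj_cong)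
qed

section \<open>Open sets and separation in the compactification\<close>

lemma open_positive: "open_in_realization X {p \<in> realization X. \<exists>v\<in>B. p v > 0}"
  unfolding open_in_realization_def
proof (intro conjI allI impI)
  fix u v assume uv: "adj X u v"
  have "open (\<Union>c\<in>B. {t. 0 < edge_point u v t c})"
    unfolding edge_point_def by (intro open_UN ballI open_Collect_less continuous_intros)
  moreover have "{t \<in> {0..1}. edge_point u v t \<in> {p \<in> realization X. \<exists>v\<in>B. p v > 0}} =
      {0..1} \<inter> (\<Union>c\<in>B. {t. 0 < edge_point u v t c})"
    using uv by (auto simp: realization_def)
  ultimately show "openin (top_of_set {0..1}) {t \<in> {0..1}. edge_point u v t \<in> {p \<in> realization X. \<exists>v\<in>B. p v > 0}}"
    by (simp add: openin_open_Int)
qed auto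

lemma openin_Point: "open_in_realization X U \<Longrightarrow> openin (freudenthal X) (Point ` U)"
  unfolding freudenthal_def by (rule topology_generated_by_Basis) blast

text \<open>The points form an open set by \<open>open_positive\<close>. For an end living in
  \<open>B\<close>, its component outside \<open>boundary B\<close> cannot cross that boundary, so
  it lies in \<open>B\<close> and provides a basic neighbourhood.\<close>

lemma openin_region:
  assumes "finite (boundary B)"
  shows "openin (freudenthal X) (region B)"
proof -
  let ?E = "{\<omega> \<in> ends X. lives_in \<omega> B}" and ?K = "boundary B"
  let ?P = "Point ` {p \<in> realization X. \<exists>v\<in>B. p v > 0}"
  have sub: "region (end_component X ?K \<omega>) \<subseteq> region B" if "\<omega> \<in> ?E" for \<omega>
  proof (rule region_mono)
    have "lives_in \<omega> (B \<inter> end_component X ?K \<omega>)"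
      using that assms boundary_verts
      by (intro lives_in_Int) (auto intro: end_component_tail finite_boundary_end_component)
    then obtain u where u: "u \<in> B" "u \<in> end_component X ?K \<omega>"
      unfolding lives_in_def by blast
    show "end_component X ?K \<omega> \<subseteq> B"
    proof
      fix v assume "v \<in> end_component X ?K \<omega>"
      then have "connected_avoiding X ?K u v"
        using end_component_connected[of \<omega> ?K u] u(2) that assms boundary_verts by simp
      then show "v \<in> B"
        using connected_avoiding_boundary[of ?K u v B] u(1) by simp
    qed
  qed
  have "region B = ?P \<union> (\<Union>\<omega>\<in>?E. end_nbhd X ?K \<omega>)"
  proof (rule antisym)
    have "End \<omega> \<in> end_nbhd X ?K \<omega>" if "\<omega> \<in> ?E" for \<omega>
      using that by (auto simp: end_nbhd_def)
    then show "region B \<subseteq> ?P \<union> (\<Union>\<omega>\<in>?E. end_nbhd X ?K \<omega>)"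
      unfolding region_def by (intro Un_mono order_refl image_subsetI) blast
    have "end_nbhd X ?K \<omega> \<subseteq> region B" if "\<omega> \<in> ?E" for \<omega>
      using sub[OF that] end_nbhd_eq_region[of \<omega> ?K] that assms boundary_verts by simp
    then have "(\<Union>\<omega>\<in>?E. end_nbhd X ?K \<omega>) \<subseteq> region B"
      by (rule UN_least)
    moreover have "?P \<subseteq> region B"
      unfolding region_def by (rule Un_upper1)
    ultimately show "?P \<union> (\<Union>\<omega>\<in>?E. end_nbhd X ?K \<omega>) \<subseteq> region B"
      by simp
  qed
  moreover have "openin (freudenthal X) (end_nbhd X ?K \<omega>)" if "\<omega> \<in> ?E" for \<omega>
    unfolding freudenthal_def
    by (rule topology_generated_by_Basis, intro UnI2 CollectI exI[of _ ?K] exI[of _ \<omega>])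
       (use that assms boundary_verts in simp)
  ultimately show ?thesis
    using openin_Point[OF open_positive] by (metis (no_types, lifting) imageE openin_Un openin_Union)
qed

text \<open>Induction over the generation of the topology: subbasic sets around the end are regions
  of end components, and finiteness of the boundary survives intersection.\<close>

lemma end_neighbourhood:
  assumes "openin (freudenthal X) W" "End \<omega> \<in> W" "\<omega> \<in> ends X"
  obtains B where "finite (boundary B)" "lives_in \<omega> B" "region B \<subseteq> W"
proof -
  let ?S = "{Point ` U | U. open_in_realization X U} \<union>
      {end_nbhd X K \<omega> | K \<omega>. finite K \<and> K \<subseteq> verts X \<and> \<omega> \<in> ends X}"
  have "generate_topology_on ?S W"
    using assms(1) unfolding freudenthal_def openin_topology_generated_by_iff .
  then have "End \<omega> \<in> W \<longrightarrow> (\<exists>B. finite (boundary B) \<and> lives_in \<omega> B \<and> region B \<subseteq> W)"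
  proof induction
    case (Int V W)
    show ?case
    proof
      assume "End \<omega> \<in> V \<inter> W"
      then obtain B C where "finite (boundary B)" "lives_in \<omega> B" "region B \<subseteq> V"
        "finite (boundary C)" "lives_in \<omega> C" "region C \<subseteq> W"
        using Int by blast
      then show "\<exists>B. finite (boundary B) \<and> lives_in \<omega> B \<and> region B \<subseteq> V \<inter> W"
        using region_mono[of "B \<inter> C" B] region_mono[of "B \<inter> C" C] lives_in_Int[of \<omega> B C] assms(3)
          finite_subset[OF boundary_Int[of B C]]
        by (intro exI[of _ "B \<inter> C"]) auto
    qed
  next
    case (UN \<W>)
    then show ?case by blast
  next
    case (Basis s)
    show ?case
    proof
      assume "End \<omega> \<in> s"
      then obtain K \<omega>' where K: "finite K" "K \<subseteq> verts X" "\<omega>' \<in> ends X" "s = end_nbhd X K \<omega>'"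
        using Basis by auto
      have "end_component X K \<omega> = end_component X K \<omega>'"
        using \<open>End \<omega> \<in> s\<close> unfolding K(4) end_nbhd_def by auto
      then show "\<exists>B. finite (boundary B) \<and> lives_in \<omega> B \<and> region B \<subseteq> s"
        using end_component_tail[OF assms(3) K(1,2)] end_nbhd_eq_region[OF K(3) K(1,2)]
          finite_boundary_end_component[OF assms(3) K(1,2)] K(4) by (metis order_refl)
    qed
  qed simp
  then show thesis using that assms(2) by blast
qed

lemma realization_adjacent:
  assumes "p \<in> realization X" "p u > 0" "p v > 0"
  shows "u = v \<or> adj X u v"
  using assms adj_sym
  by (auto simp: realization_def vertex_point_def edge_point_def of_bool_def split: if_splits)

lemma realization_support:
  assumes "p \<in> realization X"
  shows "finite {v. p v > 0}" "\<exists>v. p v > 0"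
proof -
  show "finite {v. p v > 0}"
    using assms
  proof (auto simp: realization_def)
    fix v show "finite {w. 0 < vertex_point v w}"
      by (rule finite_subset[of _ "{v}"]) (auto simp: vertex_point_def)
  next
    fix u v and t :: real show "finite {w. 0 < edge_point u v t w}"
      by (rule finite_subset[of _ "{u, v}"]) (auto simp: edge_point_def)
  qed
  have "0 < edge_point u v t u \<or> 0 < edge_point u v t v" if "t \<in> {0..1}" for v u :: 'v and t :: real
    using that by (cases "t = 0") (auto simp: edge_point_def of_bool_def)
  then show "\<exists>v. p v > 0"
    using assms unfolding realization_def
  proof (elim UnE imageE CollectE exE conjE)
    fix v assume "p = vertex_point v"
    then have "p v > 0" by (simp add: vertex_point_def)
    then show ?thesis ..
  next
    fix u v t assume p: "p = edge_point u v t" "t \<in> {0..1}"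
    with \<open>\<And>v u t. t \<in> {0..1} \<Longrightarrow> 0 < edge_point u v t u \<or> 0 < edge_point u v t v\<close>
    show ?thesis by blast
  qed
qed

text \<open>The regions of \<open>B\<close> and of its complement overlap on the edges between them.
  Shrinking the complement by the finite boundary removes the overlap, and no end notices the loss
  of finitely many vertices.\<close>

lemma separating_region:
  assumes "finite (boundary B)"
  obtains B' where "finite (boundary B')" "\<And>\<omega>. \<omega> \<in> ends X \<Longrightarrow> \<not> lives_in \<omega> B \<Longrightarrow> lives_in \<omega> B'"
    "region B \<inter> region B' = {}"
proof
  let ?B' = "- B \<inter> - boundary B"
  show fin: "finite (boundary ?B')"
    using finite_subset[OF boundary_Int[of "- B" "- boundary B"]] assms finite_boundary by simp
  show "lives_in \<omega> ?B'" if "\<omega> \<in> ends X" "\<not> lives_in \<omega> B" for \<omega>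
    using that lives_in_Compl lives_in_cofinite assms finite_boundary by (intro lives_in_Int) auto
  have "\<not> (lives_in \<omega> B \<and> lives_in \<omega> ?B')" if "\<omega> \<in> ends X" for \<omega>
    using lives_in_Int[of \<omega> B ?B'] that assms fin unfolding lives_in_def by fastforce
  moreover have "False" if "p \<in> realization X" "p u > 0" "u \<in> B" "p v > 0" "v \<in> ?B'" for p u v
    using realization_adjacent[OF that(1,2,4)] that(3,5) adj_sym unfolding boundary_def by blast
  ultimately show "region B \<inter> region ?B' = {}"
    unfolding region_def by blast
qed

lemma ends_separated:
  assumes "\<omega> \<in> ends X" "\<omega>' \<in> ends X" "\<omega> \<noteq> \<omega>'"
  obtains B where "finite (boundary B)" "lives_in \<omega> B" "\<not> lives_in \<omega>' B"
proof -
  obtain r r' where r: "r \<in> \<omega>" "r' \<in> \<omega>'" "ray X r" "ray X r'"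
    using assms end_nonempty end_ray by metis
  have "(r, r') \<notin> ray_equiv X"
    using end_eq_ray_class[OF assms(1) r(1)] end_eq_ray_class[OF assms(2) r(2)] assms(3)
      equiv_class_eq[OF equiv_ray_equiv] by metis
  then obtain K where K: "finite K" "K \<subseteq> verts X"
    "\<And>N. \<exists>i\<ge>N. \<exists>j\<ge>N. \<not> connected_avoiding X K (r i) (r' j)"
  proof -
    obtain K where K: "finite K" "K \<subseteq> verts X"
      "\<not> (\<exists>N. \<forall>i\<ge>N. \<forall>j\<ge>N. connected_avoiding X K (r i) (r' j))"
      using \<open>(r, r') \<notin> ray_equiv X\<close> r(3,4) unfolding ray_equiv_def by auto
    then show thesis
      using that[OF K(1,2)] by meson
  qed
  let ?B = "end_component X K \<omega>"
  have fin: "finite (boundary ?B)" and tail: "lives_in \<omega> ?B"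
    using finite_boundary_end_component end_component_tail assms(1) K(1,2) by auto
  have "\<not> lives_in \<omega>' ?B"
  proof
    assume "lives_in \<omega>' ?B"
    then obtain M where M: "\<forall>i\<ge>M. r' i \<in> ?B"
      using lives_in_ray[OF _ assms(2) fin r(2)] by blast
    obtain N where N: "\<forall>i\<ge>N. r i \<in> ?B"
      using lives_in_ray[OF tail assms(1) fin r(1)] by blast
    obtain i j where ij: "i \<ge> max M N" "j \<ge> max M N" "\<not> connected_avoiding X K (r i) (r' j)"
      using K(3)[of "max M N"] by blast
    then have "r i \<in> ?B" "r' j \<in> ?B"
      using M N by simp_all
    then show False
      using ij(3) end_component_connected[OF assms(1) K(1,2)] by blast
  qed
  then show thesis
    using that[OF fin tail] by blast
qed

text \<open>Two ends are separated by a component outside a finite vertex set, a point and an end by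
  the finitely many vertices with positive coordinate at the point, and two points by a threshold
  for a coordinate in which they differ.\<close>

lemma Hausdorff_freudenthal: "Hausdorff_space (freudenthal X)"
proof -
  let ?sep = "\<lambda>x y. \<exists>U V. openin (freudenthal X) U \<and> openin (freudenthal X) V \<and> x \<in> U \<and> y \<in> V \<and> disjnt U V"
  have ends: "?sep (End \<omega>) (End \<omega>')" if e: "\<omega> \<in> ends X" "\<omega>' \<in> ends X" "\<omega> \<noteq> \<omega>'" for \<omega> \<omega>'
  proof -
    obtain B where B: "finite (boundary B)" "lives_in \<omega> B" "\<not> lives_in \<omega>' B"
      using ends_separated[OF e] by blast
    obtain B' where B': "finite (boundary B')" "lives_in \<omega>' B'" "region B \<inter> region B' = {}"
    proof (rule separating_region[OF B(1)])
      fix C assume "finite (boundary C)" "\<And>\<omega>. \<omega> \<in> ends X \<Longrightarrow> \<not> lives_in \<omega> B \<Longrightarrow> lives_in \<omega> C"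
        "region B \<inter> region C = {}"
      then show thesis using that[of C] B(3) e(2) by simp
    qed
    show ?thesis
      using openin_region[OF B(1)] openin_region[OF B'(1)] B B' e
      by (intro exI[of _ "region B"] exI[of _ "region B'"]) (simp add: End_in_region disjnt_def)
  qed
  have mixed: "?sep (Point p) (End \<omega>)" if m: "p \<in> realization X" "\<omega> \<in> ends X" for p \<omega>
  proof -
    let ?N = "{v. p v > 0}"
    have N: "finite (boundary ?N)" "\<not> lives_in \<omega> ?N"
      using realization_support(1)[OF m(1)] finite_boundary lives_in_Compl[OF m(2)]
        lives_in_cofinite[OF m(2)] by auto
    obtain B' where B': "finite (boundary B')" "lives_in \<omega> B'" "region ?N \<inter> region B' = {}"
    proof (rule separating_region[OF N(1)])
      fix C assume "finite (boundary C)" "\<And>\<omega>. \<omega> \<in> ends X \<Longrightarrow> \<not> lives_in \<omega> ?N \<Longrightarrow> lives_in \<omega> C"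
        "region ?N \<inter> region C = {}"
      then show thesis using that[of C] N(2) m(2) by simp
    qed
    show ?thesis
      using openin_region[OF N(1)] openin_region[OF B'(1)] B' m realization_support(2)[OF m(1)]
      by (intro exI[of _ "region ?N"] exI[of _ "region B'"]) (simp add: End_in_region Point_in_region disjnt_def)
  qed
  have points: "?sep (Point p) (Point q)" if pq: "p \<in> realization X" "q \<in> realization X" "p w < q w" for p q w
  proof -
    obtain c where c: "p w < c" "c < q w"
      using dense pq(3) by blast
    have *: "openin (top_of_set {0..1}) {t \<in> {0..1}. edge_point u v t \<in> realization X \<and> P (edge_point u v t w)}"
      if "adj X u v" "open {x. P x}" for u v and P :: "real \<Rightarrow> bool"
    proof -
      have "{t \<in> {0..1}. edge_point u v t \<in> realization X \<and> P (edge_point u v t w)} =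
          {0..1} \<inter> (\<lambda>t. edge_point u v t w) -` {x. P x}"
        using that(1) by (auto simp: realization_def)
      moreover have "open ((\<lambda>t. edge_point u v t w) -` {x. P x})"
        using that(2) unfolding edge_point_def by (intro open_vimage continuous_intros)
      ultimately show ?thesis by (simp add: openin_open_Int)
    qed
    have "open_in_realization X {r \<in> realization X. r w < c}" "open_in_realization X {r \<in> realization X. c < r w}"
      unfolding open_in_realization_def using *[of _ _ "\<lambda>x. x < c"] *[of _ _ "\<lambda>x. c < x"]
      by (auto simp: open_Collect_less)
    then show ?thesis
      using c pq
      by (intro exI[of _ "Point ` {r \<in> realization X. r w < c}"] exI[of _ "Point ` {r \<in> realization X. c < r w}"])
         (auto intro!: openin_Point simp: disjnt_def)
  qed
  have sym: "?sep x y \<Longrightarrow> ?sep y x" for x y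
    by (metis disjnt_sym)
  show ?thesis
    unfolding Hausdorff_space_def topspace_freudenthal
  proof (intro allI impI)
    fix x y assume xy: "x \<in> Point ` realization X \<union> End ` ends X \<and> y \<in> Point ` realization X \<union> End ` ends X \<and> x \<noteq> y"
    have pts: "?sep (Point p) (Point q)" if pq: "p \<in> realization X" "q \<in> realization X" "p \<noteq> q" for p q
    proof -
      obtain w where "p w \<noteq> q w" using \<open>p \<noteq> q\<close> by blast
      then consider "p w < q w" | "q w < p w" by linarith
      then show ?thesis
      proof cases
        case 1
        show ?thesis by (rule points[OF pq(1,2) 1])
      next
        case 2
        show ?thesis by (rule sym, rule points[OF pq(2,1) 2])
      qed
    qed
    show "?sep x y"
    proof (cases x)
      case (Point p)
      then show ?thesis
        using xy pts[of p] mixed[of p] by (cases y) (simp_all add: image_iff)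
    next
      case (End \<omega>)
      then show ?thesis
        using xy ends[of \<omega>] sym[OF mixed[of _ \<omega>]] by (cases y) (simp_all add: image_iff)
    qed
  qed
qed

lemma continuous_map_edge_point:
  assumes "adj X u v"
  shows "continuous_map (top_of_set {0..1}) (freudenthal X) (\<lambda>t. Point (edge_point u v t))"
proof -
  have "openin (top_of_set {0..1}) ((\<lambda>t. Point (edge_point u v t)) -` V \<inter> {0..1})"
    if V: "V \<in> {Point ` U | U. open_in_realization X U} \<union>
      {end_nbhd X K \<omega> | K \<omega>. finite K \<and> K \<subseteq> verts X \<and> \<omega> \<in> ends X}" for V
  proof -
    have "\<exists>U. open_in_realization X U \<and> (\<lambda>t. Point (edge_point u v t)) -` V = edge_point u v -` U"
      using V
    proof (elim UnE CollectE exE conjE)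
      fix U assume "V = Point ` U" "open_in_realization X U"
      then show ?thesis by (intro exI[of _ U]) auto
    next
      fix K \<omega> assume "V = end_nbhd X K \<omega>" "finite K" "K \<subseteq> verts X" "\<omega> \<in> ends X"
      then show ?thesis
        by (intro exI[of _ "{p \<in> realization X. \<exists>v\<in>end_component X K \<omega>. p v > 0}"])
           (auto simp: open_positive end_nbhd_def)
    qed
    then obtain U where U: "open_in_realization X U" "(\<lambda>t. Point (edge_point u v t)) -` V = edge_point u v -` U"
      by blast
    have "(\<lambda>t. Point (edge_point u v t)) -` V \<inter> {0..1} = {t \<in> {0..1}. edge_point u v t \<in> U}"
      unfolding U(2) by auto
    then show ?thesis
      using U(1) assms unfolding open_in_realization_def by simp
  qed
  moreover have "(\<lambda>t. Point (edge_point u v t)) ` {0..1} \<subseteq> topspace (freudenthal X)"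
  proof -
    have "edge_point u v t \<in> realization X" if "t \<in> {0..1}" for t
      using assms that unfolding realization_def by blast
    then show ?thesis
      unfolding topspace_freudenthal by blast
  qed
  ultimately show ?thesis
    unfolding freudenthal_def
    by (subst continuous_on_generated_topo_iff) (auto simp: topology_generated_by_topspace)
qed

end

section \<open>Ends of Cayley graphs of free groups\<close>

lemma reduced_append_single:
  "reduced (u @ [x]) \<longleftrightarrow> reduced u \<and> (u \<noteq> [] \<longrightarrow> x \<noteq> inv_letter (last u))"
  by (auto simp: reduced_def successively_append_iff)

lemma reduce_snoc:
  assumes "reduced u"
  shows "reduce (u @ [x]) = (if u \<noteq> [] \<and> x = inv_letter (last u) then butlast u else u @ [x])"
proof (cases "u \<noteq> [] \<and> x = inv_letter (last u)")
  case True
  then have "u @ [x] = butlast u @ [last u] @ winv [last u]"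
    by simp
  moreover have "reduced (butlast u)"
    using assms True reduced_append_single[of "butlast u" "last u"] by simp
  ultimately have "reduce (u @ [x]) = butlast u"
    using reduce_winv_cancel(6)[of "butlast u" "[last u]"] by (simp only: reduce_reduced)
  then show ?thesis
    using True by simp
next
  case False
  then have "reduced (u @ [x])"
    using assms by (auto simp: reduced_append_single)
  then show ?thesis
    using False by (auto simp: reduce_reduced)
qed

text \<open>Every appended letter removes at most one final letter of \<open>u\<close>. This
  stability of long prefixes is what connects the generating set \<open>S\<close> with the
  tree.\<close>

lemma take_reduce_append:
  assumes "reduced u" "k + length v \<le> length u"
  shows "take k (reduce (u @ v)) = take k u"
  using assms
proof (induction v arbitrary: u)
  case Nil
  then show ?case by (simp add: reduce_reduced)
next
  case (Cons x v)
  let ?u = "reduce (u @ [x])"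
  have "k + length v \<le> length ?u" "take k ?u = take k u"
    using Cons.prems by (auto simp: reduce_snoc take_butlast)
  moreover have "reduce (u @ x # v) = reduce (?u @ v)"
    by simp
  ultimately show ?case
    using Cons.IH[of ?u] by simp
qed

lemma reduced_take: "reduced w \<Longrightarrow> reduced (take k w)"
  unfolding reduced_def by (metis append_take_drop_id successively_append_iff)

text \<open>\<open>G\<close> and \<open>\<phi>\<close> are kept apart so that the Cayley graphs stay
  fixed while the automorphism varies: group elements are read as words through
  \<open>\<phi>\<close>.\<close>

locale free_cayley = group G for G :: "'g monoid" (structure) +
  fixes A :: "'a set" and \<phi> :: "'g \<Rightarrow> 'a word" and S :: "'g set" and s :: 'g
  assumes finite_A: "finite A"
    and \<phi>_iso: "\<phi> \<in> iso G (free_group A)"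
    and finite_S: "finite S" and S_carrier: "S \<subseteq> carrier G"
    and S_inv: "x \<in> S \<Longrightarrow> inv x \<in> S"
    and S_gen: "generate G S = carrier G"
    and s_in: "s \<in> S"
begin

abbreviation X :: "'g graph" where "X \<equiv> cayley_graph G S"
abbreviation Y :: "'g graph" where "Y \<equiv> cayley_graph G {s, inv s}"

definition vtx :: "'a word \<Rightarrow> 'g" where
  "vtx w = inv_into (carrier G) \<phi> (reduce w)"

lemma bij_\<phi>: "bij_betw \<phi> (carrier G) (carrier (free_group A))"
  and hom_\<phi>: "\<phi> \<in> hom G (free_group A)"
  using \<phi>_iso by (auto simp: iso_def)

lemma \<phi>_carrier: "g \<in> carrier G \<Longrightarrow> reduced (\<phi> g)" "g \<in> carrier G \<Longrightarrow> fst ` set (\<phi> g) \<subseteq> A"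
  using bij_betwE[OF bij_\<phi>] by (auto simp: carrier_free_group)

lemma \<phi>_mult: "g \<in> carrier G \<Longrightarrow> h \<in> carrier G \<Longrightarrow> \<phi> (g \<otimes> h) = reduce (\<phi> g @ \<phi> h)"
  using hom_mult[OF hom_\<phi>] by simp

lemma \<phi>_inj: "g \<in> carrier G \<Longrightarrow> h \<in> carrier G \<Longrightarrow> \<phi> g = \<phi> h \<Longrightarrow> g = h"
  using bij_\<phi> by (auto simp: bij_betw_def inj_on_def)

lemma \<phi>_one [simp]: "\<phi> \<one> = []"
  using hom_one[OF hom_\<phi> is_group group_free_group] by simp

lemma vtx_carrier: "fst ` set w \<subseteq> A \<Longrightarrow> vtx w \<in> carrier G"
  and \<phi>_vtx: "fst ` set w \<subseteq> A \<Longrightarrow> \<phi> (vtx w) = reduce w"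
  using bij_\<phi> reduce_in_carrier[of w A] unfolding vtx_def bij_betw_def
  by (auto intro: inv_into_into f_inv_into_f)

lemma vtx_\<phi>: "g \<in> carrier G \<Longrightarrow> vtx (\<phi> g) = g"
  using \<phi>_carrier \<phi>_vtx vtx_carrier by (intro \<phi>_inj) (auto simp: reduce_reduced)

lemma vtx_mult: "fst ` set u \<subseteq> A \<Longrightarrow> fst ` set v \<subseteq> A \<Longrightarrow> vtx u \<otimes> vtx v = vtx (u @ v)"
  by (intro \<phi>_inj) (auto simp: vtx_carrier \<phi>_mult \<phi>_vtx image_Un)

lemma vtx_Nil [simp]: "vtx [] = \<one>"
  using vtx_\<phi>[of \<one>] by simp

lemma vtx_eqI: "reduce u = reduce v \<Longrightarrow> vtx u = vtx v"
  by (simp add: vtx_def)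

lemma \<phi>_inv: "g \<in> carrier G \<Longrightarrow> \<phi> (inv g) = winv (\<phi> g)"
proof -
  assume g: "g \<in> carrier G"
  have "vtx (winv (\<phi> g)) \<otimes> g = vtx (winv (\<phi> g) @ \<phi> g)"
    using vtx_mult[of "winv (\<phi> g)" "\<phi> g"] \<phi>_carrier(2)[OF g] vtx_\<phi>[OF g] by simp
  also have "\<dots> = \<one>"
    using vtx_eqI[of "winv (\<phi> g) @ \<phi> g" "[]"] by simp
  finally have "inv g = vtx (winv (\<phi> g))"
    using g \<phi>_carrier(2)[OF g] by (intro inv_equality vtx_carrier) simp_all
  then show "\<phi> (inv g) = winv (\<phi> g)"
    using g \<phi>_carrier(2)[OF g] by (simp add: \<phi>_vtx reduce_winv reduce_reduced \<phi>_carrier(1))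
qed

lemma s_carrier: "s \<in> carrier G"
  using s_in S_carrier by blast

lemma adj_X_iff: "adj X u v \<longleftrightarrow> u \<in> carrier G \<and> (\<exists>x\<in>S. v = u \<otimes> x)"
proof
  assume "adj X u v"
  then have "u \<in> carrier G" "v \<in> carrier G" "inv u \<otimes> v \<in> S"
    by (simp_all add: cayley_graph_def)
  then show "u \<in> carrier G \<and> (\<exists>x\<in>S. v = u \<otimes> x)"
    by (intro conjI bexI[of _ "inv u \<otimes> v"]) (simp_all add: m_assoc[symmetric])
next
  assume "u \<in> carrier G \<and> (\<exists>x\<in>S. v = u \<otimes> x)"
  then obtain x where "u \<in> carrier G" "x \<in> S" "v = u \<otimes> x" by blast
  moreover have "x \<in> carrier G"
    using S_carrier calculation(2) by blast
  ultimately show "adj X u v"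
    by (simp add: cayley_graph_def m_assoc[symmetric])
qed

lemma verts_X [simp]: "verts X = carrier G"
  by (simp add: cayley_graph_def)

lemma cayley_adj_sym:
  assumes "\<And>x. x \<in> T \<Longrightarrow> inv x \<in> T" "adj (cayley_graph G T) u v"
  shows "adj (cayley_graph G T) v u"
proof -
  have "u \<in> carrier G" "v \<in> carrier G" "inv u \<otimes> v \<in> T"
    using assms(2) by (simp_all add: cayley_graph_def)
  moreover from this have "inv (inv u \<otimes> v) = inv v \<otimes> u"
    by (simp add: inv_mult_group)
  ultimately show ?thesis
    using assms(1)[of "inv u \<otimes> v"] by (simp add: cayley_graph_def)
qed

sublocale locally_finite_graph X
proof
  show "adj X v u" if "adj X u v" for u v
    using cayley_adj_sym[OF S_inv that] .
  show "u \<in> verts X" if "adj X u v" for u v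
    using that by (simp add: cayley_graph_def)
  show "finite {v. adj X u v}" for u
  proof (rule finite_subset)
    show "{v. adj X u v} \<subseteq> (\<otimes>) u ` S"
      using adj_X_iff by blast
  qed (simp add: finite_S)
qed

definition radius :: nat where
  "radius = Max (insert 0 ((\<lambda>x. length (\<phi> x)) ` S))"

lemma length_radius: "x \<in> S \<Longrightarrow> length (\<phi> x) \<le> radius"
  using finite_S by (auto simp: radius_def intro: Max_ge)

lemma finite_ball: "finite {v \<in> carrier G. length (\<phi> v) \<le> k}"
proof (rule inj_on_finite)
  show "inj_on \<phi> {v \<in> carrier G. length (\<phi> v) \<le> k}"
    using \<phi>_inj by (auto intro: inj_onI)
  show "\<phi> ` {v \<in> carrier G. length (\<phi> v) \<le> k} \<subseteq> {w. set w \<subseteq> A \<times> UNIV \<and> length w \<le> k}"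
  proof (rule image_subsetI)
    fix v assume "v \<in> {v \<in> carrier G. length (\<phi> v) \<le> k}"
    then show "\<phi> v \<in> {w. set w \<subseteq> A \<times> UNIV \<and> length w \<le> k}"
      using \<phi>_carrier(2)[of v] by force
  qed
  show "finite {w :: 'a word. set w \<subseteq> A \<times> UNIV \<and> length w \<le> k}"
    using finite_A by (intro finite_lists_length_le) simp
qed

text \<open>The vertices beyond the edge of the tree \<open>Cay(G; A)\<close> that ends in \<open>w\<close>.\<close>

definition shadow :: "'a word \<Rightarrow> 'g set" where
  "shadow w = {v \<in> carrier G. take (length w) (\<phi> v) = w}"

lemma shadow_stable:
  assumes "u \<in> carrier G" "x \<in> carrier G" "length w + length (\<phi> x) \<le> length (\<phi> u)"
  shows "u \<otimes> x \<in> shadow w \<longleftrightarrow> u \<in> shadow w"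
  using assms by (simp add: shadow_def \<phi>_mult take_reduce_append \<phi>_carrier)

lemma shadow_length: "u \<in> shadow w \<Longrightarrow> length w \<le> length (\<phi> u)"
  unfolding shadow_def by (metis (mono_tags, lifting) length_take mem_Collect_eq min.cobounded1)

text \<open>By \<open>shadow_stable\<close> an element of \<open>S\<close> can carry only words
  shorter than \<open>length w + radius\<close> across, and there are finitely many of
  these.\<close>

lemma finite_boundary_shadow: "finite (boundary (shadow w))"
proof (rule finite_subset[OF _ finite_ball[of "length w + radius"]])
  show "boundary (shadow w) \<subseteq> {v \<in> carrier G. length (\<phi> v) \<le> length w + radius}"
  proof
    fix u assume "u \<in> boundary (shadow w)"
    then obtain x where x: "u \<in> carrier G" "x \<in> S" "(u \<in> shadow w) \<noteq> (u \<otimes> x \<in> shadow w)"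
      unfolding boundary_def adj_X_iff by blast
    moreover have "x \<in> carrier G"
      using S_carrier x(2) by blast
    ultimately have "\<not> length w + length (\<phi> x) \<le> length (\<phi> u)"
      using shadow_stable by blast
    then show "u \<in> {v \<in> carrier G. length (\<phi> v) \<le> length w + radius}"
      using x length_radius[OF x(2)] by simp
  qed
qed

lemma shadow_append_subset: "shadow (u @ v) \<subseteq> shadow u"
proof
  fix g assume "g \<in> shadow (u @ v)"
  then have "take (length u) (take (length (u @ v)) (\<phi> g)) = take (length u) (u @ v)" "g \<in> carrier G"
    unfolding shadow_def by auto
  then show "g \<in> shadow u"
    by (simp add: shadow_def min_def)
qed

lemma shadow_disjoint: "length u = length v \<Longrightarrow> u \<noteq> v \<Longrightarrow> shadow u \<inter> shadow v = {}"
  by (auto simp: shadow_def)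

lemma shadow_reduced: "v \<in> shadow w \<Longrightarrow> reduced w" "v \<in> shadow w \<Longrightarrow> fst ` set w \<subseteq> A"
proof -
  assume v: "v \<in> shadow w"
  then have w: "w = take (length w) (\<phi> v)" "v \<in> carrier G"
    unfolding shadow_def by auto
  show "reduced w"
    using reduced_take[of "\<phi> v" "length w"] \<phi>_carrier(1)[OF w(2)] w(1) by simp
  have "set w \<subseteq> set (\<phi> v)"
    using w(1) by (metis set_take_subset)
  then show "fst ` set w \<subseteq> A"
    using \<phi>_carrier(2)[OF w(2)] by blast
qed

lemma vtx_in_shadow: "reduced (w @ v) \<Longrightarrow> fst ` set (w @ v) \<subseteq> A \<Longrightarrow> vtx (w @ v) \<in> shadow w"
  unfolding shadow_def by (simp add: \<phi>_vtx vtx_carrier reduce_reduced del: set_append)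

section \<open>Ends as infinite reduced words\<close>

definition boundary_words :: "(nat \<Rightarrow> 'a \<times> bool) set" where
  "boundary_words = {\<xi>. \<forall>i. fst (\<xi> i) \<in> A \<and> \<xi> (Suc i) \<noteq> inv_letter (\<xi> i)}"

definition pre :: "(nat \<Rightarrow> 'a \<times> bool) \<Rightarrow> nat \<Rightarrow> 'a word" where
  "pre \<xi> m = map \<xi> [0..<m]"

lemma length_pre [simp]: "length (pre \<xi> m) = m"
  and pre_Suc: "pre \<xi> (Suc m) = pre \<xi> m @ [\<xi> m]"
  and pre_0 [simp]: "pre \<xi> 0 = []"
  by (simp_all add: pre_def)

lemma pre_reduced: "\<xi> \<in> boundary_words \<Longrightarrow> reduced (pre \<xi> m)"
proof (induction m)
  case (Suc m)
  then have "reduced (pre \<xi> m @ [\<xi> m])"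
    unfolding reduced_append_single by (cases m) (simp_all add: boundary_words_def pre_Suc)
  then show ?case
    by (simp add: pre_Suc)
qed simp

lemma pre_letters: "\<xi> \<in> boundary_words \<Longrightarrow> fst ` set (pre \<xi> m) \<subseteq> A"
  by (auto simp: pre_def boundary_words_def)

lemma shadow_pre_antimono: "m \<le> k \<Longrightarrow> shadow (pre \<xi> k) \<subseteq> shadow (pre \<xi> m)"
proof (induction k rule: dec_induct)
  case (step k)
  then show ?case using shadow_append_subset[of "pre \<xi> k" "[\<xi> k]"] by (auto simp: pre_Suc)
qed simp

definition ends_at :: "(nat \<Rightarrow> 'g) set \<Rightarrow> (nat \<Rightarrow> 'a \<times> bool) \<Rightarrow> bool" where
  "ends_at \<omega> \<xi> \<longleftrightarrow> (\<forall>m. lives_in \<omega> (shadow (pre \<xi> m)))"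

text \<open>Pigeonhole over the finitely many words of length \<open>m\<close>: the ray leaves the
  ball of radius \<open>m\<close>, and as shadows have finite boundary, each of them either contains
  a tail of the ray or misses one.\<close>

lemma end_in_level:
  assumes "\<omega> \<in> ends X"
  shows "\<exists>w. length w = m \<and> lives_in \<omega> (shadow w)"
proof -
  obtain r where r: "r \<in> \<omega>" "ray X r"
    using assms end_nonempty end_ray by metis
  obtain N where N: "\<And>i. i \<ge> N \<Longrightarrow> r i \<notin> {v \<in> carrier G. length (\<phi> v) \<le> m}"
    using ray_avoids[OF r(2) finite_ball] by blast
  have rc: "r i \<in> carrier G" for i
    using r(2) by (auto simp: ray_def)
  let ?W = "{w :: 'a word. set w \<subseteq> A \<times> UNIV \<and> length w = m}"
  have fin: "finite ?W"
    using finite_A by (intro finite_lists_length_eq) simp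
  have in_W: "\<exists>w\<in>?W. r i \<in> shadow w" if "i \<ge> N" for i
  proof (rule bexI[of _ "take m (\<phi> (r i))"])
    have "length (\<phi> (r i)) > m"
      using N[OF that] rc[of i] by auto
    moreover have "set (\<phi> (r i)) \<subseteq> A \<times> UNIV"
      using \<phi>_carrier(2)[OF rc[of i]] by force
    ultimately show "take m (\<phi> (r i)) \<in> ?W" "r i \<in> shadow (take m (\<phi> (r i)))"
      using set_take_subset[of m "\<phi> (r i)"] rc[of i] by (auto simp: shadow_def)
  qed
  show ?thesis
  proof (rule ccontr)
    assume contra: "\<not> ?thesis"
    have "\<forall>w\<in>?W. \<exists>M. \<forall>i\<ge>M. r i \<notin> shadow w"
    proof
      fix w assume "w \<in> ?W"
      then have "\<not> lives_in \<omega> (shadow w)"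
        using contra by blast
      then have "\<not> (\<exists>N. \<forall>i\<ge>N. r i \<in> shadow w)"
        using r(1) by (auto simp: lives_in_def)
      then show "\<exists>M. \<forall>i\<ge>M. r i \<notin> shadow w"
        using ray_side[OF r(2) finite_boundary_shadow, of w] by blast
    qed
    then obtain M where M: "\<forall>w\<in>?W. \<forall>i\<ge>M w. r i \<notin> shadow w"
      by (rule bchoice[THEN exE])
    let ?i = "Max (insert N (M ` ?W))"
    have "?i \<ge> N" "\<And>w. w \<in> ?W \<Longrightarrow> ?i \<ge> M w"
      using fin by (auto intro!: Max_ge)
    then show False
      using in_W M by blast
  qed
qed

lemma lives_in_shadow_unique:
  assumes "\<omega> \<in> ends X" "lives_in \<omega> (shadow u)" "lives_in \<omega> (shadow v)" "length u = length v"
  shows "u = v"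
  using lives_in_Int[OF assms(2,3,1)] finite_boundary_shadow shadow_disjoint[OF assms(4)]
  unfolding lives_in_def by fastforce

lemma end_ends_at:
  assumes "\<omega> \<in> ends X"
  obtains \<xi> where "\<xi> \<in> boundary_words" "ends_at \<omega> \<xi>"
proof -
  obtain w where w: "\<And>m. length (w m) = m" "\<And>m. lives_in \<omega> (shadow (w m))"
    using end_in_level[OF assms] by metis
  define \<xi> where "\<xi> i = w (Suc i) ! i" for i
  have take_w: "take m (w (Suc m)) = w m" for m
  proof (rule lives_in_shadow_unique[OF assms _ w(2)])
    show "lives_in \<omega> (shadow (take m (w (Suc m))))"
      using lives_in_mono[OF w(2)[of "Suc m"]] shadow_append_subset[of "take m (w (Suc m))" "drop m (w (Suc m))"]
      by simp
  qed (simp add: w(1))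
  have pre: "pre \<xi> m = w m" for m
  proof (induction m)
    case 0
    show ?case using w(1)[of 0] by simp
  next
    case (Suc m)
    have "w (Suc m) = take m (w (Suc m)) @ [w (Suc m) ! m]"
      using w(1)[of "Suc m"] take_Suc_conv_app_nth[of m "w (Suc m)"] by simp
    then show ?case
      using Suc take_w[of m] by (simp add: pre_Suc \<xi>_def)
  qed
  have wr: "reduced (pre \<xi> m)" "fst ` set (pre \<xi> m) \<subseteq> A" for m
    using w(2)[of m] shadow_reduced unfolding lives_in_def pre by blast+
  have "fst (\<xi> i) \<in> A" for i
    using wr(2)[of "Suc i"] by (simp add: pre_Suc)
  moreover have "\<xi> (Suc i) \<noteq> inv_letter (\<xi> i)" for i
    using wr(1)[of "Suc (Suc i)"] by (auto simp: pre_Suc reduced_def successively_append_iff)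
  ultimately have "\<xi> \<in> boundary_words"
    by (simp add: boundary_words_def)
  moreover have "ends_at \<omega> \<xi>"
    using w(2) by (simp add: ends_at_def pre)
  ultimately show thesis
    using that by blast
qed

text \<open>\<open>Q\<close> collects the vertices of a path in \<open>X\<close> from the identity
  to \<open>h\<close>. Its translate by \<open>g\<close> runs from \<open>g\<close> to
  \<open>g \<otimes> h\<close>, and only this translate has to avoid \<open>K\<close>.\<close>

lemma generate_connected:
  assumes "h \<in> generate G S"
  shows "\<exists>Q. finite Q \<and> Q \<subseteq> carrier G \<and>
     (\<forall>g\<in>carrier G. \<forall>K. (\<forall>y\<in>Q. g \<otimes> y \<notin> K) \<longrightarrow> connected_avoiding X K g (g \<otimes> h))"
  using assms
proof induction
  case one
  show ?case
    by (rule exI[of _ "{\<one>}"]) (auto intro: connected_avoiding_refl)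
next
  case (incl h)
  have "connected_avoiding X K g (g \<otimes> h)"
    if "g \<in> carrier G" "\<forall>y\<in>{\<one>, h}. g \<otimes> y \<notin> K" for g K
    using that incl by (intro connected_avoiding_step) (auto simp: adj_X_iff)
  then show ?case
    using incl S_carrier by (intro exI[of _ "{\<one>, h}"]) blast
next
  case (inv h)
  have "connected_avoiding X K g (g \<otimes> inv h)"
    if "g \<in> carrier G" "\<forall>y\<in>{\<one>, inv h}. g \<otimes> y \<notin> K" for g K
    using that S_inv[OF inv] by (intro connected_avoiding_step) (auto simp: adj_X_iff)
  then show ?case
    using S_inv[OF inv] S_carrier by (intro exI[of _ "{\<one>, inv h}"]) blast
next
  case (eng h1 h2)
  have h: "h1 \<in> carrier G" "h2 \<in> carrier G"
    using eng.hyps S_gen by auto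
  obtain Q1 Q2 where Q1: "finite Q1" "Q1 \<subseteq> carrier G"
      "\<And>g K. g \<in> carrier G \<Longrightarrow> \<forall>y\<in>Q1. g \<otimes> y \<notin> K \<Longrightarrow> connected_avoiding X K g (g \<otimes> h1)"
    and Q2: "finite Q2" "Q2 \<subseteq> carrier G"
      "\<And>g K. g \<in> carrier G \<Longrightarrow> \<forall>y\<in>Q2. g \<otimes> y \<notin> K \<Longrightarrow> connected_avoiding X K g (g \<otimes> h2)"
    using eng.IH by metis
  let ?Q = "Q1 \<union> (\<otimes>) h1 ` Q2"
  have "connected_avoiding X K g (g \<otimes> (h1 \<otimes> h2))"
    if g: "g \<in> carrier G" and K: "\<forall>y\<in>?Q. g \<otimes> y \<notin> K" for g K
  proof -
    have "\<forall>y\<in>Q2. (g \<otimes> h1) \<otimes> y \<notin> K"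
      using K g h Q2(2) by (auto simp: m_assoc)
    then have "connected_avoiding X K (g \<otimes> h1) ((g \<otimes> h1) \<otimes> h2)"
      using g h by (intro Q2(3)) auto
    moreover have "connected_avoiding X K g (g \<otimes> h1)"
      using g K by (intro Q1(3)) auto
    ultimately show ?thesis
      using connected_avoiding_trans g h by (simp add: m_assoc)
  qed
  then show ?case
    using Q1 Q2 h by (intro exI[of _ ?Q]) auto
qed

text \<open>Each tree edge is replaced by a path of bounded size in \<open>X\<close>. Far from the
  identity such paths miss \<open>K\<close>, and a shadow is connected in the tree.\<close>

lemma shadow_connected:
  assumes "finite K"
  obtains M where "\<And>w u v. length w \<ge> M \<Longrightarrow> u \<in> shadow w \<Longrightarrow> v \<in> shadow w \<Longrightarrow> connected_avoiding X K u v"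
proof -
  let ?L = "A \<times> (UNIV :: bool set)"
  have "\<exists>Q. finite Q \<and> Q \<subseteq> carrier G \<and>
     (\<forall>g\<in>carrier G. \<forall>K. (\<forall>y\<in>Q. g \<otimes> y \<notin> K) \<longrightarrow> connected_avoiding X K g (g \<otimes> vtx [x]))" if "x \<in> ?L" for x
    using that by (intro generate_connected) (auto simp: S_gen intro!: vtx_carrier)
  then obtain Q where Q: "\<And>x. x \<in> ?L \<Longrightarrow> finite (Q x)" "\<And>x. x \<in> ?L \<Longrightarrow> Q x \<subseteq> carrier G"
    "\<And>x g K. x \<in> ?L \<Longrightarrow> g \<in> carrier G \<Longrightarrow> \<forall>y\<in>Q x. g \<otimes> y \<notin> K \<Longrightarrow> connected_avoiding X K g (g \<otimes> vtx [x])"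
    by metis
  let ?Q = "\<Union>x\<in>?L. Q x"
  let ?B = "(\<lambda>(k, y). k \<otimes> inv y) ` (K \<times> ?Q)"
  have fin: "finite ?B"
    using assms Q(1) finite_A by (intro finite_imageI finite_cartesian_product finite_UN_I) auto
  \<comment> \<open>An element \<open>g\<close> for which some \<open>g \<otimes> y\<close> hits
    \<open>K\<close> lies in \<open>?B\<close>; \<open>M\<close> exceeds the length of all of
    these.\<close>
  define M where "M = Suc (Max (insert 0 ((\<lambda>g. length (\<phi> g)) ` ?B)))"
  have far: "g \<otimes> y \<notin> K" if "g \<in> carrier G" "length (\<phi> g) \<ge> M" "y \<in> ?Q" for g y
  proof
    assume "g \<otimes> y \<in> K"
    moreover have "y \<in> carrier G"
      using that Q(2) by blast
    then have "g = (g \<otimes> y) \<otimes> inv y"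
      using that by (simp add: m_assoc)
    ultimately have "g \<in> ?B"
      using that(3) by (intro image_eqI[of _ _ "(g \<otimes> y, y)"]) auto
    then have "length (\<phi> g) < M"
      using fin by (simp add: M_def le_imp_less_Suc)
    then show False using that by simp
  qed
  have "connected_avoiding X K (vtx w) v" if w: "length w \<ge> M" and v: "v \<in> shadow w" for w v
  proof -
    have vc: "v \<in> carrier G" "take (length w) (\<phi> v) = w"
      using v by (auto simp: shadow_def)
    define p where "p j = vtx (take j (\<phi> v))" for j
    have letters: "fst ` set (take j (\<phi> v)) \<subseteq> A" for j
      using \<phi>_carrier(2)[OF vc(1)] set_take_subset[of j "\<phi> v"] by blast
    have p: "p j \<in> carrier G" "\<phi> (p j) = take j (\<phi> v)" for j
      using letters[of j] reduced_take[OF \<phi>_carrier(1)[OF vc(1)], of j]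
      by (auto simp: p_def vtx_carrier \<phi>_vtx reduce_reduced)
    have "connected_avoiding X K (p (length w)) (p j)" if "length w \<le> j" "j \<le> length (\<phi> v)" for j
      using that
    proof (induction rule: dec_induct)
      case base
      show ?case
      proof (cases "A = {}")
        case True
        then have "\<phi> v = []"
          using \<phi>_carrier(2)[OF vc(1)] by auto
        then show ?thesis
          using w shadow_length[OF v] by (simp add: M_def)
      next
        case False
        then obtain x where x: "x \<in> ?L" by auto
        \<comment> \<open>One step out and back also yields that the vertex itself is not in
          \<open>K\<close>.\<close>
        have "connected_avoiding X K (p (length w)) (p (length w) \<otimes> vtx [x])"
        proof (intro Q(3)[OF x p(1)] ballI far[OF p(1)])
          show "M \<le> length (\<phi> (p (length w)))"
            using w shadow_length[OF v] by (simp add: p(2))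
        qed (rule UN_I[OF x])
        then show ?thesis
          using connected_avoiding_trans connected_avoiding_sym by blast
      qed
    next
      case (step j)
      let ?x = "\<phi> v ! j"
      have j: "j < length (\<phi> v)" using step by simp
      then have x: "?x \<in> ?L"
        using \<phi>_carrier(2)[OF vc(1)] nth_mem[OF j] by (cases ?x) force
      have "p (Suc j) = p j \<otimes> vtx [?x]"
        using x letters[of j] unfolding p_def take_Suc_conv_app_nth[OF j]
        by (subst vtx_mult) auto
      moreover have "connected_avoiding X K (p j) (p j \<otimes> vtx [?x])"
      proof (intro Q(3)[OF x p(1)] ballI far[OF p(1)])
        show "M \<le> length (\<phi> (p j))"
          using w step.hyps j by (simp add: p(2))
      qed (rule UN_I[OF x])
      ultimately show ?case
        using step connected_avoiding_trans by auto
    qed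
    from this[of "length (\<phi> v)"] show ?thesis
      using shadow_length[OF v] vc by (simp add: p_def vtx_\<phi>)
  qed
  then have "connected_avoiding X K u v" if "length w \<ge> M" "u \<in> shadow w" "v \<in> shadow w" for w u v
    using connected_avoiding_trans[OF connected_avoiding_sym[of K "vtx w" u], of v] that by blast
  then show thesis
    by (rule that)
qed

text \<open>Loop erasure: follow the walk from the last visit of each vertex.\<close>

lemma ray_of_walk:
  assumes verts: "\<And>k. W k \<in> verts X" and step: "\<And>k. W k = W (Suc k) \<or> adj X (W k) (W (Suc k))"
    and fin: "\<And>v. finite {k. W k = v}"
  obtains r i where "ray X r" "strict_mono i" "\<And>j. r j = W (i j)"
proof -
  define last where "last k = Max {l. W l = W k}" for k
  have last: "W (last k) = W k" "\<And>l. W l = W k \<Longrightarrow> l \<le> last k" for k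
    using Max_in[OF fin[of "W k"]] Max_ge[OF fin[of "W k"]] unfolding last_def by auto
  define i where "i = rec_nat (last 0) (\<lambda>_ k. last (Suc k))"
  have i_Suc: "i (Suc j) = last (Suc (i j))" for j
    by (simp add: i_def)
  have i_last: "\<exists>k. i j = last k" for j
    by (cases j) (auto simp: i_def)
  have mono: "strict_mono i"
    unfolding strict_mono_Suc_iff i_Suc using last(2)[of _ "Suc _"] by (metis Suc_le_lessD)
  have "inj (\<lambda>j. W (i j))"
  proof (rule linorder_injI)
    fix j k :: nat assume "j < k"
    then have "i j < i k"
      using mono by (simp add: strict_mono_less)
    moreover obtain l where l: "i j = last l"
      using i_last by blast
    ultimately show "W (i j) \<noteq> W (i k)"
      using last(1)[of l] last(2)[of "i k" l] by auto
  qed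
  moreover have "adj X (W (i j)) (W (i (Suc j)))" for j
  proof -
    have "W (i (Suc j)) = W (Suc (i j))"
      by (simp add: i_Suc last(1))
    moreover have "W (i (Suc j)) \<noteq> W (i j)"
      using \<open>inj (\<lambda>j. W (i j))\<close> by (auto dest: injD)
    ultimately show ?thesis
      using step[of "i j"] by metis
  qed
  ultimately have "ray X (\<lambda>j. W (i j))"
    using verts by (auto simp: ray_def)
  then show thesis
    using that mono by blast
qed

text \<open>The walk rests at \<open>h\<close> after time \<open>D\<close>, so that walks for
  different generators can be given a common length.\<close>

lemma generate_walk:
  assumes "h \<in> generate G S"
  obtains q D where "q 0 = \<one>" "\<And>j. j \<ge> D \<Longrightarrow> q j = h" "\<And>j. q j \<in> carrier G"
    "\<And>j. q (Suc j) = q j \<or> (\<exists>x\<in>S. q (Suc j) = q j \<otimes> x)"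
proof -
  have "\<exists>q D. q (0::nat) = \<one> \<and> (\<forall>j\<ge>D. q j = h) \<and> (\<forall>j. q j \<in> carrier G) \<and>
    (\<forall>j. q (Suc j) = q j \<or> (\<exists>x\<in>S. q (Suc j) = q j \<otimes> x))"
    using assms
  proof induction
    case one
    show ?case by (rule exI[of _ "\<lambda>_. \<one>"]) auto
  next
    case (incl h)
    then have "h \<in> carrier G"
      using S_carrier by blast
    then show ?case
      using incl by (intro exI[of _ "\<lambda>j. if j = 0 then \<one> else h"] exI[of _ 1]) (auto intro: bexI[of _ h])
  next
    case (inv h)
    then have "inv h \<in> S" "inv h \<in> carrier G"
      using S_carrier S_inv by blast+
    then show ?case
      by (intro exI[of _ "\<lambda>j. if j = 0 then \<one> else inv h"] exI[of _ 1]) (auto intro: bexI[of _ "inv h"])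
  next
    case (eng h1 h2)
    obtain q1 D1 q2 D2 where q: "q1 (0::nat) = \<one>" "\<forall>j\<ge>D1. q1 j = h1" "\<forall>j. q1 j \<in> carrier G"
      "\<forall>j. q1 (Suc j) = q1 j \<or> (\<exists>x\<in>S. q1 (Suc j) = q1 j \<otimes> x)"
      "q2 (0::nat) = \<one>" "\<forall>j\<ge>D2. q2 j = h2" "\<forall>j. q2 j \<in> carrier G"
      "\<forall>j. q2 (Suc j) = q2 j \<or> (\<exists>x\<in>S. q2 (Suc j) = q2 j \<otimes> x)"
      using eng.IH by metis
    let ?q = "\<lambda>j. if j < D1 then q1 j else h1 \<otimes> q2 (j - D1)"
    have h1: "h1 \<in> carrier G"
      using eng.hyps S_gen by auto
    have "?q (Suc j) = ?q j \<or> (\<exists>x\<in>S. ?q (Suc j) = ?q j \<otimes> x)" for j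
    proof (cases "j < D1")
      case True
      then have "?q (Suc j) = q1 (Suc j)" "?q j = q1 j"
        using q(2,5) h1 by (auto simp: not_less)
      then show ?thesis
        using q(4) by simp
    next
      case False
      then have "?q (Suc j) = h1 \<otimes> q2 (Suc (j - D1))" "?q j = h1 \<otimes> q2 (j - D1)"
        by (auto simp: Suc_diff_le)
      then show ?thesis
      proof (cases "q2 (Suc (j - D1)) = q2 (j - D1)")
        case False
        then obtain x where x: "x \<in> S" "q2 (Suc (j - D1)) = q2 (j - D1) \<otimes> x"
          using q(8) by blast
        then have "h1 \<otimes> q2 (Suc (j - D1)) = (h1 \<otimes> q2 (j - D1)) \<otimes> x"
          using m_assoc[OF h1] q(7) S_carrier by (simp add: subset_iff)
        then show ?thesis
          unfolding \<open>?q (Suc j) = h1 \<otimes> q2 (Suc (j - D1))\<close> \<open>?q j = h1 \<otimes> q2 (j - D1)\<close> using x(1) by blast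
      qed (simp only: \<open>?q (Suc j) = h1 \<otimes> q2 (Suc (j - D1))\<close> \<open>?q j = h1 \<otimes> q2 (j - D1)\<close> simp_thms)
    qed
    moreover have "?q 0 = \<one>"
      using q(1,2,5) h1 by auto
    moreover have "?q j = h1 \<otimes> h2" if "j \<ge> D1 + D2" for j
      using that q(6) by auto
    moreover have "?q j \<in> carrier G" for j
      using q(3,7) h1 by auto
    ultimately show ?case
      by (intro exI[of _ ?q] exI[of _ "D1 + D2"]) blast
  qed
  then show thesis
    using that by blast
qed

text \<open>Each letter of the infinite word is replaced by a walk in \<open>X\<close>. The
  concatenation follows the tree geodesic at bounded distance, and loop erasure turns it into a
  ray.\<close>

lemma ends_at_exists:
  assumes \<xi>: "\<xi> \<in> boundary_words"
  obtains \<omega> where "\<omega> \<in> ends X" "ends_at \<omega> \<xi>"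
proof -
  let ?L = "A \<times> (UNIV :: bool set)"
  have \<xi>L: "\<xi> m \<in> ?L" for m
    using \<xi> by (cases "\<xi> m") (auto simp: boundary_words_def dest: spec[of _ m])
  define R where "R x q D \<longleftrightarrow> q (0::nat) = \<one> \<and> (\<forall>j\<ge>D. q j = vtx [x]) \<and> (\<forall>j. q j \<in> carrier G) \<and>
    (\<forall>j. q (Suc j) = q j \<or> (\<exists>y\<in>S. q (Suc j) = q j \<otimes> y))" for x and q :: "nat \<Rightarrow> 'g" and D :: nat
  have "\<exists>q D. R x q D" if "x \<in> ?L" for x
  proof -
    have "vtx [x] \<in> generate G S"
      using that by (auto simp: S_gen intro!: vtx_carrier)
    then show ?thesis
      unfolding R_def by (rule generate_walk) blast
  qed
  then obtain q D0 where "\<And>x. x \<in> ?L \<Longrightarrow> R x (q x) (D0 x)"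
    by metis
  then have q0: "\<And>x. x \<in> ?L \<Longrightarrow> q x (0::nat) = \<one>"
    "\<And>x j. x \<in> ?L \<Longrightarrow> j \<ge> D0 x \<Longrightarrow> q x j = vtx [x]" "\<And>x j. x \<in> ?L \<Longrightarrow> q x j \<in> carrier G"
    "\<And>x j. x \<in> ?L \<Longrightarrow> q x (Suc j) = q x j \<or> (\<exists>y\<in>S. q x (Suc j) = q x j \<otimes> y)"
    unfolding R_def by blast+
  \<comment> \<open>A common length for the walks of all letters; the successor keeps it positive
    for the divisions by \<open>D\<close>.\<close>
  define D where "D = Suc (Max (insert 0 (D0 ` ?L)))"
  have finL: "finite ?L"
    using finite_A by simp
  have D: "D0 x \<le> D" "0 < D" if "x \<in> ?L" for x
    using that finL by (auto simp: D_def intro!: le_SucI Max_ge)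
  define v where "v m = vtx (pre \<xi> m)" for m
  have v: "v m \<in> carrier G" "\<phi> (v m) = pre \<xi> m" for m
    using pre_letters[OF \<xi>, of m] pre_reduced[OF \<xi>, of m]
    by (auto simp: v_def vtx_carrier \<phi>_vtx reduce_reduced)
  have v_Suc: "v (Suc m) = v m \<otimes> vtx [\<xi> m]" for m
    using pre_letters[OF \<xi>, of m] \<xi>L[of m] by (subst v_def, subst pre_Suc) (auto simp: v_def vtx_mult)
  define W where "W k = v (k div D) \<otimes> q (\<xi> (k div D)) (k mod D)" for k
  have step: "W k = W (Suc k) \<or> adj X (W k) (W (Suc k))" for k
  proof -
    let ?m = "k div D" and ?x = "\<xi> (k div D)"
    have x: "?x \<in> ?L" by (rule \<xi>L)
    have W_Suc: "W (Suc k) = v ?m \<otimes> q ?x (Suc (k mod D))"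
    proof (cases "Suc (k mod D) = D")
      case True
      then have "Suc k div D = Suc ?m" "Suc k mod D = 0"
        by (auto simp: div_Suc mod_Suc)
      then show ?thesis
        using q0(1)[OF \<xi>L[of "Suc ?m"]] q0(2)[OF x D(1)[OF x]] v(1)[of "Suc ?m"] True
        by (simp add: W_def) (simp add: v_Suc)
    next
      case False
      then have "Suc k div D = ?m" "Suc k mod D = Suc (k mod D)"
        by (auto simp: div_Suc mod_Suc)
      then show ?thesis by (simp add: W_def)
    qed
    from q0(4)[OF x, of "k mod D"] show ?thesis
    proof
      assume "q ?x (Suc (k mod D)) = q ?x (k mod D)"
      then show ?thesis using W_Suc by (simp add: W_def)
    next
      assume "\<exists>y\<in>S. q ?x (Suc (k mod D)) = q ?x (k mod D) \<otimes> y"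
      then obtain y where y: "y \<in> S" "q ?x (Suc (k mod D)) = q ?x (k mod D) \<otimes> y"
        by blast
      then have "W (Suc k) = W k \<otimes> y"
        using W_Suc v(1) q0(3)[OF x] S_carrier by (simp add: W_def m_assoc subset_iff)
      then show ?thesis
        using y(1) v(1) q0(3)[OF x] by (auto simp: adj_X_iff W_def)
    qed
  qed
  let ?Q = "(\<lambda>(x, j). q x j) ` (?L \<times> {..<D})"
  \<comment> \<open>A detour alters at most \<open>b\<close> final letters, so the walk is in the
    shadow of a prefix as soon as its tree vertex is \<open>b\<close> letters deeper.\<close>
  obtain b where b: "\<And>y. y \<in> ?Q \<Longrightarrow> length (\<phi> y) \<le> b"
    using finite_maxlen[of "\<phi> ` ?Q"] finL by (metis (no_types, lifting) finite_SigmaI finite_imageI finite_lessThan imageI less_imp_le)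
  have in_shadow: "W k \<in> shadow (pre \<xi> j)" if "k \<ge> (j + b) * D" for k j
  proof -
    let ?y = "q (\<xi> (k div D)) (k mod D)"
    have "D > 0" using D(2)[OF \<xi>L] .
    then have m: "k div D \<ge> j + b"
      using that by (metis div_le_mono nonzero_mult_div_cancel_right not_less_zero)
    have "?y \<in> ?Q"
      using \<xi>L[of "k div D"] \<open>D > 0\<close> by (intro image_eqI[of _ _ "(\<xi> (k div D), k mod D)"]) auto
    then have "length (pre \<xi> j) + length (\<phi> ?y) \<le> length (\<phi> (v (k div D)))"
      using b[OF \<open>?y \<in> ?Q\<close>] m v(2)[of "k div D"] by simp
    moreover have "v (k div D) \<in> shadow (pre \<xi> (k div D))"
      using v by (simp add: shadow_def)
    then have "v (k div D) \<in> shadow (pre \<xi> j)"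
      using shadow_pre_antimono[of j "k div D" \<xi>] m by auto
    ultimately show ?thesis
      unfolding W_def using shadow_stable v(1) q0(3)[OF \<xi>L] by blast
  qed
  have W_carrier: "W k \<in> carrier G" for k
    using v(1) q0(3)[OF \<xi>L] by (simp add: W_def)
  have fin: "finite {k. W k = u}" for u
  proof (rule finite_subset)
    let ?j = "Suc (length (\<phi> u))"
    have "u \<notin> shadow (pre \<xi> ?j)"
      using shadow_length[of u "pre \<xi> ?j"] by auto
    then show "{k. W k = u} \<subseteq> {..<(?j + b) * D}"
      using in_shadow[of ?j] by (auto simp: not_le[symmetric])
  qed simp
  obtain r i where r: "ray X r" "strict_mono i" "\<And>j. r j = W (i j)"
    using ray_of_walk[of W, OF _ step fin] W_carrier by auto
  have "lives_in (ray_equiv X `` {r}) (shadow (pre \<xi> m))" for m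
    unfolding lives_in_def
  proof (intro bexI[of _ r] exI[of _ "(m + b) * D"] allI impI)
    fix j assume "(m + b) * D \<le> j"
    also have "j \<le> i j"
      by (rule strict_mono_imp_increasing[OF r(2)])
    finally show "r j \<in> shadow (pre \<xi> m)"
      using in_shadow r(3) by simp
  qed (rule end_ray_class(2)[OF r(1)])
  then show thesis
    using that[of "ray_equiv X `` {r}"] end_ray_class(1)[OF r(1)] by (simp add: ends_at_def)
qed

text \<open>A deep shadow along the end is not divided by the boundary of \<open>B\<close> and meets
  \<open>B\<close>, hence lies in it.\<close>

lemma shadow_subset:
  assumes "\<omega> \<in> ends X" "ends_at \<omega> \<xi>" "finite (boundary B)" "lives_in \<omega> B"
  obtains M where "shadow (pre \<xi> M) \<subseteq> B"
proof -
  obtain M where M: "\<And>w u v. length w \<ge> M \<Longrightarrow> u \<in> shadow w \<Longrightarrow> v \<in> shadow w \<Longrightarrow>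
      connected_avoiding X (boundary B) u v"
    using shadow_connected[OF assms(3)] by blast
  have "lives_in \<omega> (B \<inter> shadow (pre \<xi> M))"
    using assms finite_boundary_shadow by (intro lives_in_Int) (auto simp: ends_at_def)
  then obtain u where "u \<in> B" "u \<in> shadow (pre \<xi> M)"
    unfolding lives_in_def by blast
  then have "shadow (pre \<xi> M) \<subseteq> B"
    using M[of "pre \<xi> M" u] connected_avoiding_boundary[of "boundary B" u _ B] by auto
  then show thesis
    using that by blast
qed

text \<open>A set separating the two ends would contain a whole shadow in which both of them
  live.\<close>

lemma ends_at_unique:
  assumes "\<omega> \<in> ends X" "ends_at \<omega> \<xi>" "\<omega>' \<in> ends X" "ends_at \<omega>' \<xi>"
  shows "\<omega> = \<omega>'"
proof (rule ccontr)
  assume "\<omega> \<noteq> \<omega>'"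
  then obtain B where B: "finite (boundary B)" "lives_in \<omega> B" "\<not> lives_in \<omega>' B"
    using ends_separated assms(1,3) by blast
  obtain M where "shadow (pre \<xi> M) \<subseteq> B"
    using shadow_subset[OF assms(1,2) B(1,2)] by blast
  then have "lives_in \<omega>' B"
    using assms(4) lives_in_mono unfolding ends_at_def by blast
  then show False using B(3) by blast
qed

lemma end_shadow_neighbourhood:
  assumes "openin (freudenthal X) V" "End \<omega> \<in> V" "\<omega> \<in> ends X" "ends_at \<omega> \<xi>"
  obtains m where "region (shadow (pre \<xi> m)) \<subseteq> V"
proof -
  obtain B where B: "finite (boundary B)" "lives_in \<omega> B" "region B \<subseteq> V"
    using end_neighbourhood[OF assms(1-3)] by blast
  obtain M where "shadow (pre \<xi> M) \<subseteq> B"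
    using shadow_subset[OF assms(3,4) B(1,2)] by blast
  then show thesis
    using that[of M] region_mono[of "shadow (pre \<xi> M)" B] B(3) by simp
qed

section \<open>The lines spanned by \<open>s\<close> and their closure\<close>

lemma adj_Y_iff: "adj Y u v \<longleftrightarrow> u \<in> carrier G \<and> v \<in> carrier G \<and> (v = u \<otimes> s \<or> u = v \<otimes> s)"
proof -
  have "inv u \<otimes> v = s \<longleftrightarrow> v = u \<otimes> s" "inv u \<otimes> v = inv s \<longleftrightarrow> u = v \<otimes> s"
    if "u \<in> carrier G" "v \<in> carrier G"
    using that s_carrier by (metis inv_closed inv_solve_left m_closed, metis inv_closed inv_inv inv_mult_group inv_solve_left m_closed)
  then show ?thesis
    by (auto simp: cayley_graph_def)
qed

lemma adj_Y_imp_X: "adj Y u v \<Longrightarrow> adj X u v"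
  using s_in S_inv by (auto simp: cayley_graph_def)

lemma verts_Y [simp]: "verts Y = carrier G"
  by (simp add: cayley_graph_def)

lemma spanning: "spanning_subgraph Y X"
  using adj_Y_imp_X by (auto simp: spanning_subgraph_def)

lemma realization_Y_subset: "realization Y \<subseteq> realization X"
  unfolding realization_def verts_Y verts_X using adj_Y_imp_X by blast

lemma edge_point_in_Y:
  assumes "0 < t" "t < 1" "edge_point u v t \<in> realization Y"
  shows "u = v \<or> adj Y u v"
proof -
  have "edge_point u v t u > 0" "edge_point u v t v > 0"
    using assms(1,2) by (auto simp: edge_point_def of_bool_def)
  moreover have "u' = v' \<or> adj Y u' v'" if "p \<in> realization Y" "p u' > 0" "p v' > 0" for p u' v'
    using that adj_Y_iff[of u' v'] adj_Y_iff[of v' u']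
    by (auto simp: realization_def vertex_point_def edge_point_def of_bool_def split: if_splits)
  ultimately show ?thesis
    using assms(3) by blast
qed

text \<open>Every neighbourhood of an end contains vertices, and all vertices lie in
  \<open>Y\<close>. Conversely, an edge of \<open>X\<close> outside \<open>Y\<close> contributes its
  open interior to the complement, which is open in the weak topology.\<close>

lemma closure_Y: "freudenthal X closure_of (Point ` realization Y) = Point ` realization Y \<union> End ` ends X"
proof (rule antisym)
  have "open_in_realization X (realization X - realization Y)"
    unfolding open_in_realization_def
  proof (intro conjI allI impI)
    fix u v assume uv: "adj X u v"
    then have uvc: "u \<in> carrier G" "v \<in> carrier G"
      using adj_verts adj_sym by auto
    show "openin (top_of_set {0..1}) {t \<in> {0..1}. edge_point u v t \<in> realization X - realization Y}"
    proof (cases "u = v \<or> adj Y u v")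
      case True
      have "edge_point u v t \<in> realization Y" if "t \<in> {0..1}" for t
      proof (cases "u = v")
        case True
        then have "edge_point u v t = vertex_point v"
          by (auto simp: edge_point_def vertex_point_def)
        then show ?thesis using uvc by (auto simp: realization_def)
      next
        case False
        then show ?thesis using \<open>u = v \<or> adj Y u v\<close> that unfolding realization_def by blast
      qed
      then have "{t \<in> {0..1}. edge_point u v t \<in> realization X - realization Y} = {}"
        by blast
      then show ?thesis by (simp only: openin_empty)
    next
      case False
      have "{t \<in> {0..1}. edge_point u v t \<in> realization X - realization Y} = {0<..<1}"
      proof (intro antisym subsetI)
        fix t :: real assume t: "t \<in> {t \<in> {0..1}. edge_point u v t \<in> realization X - realization Y}"
        have "edge_point u v 0 = vertex_point u" "edge_point u v 1 = vertex_point v"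
          by (auto simp: edge_point_def vertex_point_def)
        then have "edge_point u v 0 \<in> realization Y" "edge_point u v 1 \<in> realization Y"
          using uvc by (auto simp: realization_def)
        then have "t \<noteq> 0" "t \<noteq> 1" using t by auto
        then show "t \<in> {0<..<1}" using t by auto
      next
        fix t :: real assume t: "t \<in> {0<..<1}"
        then have "edge_point u v t \<in> realization X"
          using uv unfolding realization_def by fastforce
        then show "t \<in> {t \<in> {0..1}. edge_point u v t \<in> realization X - realization Y}"
          using t False edge_point_in_Y[of t u v] by auto
      qed
      also have "\<dots> = {0..1} \<inter> {0<..<1}"
        by auto
      finally show ?thesis
        by (simp only: openin_open_Int[OF open_greaterThanLessThan])
    qed
  qed auto
  then have "openin (freudenthal X) (Point ` (realization X - realization Y))"
    by (rule openin_Point)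
  then have "closedin (freudenthal X) (topspace (freudenthal X) - Point ` (realization X - realization Y))"
    by (rule openin_closedin_eq[THEN iffD1, THEN conjunct2])
  moreover have "topspace (freudenthal X) - Point ` (realization X - realization Y) = Point ` realization Y \<union> End ` ends X"
    using realization_Y_subset unfolding topspace_freudenthal by auto
  ultimately show "freudenthal X closure_of (Point ` realization Y) \<subseteq> Point ` realization Y \<union> End ` ends X"
    by (metis Un_upper1 closure_of_minimal)
next
  have "End \<omega> \<in> freudenthal X closure_of (Point ` realization Y)" if \<omega>: "\<omega> \<in> ends X" for \<omega>
    unfolding in_closure_of
  proof (intro conjI allI impI)
    show "End \<omega> \<in> topspace (freudenthal X)"
      using \<omega> by (simp add: topspace_freudenthal)
    fix T assume T: "End \<omega> \<in> T \<and> openin (freudenthal X) T"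
    then obtain B where B: "lives_in \<omega> B" "region B \<subseteq> T"
      using end_neighbourhood[of T \<omega>] \<omega> by blast
    then obtain r N where r: "r \<in> \<omega>" "r N \<in> B"
      unfolding lives_in_def by blast
    then have "r N \<in> carrier G"
      using end_ray[OF \<omega>] by (auto simp: ray_def)
    then have "vertex_point (r N) \<in> realization Y"
      by (simp add: realization_def)
    moreover from this have "Point (vertex_point (r N)) \<in> region B"
      using r(2) realization_Y_subset by (auto simp: vertex_point_def)
    ultimately show "\<exists>y. y \<in> Point ` realization Y \<and> y \<in> T"
      using B(2) by blast
  qed
  moreover have "Point ` realization Y \<subseteq> freudenthal X closure_of (Point ` realization Y)"
    using realization_Y_subset by (intro closure_of_subset) (auto simp: topspace_freudenthal)
  ultimately show "Point ` realization Y \<union> End ` ends X \<subseteq> freudenthal X closure_of (Point ` realization Y)"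
    by blast
qed

text \<open>The name anticipates the result: this is the closure computed in
  \<open>closure_Y\<close>, and whether it is a circle is the question.\<close>

definition circle :: "'g fpoint set" where
  "circle = Point ` realization Y \<union> End ` ends X"

lemma hamiltonian_circle_subgraph_iff:
  "hamiltonian_circle_subgraph Y X \<longleftrightarrow>
     subtopology (freudenthal X) circle homeomorphic_space top_of_set (sphere (0::complex) 1)"
proof -
  have "circle \<subseteq> topspace (freudenthal X)"
    using realization_Y_subset unfolding circle_def topspace_freudenthal by blast
  moreover have "Point ` vertex_point ` verts X \<subseteq> circle"
    by (auto simp: circle_def realization_def)
  ultimately show ?thesis
    using spanning unfolding hamiltonian_circle_subgraph_def hamiltonian_circle_def closure_Y circle_def
    by blast
qed

end

section \<open>Cyclic links and their intervals\<close>

text \<open>A finite graph all of whose vertices have degree two, given by its darts: \<open>lab d\<close> is the vertex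
  of the dart \<open>d\<close>, \<open>flip d\<close> is the opposite dart of the same edge and \<open>twin d\<close> the other dart at the
  same vertex. If the graph is connected, then \<open>twin \<circ> flip\<close> runs once around a cycle.\<close>

locale cyclic_link =
  fixes D :: "'d set" and lab :: "'d \<Rightarrow> 'x" and flip twin :: "'d \<Rightarrow> 'd"
  assumes finite_D: "finite D"
    and flip_D: "d \<in> D \<Longrightarrow> flip d \<in> D" and flip_flip: "d \<in> D \<Longrightarrow> flip (flip d) = d"
    and flip_neq: "d \<in> D \<Longrightarrow> flip d \<noteq> d"
    and twin_D: "d \<in> D \<Longrightarrow> twin d \<in> D" and lab_twin: "d \<in> D \<Longrightarrow> lab (twin d) = lab d"
    and twin_neq: "d \<in> D \<Longrightarrow> twin d \<noteq> d"
    and twin_unique: "d \<in> D \<Longrightarrow> d' \<in> D \<Longrightarrow> lab d' = lab d \<Longrightarrow> d' = d \<or> d' = twin d"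
    and link_connected: "B \<subseteq> lab ` D \<Longrightarrow> B \<noteq> {} \<Longrightarrow> (\<And>d. d \<in> D \<Longrightarrow> lab d \<in> B \<Longrightarrow> lab (flip d) \<in> B) \<Longrightarrow> B = lab ` D"
begin

definition nxt :: "'d \<Rightarrow> 'd" where "nxt d = twin (flip d)"

definition degree :: nat where "degree = card (lab ` D)"

abbreviation walk :: "'d \<Rightarrow> nat \<Rightarrow> 'd" where "walk d j \<equiv> (nxt ^^ j) d"

lemma twin_twin: "d \<in> D \<Longrightarrow> twin (twin d) = d"
  using twin_unique[of "twin d" d] twin_D lab_twin twin_neq by metis

lemma nxt_D: "d \<in> D \<Longrightarrow> nxt d \<in> D"
  by (simp add: nxt_def twin_D flip_D)

lemma walk_D: "d \<in> D \<Longrightarrow> walk d j \<in> D"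
  by (induction j) (simp_all add: nxt_D)

lemma lab_nxt: "d \<in> D \<Longrightarrow> lab (nxt d) = lab (flip d)"
  by (simp add: nxt_def lab_twin flip_D)

lemma nxt_inj: "d \<in> D \<Longrightarrow> d' \<in> D \<Longrightarrow> nxt d = nxt d' \<Longrightarrow> d = d'"
  unfolding nxt_def by (metis flip_D flip_flip twin_twin)

lemma twin_nxt: "d \<in> D \<Longrightarrow> twin (nxt d) = flip d"
  by (simp add: nxt_def twin_twin flip_D)

text \<open>\<open>nxt\<close> is injective, so a common initial stretch of a repetition can be
  cancelled and the first repetition is a return to the start.\<close>

lemma walk_period:
  assumes d: "d \<in> D"
  obtains p where "p > 0" "walk d p = d" "inj_on (walk d) {..<p}"
proof -
  have cancel: "walk d (j - i) = d" if "i \<le> j" "walk d i = walk d j" for i j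
    using that
  proof (induction i arbitrary: j)
    case (Suc i)
    then obtain k where "j = Suc k" by (cases j) auto
    then show ?case
      using Suc nxt_inj[of "walk d i" "walk d k"] walk_D[OF d] by simp
  qed simp
  have "\<not> inj (walk d)"
    using finite_subset[of "range (walk d)" D] walk_D[OF d] finite_D
    by (metis finite_imageD image_subsetI infinite_UNIV_nat)
  then obtain i j where "i < j" "walk d i = walk d j"
    unfolding inj_def by (metis linorder_neqE_nat)
  then have ex: "\<exists>p. p > 0 \<and> walk d p = d"
    using cancel[of i j] by (intro exI[of _ "j - i"]) simp
  define p where "p = (LEAST p. p > 0 \<and> walk d p = d)"
  have p: "p > 0" "walk d p = d"
    using LeastI_ex[OF ex] by (auto simp: p_def)
  have "inj_on (walk d) {..<p}"
  proof (rule linorder_inj_onI)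
    fix i j assume ij: "i < j" "i \<in> {..<p}" "j \<in> {..<p}"
    show "walk d i \<noteq> walk d j"
    proof
      assume "walk d i = walk d j"
      then have "walk d (j - i) = d"
        using cancel ij by simp
      then have "p \<le> j - i"
        unfolding p_def by (intro Least_le) (use ij in simp)
      then show False using ij by simp
    qed
  qed auto
  then show thesis
    using that p by blast
qed

text \<open>The main point is that the walk never runs backwards along one of its own edges. If it
  did, the two opposite runs would meet halfway, in a dart equal to its flip or in one equal to its
  twin. By connectedness the walk then visits each label exactly once per period, so the period is
  \<open>degree\<close>.\<close>

lemma walk_cycle:
  assumes d: "d \<in> D"
  shows "walk d degree = d" "bij_betw (\<lambda>j. lab (walk d j)) {..<degree} (lab ` D)"
    "D = walk d ` {..<degree} \<union> (\<lambda>j. flip (walk d j)) ` {..<degree}"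
    "walk d i \<noteq> flip (walk d j)"
proof -
  obtain p where p: "p > 0" "walk d p = d" "inj_on (walk d) {..<p}"
    using walk_period[OF d] by blast
  let ?e = "walk d"
  note eD = walk_D[OF d]
  have per: "?e (j + p * k) = ?e j" for j k
  proof (induction k)
    case (Suc k)
    have "?e (j + p * Suc k) = (nxt ^^ (j + p * k)) (?e p)"
      by (simp add: funpow_add[symmetric, unfolded comp_def, THEN fun_cong] add.commute algebra_simps)
    then show ?case using Suc p(2) by simp
  qed simp
  have pred: "\<exists>k. ?e j = ?e (Suc k)" for j
    using per[of j 1] p(1) by (metis One_nat_def Suc_pred add_gr_0 mult_1_right)
  have red: "?e j = ?e (j mod p)" for j
    using per[of "j mod p" "j div p"] by simp
  have reverse: "?e (i + k) = flip (?e (j - k))" if "?e i = flip (?e j)" "k \<le> j" for i j k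
    using that(2)
  proof (induction k)
    case (Suc k)
    then have IH: "?e (i + k) = flip (?e (Suc (j - Suc k)))"
      by (simp add: Suc_diff_Suc)
    have "?e (i + Suc k) = twin (flip (?e (i + k)))"
      by (simp add: nxt_def)
    also have "\<dots> = twin (?e (Suc (j - Suc k)))"
      using IH eD flip_flip by metis
    also have "\<dots> = flip (?e (j - Suc k))"
      using twin_nxt[OF eD] by simp
    finally show ?case .
  qed (use that(1) in simp)
  have disj: "?e i \<noteq> flip (?e j)" for i j
  proof
    assume eq: "?e i = flip (?e j)"
    \<comment> \<open>Adding multiples of the period moves the second index behind the
      first.\<close>
    define j' where "j' = j + p * i"
    have j': "?e i = flip (?e j')" "i \<le> j'"
      using eq per[of j i] p(1) by (auto simp: j'_def intro: trans_le_add2)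
    define c where "c = j' - i"
    show False
    proof (cases "even c")
      case True
      then obtain k where "c = 2 * k" by blast
      then have "j' - k = i + k" "k \<le> j'"
        using j'(2) by (auto simp: c_def)
      then have "?e (i + k) = flip (?e (i + k))"
        using reverse[OF j'(1), of k] by simp
      then show False using flip_neq[OF eD] by metis
    next
      case False
      then obtain k where "c = 2 * k + 1" by (blast elim: oddE)
      then have "j' - k = Suc (i + k)" "k \<le> j'"
        using j'(2) by (auto simp: c_def)
      then have "?e (i + k) = flip (?e (Suc (i + k)))"
        using reverse[OF j'(1), of k] by simp
      then have "flip (?e (i + k)) = twin (flip (?e (i + k)))"
        using eD flip_flip by (metis comp_apply funpow.simps(2) nxt_def)
      then show False using twin_neq[OF flip_D[OF eD]] by metis
    qed
  qed
  have twin_e: "\<exists>k. twin (?e j) = flip (?e k)" for j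
    using pred[of j] twin_nxt[OF eD] by (metis comp_apply funpow.simps(2))
  have inj: "inj_on (\<lambda>j. lab (?e j)) {..<p}"
  proof (rule inj_onI)
    fix i j assume ij: "i \<in> {..<p}" "j \<in> {..<p}" "lab (?e i) = lab (?e j)"
    then have "?e i = ?e j \<or> ?e i = twin (?e j)"
      using twin_unique[OF eD eD] by blast
    then show "i = j"
      using twin_e[of j] disj ij p(3) by (metis inj_onD)
  qed
  have range_p: "?e ` {..<p} = range ?e"
    using red p(1) by (auto simp: image_iff) (metis lessThan_iff mod_less_divisor)
  have all: "lab ` range ?e = lab ` D"
  proof (rule link_connected)
    show "lab ` range ?e \<subseteq> lab ` D"
      using eD by blast
    fix d' assume d': "d' \<in> D" "lab d' \<in> lab ` range ?e"
    then obtain j where j: "lab d' = lab (?e j)" by blast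
    have "d' = ?e j \<or> d' = twin (?e j)"
      using twin_unique[OF eD d'(1) j] .
    then obtain k where "d' = ?e j \<or> d' = flip (?e k)"
      using twin_e[of j] by blast
    then have "lab (flip d') = lab (?e (Suc j)) \<or> lab (flip d') = lab (?e k)"
      using lab_nxt[OF eD] flip_flip[OF eD] by auto
    then show "lab (flip d') \<in> lab ` range ?e"
      by (metis imageI rangeI)
  qed auto
  have card: "degree = p"
    using card_image[OF inj] all range_p unfolding degree_def by (metis card_lessThan image_image)
  show "walk d degree = d"
    by (simp add: card p(2))
  show "bij_betw (\<lambda>j. lab (walk d j)) {..<degree} (lab ` D)"
  proof -
    have "(\<lambda>j. lab (?e j)) ` {..<p} = lab ` (?e ` {..<p})"
      by (simp only: image_image)
    then show ?thesis
      using inj unfolding bij_betw_def card range_p all by blast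
  qed
  show "walk d i \<noteq> flip (walk d j)"
    by (rule disj)
  have "d' \<in> range ?e \<union> flip ` range ?e" if d'D: "d' \<in> D" for d'
  proof -
    obtain j where j: "lab d' = lab (?e j)"
    proof -
      have "lab d' \<in> lab ` range ?e"
        unfolding all using d'D by (rule imageI)
      then show thesis
        by (auto intro: that)
    qed
    have "d' = ?e j \<or> d' = twin (?e j)"
      by (rule twin_unique[OF eD d'D j])
    then show ?thesis
      using twin_e[of j] by auto
  qed
  then have "D = range ?e \<union> flip ` range ?e"
    using eD flip_D by (intro antisym subsetI) auto
  then show "D = walk d ` {..<degree} \<union> (\<lambda>j. flip (walk d j)) ` {..<degree}"
    unfolding card range_p[symmetric] by (simp add: image_image)
qed

lemma lab_flip_walk:
  assumes "d \<in> D"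
  shows "lab (flip (walk d j)) = lab (walk d (Suc j))"
  using lab_nxt[OF walk_D[OF assms]] by simp

lemma bij_lab_flip_walk:
  assumes d: "d \<in> D"
  shows "bij_betw (\<lambda>j. lab (flip (walk d j))) {..<degree} (lab ` D)"
proof -
  have "bij_betw (\<lambda>j. lab (walk (nxt d) j)) {..<degree} (lab ` D)"
    by (rule walk_cycle(2)[OF nxt_D[OF d]])
  moreover have "lab (flip (walk d j)) = lab (walk (nxt d) j)" for j
    by (simp add: lab_flip_walk[OF d] funpow_swap1)
  ultimately show ?thesis by simp
qed

text \<open>In the traversal starting at \<open>d\<close>, the direction \<open>x\<close> lies
  between edge number \<open>idx d x\<close> of the cycle and the edge after it.\<close>

definition idx :: "'d \<Rightarrow> 'x \<Rightarrow> nat" where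
  "idx d x = inv_into {..<degree} (\<lambda>j. lab (flip (walk d j))) x"

lemma idx:
  assumes "d \<in> D"
  shows "x \<in> lab ` D \<Longrightarrow> idx d x < degree" "x \<in> lab ` D \<Longrightarrow> lab (flip (walk d (idx d x))) = x"
    "j < degree \<Longrightarrow> idx d (lab (flip (walk d j))) = j"
proof -
  let ?f = "\<lambda>j. lab (flip (walk d j))"
  have f: "inj_on ?f {..<degree}" "?f ` {..<degree} = lab ` D"
    using bij_lab_flip_walk[OF assms] by (simp_all add: bij_betw_def)
  show "x \<in> lab ` D \<Longrightarrow> idx d x < degree" "x \<in> lab ` D \<Longrightarrow> lab (flip (walk d (idx d x))) = x"
    unfolding f(2)[symmetric] using inv_into_into[of x ?f "{..<degree}"] f_inv_into_f[of x ?f "{..<degree}"]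
    by (simp_all add: idx_def)
  show "j < degree \<Longrightarrow> idx d (lab (flip (walk d j))) = j"
    unfolding idx_def using inv_into_f_f[OF f(1), of j] by simp
qed

lemma degree_pos: "d \<in> D \<Longrightarrow> degree > 0"
  unfolding degree_def using finite_D by (auto simp: card_gt_0_iff)

text \<open>The walk closes up at the label of its starting dart, so this direction comes last. At a
  vertex other than the root it will be the direction of the parent.\<close>

lemma idx_lab:
  assumes "d \<in> D"
  shows "idx d (lab d) = degree - 1"
proof -
  have "lab (flip (walk d (degree - 1))) = lab d"
    using lab_flip_walk[OF assms, of "degree - 1"] walk_cycle(1)[OF assms] degree_pos[OF assms] by simp
  then show ?thesis
    using idx(3)[OF assms, of "degree - 1"] degree_pos[OF assms] by simp
qed

end

text \<open>Vertices of the tree are encoded by reversed words \<open>r\<close>, last letter first. The interval of \<open>r\<close> is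
  cut into pieces that alternate between edges of the link at \<open>r\<close> and intervals of children of \<open>r\<close>;
  at the root the cycle closes up, hence one more piece. The dart \<open>cont d\<close> continues \<open>d\<close> at the other
  end of a tree edge.\<close>

locale link_tree = cyclic_link D lab flip twin
  for D :: "'d set" and lab :: "'d \<Rightarrow> 'x" and flip twin :: "'d \<Rightarrow> 'd" +
  fixes cont :: "'d \<Rightarrow> 'd" and opp :: "'x \<Rightarrow> 'x" and d0 :: 'd
  assumes cont_D: "d \<in> D \<Longrightarrow> cont d \<in> D" and cont_cont: "d \<in> D \<Longrightarrow> cont (cont d) = d"
    and lab_cont: "d \<in> D \<Longrightarrow> lab (cont d) = opp (lab d)" and opp_opp: "opp (opp x) = x"
    and opp_lab: "x \<in> lab ` D \<Longrightarrow> opp x \<in> lab ` D"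
    and d0: "d0 \<in> D" and degree_ge_2: "degree \<ge> 2"
begin

text \<open>The dart at which the traversal of the link at \<open>r\<close> starts. For a child it
  continues the dart by which the parent's traversal reaches the child, so that the end points of
  neighbouring pieces match.\<close>

fun lam :: "'x list \<Rightarrow> 'd" where
  "lam [] = d0"
| "lam (x # r) = cont (flip (walk (lam r) (idx (lam r) x)))"

definition pieces :: "'x list \<Rightarrow> real" where
  "pieces r = (if r = [] then 2 * degree else 2 * degree - 1)"

fun width :: "'x list \<Rightarrow> real" where
  "width [] = 1"
| "width (x # r) = width r / pieces r"

fun left :: "'x list \<Rightarrow> real" where
  "left [] = 0"
| "left (x # r) = left r + (2 * real (idx (lam r) x) + 1) * (width r / pieces r)"

text \<open>Reversed reduced words, with \<open>opp\<close> as the inversion of letters.\<close>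

fun valid :: "'x list \<Rightarrow> bool" where
  "valid [] \<longleftrightarrow> True"
| "valid [x] \<longleftrightarrow> x \<in> lab ` D"
| "valid (x # y # r) \<longleftrightarrow> x \<in> lab ` D \<and> x \<noteq> opp y \<and> valid (y # r)"

abbreviation sd :: "'x list \<Rightarrow> nat \<Rightarrow> 'd" where "sd r j \<equiv> walk (lam r) j"

definition unit :: "'x list \<Rightarrow> real" where
  "unit r = width r / pieces r"

text \<open>Piece \<open>2 * j\<close> of the interval belongs to edge \<open>j\<close> of the link
  and piece \<open>2 * j + 1\<close> to the child behind it; \<open>\<tau>\<close> is the parameter
  along the edge.\<close>

definition pos :: "'x list \<Rightarrow> nat \<Rightarrow> real \<Rightarrow> real" where
  "pos r j \<tau> = left r + (2 * real j + \<tau>) * unit r"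

text \<open>Half open, so that every position lies in exactly one piece.\<close>

definition interval :: "'x list \<Rightarrow> real set" where
  "interval r = {left r ..< left r + width r}"

definition step :: "'x list \<Rightarrow> 'x \<Rightarrow> 'x list" where
  "step r x = (if r \<noteq> [] \<and> x = opp (hd r) then tl r else x # r)"

lemma valid_Cons: "valid (x # r) \<longleftrightarrow> x \<in> lab ` D \<and> (r = [] \<or> x \<noteq> opp (hd r)) \<and> valid r"
  by (cases r) auto

lemma lam_D: "lam r \<in> D"
  by (induction r) (simp_all add: d0 cont_D flip_D walk_D)

lemma sd_D: "sd r j \<in> D"
  by (rule walk_D[OF lam_D])

lemma sd_degree: "sd r degree = lam r"
  by (rule walk_cycle(1)[OF lam_D])

text \<open>The traversal at a child starts with a dart pointing back to the parent, whose direction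
  therefore comes last and gets no piece.\<close>

lemma lab_lam: "valid (x # r) \<Longrightarrow> lab (lam (x # r)) = opp x"
  using idx(2)[OF lam_D, of x r] by (simp add: lab_cont flip_D sd_D valid_Cons)

lemma pieces_pos: "pieces r \<ge> 3"
  using degree_ge_2 by (auto simp: pieces_def)

lemma width_pos: "width r > 0"
proof (induction r)
  case (Cons x r)
  then show ?case using pieces_pos[of r] by simp
qed simp

lemma width_le: "width r \<le> (1 / 2) ^ length r"
proof (induction r)
  case (Cons x r)
  have "width r / pieces r \<le> width r / 2"
    using width_pos[of r] pieces_pos[of r] by (intro divide_left_mono) auto
  then show ?case using Cons by simp
qed simp

lemma unit_pos: "unit r > 0" and width_unit: "width r = pieces r * unit r"
  using width_pos[of r] pieces_pos[of r] by (auto simp: unit_def)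

lemma valid_idx:
  assumes "valid (x # r)"
  shows "idx (lam r) x < degree" "r \<noteq> [] \<Longrightarrow> Suc (idx (lam r) x) < degree"
proof -
  show lt: "idx (lam r) x < degree"
    using idx(1)[OF lam_D] assms by (auto simp: valid_Cons)
  assume "r \<noteq> []"
  then obtain y r' where r: "r = y # r'" by (cases r) auto
  have "idx (lam r) x \<noteq> degree - 1"
  proof
    assume "idx (lam r) x = degree - 1"
    then have "idx (lam r) x = idx (lam r) (lab (lam r))"
      by (simp add: idx_lab lam_D)
    moreover have "lab (lam r) = opp y" "x \<noteq> opp y"
      using lab_lam[of y r'] assms by (auto simp: r valid_Cons)
    moreover have "x \<in> lab ` D" "lab (lam r) \<in> lab ` D"
      using assms lam_D by (auto simp: valid_Cons)
    ultimately show False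
      using idx(2)[OF lam_D] by metis
  qed
  then show "Suc (idx (lam r) x) < degree"
    using lt by simp
qed

text \<open>A dart of the link at \<open>r\<close> that leaves towards the neighbour \<open>step r x\<close> is continued by a dart of
  the link there, and the two end points have the same position on the circle.\<close>

definition end_dart :: "'x list \<Rightarrow> nat \<Rightarrow> bool \<Rightarrow> 'd" where
  "end_dart r j \<eta> = (if \<eta> then flip (sd r j) else sd r j)"

lemma left_Cons: "left (x # r) = pos r (idx (lam r) x) 1"
  by (simp add: pos_def unit_def)

lemma right_Cons:
  assumes "r \<noteq> []"
  shows "left r + width r = pos r (degree - 1) 1"
proof -
  have "2 * real (degree - 1) + 1 = pieces r"
    using assms degree_ge_2 by (simp add: pieces_def of_nat_diff)
  then show ?thesis
    unfolding pos_def by (subst width_unit) simp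
qed

lemma right_Cons_parent: "left (x # r) + width (x # r) = pos r (Suc (idx (lam r) x)) 0"
  by (simp add: pos_def unit_def[symmetric] algebra_simps)

lemma pos_root_end: "pos [] degree 0 = 1"
  using degree_ge_2 by (simp add: pos_def unit_def pieces_def)

text \<open>The last edge at the child ends in the twin of its first dart. Since \<open>cont\<close>
  commutes with \<open>twin\<close>, that end continues the parent's edge behind the child.\<close>

lemma flip_last_dart:
  assumes "valid (x # r)"
  shows "flip (sd (x # r) (degree - 1)) = cont (sd r (Suc (idx (lam r) x)))"
proof -
  let ?j = "idx (lam r) x"
  have "twin (cont d) = cont (twin d)" if "d \<in> D" for d
    using twin_unique[of "cont d" "cont (twin d)"] that
    by (metis cont_D cont_cont lab_cont lab_twin twin_D twin_neq)
  then have tw: "twin (lam (x # r)) = cont (sd r (Suc ?j))"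
    by (simp add: flip_D sd_D nxt_def)
  have "nxt (sd (x # r) (degree - 1)) = lam (x # r)"
    using sd_degree[of "x # r"] degree_ge_2 by (metis One_nat_def Suc_pred comp_apply funpow.simps(2) less_le_trans pos2)
  then show ?thesis
    using twin_nxt[OF sd_D[of "degree - 1" "x # r"]] tw by simp
qed

lemma adjacent_end:
  assumes r: "valid r" and j: "j < degree"
  obtains j' c where "j' < degree" "valid (step r (lab (end_dart r j \<eta>)))"
    "end_dart (step r (lab (end_dart r j \<eta>))) j' (\<not> \<eta>) = cont (end_dart r j \<eta>)"
    "pos (step r (lab (end_dart r j \<eta>))) j' (of_bool (\<not> \<eta>)) = pos r j (of_bool \<eta>) + of_int c"
proof (cases \<eta>)
  case True
  let ?x = "lab (flip (sd r j))"
  have x: "?x \<in> lab ` D"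
    using flip_D sd_D by blast
  have ij: "idx (lam r) ?x = j"
    by (rule idx(3)[OF lam_D j])
  show thesis
  proof (cases "r \<noteq> [] \<and> j = degree - 1")
    \<comment> \<open>The edge is followed by a child, whose edge \<open>0\<close> starts where this
      edge ends.\<close>
    case False
    have "r = [] \<or> ?x \<noteq> opp (hd r)"
    proof (cases r)
      case (Cons y r')
      then have "opp (hd r) = lab (lam r)"
        using lab_lam r by simp
      then show ?thesis
        using ij idx_lab[OF lam_D, of r] False by auto
    qed simp
    then have "step r ?x = ?x # r" "valid (?x # r)"
      using r x by (auto simp: step_def valid_Cons)
    then show thesis
      using that[of 0 0] j ij True degree_ge_2
      by (simp add: end_dart_def) (simp add: pos_def unit_def)
  next
    \<comment> \<open>The last edge at a vertex other than the root runs back to the parent and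
      touches the parent's next edge.\<close>
    case True': True
    then obtain y r0 where r0: "r = y # r0" by (cases r) auto
    let ?j0 = "idx (lam r0) y"
    have "?x = lab (lam r)"
      using True' idx_lab[OF lam_D, of r] ij idx(2)[OF lam_D x] lab_flip_walk[OF lam_D[of r], of j] sd_degree[of r] degree_ge_2
      by simp
    then have st: "step r ?x = r0" "valid r0"
      using lab_lam[of y r0] r by (auto simp: r0 step_def valid_Cons)
    have fl: "flip (sd r j) = cont (sd r0 (Suc ?j0))"
      using flip_last_dart[of y r0] r True' by (simp add: r0)
    have pj: "pos r j 1 = pos r0 (Suc ?j0) 0"
      using right_Cons[of r] right_Cons_parent[of y r0] True' by (simp add: r0)
    show thesis
    proof (cases "Suc ?j0 < degree")
      case True
      then show thesis
        using that[of "Suc ?j0" 0] \<open>\<eta>\<close> st fl pj cont_cont[OF sd_D] by (simp add: end_dart_def del: funpow.simps)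
    next
      case False
      then have "r0 = []" "Suc ?j0 = degree"
        using valid_idx[of y r0] r by (auto simp: r0)
      \<comment> \<open>Behind the last child of the root the cycle returns to edge
        \<open>0\<close>, so position \<open>1\<close> is matched with position
        \<open>0\<close>.\<close>
      then show thesis
        using that[of 0 "- 1"] \<open>\<eta>\<close> st fl pj cont_cont[OF sd_D] cont_cont[OF d0] sd_degree[of r0] pos_root_end degree_ge_2
        by (simp add: end_dart_def del: funpow.simps(2)) (simp add: pos_def)
    qed
  qed
next
  case False
  let ?x = "lab (sd r j)"
  have x: "?x \<in> lab ` D"
    using sd_D by blast
  show thesis
  proof (cases j)
    case (Suc k)
    then have xk: "?x = lab (flip (sd r k))"
      using lab_flip_walk[OF lam_D[of r], of k] by simp
    have ik: "idx (lam r) ?x = k"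
      unfolding xk by (rule idx(3)[OF lam_D]) (use j Suc in simp)
    have "r = [] \<or> ?x \<noteq> opp (hd r)"
    proof (cases r)
      case (Cons y r')
      then have "opp (hd r) = lab (lam r)"
        using lab_lam r by simp
      then show ?thesis
        using ik idx_lab[OF lam_D, of r] j Suc by auto
    qed simp
    then have st: "step r ?x = ?x # r" "valid (?x # r)"
      using r x by (auto simp: step_def valid_Cons)
    have "pos (?x # r) (degree - 1) 1 = pos r j 0"
      using right_Cons[of "?x # r"] right_Cons_parent[of ?x r] ik Suc by simp
    then show thesis
      using that[of "degree - 1" 0] False st flip_last_dart[OF st(2)] ik Suc degree_ge_2
      by (simp add: end_dart_def del: funpow.simps(2))
  next
    case 0
    show thesis
    proof (cases r)
      \<comment> \<open>Edge \<open>0\<close> at the root begins where the interval of the last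
        child ends, one full turn away.\<close>
      case Nil
      have ik: "idx (lam r) ?x = degree - 1"
        using idx_lab[OF lam_D, of r] 0 by simp
      have st: "step r ?x = ?x # r" "valid (?x # r)"
        using x by (auto simp: step_def Nil)
      have "pos (?x # r) (degree - 1) 1 = 1"
        using right_Cons[of "?x # r"] right_Cons_parent[of ?x r] ik pos_root_end degree_ge_2 Nil by simp
      moreover have "flip (sd (?x # r) (degree - 1)) = cont (sd r j)"
        using flip_last_dart[OF st(2)] ik sd_degree[of r] degree_ge_2 0 by (simp del: funpow.simps(2))
      ultimately show thesis
        using that[of "degree - 1" 1] False st degree_ge_2 Nil 0
        by (simp add: end_dart_def) (simp add: pos_def)
    next
      case (Cons y r0)
      have "?x = opp y"
        using lab_lam[of y r0] r 0 Cons by simp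
      then have st: "step r ?x = r0" "valid r0"
        using r Cons by (auto simp: step_def valid_Cons)
      have "cont (sd r j) = flip (sd r0 (idx (lam r0) y))"
        using 0 Cons by (simp add: cont_cont flip_D sd_D)
      moreover have "pos r j 0 = pos r0 (idx (lam r0) y) 1"
        using 0 Cons left_Cons[of y r0] by (simp add: pos_def)
      ultimately show thesis
        using that[of "idx (lam r0) y" 0] False st valid_idx(1)[of y r0] r Cons
        by (simp add: end_dart_def)
    qed
  qed
qed

text \<open>A traversal begins with an edge, and at a vertex other than the root it also ends with
  one, so children stay away from the end points. At the root the last child touches the right end.
  The strict inequalities put the position of an end into the interior of its intervals.\<close>

lemma interval_child:
  assumes "valid (x # r)"
  shows "left r < left (x # r)" "left (x # r) + width (x # r) \<le> left r + width r"
    "r \<noteq> [] \<Longrightarrow> left (x # r) + width (x # r) < left r + width r"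
proof -
  let ?h = "unit r"
  have h: "?h > 0" "width r = pieces r * ?h"
    by (rule unit_pos, rule width_unit)
  show "left r < left (x # r)"
    using h(1) unfolding left_Cons pos_def by simp
  have right: "left (x # r) + width (x # r) = left r + (2 * real (Suc (idx (lam r) x))) * ?h"
    unfolding right_Cons_parent pos_def by simp
  have "2 * real (Suc (idx (lam r) x)) \<le> pieces r"
    using valid_idx[OF assms] degree_ge_2 by (cases "r = []") (auto simp: pieces_def of_nat_diff)
  then show "left (x # r) + width (x # r) \<le> left r + width r"
    unfolding right using h by (metis add_left_mono mult_le_cancel_right_pos)
  assume "r \<noteq> []"
  then have "2 * real (Suc (idx (lam r) x)) < pieces r"
    using valid_idx(2)[OF assms] degree_ge_2 by (simp add: pieces_def of_nat_diff)
  then show "left (x # r) + width (x # r) < left r + width r"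
    unfolding right using h by (metis add_strict_left_mono mult_less_cancel_right_pos)
qed

lemma interval_mono: "valid (x # r) \<Longrightarrow> interval (x # r) \<subseteq> interval r"
  using interval_child[of x r] by (auto simp: interval_def)

text \<open>The number of the piece containing \<open>\<theta>\<close>: even on edges, odd on
  children.\<close>

definition digit :: "'x list \<Rightarrow> real \<Rightarrow> int" where
  "digit r \<theta> = \<lfloor>(\<theta> - left r) / unit r\<rfloor>"

lemma digit_pos:
  assumes "0 \<le> \<tau>" "\<tau> < 1"
  shows "digit r (pos r j \<tau>) = 2 * int j"
proof -
  have "(pos r j \<tau> - left r) / unit r = 2 * real j + \<tau>"
    using unit_pos[of r] by (simp add: pos_def)
  then show ?thesis
    using assms unfolding digit_def by (intro floor_unique) auto
qed

lemma digit_child: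
  assumes "\<theta> \<in> interval (x # r)"
  shows "digit r \<theta> = 2 * int (idx (lam r) x) + 1"
proof -
  let ?h = "unit r"
  have h: "?h > 0" by (rule unit_pos)
  have "left r + (2 * real (idx (lam r) x) + 1) * ?h \<le> \<theta>" "\<theta> < left r + (2 * real (idx (lam r) x) + 2) * ?h"
    using assms right_Cons_parent[of x r] left_Cons[of x r] unfolding interval_def pos_def
    by (auto simp: algebra_simps)
  then have "(2 * real (idx (lam r) x) + 1) \<le> (\<theta> - left r) / ?h" "(\<theta> - left r) / ?h < 2 * real (idx (lam r) x) + 2"
    using h by (simp_all add: pos_le_divide_eq pos_divide_less_eq algebra_simps)
  then show ?thesis
    unfolding digit_def by (simp add: floor_eq_iff)
qed

lemma pos_in_interval:
  assumes "j < degree" "0 \<le> \<tau>" "\<tau> < 1"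
  shows "pos r j \<tau> \<in> interval r"
proof -
  let ?h = "unit r"
  have h: "?h > 0" "width r = pieces r * ?h"
    by (rule unit_pos, rule width_unit)
  have "2 * real j + \<tau> < pieces r"
    using assms degree_ge_2 by (auto simp: pieces_def of_nat_diff)
  then have "(2 * real j + \<tau>) * ?h < width r" "0 \<le> (2 * real j + \<tau>) * ?h"
    using h assms by (metis mult_less_cancel_right_pos, simp)
  then show ?thesis
    by (simp add: interval_def pos_def)
qed

lemma interval_cases:
  assumes r: "valid r" and \<theta>: "\<theta> \<in> interval r"
  shows "(\<exists>j \<tau>. j < degree \<and> 0 \<le> \<tau> \<and> \<tau> < 1 \<and> \<theta> = pos r j \<tau>) \<or> (\<exists>x. valid (x # r) \<and> \<theta> \<in> interval (x # r))"
proof -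
  let ?h = "unit r" and ?k = "digit r \<theta>"
  define q where "q = (\<theta> - left r) / ?h"
  have h: "?h > 0" "width r = pieces r * ?h"
    by (rule unit_pos, rule width_unit)
  have q: "\<theta> = left r + q * ?h" "0 \<le> q" "q < pieces r"
  proof -
    show *: "\<theta> = left r + q * ?h"
      unfolding q_def using h(1) by simp
    show "0 \<le> q"
      using \<theta> h(1) by (simp add: q_def interval_def)
    show "q < pieces r"
      using \<theta> h unfolding interval_def by (metis * add_less_cancel_left atLeastLessThan_iff mult_less_cancel_right_pos)
  qed
  have k: "?k = \<lfloor>q\<rfloor>" "0 \<le> ?k"
    using q by (auto simp: digit_def q_def)
  show ?thesis
  proof (cases "even ?k")
    case True
    then obtain j where j: "?k = 2 * int j"
      using that[of "nat (?k div 2)"] k(2) by simp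
    have fl: "real_of_int ?k \<le> q" "q < real_of_int ?k + 1"
      using k(1) by linarith+
    then have "real_of_int ?k < pieces r" using q by simp
    then have "j < degree"
      using j degree_ge_2 by (auto simp: pieces_def of_nat_diff split: if_splits)
    moreover have "\<theta> = pos r j (q - 2 * real j)"
      using q(1) by (simp add: pos_def)
    ultimately show ?thesis
      using fl j by (intro disjI1 exI[of _ j] exI[of _ "q - 2 * real j"]) auto
  next
    case False
    then obtain j where j: "?k = 2 * int j + 1"
      using that[of "nat (?k div 2)"] k(2) by simp
    have fl: "real_of_int ?k \<le> q" "q < real_of_int ?k + 1"
      using k(1) by linarith+
    then have lt: "real_of_int ?k < pieces r" using q by simp
    have jd: "j < degree" "r \<noteq> [] \<Longrightarrow> Suc j < degree"
      using j lt degree_ge_2 by (auto simp: pieces_def of_nat_diff split: if_splits)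
    let ?x = "lab (flip (sd r j))"
    have ij: "idx (lam r) ?x = j"
      by (rule idx(3)[OF lam_D jd(1)])
    have "r = [] \<or> ?x \<noteq> opp (hd r)"
    proof (cases r)
      case (Cons y r')
      then have "opp (hd r) = lab (lam r)"
        using lab_lam r by simp
      then show ?thesis
        using ij idx_lab[OF lam_D, of r] jd Cons by auto
    qed simp
    then have v: "valid (?x # r)"
      using r flip_D sd_D by (auto simp: valid_Cons)
    have "left (?x # r) = left r + real_of_int ?k * ?h" "left (?x # r) + width (?x # r) = left r + (real_of_int ?k + 1) * ?h"
      unfolding left_Cons right_Cons_parent pos_def ij using j by (simp_all add: algebra_simps unit_def[symmetric])
    then have "\<theta> \<in> interval (?x # r)"
      using q(1) fl h(1) unfolding interval_def by simp
    then show ?thesis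
      using v by blast
  qed
qed

lemma interval_unique:
  "valid r \<Longrightarrow> valid r' \<Longrightarrow> length r = length r' \<Longrightarrow> \<theta> \<in> interval r \<Longrightarrow> \<theta> \<in> interval r' \<Longrightarrow> r = r'"
proof (induction r arbitrary: r')
  case (Cons x r)
  then obtain y r0 where r': "r' = y # r0" by (cases r') auto
  have v: "valid (x # r)" "valid (y # r0)" "valid r" "valid r0" and len: "length r = length r0"
    using Cons.prems by (auto simp: r' valid_Cons)
  have "\<theta> \<in> interval r" "\<theta> \<in> interval r0"
    using Cons.prems(4,5) interval_mono[OF v(1)] interval_mono[OF v(2)] by (auto simp: r')
  then have "r = r0"
    using Cons.IH[OF v(3,4) len] by simp
  then have "idx (lam r) x = idx (lam r) y"
    using digit_child[of \<theta> x r] digit_child[of \<theta> y r] Cons.prems by (simp add: r')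
  then have "x = y"
    using idx(2)[OF lam_D[of r], of x] idx(2)[OF lam_D[of r], of y] v(1,2) \<open>r = r0\<close>
    by (metis valid_Cons)
  then show ?case
    using \<open>r = r0\<close> r' by simp
qed simp

lemma valid_drop: "valid r \<Longrightarrow> valid (drop k r)"
proof (induction r arbitrary: k)
  case (Cons x r)
  then show ?case by (cases k) (simp_all add: valid_Cons)
qed simp

lemma interval_drop: "valid r \<Longrightarrow> interval r \<subseteq> interval (drop k r)"
proof (induction r arbitrary: k)
  case (Cons x r)
  then show ?case
    using interval_mono[of x r] by (cases k) (auto simp: valid_Cons)
qed simp

text \<open>If \<open>r'\<close> were longer, some child of \<open>r\<close> would contain the
  position in its interval, but positions on edges have an even digit and positions in children an
  odd one. Otherwise intervals of equal depth are compared.\<close>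

lemma pos_below:
  assumes "valid r" "valid r'" "0 \<le> \<tau>" "\<tau> < 1" "j < degree" "pos r j \<tau> \<in> interval r'"
  shows "length r' \<le> length r \<and> r' = drop (length r - length r') r"
proof (cases "length r' \<le> length r")
  case True
  have "pos r j \<tau> \<in> interval (drop (length r - length r') r)"
    using pos_in_interval[OF assms(5,3,4)] interval_drop[OF assms(1)] by blast
  then show ?thesis
    using interval_unique[OF valid_drop[OF assms(1), of "length r - length r'"] assms(2) _ _ assms(6)] True
    by simp
next
  case False
  define k where "k = length r' - Suc (length r)"
  have k: "length (drop k r') = Suc (length r)"
    using False by (simp add: k_def)
  then obtain x r0 where r0: "drop k r' = x # r0" "length r0 = length r"
    by (cases "drop k r'") auto
  have v: "valid (x # r0)" "pos r j \<tau> \<in> interval (x # r0)"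
    using valid_drop[OF assms(2), of k] interval_drop[OF assms(2), of k] assms(6) by (auto simp: r0)
  have "valid r0" "pos r j \<tau> \<in> interval r0"
    using v interval_mono[OF v(1)] by (auto simp: valid_Cons)
  then have "r0 = r"
    using interval_unique[of r0 r] assms(1) r0(2) pos_in_interval[OF assms(5,3,4)] by blast
  then have "2 * int j = 2 * int (idx (lam r) x) + 1"
    using digit_child[of "pos r j \<tau>" x r] v(2) digit_pos[OF assms(3,4)] by simp
  then show ?thesis by presburger
qed

lemma pos_unique:
  assumes "valid r" "valid r'" "0 \<le> \<tau>" "\<tau> < 1" "0 \<le> \<tau>'" "\<tau>' < 1" "j < degree" "j' < degree"
    "pos r j \<tau> = pos r' j' \<tau>'"
  shows "r = r' \<and> j = j' \<and> \<tau> = \<tau>'"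
proof -
  have "pos r j \<tau> \<in> interval r'" "pos r' j' \<tau>' \<in> interval r"
    using pos_in_interval[OF assms(7,3,4), of r] pos_in_interval[OF assms(8,5,6), of r'] assms(9) by simp_all
  then have "r' = drop (length r - length r') r" "length r \<le> length r'"
    using pos_below[OF assms(1,2,3,4,7)] pos_below[OF assms(2,1,5,6,8)] by simp_all
  then have "r = r'"
    by simp
  moreover from this have "j = j'"
    using digit_pos[OF assms(3,4), of r j] digit_pos[OF assms(5,6), of r' j'] assms(9) by simp
  ultimately show ?thesis
    using assms(9) unit_pos[of r] by (simp add: pos_def)
qed

end

section \<open>Quadratic words with connected link give circles\<close>

lemma reduced_nth: "reduced w \<Longrightarrow> Suc i < length w \<Longrightarrow> w ! Suc i \<noteq> inv_letter (w ! i)"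
  by (simp add: reduced_def successively_conv_nth)

lemma winv_nth: "k < length w \<Longrightarrow> winv w ! k = inv_letter (w ! (length w - Suc k))"
  by (simp add: winv_def rev_nth)

text \<open>Free groups have no involutions: in the middle of the word the equation gives a
  cancelling pair or a letter equal to its own inverse. This will show that \<open>s\<close> differs
  from its inverse.\<close>

lemma reduced_neq_winv:
  assumes "reduced w" "w \<noteq> []"
  shows "winv w \<noteq> w"
proof
  assume eq: "winv w = w"
  have w: "w ! k = inv_letter (w ! (length w - Suc k))" if "k < length w" for k
    using winv_nth[OF that] eq by simp
  show False
  proof (cases "even (length w)")
    case True
    then obtain h where h: "length w = 2 * h" by blast
    then have "h > 0" using assms(2) by (cases h) auto
    then have "w ! Suc (h - 1) = inv_letter (w ! (h - 1))"
      using w[of h] h by simp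
    then show False
      using reduced_nth[OF assms(1), of "h - 1"] h \<open>h > 0\<close> by simp
  next
    case False
    then obtain h where h: "length w = 2 * h + 1" by (blast elim: oddE)
    then show False
      using w[of h] by simp
  qed
qed

lemma letter_occ_card: "letter_occ a w = card {k. k < length w \<and> fst (w ! k) = a}"
proof -
  have "letter_occ a w = length (filter (\<lambda>x. fst x = a) w)"
    by (induction w) auto
  then show ?thesis
    by (simp add: length_filter_conv_card)
qed

text \<open>\<open>linked\<close> says that the Whitehead graph of the cyclic word
  \<open>\<phi> s\<close> is connected: its edges join the inverse of a letter to the letter that
  follows.\<close>

locale free_circle = free_cayley G A \<phi> S s
  for G :: "'g monoid" (structure) and A :: "'a set" and \<phi> :: "'g \<Rightarrow> 'a word" and S :: "'g set" and s :: 'g +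
  assumes occ_2: "a \<in> A \<Longrightarrow> letter_occ a (\<phi> s) = 2" and A_nonempty: "A \<noteq> {}"
    and linked: "B \<subseteq> {x. fst x \<in> A} \<Longrightarrow> B \<noteq> {} \<Longrightarrow>
      (\<And>i. i < length (\<phi> s) \<Longrightarrow> \<phi> s ! (Suc i mod length (\<phi> s)) \<in> B \<longleftrightarrow> inv_letter (\<phi> s ! i) \<in> B) \<Longrightarrow>
      B = {x. fst x \<in> A}"
begin

abbreviation t :: "'a word" where "t \<equiv> \<phi> s"
abbreviation L :: nat where "L \<equiv> length t"

lemma t: "reduced t" "fst ` set t \<subseteq> A" "t \<noteq> []" "L > 0"
proof -
  show "reduced t" "fst ` set t \<subseteq> A"
    using \<phi>_carrier s_carrier by auto
  show "t \<noteq> []"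
    using occ_2 A_nonempty by fastforce
  then show "L > 0" by simp
qed

text \<open>The dart \<open>(k, True)\<close> leaves a vertex along the \<open>k\<close>-th letter of \<open>t\<close> and \<open>(k, False)\<close> leaves it
  along the inverse of that letter.\<close>

definition darts :: "(nat \<times> bool) set" where
  "darts = {..<L} \<times> UNIV"

definition dlab :: "nat \<times> bool \<Rightarrow> 'a \<times> bool" where
  "dlab = (\<lambda>(k, b). if b then t ! k else inv_letter (t ! k))"

text \<open>A line is at a tree vertex at position \<open>k\<close> if it arrives by letter
  \<open>k - 1\<close> and leaves by letter \<open>k\<close>, with indices modulo
  \<open>L\<close>.\<close>

definition dflip :: "nat \<times> bool \<Rightarrow> nat \<times> bool" where
  "dflip = (\<lambda>(k, b). if b then ((k + L - 1) mod L, False) else (Suc k mod L, True))"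

definition dcont :: "nat \<times> bool \<Rightarrow> nat \<times> bool" where
  "dcont = (\<lambda>(k, b). (k, \<not> b))"

definition other :: "nat \<Rightarrow> nat" where
  "other k = (THE k'. k' < L \<and> k' \<noteq> k \<and> fst (t ! k') = fst (t ! k))"

text \<open>The truth value makes both occurrences of the generator leave by the same signed
  letter.\<close>

definition dtwin :: "nat \<times> bool \<Rightarrow> nat \<times> bool" where
  "dtwin = (\<lambda>(k, b). (other k, (t ! other k = t ! k) = b))"

lemma pred_succ: "k < L \<Longrightarrow> Suc ((k + L - 1) mod L) mod L = k" "k < L \<Longrightarrow> (Suc k mod L + L - 1) mod L = k"
proof -
  assume k: "k < L"
  show "Suc ((k + L - 1) mod L) mod L = k"
    using k by (metis Suc_diff_1 add_gr_0 mod_Suc_eq mod_add_self2 mod_less t(4))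
  show "(Suc k mod L + L - 1) mod L = k"
  proof (cases "Suc k = L")
    case False
    then show ?thesis using k by (simp add: mod_less)
  qed (use k in simp)
qed

lemma other:
  assumes "k < L"
  shows "other k < L" "other k \<noteq> k" "fst (t ! other k) = fst (t ! k)"
    "k' < L \<Longrightarrow> fst (t ! k') = fst (t ! k) \<Longrightarrow> k' = k \<or> k' = other k"
proof -
  let ?K = "{j. j < L \<and> fst (t ! j) = fst (t ! k)}"
  have "fst (t ! k) \<in> A"
    using t(2) nth_mem[OF assms] by blast
  then have "card ?K = 2"
    using occ_2 by (simp add: letter_occ_card)
  then obtain a b where ab: "?K = {a, b}" "a \<noteq> b"
    by (auto simp: card_2_iff)
  have "k \<in> ?K" using assms by simp
  then obtain c where c: "?K = {k, c}" "c \<noteq> k"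
    using ab by auto
  have "other k = c"
    unfolding other_def
  proof (rule the_equality)
    show "c < L \<and> c \<noteq> k \<and> fst (t ! c) = fst (t ! k)"
      using c by blast
    show "j = c" if "j < L \<and> j \<noteq> k \<and> fst (t ! j) = fst (t ! k)" for j
      using that c by blast
  qed
  moreover have "c \<in> ?K" using c by simp
  ultimately show "other k < L" "other k \<noteq> k" "fst (t ! other k) = fst (t ! k)"
    using c(2) by auto
  show "k' = k \<or> k' = other k" if "k' < L" "fst (t ! k') = fst (t ! k)"
    using that c(1) \<open>other k = c\<close> by blast
qed

lemma dlab_range: "dlab ` darts = {x. fst x \<in> A}"
proof (intro antisym subsetI)
  fix x assume "x \<in> dlab ` darts"
  then obtain k where "k < L" "fst x = fst (t ! k)"
    by (auto simp: darts_def dlab_def)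
  then show "x \<in> {x. fst x \<in> A}"
    using t(2) nth_mem[of k t] by auto
next
  fix x :: "'a \<times> bool" assume "x \<in> {x. fst x \<in> A}"
  then have "letter_occ (fst x) t \<noteq> 0"
    using occ_2 by simp
  then obtain y where "y \<in> set t" "fst y = fst x"
    unfolding letter_occ_eq_0_iff not_not image_iff by metis
  then obtain k where k: "k < L" "t ! k = x \<or> t ! k = inv_letter x"
    unfolding in_set_conv_nth fst_eq_letter by metis
  then show "x \<in> dlab ` darts"
    by (intro image_eqI[of _ _ "(k, t ! k = x)"]) (auto simp: dlab_def darts_def)
qed

sublocale link: cyclic_link darts dlab dflip dtwin
proof
  show "finite darts"
    by (simp add: darts_def)
  show "dflip d \<in> darts" "dflip (dflip d) = d" if "d \<in> darts" for d
    using that pred_succ t(4) by (auto simp: darts_def dflip_def split: prod.splits)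
  show "dflip d \<noteq> d" if "d \<in> darts" for d
    by (auto simp: dflip_def split: prod.splits)
  show "dtwin d \<in> darts" "dlab (dtwin d) = dlab d" "dtwin d \<noteq> d" if d: "d \<in> darts" for d
  proof -
    obtain k b where kb: "d = (k, b)" "k < L"
      using d by (auto simp: darts_def)
    note o = other[OF kb(2)]
    have "t ! other k = t ! k \<or> t ! other k = inv_letter (t ! k)"
      using o(3) by (simp add: fst_eq_letter)
    then show "dtwin d \<in> darts" "dlab (dtwin d) = dlab d" "dtwin d \<noteq> d"
      using o(1,2) by (auto simp: kb dtwin_def darts_def dlab_def)
  qed
  show "d' = d \<or> d' = dtwin d" if d: "d \<in> darts" "d' \<in> darts" "dlab d' = dlab d" for d d'
  proof -
    obtain k b k' b' where kb: "d = (k, b)" "k < L" "d' = (k', b')" "k' < L"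
      using d(1,2) by (auto simp: darts_def)
    note o = other[OF kb(2)]
    have "fst (t ! k') = fst (t ! k)"
      using arg_cong[OF d(3), of fst] by (simp add: kb dlab_def split: if_splits)
    then consider "k' = k" | "k' = other k"
      using o(4) kb(4) by blast
    then show ?thesis
    proof cases
      case 1
      then show ?thesis using d(3) by (auto simp: kb dlab_def split: if_splits)
    next
      case 2
      have "t ! other k = t ! k \<or> t ! other k = inv_letter (t ! k)"
        using o(3) by (simp add: fst_eq_letter)
      then show ?thesis
        using d(3) 2 by (auto simp: kb dlab_def dtwin_def split: if_splits)
    qed
  qed
  show "B = dlab ` darts" if B: "B \<subseteq> dlab ` darts" "B \<noteq> {}"
    "\<And>d. d \<in> darts \<Longrightarrow> dlab d \<in> B \<Longrightarrow> dlab (dflip d) \<in> B" for B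
    unfolding dlab_range
  proof (rule linked)
    show "B \<subseteq> {x. fst x \<in> A}"
      using B(1) by (simp add: dlab_range)
    fix i assume i: "i < L"
    have "(i, False) \<in> darts" "(Suc i mod L, True) \<in> darts"
      using i mod_less_divisor[OF t(4)] by (auto simp: darts_def)
    then show "t ! (Suc i mod L) \<in> B \<longleftrightarrow> inv_letter (t ! i) \<in> B"
      using B(3)[of "(i, False)"] B(3)[of "(Suc i mod L, True)"] pred_succ(2)[OF i]
      by (auto simp: dlab_def dflip_def)
  qed (fact B(2))
qed

sublocale link: link_tree darts dlab dflip dtwin dcont inv_letter "(0, True)"
proof
  show "dcont d \<in> darts" "dcont (dcont d) = d" "dlab (dcont d) = inv_letter (dlab d)" if "d \<in> darts" for d
    using that by (auto simp: dcont_def darts_def dlab_def split: prod.splits)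
  show "inv_letter (inv_letter x) = x" for x :: "'a \<times> bool"
    by simp
  show "inv_letter x \<in> dlab ` darts" if "x \<in> dlab ` darts" for x
    using that by (simp add: dlab_range)
  show "(0, True) \<in> darts"
    using t(4) by (simp add: darts_def)
  have "{t ! 0, inv_letter (t ! 0)} \<subseteq> dlab ` darts"
    using t(2) t(4) nth_mem[of 0 t] by (auto simp: dlab_range)
  then have "card {t ! 0, inv_letter (t ! 0)} \<le> card (dlab ` darts)"
    by (intro card_mono) (simp_all add: darts_def)
  then have "2 \<le> card (dlab ` darts)"
    by simp
  then show "2 \<le> link.degree"
    by (simp add: link.degree_def)
qed

end

context free_circle
begin

text \<open>The edge from \<open>g\<close> to \<open>g \<otimes> s\<close> passes one tree vertex
  for each proper prefix of \<open>t\<close>. Segment \<open>i\<close> of its \<open>L\<close> equal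
  segments is assigned to the vertex \<open>w\<close> reached from \<open>g\<close> after
  \<open>i\<close> letters.\<close>

definition seg_point :: "'a word \<Rightarrow> nat \<Rightarrow> real \<Rightarrow> 'g fpoint" where
  "seg_point w i \<sigma> = (let g = vtx (w @ winv (take i t)) in Point (edge_point g (g \<otimes> s) ((real i + \<sigma>) / real L)))"

text \<open>The parameter runs from the end of the segment on the side of the dart to the end on the
  side of its flip.\<close>

definition dart_point :: "'a word \<Rightarrow> nat \<times> bool \<Rightarrow> real \<Rightarrow> 'g fpoint" where
  "dart_point w = (\<lambda>(k, b) \<tau>. if b then seg_point w k (1 - \<tau>) else seg_point w (Suc k mod L) \<tau>)"

lemma take_letters: "fst ` set (take i t) \<subseteq> A"
  using t(2) set_take_subset[of i t] by blast

lemma word_letters: "fst ` set w \<subseteq> A \<Longrightarrow> fst ` set (w @ winv (take i t)) \<subseteq> A"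
  using take_letters[of i] by (simp only: set_append image_Un fst_set_winv Un_subset_iff simp_thms)

lemma seg_point_cong: "reduce w = reduce w' \<Longrightarrow> seg_point w i \<sigma> = seg_point w' i \<sigma>"
proof -
  assume "reduce w = reduce w'"
  then have "vtx (w @ v) = vtx (w' @ v)" for v
    by (intro vtx_eqI) (metis reduce_append_left)
  then show ?thesis by (simp add: seg_point_def)
qed

lemma seg_point_next:
  assumes w: "fst ` set w \<subseteq> A" and k: "k < L"
  shows "seg_point w k 1 = seg_point (w @ [t ! k]) (Suc k mod L) 0"
proof (cases "Suc k = L")
  case False
  then have "take (Suc k) t = take k t @ [t ! k]" "Suc k mod L = Suc k"
    using k by (auto simp: take_Suc_conv_app_nth)
  moreover have "vtx ((w @ [t ! k]) @ winv (take k t @ [t ! k])) = vtx (w @ winv (take k t))"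
    using reduce_winv_cancel(2)[of w "[t ! k]" "winv (take k t)"] by (intro vtx_eqI) simp
  ultimately show ?thesis
    by (simp add: seg_point_def Let_def add.commute)
next
  \<comment> \<open>The last segment of an edge ends at \<open>?g \<otimes> s\<close>, where the
    next edge of the line begins.\<close>
  case True
  let ?g = "vtx (w @ winv (take k t))"
  have "t = take k t @ [t ! k]"
    using k True take_Suc_conv_app_nth[OF k] by simp
  then have "reduce (w @ winv (take k t) @ t) = reduce (w @ winv (take k t) @ take k t @ [t ! k])"
    by simp
  also have "\<dots> = reduce (w @ [t ! k])"
    by (rule reduce_winv_cancel)
  finally have "vtx (w @ winv (take k t) @ t) = vtx (w @ [t ! k])"
    by (rule vtx_eqI)
  moreover have "?g \<otimes> s = vtx (w @ winv (take k t) @ t)"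
    using vtx_mult[OF word_letters[OF w] t(2), of k] vtx_\<phi>[OF s_carrier] by simp
  ultimately have "?g \<otimes> s = vtx (w @ [t ! k])"
    by simp
  moreover have "(real k + 1) / real L = 1" "Suc k mod L = 0"
    using True t(4) by (simp_all add: field_simps)
  ultimately show ?thesis
    unfolding seg_point_def Let_def by (simp add: edge_point_def)
qed

lemma dart_point_flip:
  assumes "d \<in> darts" "fst ` set w \<subseteq> A"
  shows "dart_point w d 1 = dart_point (w @ [dlab (dflip d)]) (dcont (dflip d)) 0"
proof -
  obtain k b where d: "d = (k, b)" "k < L"
    using assms(1) by (auto simp: darts_def)
  show ?thesis
  proof (cases b)
    case True
    let ?m = "(k + L - 1) mod L"
    have m: "?m < L" "Suc ?m mod L = k"
      using d(2) t(4) pred_succ(1) by auto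
    have lt: "fst ` set (w @ [inv_letter (t ! ?m)]) \<subseteq> A"
      using assms(2) t(2) nth_mem[OF m(1)] by auto
    have "seg_point (w @ [inv_letter (t ! ?m)]) ?m 1 = seg_point ((w @ [inv_letter (t ! ?m)]) @ [t ! ?m]) k 0"
      using seg_point_next[OF lt m(1)] m(2) by simp
    also have "\<dots> = seg_point w k 0"
      using reduce_winv_cancel(5)[of w "[t ! ?m]"] by (intro seg_point_cong) simp
    finally show ?thesis
      using True by (simp add: d dart_point_def dlab_def dflip_def dcont_def)
  next
    case False
    have "Suc k mod L < L"
      using t(4) by simp
    then show ?thesis
      using False seg_point_next[OF assms(2)] by (simp add: d dart_point_def dlab_def dflip_def dcont_def)
  qed
qed

section \<open>Parametrization of the closure by positions\<close>

definition seg :: "('a \<times> bool) list \<Rightarrow> nat \<Rightarrow> real \<Rightarrow> 'g fpoint" where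
  "seg r j = dart_point (rev r) (link.sd r j)"

lemma valid_iff: "link.valid r \<longleftrightarrow> reduced (rev r) \<and> fst ` set r \<subseteq> A"
proof (induction r)
  case (Cons x r)
  have "r = [] \<or> x \<noteq> inv_letter (hd r) \<longleftrightarrow> (rev r \<noteq> [] \<longrightarrow> x \<noteq> inv_letter (last (rev r)))"
    by (auto simp: last_rev)
  then show ?case
    using Cons by (auto simp: link.valid_Cons dlab_range reduced_append_single)
qed simp

lemma step_reduce: "reduce (rev r @ [x]) = reduce (rev (link.step r x))"
proof (cases "r \<noteq> [] \<and> x = inv_letter (hd r)")
  case True
  then have "rev r @ [x] = rev (tl r) @ [hd r] @ winv [hd r]"
    by (cases r) auto
  then show ?thesis
    using True reduce_winv_cancel(6)[of "rev (tl r)" "[hd r]"] by (simp only: link.step_def if_True simp_thms)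
qed (auto simp: link.step_def)

lemma sd_darts: "link.sd r j \<in> darts"
  by (rule link.sd_D)

lemma flip_eq: "d \<in> darts \<Longrightarrow> dcont (dcont d) = d" "d \<in> darts \<Longrightarrow> dflip (dflip d) = d"
  by (rule link.cont_cont, assumption) (rule link.flip_flip)

lemma adjacent_seg:
  assumes r: "link.valid r" "j < link.degree"
  shows "\<exists>r' j' c. link.valid r' \<and> j' < link.degree \<and> link.sd r' j' = dcont (dflip (link.sd r j)) \<and>
      link.pos r' j' 0 = link.pos r j 1 + of_int c \<and> seg r' j' 0 = seg r j 1"
    "\<exists>r' j' c. link.valid r' \<and> j' < link.degree \<and> link.sd r' j' = dflip (dcont (link.sd r j)) \<and>
      link.pos r' j' 1 = link.pos r j 0 + of_int c"
proof -
  let ?d = "link.sd r j"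
  let ?r = "link.step r (dlab (dflip ?d))"
  obtain j' c where *: "j' < link.degree" "link.valid ?r" "link.sd ?r j' = dcont (dflip ?d)"
    "link.pos ?r j' 0 = link.pos r j 1 + of_int c"
    using link.adjacent_end[OF r, of True] by (auto simp: link.end_dart_def)
  have "seg r j 1 = dart_point (rev r @ [dlab (dflip ?d)]) (dcont (dflip ?d)) 0"
    unfolding seg_def by (rule dart_point_flip[OF sd_darts]) (use r(1) in \<open>simp add: valid_iff\<close>)
  also have "\<dots> = seg ?r j' 0"
    using seg_point_cong[OF step_reduce] unfolding seg_def *(3) by (simp add: dart_point_def split: prod.splits)
  finally show "\<exists>r' j' c. link.valid r' \<and> j' < link.degree \<and> link.sd r' j' = dcont (dflip (link.sd r j)) \<and>
      link.pos r' j' 0 = link.pos r j 1 + of_int c \<and> seg r' j' 0 = seg r j 1"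
    using * by metis
  let ?r' = "link.step r (dlab ?d)"
  obtain j' c where "j' < link.degree" "link.valid ?r'" "dflip (link.sd ?r' j') = dcont ?d"
    "link.pos ?r' j' 1 = link.pos r j 0 + of_int c"
    using link.adjacent_end[OF r, of False] by (auto simp: link.end_dart_def)
  moreover from this have "link.sd ?r' j' = dflip (dcont ?d)"
    using flip_eq(2)[OF sd_darts] by metis
  ultimately show "\<exists>r' j' c. link.valid r' \<and> j' < link.degree \<and> link.sd r' j' = dflip (dcont (link.sd r j)) \<and>
      link.pos r' j' 1 = link.pos r j 0 + of_int c"
    by blast
qed

text \<open>Stated as a relation, because existence and uniqueness have separate reasons;
  \<open>circle_map\<close> is the resulting function, continued with period
  \<open>1\<close>.\<close>

definition located :: "real \<Rightarrow> 'g fpoint \<Rightarrow> bool" where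
  "located \<theta> p \<longleftrightarrow>
     (\<exists>r j \<tau>. link.valid r \<and> j < link.degree \<and> 0 \<le> \<tau> \<and> \<tau> < 1 \<and> \<theta> = link.pos r j \<tau> \<and> p = seg r j \<tau>) \<or>
     (\<exists>\<xi> \<omega>. \<xi> \<in> boundary_words \<and> (\<forall>k. \<theta> \<in> link.interval (rev (pre \<xi> k))) \<and> \<omega> \<in> ends X \<and> ends_at \<omega> \<xi> \<and> p = End \<omega>)"

lemma valid_pre: "\<xi> \<in> boundary_words \<Longrightarrow> link.valid (rev (pre \<xi> k))"
  using pre_reduced[of \<xi> k] pre_letters[of \<xi> k] by (simp add: valid_iff)

lemma interval_Nil [simp]: "link.interval [] = {0..<1}"
  by (simp add: link.interval_def)

lemma interval_subset: "link.valid r \<Longrightarrow> link.interval r \<subseteq> {0..<1}"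
  using link.interval_drop[of r "length r"] by simp

text \<open>A position that never falls on a segment descends into a child at every level, and the
  children passed spell an infinite reduced word.\<close>

lemma located_exists:
  assumes "0 \<le> \<theta>" "\<theta> < 1"
  shows "\<exists>p. located \<theta> p"
proof (cases "\<exists>r j \<tau>. link.valid r \<and> j < link.degree \<and> 0 \<le> \<tau> \<and> \<tau> < 1 \<and> \<theta> = link.pos r j \<tau>")
  case True
  then show ?thesis unfolding located_def by blast
next
  case False
  let ?Q = "\<lambda>r. link.valid r \<and> \<theta> \<in> link.interval r"
  have "\<exists>x. ?Q (x # r)" if "?Q r" for r
    using link.interval_cases[of r \<theta>] that False by blast
  then obtain f where f: "\<And>r. ?Q r \<Longrightarrow> ?Q (f r # r)"
    by metis
  define R where "R = rec_nat [] (\<lambda>_ r. f r # r)"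
  have R: "R 0 = []" "\<And>k. R (Suc k) = f (R k) # R k"
    by (simp_all add: R_def)
  have QR: "?Q (R k)" for k
    by (induction k) (use assms f in \<open>auto simp: R\<close>)
  define \<xi> where "\<xi> k = f (R k)" for k
  have pre: "rev (pre \<xi> k) = R k" for k
    by (induction k) (simp_all add: R pre_Suc \<xi>_def)
  have "\<xi> \<in> boundary_words"
    unfolding boundary_words_def
  proof (intro CollectI allI conjI)
    fix k
    have "link.valid (\<xi> (Suc k) # \<xi> k # R k)"
      using QR[of "Suc (Suc k)"] by (simp only: R \<xi>_def)
    then show "fst (\<xi> k) \<in> A" "\<xi> (Suc k) \<noteq> inv_letter (\<xi> k)"
      using dlab_range by (auto simp: link.valid_Cons)
  qed
  moreover from this obtain \<omega> where "\<omega> \<in> ends X" "ends_at \<omega> \<xi>"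
    by (rule ends_at_exists)
  ultimately show ?thesis
    unfolding located_def using pre QR by metis
qed

lemma located_unique:
  assumes "located \<theta> p" "located \<theta> q"
  shows "p = q"
proof -
  have mixed: False if "link.valid r" "j < link.degree" "0 \<le> \<tau>" "\<tau> < 1" "\<xi> \<in> boundary_words"
    "\<forall>k. link.pos r j \<tau> \<in> link.interval (rev (pre \<xi> k))" for r j \<tau> \<xi>
    using link.pos_below[OF that(1) valid_pre[OF that(5), of "Suc (length r)"] that(3,4,2)] that(6) by simp
  have ends: "\<omega> = \<omega>'" if "\<xi> \<in> boundary_words" "\<forall>k. \<theta> \<in> link.interval (rev (pre \<xi> k))" "\<omega> \<in> ends X" "ends_at \<omega> \<xi>"
    "\<xi>' \<in> boundary_words" "\<forall>k. \<theta> \<in> link.interval (rev (pre \<xi>' k))" "\<omega>' \<in> ends X" "ends_at \<omega>' \<xi>'" for \<omega> \<omega>' \<xi> \<xi>'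
  proof -
    have "rev (pre \<xi> k) = rev (pre \<xi>' k)" for k
      by (rule link.interval_unique) (use that valid_pre in auto)
    then have "ends_at \<omega> \<xi>'"
      using that(4) by (simp add: ends_at_def)
    then show ?thesis
      using ends_at_unique that by blast
  qed
  show ?thesis
    using assms(1)[unfolded located_def] assms(2)[unfolded located_def]
  proof (elim disjE exE conjE)
    fix r j \<tau> r' j' \<tau>'
    assume *: "link.valid r" "j < link.degree" "0 \<le> \<tau>" "\<tau> < 1" "\<theta> = link.pos r j \<tau>" "p = seg r j \<tau>"
      "link.valid r'" "j' < link.degree" "0 \<le> \<tau>'" "\<tau>' < 1" "\<theta> = link.pos r' j' \<tau>'" "q = seg r' j' \<tau>'"
    show "p = q"
      using link.pos_unique[OF *(1,7,3,4,9,10,2,8)] *(5,6,11,12) by simp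
  qed (use mixed ends in metis)+
qed

definition circle_map :: "real \<Rightarrow> 'g fpoint" where
  "circle_map \<theta> = (THE p. located (frac \<theta>) p)"

lemma located_circle_map: "located (frac \<theta>) (circle_map \<theta>)"
proof -
  obtain p where "located (frac \<theta>) p"
    using located_exists[of "frac \<theta>"] frac_ge_0 frac_lt_1 by blast
  then show ?thesis
    unfolding circle_map_def using located_unique by (metis the_equality)
qed

lemma circle_mapI: "located (frac \<theta>) p \<Longrightarrow> circle_map \<theta> = p"
  using located_circle_map located_unique by blast

lemma circle_map_shift: "circle_map (\<theta> + of_int c) = circle_map \<theta>"
proof -
  have "frac (\<theta> + of_int c) = frac \<theta>"
    by (simp add: frac_def)
  then show ?thesis by (simp add: circle_map_def)
qed

lemma circle_map_pos:
  assumes "link.valid r" "j < link.degree" "0 \<le> \<tau>" "\<tau> \<le> 1"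
  shows "circle_map (link.pos r j \<tau>) = seg r j \<tau>"
proof -
  have lt: "circle_map (link.pos r j \<tau>) = seg r j \<tau>"
    if "link.valid r" "j < link.degree" "0 \<le> \<tau>" "\<tau> < 1" for r j \<tau>
  proof (rule circle_mapI)
    have "link.pos r j \<tau> \<in> {0..<1}"
      using link.pos_in_interval[OF that(2-4), of r] interval_subset[OF that(1)] by blast
    then have "frac (link.pos r j \<tau>) = link.pos r j \<tau>"
      by (simp add: frac_eq)
    then show "located (frac (link.pos r j \<tau>)) (seg r j \<tau>)"
      unfolding located_def using that by metis
  qed
  show ?thesis
  proof (cases "\<tau> = 1")
    case True
    obtain r' j' c where *: "link.valid r'" "j' < link.degree"
      "link.pos r' j' 0 = link.pos r j 1 + of_int c" "seg r' j' 0 = seg r j 1"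
      using adjacent_seg(1)[OF assms(1,2)] by metis
    then show ?thesis
      using lt[OF *(1,2), of 0] circle_map_shift[of "link.pos r j 1" c] True by simp
  qed (use lt assms in simp)
qed

lemma circle_map_end:
  assumes "\<xi> \<in> boundary_words" "\<And>k. \<theta> \<in> link.interval (rev (pre \<xi> k))" "\<omega> \<in> ends X" "ends_at \<omega> \<xi>"
  shows "circle_map \<theta> = End \<omega>"
proof (rule circle_mapI)
  have "frac \<theta> = \<theta>"
    using assms(2)[of 0] by (simp add: frac_eq)
  then show "located (frac \<theta>) (End \<omega>)"
    unfolding located_def using assms by metis
qed

lemma vtx_edge_Y: "fst ` set w \<subseteq> A \<Longrightarrow> adj Y (vtx w) (vtx w \<otimes> s)"
  using vtx_carrier s_carrier by (simp add: adj_Y_iff)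

lemma subdivision_bounds:
  assumes "i < L" "0 \<le> \<sigma>" "\<sigma> \<le> 1"
  shows "(real i + \<sigma>) / real L \<in> {0..1}"
proof -
  have "real i + \<sigma> \<le> real L"
    using assms by linarith
  then show ?thesis
    using assms by (simp add: divide_le_eq_1)
qed

lemma seg_point_range:
  assumes "fst ` set w \<subseteq> A" "i < L" "0 \<le> \<sigma>" "\<sigma> \<le> 1"
  shows "seg_point w i \<sigma> \<in> Point ` realization Y"
proof -
  have "(real i + \<sigma>) / real L \<in> {0..1}"
    using subdivision_bounds[OF assms(2-4)] .
  then show ?thesis
    using vtx_edge_Y[OF word_letters[OF assms(1), of i]] unfolding seg_point_def Let_def realization_def by blast
qed

lemma seg_obtain:
  assumes "link.valid r"
  obtains i where "i < L" "(\<forall>\<tau>. seg r j \<tau> = seg_point (rev r) i \<tau>) \<or> (\<forall>\<tau>. seg r j \<tau> = seg_point (rev r) i (1 - \<tau>))"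
proof -
  obtain k b where k: "link.sd r j = (k, b)" "k < L"
    using sd_darts[of j r] by (cases "link.sd r j") (auto simp: darts_def)
  show thesis
  proof (cases b)
    case True
    then show thesis using that[of k] k by (simp add: seg_def dart_point_def)
  next
    case False
    then show thesis using that[of "Suc k mod L"] k t(4) by (simp add: seg_def dart_point_def)
  qed
qed

lemma seg_range:
  assumes "link.valid r" "0 \<le> \<tau>" "\<tau> \<le> 1"
  shows "seg r j \<tau> \<in> Point ` realization Y"
proof (rule seg_obtain[OF assms(1), of j])
  fix i assume i: "i < L" "(\<forall>\<tau>. seg r j \<tau> = seg_point (rev r) i \<tau>) \<or> (\<forall>\<tau>. seg r j \<tau> = seg_point (rev r) i (1 - \<tau>))"
  have "fst ` set (rev r) \<subseteq> A"
    using assms(1) by (simp add: valid_iff)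
  then show ?thesis
    using i seg_point_range[OF _ i(1), of "rev r" \<tau>] seg_point_range[OF _ i(1), of "rev r" "1 - \<tau>"] assms(2,3) by auto
qed

lemma circle_map_range: "circle_map \<theta> \<in> circle"
  using located_circle_map[of \<theta>] seg_range unfolding located_def circle_def by (metis UnI1 UnI2 imageI less_imp_le)

lemma seg_continuous:
  assumes "link.valid r"
  shows "continuous_map (top_of_set {0..1}) (freudenthal X) (seg r j)"
proof (rule seg_obtain[OF assms, of j])
  fix i assume i: "i < L" "(\<forall>\<tau>. seg r j \<tau> = seg_point (rev r) i \<tau>) \<or> (\<forall>\<tau>. seg r j \<tau> = seg_point (rev r) i (1 - \<tau>))"
  let ?g = "vtx (rev r @ winv (take i t))"
  have adj: "adj X ?g (?g \<otimes> s)"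
    using vtx_edge_Y[OF word_letters] adj_Y_imp_X assms by (simp add: valid_iff)
  have *: "continuous_map (top_of_set {0..1}) (freudenthal X) (\<lambda>\<tau>. seg_point (rev r) i (h \<tau>))"
    if "continuous_on {0..1} h" "h ` {0..1} \<subseteq> {0..1}" for h :: "real \<Rightarrow> real"
  proof -
    have "(real i + h \<tau>) / real L \<in> {0..1}" if "\<tau> \<in> {0..1}" for \<tau>
    proof -
      have "h \<tau> \<in> {0..1}"
        using that \<open>h ` {0..1} \<subseteq> {0..1}\<close> by blast
      then show ?thesis
        using subdivision_bounds[OF i(1)] by simp
    qed
    moreover have "continuous_on {0..1} (\<lambda>\<tau>. (real i + h \<tau>) / real L)"
      using that(1) t(4) by (intro continuous_intros) auto
    ultimately have "continuous_map (top_of_set {0..1}) (top_of_set {0..1}) (\<lambda>\<tau>. (real i + h \<tau>) / real L)"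
      by (auto simp: continuous_map_in_subtopology)
    from continuous_map_compose[OF this continuous_map_edge_point[OF adj]] show ?thesis
      by (simp add: comp_def seg_point_def Let_def)
  qed
  show ?thesis
    using i(2)
  proof
    assume "\<forall>\<tau>. seg r j \<tau> = seg_point (rev r) i \<tau>"
    then have "seg r j = (\<lambda>\<tau>. seg_point (rev r) i \<tau>)" by auto
    then show ?thesis using *[of "\<lambda>\<tau>. \<tau>"] by simp
  next
    assume "\<forall>\<tau>. seg r j \<tau> = seg_point (rev r) i (1 - \<tau>)"
    then have "seg r j = (\<lambda>\<tau>. seg_point (rev r) i (1 - \<tau>))" by auto
    moreover have "continuous_on {0..1} (\<lambda>\<tau>::real. 1 - \<tau>)"
      by (intro continuous_intros)
    ultimately show ?thesis
      using *[of "\<lambda>\<tau>. 1 - \<tau>"] by auto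
  qed
qed

text \<open>This is continuity within one segment; at a common end point two such neighbourhoods are
  glued in \<open>circle_map_near\<close>.\<close>

lemma seg_near:
  assumes V: "openin (freudenthal X) V" and r: "link.valid r" "j < link.degree"
    and \<tau>0: "0 \<le> \<tau>0" "\<tau>0 \<le> 1" "seg r j \<tau>0 \<in> V"
  obtains \<delta> where "\<delta> > 0"
    "\<And>\<theta>. link.pos r j 0 \<le> \<theta> \<Longrightarrow> \<theta> \<le> link.pos r j 1 \<Longrightarrow> \<bar>\<theta> - link.pos r j \<tau>0\<bar> < \<delta> \<Longrightarrow> circle_map \<theta> \<in> V"
proof -
  let ?h = "link.unit r"
  have h: "?h > 0" by (rule link.unit_pos)
  have "openin (top_of_set {0..1}) {\<tau> \<in> {0..1}. seg r j \<tau> \<in> V}"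
    using openin_continuous_map_preimage[OF seg_continuous[OF r(1)] V] by simp
  then obtain e where e: "e > 0" "\<And>\<tau>. \<tau> \<in> {0..1} \<Longrightarrow> dist \<tau> \<tau>0 < e \<Longrightarrow> seg r j \<tau> \<in> V"
    unfolding openin_euclidean_subtopology_iff using \<tau>0 by auto
  show thesis
  proof (rule that[of "e * ?h"])
    show "e * ?h > 0" using e h by simp
    fix \<theta> assume \<theta>: "link.pos r j 0 \<le> \<theta>" "\<theta> \<le> link.pos r j 1" "\<bar>\<theta> - link.pos r j \<tau>0\<bar> < e * ?h"
    define \<tau> where "\<tau> = (\<theta> - link.pos r j 0) / ?h"
    have "\<tau> * ?h = \<theta> - link.pos r j 0"
      using h by (simp add: \<tau>_def)
    then have \<theta>_eq: "\<theta> = link.pos r j \<tau>"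
      by (simp add: link.pos_def algebra_simps)
    have "0 \<le> \<tau>" "\<tau> \<le> 1"
      using \<theta>(1,2) h unfolding \<theta>_eq link.pos_def by simp_all
    moreover have "\<theta> - link.pos r j \<tau>0 = (\<tau> - \<tau>0) * ?h"
      by (simp add: \<theta>_eq link.pos_def algebra_simps)
    then have "\<bar>\<tau> - \<tau>0\<bar> * ?h < e * ?h"
      using \<theta>(3) h by (simp add: abs_mult)
    then have "\<bar>\<tau> - \<tau>0\<bar> < e"
      using h by simp
    ultimately show "circle_map \<theta> \<in> V"
      using e(2)[of \<tau>] circle_map_pos[OF r, of \<tau>] by (simp add: \<theta>_eq dist_real_def)
  qed
qed

text \<open>The \<open>L\<close> additional levels absorb the length of an edge: a segment at depth
  at least \<open>m + L\<close> lies on an edge whose end points arise by appending at most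
  \<open>L\<close> letters, so both keep the prefix of length \<open>m\<close>.\<close>

lemma region_of_interval:
  assumes \<xi>: "\<xi> \<in> boundary_words" and \<theta>: "\<theta> \<in> link.interval (rev (pre \<xi> (m + L)))"
  shows "circle_map \<theta> \<in> region (shadow (pre \<xi> m))"
proof -
  let ?r = "rev (pre \<xi> (m + L))"
  have "\<theta> \<in> {0..<1}"
    using \<theta> interval_subset[OF valid_pre[OF \<xi>]] by blast
  then have "frac \<theta> = \<theta>"
    by (simp add: frac_eq)
  then have "located \<theta> (circle_map \<theta>)"
    using located_circle_map[of \<theta>] by simp
  then show ?thesis
    unfolding located_def
  proof (elim disjE exE conjE)
    fix r j \<tau> assume *: "link.valid r" "j < link.degree" "0 \<le> \<tau>" "\<tau> < 1" "\<theta> = link.pos r j \<tau>" "circle_map \<theta> = seg r j \<tau>"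
    have below: "?r = drop (length r - (m + L)) r" "m + L \<le> length r"
      using link.pos_below[OF *(1) valid_pre[OF \<xi>] *(3,4,2)] \<theta> *(5) by auto
    let ?w = "rev r"
    have w: "reduced ?w" "fst ` set ?w \<subseteq> A"
      using *(1) by (auto simp: valid_iff)
    have "pre \<xi> (m + L) = take (m + L) ?w"
      using arg_cong[OF below(1), of rev] by (simp only: rev_rev_ident take_rev)
    moreover have "pre \<xi> m = take m (pre \<xi> (m + L))"
      by (simp add: pre_def take_map)
    ultimately have pm: "take m ?w = pre \<xi> m"
      by (simp add: min_def)
    have in_sh: "vtx (?w @ u) \<in> shadow (pre \<xi> m)" if "length u \<le> L" "fst ` set u \<subseteq> A" for u
    proof -
      have "take m (reduce (?w @ u)) = take m ?w"
        using that(1) below(2) by (intro take_reduce_append[OF w(1)]) simp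
      then show ?thesis
        using w(2) that(2) pm by (simp add: shadow_def vtx_carrier \<phi>_vtx image_Un)
    qed
    obtain i where i: "i < L" "(\<forall>\<tau>. seg r j \<tau> = seg_point (rev r) i \<tau>) \<or> (\<forall>\<tau>. seg r j \<tau> = seg_point (rev r) i (1 - \<tau>))"
      by (rule seg_obtain[OF *(1), of j])
    let ?g = "vtx (?w @ winv (take i t))"
    obtain \<rho> where \<rho>: "seg r j \<tau> = Point (edge_point ?g (?g \<otimes> s) \<rho>)"
      using i(2) unfolding seg_point_def Let_def by blast
    have "?g \<in> shadow (pre \<xi> m)"
      using take_letters[of i] i(1) by (intro in_sh) (simp_all only: length_winv length_take fst_set_winv)
    moreover have "?g \<otimes> s \<in> shadow (pre \<xi> m)"
    proof -
      have "fst ` set (?w @ winv (take i t)) \<subseteq> A" "fst ` set t \<subseteq> A"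
        using word_letters[OF w(2)] t(2) by auto
      then have "?g \<otimes> s = vtx ((?w @ winv (take i t)) @ t)"
        using vtx_mult[of "?w @ winv (take i t)" t] vtx_\<phi>[OF s_carrier] by simp
      also have "\<dots> = vtx (?w @ drop i t)"
        using reduce_winv_cancel(1)[of ?w "take i t" "drop i t"] by (intro vtx_eqI) simp
      also have "\<dots> \<in> shadow (pre \<xi> m)"
        using t(2) set_drop_subset[of i t] by (intro in_sh) auto
      finally show ?thesis .
    qed
    moreover obtain p where p: "seg r j \<tau> = Point p" "p \<in> realization X"
      using seg_range[OF *(1,3), of j] *(4) realization_Y_subset by auto
    moreover obtain v where v: "p v > 0"
      using realization_support(2)[OF p(2)] by blast
    moreover have "p = edge_point ?g (?g \<otimes> s) \<rho>"
      using \<rho> p(1) by simp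
    moreover from this v have "v = ?g \<or> v = ?g \<otimes> s"
      by (auto simp: edge_point_def of_bool_def split: if_splits)
    ultimately show ?thesis
      using *(6) by auto
  next
    fix \<xi>' \<omega> assume *: "\<xi>' \<in> boundary_words" "\<forall>k. \<theta> \<in> link.interval (rev (pre \<xi>' k))" "\<omega> \<in> ends X" "ends_at \<omega> \<xi>'"
      "circle_map \<theta> = End \<omega>"
    have "rev (pre \<xi>' (m + L)) = ?r"
      by (rule link.interval_unique) (use * \<xi> \<theta> valid_pre in auto)
    then have "take m (pre \<xi>' (m + L)) = take m (pre \<xi> (m + L))"
      by simp
    then have "pre \<xi>' m = pre \<xi> m"
      by (simp add: pre_def take_map)
    then show ?thesis
      using *(3,5) *(4)[unfolded ends_at_def, rule_format, of m] by simp
  qed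
qed

lemma circle_map_near:
  assumes V: "openin (freudenthal X) V" "circle_map \<theta>0 \<in> V" and \<theta>0: "0 \<le> \<theta>0" "\<theta>0 < 1"
  shows "\<exists>\<delta>>0. \<forall>\<theta>. \<bar>\<theta> - \<theta>0\<bar> < \<delta> \<longrightarrow> circle_map \<theta> \<in> V"
proof -
  have "located \<theta>0 (circle_map \<theta>0)"
    using located_circle_map[of \<theta>0] \<theta>0 by (simp add: frac_eq)
  then show ?thesis
    unfolding located_def
  proof (elim disjE exE conjE)
    fix r j \<tau> assume *: "link.valid r" "j < link.degree" "0 \<le> \<tau>" "\<tau> < 1" "\<theta>0 = link.pos r j \<tau>" "circle_map \<theta>0 = seg r j \<tau>"
    let ?h = "link.unit r"
    have h: "?h > 0" by (rule link.unit_pos)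
    obtain \<delta> where \<delta>: "\<delta> > 0"
      "\<And>\<theta>. link.pos r j 0 \<le> \<theta> \<Longrightarrow> \<theta> \<le> link.pos r j 1 \<Longrightarrow> \<bar>\<theta> - \<theta>0\<bar> < \<delta> \<Longrightarrow> circle_map \<theta> \<in> V"
      using seg_near[OF V(1) *(1,2,3)] *(4,5,6) V(2) by (metis less_imp_le)
    have right: "\<theta>0 + (1 - \<tau>) * ?h = link.pos r j 1" "(1 - \<tau>) * ?h > 0"
      using * h by (auto simp: link.pos_def algebra_simps)
    show ?thesis
    proof (cases "\<tau> = 0")
      case False
      have "link.pos r j 0 + \<tau> * ?h = \<theta>0" "\<tau> * ?h > 0"
        using * h False by (auto simp: link.pos_def algebra_simps)
      then show ?thesis
        using \<delta> right by (intro exI[of _ "min \<delta> (min (\<tau> * ?h) ((1 - \<tau>) * ?h))"]) (auto simp: abs_less_iff)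
    next
      \<comment> \<open>At the start of a segment the left neighbourhood comes from the segment that
        ends at this position, possibly full turns away.\<close>
      case True
      obtain r' j' c where adj': "link.valid r'" "j' < link.degree" "link.pos r' j' 1 = link.pos r j 0 + of_int c"
        using adjacent_seg(2)[OF *(1,2)] by metis
      have eq: "link.pos r' j' 1 = \<theta>0 + of_int c"
        using adj'(3) True *(5) by simp
      have "seg r' j' 1 = circle_map (link.pos r' j' 1)"
        using circle_map_pos[OF adj'(1,2), of 1] by simp
      also have "\<dots> = circle_map \<theta>0"
        unfolding eq by (rule circle_map_shift)
      finally have "seg r' j' 1 \<in> V"
        using V(2) by simp
      then obtain \<delta>' where \<delta>': "\<delta>' > 0"
        "\<And>\<theta>. link.pos r' j' 0 \<le> \<theta> \<Longrightarrow> \<theta> \<le> link.pos r' j' 1 \<Longrightarrow> \<bar>\<theta> - link.pos r' j' 1\<bar> < \<delta>' \<Longrightarrow> circle_map \<theta> \<in> V"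
        using seg_near[OF V(1) adj'(1,2), of 1] by auto
      have h': "link.unit r' > 0" "link.pos r' j' 0 = link.pos r' j' 1 - link.unit r'"
        using link.unit_pos by (auto simp: link.pos_def algebra_simps)
      show ?thesis
      proof (intro exI[of _ "min (min \<delta> \<delta>') (min ((1 - \<tau>) * ?h) (link.unit r'))"] conjI allI impI)
        show "0 < min (min \<delta> \<delta>') (min ((1 - \<tau>) * ?h) (link.unit r'))"
          using \<delta>(1) \<delta>'(1) right(2) h'(1) by simp
        fix \<theta> assume \<theta>: "\<bar>\<theta> - \<theta>0\<bar> < min (min \<delta> \<delta>') (min ((1 - \<tau>) * ?h) (link.unit r'))"
        show "circle_map \<theta> \<in> V"
        proof (cases "\<theta>0 \<le> \<theta>")
          case True
          have "link.pos r j 0 \<le> \<theta>"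
            using True *(5) \<open>\<tau> = 0\<close> by simp
          moreover have "\<theta> \<le> link.pos r j 1"
            using \<theta> right(1) by (simp add: abs_less_iff)
          ultimately show ?thesis
            using \<delta>(2) \<theta> by simp
        next
          case False
          have "circle_map (\<theta> + of_int c) \<in> V"
            by (rule \<delta>'(2)) (use \<theta> False h'(2) in \<open>auto simp: eq abs_less_iff\<close>)
          then show ?thesis by (simp only: circle_map_shift)
        qed
      qed
    qed
  next
    fix \<xi> \<omega> assume *: "\<xi> \<in> boundary_words" "\<forall>k. \<theta>0 \<in> link.interval (rev (pre \<xi> k))" "\<omega> \<in> ends X" "ends_at \<omega> \<xi>"
      "circle_map \<theta>0 = End \<omega>"
    obtain m where m: "region (shadow (pre \<xi> m)) \<subseteq> V"
      using end_shadow_neighbourhood[OF V(1) _ *(3,4)] V(2) *(5) by auto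
    \<comment> \<open>One level more, so that the word is nonempty and \<open>interval_child\<close>
      places \<open>\<theta>0\<close> strictly inside its interval.\<close>
    define k where "k = Suc (m + L)"
    let ?r = "rev (pre \<xi> k)"
    have sub: "link.interval ?r \<subseteq> link.interval (rev (pre \<xi> (m + L)))"
      using link.interval_mono[of "\<xi> (m + L)" "rev (pre \<xi> (m + L))"] valid_pre[OF *(1), of k] by (simp add: k_def pre_Suc)
    have inV: "circle_map \<theta> \<in> V" if "\<theta> \<in> link.interval ?r" for \<theta>
      using region_of_interval[OF *(1), of \<theta> m] that sub m by blast
    have rS: "rev (pre \<xi> (Suc k)) = \<xi> k # ?r" "?r \<noteq> []"
      by (simp_all add: pre_Suc k_def)
    have "link.left ?r < \<theta>0" "\<theta>0 < link.left ?r + link.width ?r"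
      using link.interval_child[of "\<xi> k" ?r] valid_pre[OF *(1), of "Suc k"] *(2)[rule_format, of "Suc k"] rS
      by (auto simp: link.interval_def)
    then show ?thesis
      by (intro exI[of _ "min (\<theta>0 - link.left ?r) (link.left ?r + link.width ?r - \<theta>0)"])
         (auto intro!: inV simp: link.interval_def abs_less_iff)
  qed
qed

lemma circle_map_continuous: "continuous_map euclideanreal (subtopology (freudenthal X) circle) circle_map"
proof -
  have "open {\<theta>. circle_map \<theta> \<in> V}" if V: "openin (freudenthal X) V" for V
    unfolding open_dist
  proof (intro ballI)
    fix \<theta>0 assume "\<theta>0 \<in> {\<theta>. circle_map \<theta> \<in> V}"
    then have "circle_map (frac \<theta>0) \<in> V"
      using circle_map_shift[of "frac \<theta>0" "\<lfloor>\<theta>0\<rfloor>"] by (simp add: frac_def)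
    then obtain \<delta> where \<delta>: "\<delta> > 0" "\<And>\<theta>. \<bar>\<theta> - frac \<theta>0\<bar> < \<delta> \<Longrightarrow> circle_map \<theta> \<in> V"
      using circle_map_near[OF V] frac_ge_0 frac_lt_1 by metis
    have "circle_map \<theta> \<in> V" if "dist \<theta> \<theta>0 < \<delta>" for \<theta>
    proof -
      have "circle_map (\<theta> - of_int \<lfloor>\<theta>0\<rfloor>) \<in> V"
        using that by (intro \<delta>(2)) (simp add: dist_real_def frac_def)
      then show ?thesis
        using circle_map_shift[of \<theta> "- \<lfloor>\<theta>0\<rfloor>"] by simp
    qed
    then show "\<exists>e>0. \<forall>\<theta>. dist \<theta> \<theta>0 < e \<longrightarrow> \<theta> \<in> {\<theta>. circle_map \<theta> \<in> V}"
      using \<delta>(1) by blast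
  qed
  then have "continuous_map euclideanreal (freudenthal X) circle_map"
    using circle_map_range realization_Y_subset
    unfolding continuous_map_def circle_def topspace_freudenthal by fastforce
  then show ?thesis
    using circle_map_range by (auto simp: continuous_map_in_subtopology)
qed

end

section \<open>Bijectivity of the parametrization and the homeomorphism\<close>

context free_circle
begin

text \<open>Barycentric coordinates forget the direction of an edge. Two different directed edges
  could share the point only if \<open>g = h \<otimes> s\<close> and
  \<open>h = g \<otimes> s\<close>, which would make \<open>s\<close> an involution.\<close>

lemma edge_point_inject:
  assumes g: "g \<in> carrier G" "h \<in> carrier G" and \<rho>: "0 \<le> \<rho>" "\<rho> < 1" "0 \<le> \<rho>'" "\<rho>' < 1"
    and eq: "edge_point g (g \<otimes> s) \<rho> = edge_point h (h \<otimes> s) \<rho>'"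
  shows "g = h \<and> \<rho> = \<rho>'"
proof -
  have s1: "s \<noteq> \<one>"
    using t(3) \<phi>_one by metis
  then have gs: "x \<otimes> s \<noteq> x" if "x \<in> carrier G" for x
    using l_cancel_one[OF that s_carrier] by simp
  have ss: "s \<otimes> s \<noteq> \<one>"
  proof
    assume "s \<otimes> s = \<one>"
    then have "inv s = s"
      using s_carrier by (simp add: inv_equality)
    then show False
      using \<phi>_inv[OF s_carrier] reduced_neq_winv[OF t(1,3)] by simp
  qed
  have val: "edge_point g (g \<otimes> s) \<rho> g = 1 - \<rho>" "edge_point h (h \<otimes> s) \<rho>' h = 1 - \<rho>'"
    using gs[OF g(1)] gs[OF g(2)] by (simp_all add: edge_point_def)
  show ?thesis
  proof (cases "g = h")
    case True
    then have "edge_point g (g \<otimes> s) \<rho> g = edge_point h (h \<otimes> s) \<rho>' h"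
      using fun_cong[OF eq, of g] by (simp only:)
    then show ?thesis using val True by simp
  next
    case False
    have "edge_point h (h \<otimes> s) \<rho>' g = 1 - \<rho>" "edge_point g (g \<otimes> s) \<rho> h = 1 - \<rho>'"
      using fun_cong[OF eq, of g] fun_cong[OF eq, of h] val by simp_all
    then have "edge_point h (h \<otimes> s) \<rho>' g > 0" "edge_point g (g \<otimes> s) \<rho> h > 0"
      using \<rho> by simp_all
    then have "g = h \<otimes> s" "h = g \<otimes> s"
      using False by (auto simp: edge_point_def of_bool_def split: if_splits)
    then have "g \<otimes> (s \<otimes> s) = g"
      using g s_carrier by (metis m_assoc)
    then show ?thesis
      using ss r_cancel_one[of g "s \<otimes> s"] g s_carrier by simp
  qed
qed

lemma seg_point_inject:
  assumes w: "reduced w" "fst ` set w \<subseteq> A" and w': "reduced w'" "fst ` set w' \<subseteq> A"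
    and i: "i < L" "i' < L" and \<sigma>: "0 \<le> \<sigma>" "\<sigma> < 1" "0 \<le> \<sigma>'" "\<sigma>' < 1"
    and eq: "seg_point w i \<sigma> = seg_point w' i' \<sigma>'"
  shows "w = w' \<and> i = i' \<and> \<sigma> = \<sigma>'"
proof -
  let ?g = "vtx (w @ winv (take i t))" and ?h = "vtx (w' @ winv (take i' t))"
  have "real i + \<sigma> < real L" "real i' + \<sigma>' < real L"
    using i \<sigma> by linarith+
  then have \<rho>: "0 \<le> (real i + \<sigma>) / real L" "(real i + \<sigma>) / real L < 1"
    "0 \<le> (real i' + \<sigma>') / real L" "(real i' + \<sigma>') / real L < 1"
    using \<sigma> t(4) by simp_all
  have *: "?g = ?h" "(real i + \<sigma>) / real L = (real i' + \<sigma>') / real L"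
    using edge_point_inject[OF vtx_carrier[OF word_letters[OF w(2)]] vtx_carrier[OF word_letters[OF w'(2)]] \<rho>]
      eq unfolding seg_point_def Let_def by auto
  then have sum: "real i + \<sigma> = real i' + \<sigma>'"
    using t(4) by simp
  then have "\<lfloor>real i + \<sigma>\<rfloor> = \<lfloor>real i' + \<sigma>'\<rfloor>"
    by simp
  moreover have "\<lfloor>real i + \<sigma>\<rfloor> = int i" "\<lfloor>real i' + \<sigma>'\<rfloor> = int i'"
    by (rule floor_unique; use \<sigma> in simp)+
  ultimately have i_eq: "i = i'"
    by simp
  have "reduce (w @ winv (take i t)) = reduce (w' @ winv (take i t))"
    using arg_cong[OF *(1), of \<phi>] \<phi>_vtx[OF word_letters[OF w(2)]] \<phi>_vtx[OF word_letters[OF w'(2)]]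
    by (simp add: i_eq)
  then have "reduce ((w @ winv (take i t)) @ take i t) = reduce ((w' @ winv (take i t)) @ take i t)"
    by (metis reduce_append_left)
  then have "w = w'"
    using w w' by (simp add: reduce_reduced)
  then show ?thesis
    using i_eq sum by simp
qed

text \<open>The traversal may run along a segment in either direction. The normal form measures
  \<open>\<sigma>\<close> in the direction of \<open>s\<close> and replaces the end of a segment by
  the start of the next one; \<open>b\<close> records the direction of traversal.\<close>

lemma seg_normal_form:
  assumes r: "link.valid r" "j < link.degree" and \<tau>: "0 \<le> \<tau>" "\<tau> \<le> 1"
  obtains r' j' i \<sigma> b where "link.valid r'" "j' < link.degree" "i < L" "0 \<le> \<sigma>" "\<sigma> < 1"
    "link.sd r' j' = (if b then (i, True) else ((i + L - 1) mod L, False))"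
    "frac (link.pos r' j' (if b then 1 - \<sigma> else \<sigma>)) = frac (link.pos r j \<tau>)"
    "seg_point (rev r') i \<sigma> = seg r j \<tau>"
proof -
  note result = that
  have pair: "thesis" if "link.valid r'" "j' < link.degree" "i < L" "0 \<le> \<sigma>" "\<sigma> < 1"
    "link.sd r' j' = (if b then (i, True) else ((i + L - 1) mod L, False))"
    "link.pos r' j' (if b then 1 - \<sigma> else \<sigma>) = link.pos r j \<tau> + of_int c" for r' j' i \<sigma> b c
  proof -
    let ?\<tau> = "if b then 1 - \<sigma> else \<sigma>"
    have fr: "frac (link.pos r' j' ?\<tau>) = frac (link.pos r j \<tau>)"
      using that(7) by (simp add: frac_def)
    have "seg r j \<tau> = circle_map (link.pos r j \<tau>)"
      using circle_map_pos[OF r \<tau>] by simp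
    also have "\<dots> = circle_map (link.pos r' j' ?\<tau>)"
      by (simp add: circle_map_def fr)
    also have "\<dots> = seg r' j' ?\<tau>"
      by (rule circle_map_pos[OF that(1,2)]) (use that(4,5) in auto)
    also have "\<dots> = seg_point (rev r') i \<sigma>"
      using that(3,6) pred_succ(1)[OF that(3)] by (auto simp: seg_def dart_point_def)
    finally show thesis
      using result[OF that(1-6) fr] by simp
  qed
  obtain k b where k: "link.sd r j = (k, b)" "k < L"
    using sd_darts[of j r] by (cases "link.sd r j") (auto simp: darts_def)
  have kS: "Suc k mod L < L" "(Suc k mod L + L - 1) mod L = k"
    using t(4) pred_succ(2)[OF k(2)] by auto
  show thesis
  proof (cases b)
    case True
    show thesis
    proof (cases "\<tau> = 0")
      case False
      show thesis
        by (rule pair[of r j k "1 - \<tau>" True 0]) (use r k \<tau> True False in auto)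
    next
      case \<tau>0: True
      obtain r' j' c where *: "link.valid r'" "j' < link.degree" "link.sd r' j' = dflip (dcont (link.sd r j))"
        "link.pos r' j' 1 = link.pos r j 0 + of_int c"
        using adjacent_seg(2)[OF r] by metis
      show thesis
        by (rule pair[of r' j' "Suc k mod L" 0 True c])
           (use * k kS True \<tau>0 in \<open>auto simp: dflip_def dcont_def\<close>)
    qed
  next
    case False
    show thesis
    proof (cases "\<tau> = 1")
      case \<tau>1: False
      show thesis
        by (rule pair[of r j "Suc k mod L" \<tau> False 0]) (use r k kS \<tau> \<tau>1 False in auto)
    next
      case \<tau>1: True
      obtain r' j' c where *: "link.valid r'" "j' < link.degree" "link.sd r' j' = dcont (dflip (link.sd r j))"
        "link.pos r' j' 0 = link.pos r j 1 + of_int c"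
        using adjacent_seg(1)[OF r] by metis
      let ?i = "Suc (Suc k mod L) mod L"
      have i: "?i < L" "(?i + L - 1) mod L = Suc k mod L"
        using t(4) pred_succ(2)[OF kS(1)] by auto
      show thesis
        by (rule pair[of r' j' ?i 0 False c])
           (use * k i False \<tau>1 in \<open>auto simp: dflip_def dcont_def\<close>)
    qed
  qed
qed

text \<open>Positions of the same end lie in the same nested intervals, whose widths tend to zero.
  Positions of the same point have the same normal form up to the direction of traversal.\<close>

lemma circle_map_inject:
  assumes "0 \<le> \<theta>" "\<theta> < 1" "0 \<le> \<theta>'" "\<theta>' < 1" and eq: "circle_map \<theta> = circle_map \<theta>'"
  shows "\<theta> = \<theta>'"
proof -
  have fr: "frac \<theta> = \<theta>" "frac \<theta>' = \<theta>'"
    using assms by (simp_all add: frac_eq)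
  have loc: "located \<theta> (circle_map \<theta>)" "located \<theta>' (circle_map \<theta>)"
    using located_circle_map[of \<theta>] located_circle_map[of \<theta>'] eq by (simp_all add: fr)
  show ?thesis
  proof (cases "circle_map \<theta>")
    case (End \<omega>)
    have seg_End: "seg r j \<tau> \<noteq> End \<omega>" if "link.valid r" "0 \<le> \<tau>" "\<tau> < 1" for r j \<tau>
      using seg_range[OF that(1,2), of j] that(3) by auto
    obtain \<xi> where \<xi>: "\<xi> \<in> boundary_words" "\<And>k. \<theta> \<in> link.interval (rev (pre \<xi> k))" "\<omega> \<in> ends X" "ends_at \<omega> \<xi>"
      using loc(1) seg_End unfolding located_def End by (metis fpoint.inject(2))
    obtain \<xi>' where \<xi>': "\<xi>' \<in> boundary_words" "\<And>k. \<theta>' \<in> link.interval (rev (pre \<xi>' k))" "ends_at \<omega> \<xi>'"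
      using loc(2) seg_End unfolding located_def End by (metis fpoint.inject(2))
    have same: "pre \<xi> k = pre \<xi>' k" for k
      by (rule lives_in_shadow_unique[OF \<xi>(3)]) (use \<xi>(4) \<xi>'(3) in \<open>auto simp: ends_at_def\<close>)
    have close: "\<bar>\<theta> - \<theta>'\<bar> \<le> (1 / 2) ^ k" for k
    proof -
      have "\<theta> \<in> link.interval (rev (pre \<xi> k))" "\<theta>' \<in> link.interval (rev (pre \<xi> k))"
        using \<xi>(2) \<xi>'(2)[of k] by (simp_all add: same)
      then have "\<bar>\<theta> - \<theta>'\<bar> \<le> link.width (rev (pre \<xi> k))"
        by (auto simp: link.interval_def abs_if)
      also have "\<dots> \<le> (1 / 2) ^ k"
        using link.width_le[of "rev (pre \<xi> k)"] by simp
      finally show ?thesis .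
    qed
    have "(\<lambda>k. (1 / 2 :: real) ^ k) \<longlonglongrightarrow> 0"
      by (rule LIMSEQ_power_zero) simp
    then have "\<bar>\<theta> - \<theta>'\<bar> \<le> 0"
      by (rule LIMSEQ_le_const) (use close in blast)
    then show ?thesis by simp
  next
    case (Point p)
    obtain r j \<tau> where r: "link.valid r" "j < link.degree" "0 \<le> \<tau>" "\<tau> < 1" "\<theta> = link.pos r j \<tau>" "circle_map \<theta> = seg r j \<tau>"
      using loc(1) unfolding located_def Point by auto
    obtain r' j' \<tau>' where r': "link.valid r'" "j' < link.degree" "0 \<le> \<tau>'" "\<tau>' < 1" "\<theta>' = link.pos r' j' \<tau>'"
      "circle_map \<theta> = seg r' j' \<tau>'"
      using loc(2) unfolding located_def Point by auto
    obtain q k i \<sigma> b where n: "link.valid q" "k < link.degree" "i < L" "0 \<le> \<sigma>" "\<sigma> < 1"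
      "link.sd q k = (if b then (i, True) else ((i + L - 1) mod L, False))"
      "frac (link.pos q k (if b then 1 - \<sigma> else \<sigma>)) = \<theta>" "seg_point (rev q) i \<sigma> = circle_map \<theta>"
      using seg_normal_form[OF r(1,2,3) less_imp_le[OF r(4)]] unfolding r(6) r(5)[symmetric] fr(1) by blast
    obtain q' k' i' \<sigma>' b' where n': "link.valid q'" "k' < link.degree" "i' < L" "0 \<le> \<sigma>'" "\<sigma>' < 1"
      "link.sd q' k' = (if b' then (i', True) else ((i' + L - 1) mod L, False))"
      "frac (link.pos q' k' (if b' then 1 - \<sigma>' else \<sigma>')) = \<theta>'" "seg_point (rev q') i' \<sigma>' = circle_map \<theta>"
      using seg_normal_form[OF r'(1,2,3) less_imp_le[OF r'(4)]] unfolding r'(6) r'(5)[symmetric] fr(2) by blast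
    have "rev q = rev q' \<and> i = i' \<and> \<sigma> = \<sigma>'"
      by (rule seg_point_inject) (use n n' in \<open>auto simp: valid_iff\<close>)
    then have same: "q' = q" "i' = i" "\<sigma>' = \<sigma>"
      by auto
    \<comment> \<open>Opposite directions would make the walk in the link meet the flip of one of
      its own darts.\<close>
    have "b = b'"
    proof (rule ccontr)
      assume "b \<noteq> b'"
      moreover have "((i + L - 1) mod L, False) = dflip (i, True)"
        by (simp add: dflip_def)
      ultimately have "link.sd q k = dflip (link.sd q k') \<or> link.sd q k' = dflip (link.sd q k)"
        using n(6) n'(6) by (cases b) (auto simp: same)
      then show False
        using link.walk_cycle(4)[OF link.lam_D] by metis
    qed
    then have "link.sd q k = link.sd q k'"
      using n(6) n'(6) by (simp add: same)
    moreover have "inj_on (\<lambda>j. dlab (link.sd q j)) {..<link.degree}"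
      using link.walk_cycle(2)[OF link.lam_D[of q]] by (simp add: bij_betw_def)
    ultimately have "k = k'"
      using n(2) n'(2) by (metis inj_onD lessThan_iff)
    then show ?thesis
      using n(7) n'(7) unfolding same \<open>b = b'\<close> \<open>k = k'\<close> by simp
  qed
qed

lemma circle_map_point:
  assumes g: "g \<in> carrier G" and \<rho>: "0 \<le> \<rho>" "\<rho> < 1"
  shows "\<exists>\<theta>. circle_map \<theta> = Point (edge_point g (g \<otimes> s) \<rho>)"
proof -
  define i where "i = nat \<lfloor>\<rho> * real L\<rfloor>"
  define \<sigma> where "\<sigma> = \<rho> * real L - real i"
  have "0 \<le> \<rho> * real L" "\<rho> * real L < real L"
    using \<rho> t(4) by simp_all
  then have i: "real i = of_int \<lfloor>\<rho> * real L\<rfloor>" "i < L"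
    by (simp_all add: i_def floor_less_iff nat_less_iff)
  have \<sigma>: "0 \<le> \<sigma>" "\<sigma> < 1"
    unfolding \<sigma>_def i(1) by linarith+
  have \<rho>_eq: "(real i + \<sigma>) / real L = \<rho>"
    using t(4) by (simp add: \<sigma>_def)
  \<comment> \<open>The tree vertex that the edge starting at \<open>g\<close> passes after
    \<open>i\<close> letters.\<close>
  let ?w = "reduce (\<phi> g @ take i t)"
  have letters: "fst ` set (\<phi> g @ take i t) \<subseteq> A"
    using \<phi>_carrier(2)[OF g] take_letters[of i] by (simp add: image_Un)
  then have w: "reduced ?w" "fst ` set ?w \<subseteq> A"
    using reduce_in_carrier[OF letters] by (auto simp: carrier_free_group)
  have "vtx (?w @ winv (take i t)) = vtx (\<phi> g)"
    by (intro vtx_eqI) simp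
  then have pt: "seg_point ?w i \<sigma> = Point (edge_point g (g \<otimes> s) \<rho>)"
    unfolding seg_point_def Let_def \<rho>_eq by (simp add: vtx_\<phi>[OF g])
  have r: "link.valid (rev ?w)"
    using w by (simp add: valid_iff)
  have "(i, True) \<in> darts"
    using i(2) by (simp add: darts_def)
  from equalityD1[OF link.walk_cycle(3)[OF link.lam_D[of "rev ?w"]], THEN subsetD, OF this] consider j where "j < link.degree" "(i, True) = link.sd (rev ?w) j"
    | j where "j < link.degree" "(i, True) = dflip (link.sd (rev ?w) j)"
    by blast
  then show ?thesis
  proof cases
    case 1
    have "seg (rev ?w) j (1 - \<sigma>) = seg_point ?w i \<sigma>"
      using 1(2)[symmetric] by (simp add: seg_def dart_point_def)
    then show ?thesis
      using circle_map_pos[OF r 1(1), of "1 - \<sigma>"] \<sigma> pt by (metis diff_ge_0_iff_ge diff_le_eq le_add_same_cancel1 less_imp_le)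
  next
    case 2
    have "link.sd (rev ?w) j = dflip (i, True)"
      using 2(2) flip_eq(2)[OF sd_darts] by metis
    then have "seg (rev ?w) j \<sigma> = seg_point ?w i \<sigma>"
      using pred_succ(1)[OF i(2)] by (simp add: seg_def dart_point_def dflip_def)
    then show ?thesis
      using circle_map_pos[OF r 2(1), of \<sigma>] \<sigma> pt by (metis less_imp_le)
  qed
qed

text \<open>Nested half-open intervals may have empty intersection if their right ends become
  constant. By \<open>interval_child\<close> these ends decrease strictly from level one on, so the
  supremum of the left ends lies in every interval.\<close>

lemma circle_map_End:
  assumes "\<omega> \<in> ends X"
  shows "\<exists>\<theta>. circle_map \<theta> = End \<omega>"
proof -
  obtain \<xi> where \<xi>: "\<xi> \<in> boundary_words" "ends_at \<omega> \<xi>"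
    using end_ends_at[OF assms] by blast
  define l where "l k = link.left (rev (pre \<xi> k))" for k
  define u where "u k = l k + link.width (rev (pre \<xi> k))" for k
  have valid: "link.valid (\<xi> k # rev (pre \<xi> k))" for k
    using valid_pre[OF \<xi>(1), of "Suc k"] by (simp add: pre_Suc)
  have step: "l k < l (Suc k)" "u (Suc k) \<le> u k" "k > 0 \<Longrightarrow> u (Suc k) < u k" for k
  proof -
    have "k > 0 \<Longrightarrow> rev (pre \<xi> k) \<noteq> []"
      by (metis length_0_conv length_pre length_rev not_less_zero)
    then show "l k < l (Suc k)" "u (Suc k) \<le> u k" "k > 0 \<Longrightarrow> u (Suc k) < u k"
      using link.interval_child[OF valid[of k]] unfolding u_def l_def by (simp_all add: pre_Suc)
  qed
  have lu: "l k < u m" for k m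
  proof -
    have "incseq l" "decseq u"
      using step(1,2) by (auto intro!: incseq_SucI decseq_SucI intro: less_imp_le)
    then have "l k \<le> l (max k m)" "u (max k m) \<le> u m"
      by (auto simp: incseq_def decseq_def)
    moreover have "l (max k m) < u (max k m)"
      unfolding u_def using link.width_pos by simp
    ultimately show ?thesis by linarith
  qed
  define \<theta> where "\<theta> = (SUP k. l k)"
  have bdd: "bdd_above (range l)"
    using lu[of _ 0] by (intro bdd_aboveI2) (rule less_imp_le)
  have "l k \<le> \<theta>" for k
    unfolding \<theta>_def using bdd by (intro cSUP_upper) auto
  moreover have le_u: "\<theta> \<le> u k" for k
    unfolding \<theta>_def using lu by (intro cSUP_least) (auto intro: less_imp_le)
  moreover have "\<theta> < u k" for k
  proof (cases "k = 0")
    case True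
    have "\<theta> \<le> u 2" by (rule le_u)
    also have "u 2 < u 1"
      using step(3)[of 1] by (simp add: numeral_2_eq_2)
    also have "u 1 \<le> u 0"
      using step(2)[of 0] by simp
    finally show ?thesis using True by simp
  next
    case False
    then show ?thesis
      using le_u[of "Suc k"] step(3)[of k] by simp
  qed
  ultimately have "\<theta> \<in> link.interval (rev (pre \<xi> k))" for k
    by (simp add: link.interval_def l_def u_def)
  then show ?thesis
    using circle_map_end[OF \<xi>(1) _ assms \<xi>(2)] by blast
qed

lemma circle_map_surj: "circle_map ` {0..1} = circle"
proof (rule antisym)
  show "circle_map ` {0..1} \<subseteq> circle"
    using circle_map_range by blast
  have range: "p \<in> circle_map ` {0..1}" if ex: "\<exists>\<theta>. circle_map \<theta> = p" for p
  proof -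
    obtain \<theta> where "circle_map \<theta> = p" using ex by blast
    then have "circle_map (frac \<theta>) = p"
      by (simp add: circle_map_def frac_frac)
    then show ?thesis
      using frac_ge_0[of \<theta>] frac_lt_1[of \<theta>] by (intro image_eqI[of _ _ "frac \<theta>"]) auto
  qed
  have vertex: "\<exists>\<theta>. circle_map \<theta> = Point (vertex_point g)" if "g \<in> carrier G" for g
    using circle_map_point[OF that, of 0] by (simp add: edge_point_def vertex_point_def)
  have edge: "\<exists>\<theta>. circle_map \<theta> = Point (edge_point g (g \<otimes> s) \<tau>)" if "g \<in> carrier G" "\<tau> \<in> {0..1}" for g \<tau>
  proof (cases "\<tau> = 1")
    case True
    then have "edge_point g (g \<otimes> s) \<tau> = vertex_point (g \<otimes> s)"
      by (simp add: edge_point_def vertex_point_def)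
    then show ?thesis
      using vertex that(1) s_carrier by simp
  qed (use circle_map_point that in auto)
  show "circle \<subseteq> circle_map ` {0..1}"
  proof
    fix p assume "p \<in> circle"
    then consider q where "p = Point q" "q \<in> realization Y" | \<omega> where "p = End \<omega>" "\<omega> \<in> ends X"
      unfolding circle_def by blast
    then show "p \<in> circle_map ` {0..1}"
    proof cases
      case 1
      from 1(2) have "\<exists>\<theta>. circle_map \<theta> = Point q"
        unfolding realization_def
      proof (elim UnE imageE CollectE exE conjE)
        fix v assume "q = vertex_point v" "v \<in> verts Y"
        then show ?thesis using vertex by simp
      next
        fix u v \<tau> assume *: "q = edge_point u v \<tau>" "adj Y u v" "\<tau> \<in> {0..1}"
        have "u \<in> carrier G" "v \<in> carrier G" "v = u \<otimes> s \<or> u = v \<otimes> s"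
          using *(2) unfolding adj_Y_iff by auto
        moreover have "edge_point u v \<tau> = edge_point v u (1 - \<tau>)"
          by (auto simp: edge_point_def)
        ultimately show ?thesis
          using edge[of u \<tau>] edge[of v "1 - \<tau>"] *(1,3) by auto
      qed
      then show ?thesis using range 1(1) by blast
    next
      case 2
      then show ?thesis using range circle_map_End by blast
    qed
  qed
qed

text \<open>The periodic map descends along the quotient map \<open>e\<close> of the unit interval;
  the result is a continuous bijection from a compact space onto a Hausdorff space.\<close>

theorem circle_homeomorphic_sphere:
  "subtopology (freudenthal X) circle homeomorphic_space top_of_set (sphere (0::complex) 1)"
proof -
  let ?I = "top_of_set {0..1::real}" and ?S = "top_of_set (sphere (0::complex) 1)"
  let ?C = "subtopology (freudenthal X) circle"
  define e where "e \<theta> = cis (2 * pi * \<theta>)" for \<theta>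
  \<comment> \<open>The choice is ambiguous only between \<open>0\<close> and \<open>1\<close>,
    where \<open>circle_map\<close> takes the same value.\<close>
  define arg where "arg z = (SOME \<theta>. \<theta> \<in> {0..1} \<and> e \<theta> = z)" for z
  have e_range: "e ` {0..1} = sphere 0 1"
  proof (intro antisym subsetI)
    fix z :: complex assume "z \<in> sphere 0 1"
    then have "z = cis (Arg2pi z)"
      using Arg2pi_eq[of z] by (simp add: cis_conv_exp)
    then have "z = e (Arg2pi z / (2 * pi))"
      by (simp add: e_def)
    then show "z \<in> e ` {0..1}"
      using Arg2pi_ge_0[of z] Arg2pi_lt_2pi[of z] by (intro image_eqI[of _ _ "Arg2pi z / (2 * pi)"]) auto
  qed (auto simp: e_def)
  have e_inj: "\<theta> = \<theta>' \<or> {\<theta>, \<theta>'} = {0, 1}" if "\<theta> \<in> {0..1}" "\<theta>' \<in> {0..1}" "e \<theta> = e \<theta>'" for \<theta> \<theta>'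
  proof -
    have "exp (\<i> * of_real (2 * pi * \<theta>)) = exp (\<i> * of_real (2 * pi * \<theta>'))"
      using that(3) by (simp add: e_def cis_conv_exp)
    then obtain n :: int where "\<i> * of_real (2 * pi * \<theta>) = \<i> * of_real (2 * pi * \<theta>') + of_int (2 * n) * pi * \<i>"
      unfolding exp_eq by blast
    from arg_cong[OF this, of Im] have "2 * pi * \<theta> = 2 * pi * (\<theta>' + of_int n)"
      by (simp add: algebra_simps)
    then have n: "\<theta> = \<theta>' + of_int n"
      by (simp only: mult_cancel_left) simp
    then have "n = 0 \<or> n = 1 \<or> n = - 1"
      using that(1,2) by (auto; linarith)
    then show ?thesis
      using n that(1,2) by auto
  qed
  have cont_e: "continuous_map ?I ?S e"
    using e_range unfolding e_def by (auto simp: continuous_map_in_subtopology intro!: continuous_intros)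
  have compact: "compact_space ?I" "compact_space ?S"
    by (simp_all add: compact_space_subtopology)
  have quot: "quotient_map ?I ?S e"
  proof (rule continuous_imp_quotient_map)
    show "Hausdorff_space ?S"
      by (intro Hausdorff_space_subtopology Hausdorff_space_euclidean)
    show "e ` topspace ?I = topspace ?S"
      using e_range by simp
  qed (rule compact cont_e)+
  have arg: "arg z \<in> {0..1}" "e (arg z) = z" if "z \<in> sphere 0 1" for z
  proof -
    have "z \<in> e ` {0..1}"
      unfolding e_range by (fact that)
    then have "\<exists>\<theta>. \<theta> \<in> {0..1} \<and> e \<theta> = z"
      by blast
    from someI_ex[OF this] show "arg z \<in> {0..1}" "e (arg z) = z"
      unfolding arg_def by (rule conjunct1, rule conjunct2)
  qed
  let ?h = "\<lambda>z. circle_map (arg z)"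
  have h_e: "?h (e \<theta>) = circle_map \<theta>" if "\<theta> \<in> {0..1}" for \<theta>
  proof -
    have "e \<theta> \<in> sphere 0 1"
      using that e_range by blast
    then have "arg (e \<theta>) = \<theta> \<or> {arg (e \<theta>), \<theta>} = {0, 1}"
      using e_inj[of "arg (e \<theta>)" \<theta>] arg that by blast
    moreover have "circle_map 1 = circle_map 0"
      using circle_map_shift[of 0 1] by simp
    ultimately show ?thesis
      by (auto simp: doubleton_eq_iff)
  qed
  have "continuous_map ?I ?C circle_map"
    by (rule continuous_map_from_subtopology[OF circle_map_continuous])
  then have "continuous_map ?I ?C (?h \<circ> e)"
    by (rule continuous_map_eq) (simp add: h_e)
  then have cont_h: "continuous_map ?S ?C ?h"
    by (rule continuous_compose_quotient_map[OF quot])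
  have "?h ` sphere 0 1 = ?h ` e ` {0..1}"
    by (simp only: e_range)
  also have "\<dots> = circle_map ` {0..1}"
    using h_e by (simp add: image_image)
  finally have surj: "?h ` sphere 0 1 = circle"
    by (simp only: circle_map_surj)
  have inj: "inj_on ?h (sphere 0 1)"
  proof (rule inj_onI)
    fix z z' assume z: "z \<in> sphere 0 1" "z' \<in> sphere 0 1" "?h z = ?h z'"
    have red: "\<exists>\<theta>. 0 \<le> \<theta> \<and> \<theta> < 1 \<and> e \<theta> = z \<and> circle_map \<theta> = ?h z" if "z \<in> sphere 0 1" for z
    proof (cases "arg z = 1")
      case True
      have "e 0 = e 1" "circle_map 0 = circle_map 1"
        using circle_map_shift[of 0 1] by (simp_all add: e_def)
      then show ?thesis
        using arg[OF that] True by (intro exI[of _ 0]) auto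
    next
      case False
      then show ?thesis
        using arg[OF that] by (intro exI[of _ "arg z"]) auto
    qed
    obtain \<theta> \<theta>' where "0 \<le> \<theta>" "\<theta> < 1" "e \<theta> = z" "circle_map \<theta> = ?h z"
      "0 \<le> \<theta>'" "\<theta>' < 1" "e \<theta>' = z'" "circle_map \<theta>' = ?h z'"
      using red[OF z(1)] red[OF z(2)] by blast
    then show "z = z'"
      using circle_map_inject[of \<theta> \<theta>'] z(3) by metis
  qed
  have "homeomorphic_map ?S ?C ?h"
  proof (rule continuous_imp_homeomorphic_map)
    show "Hausdorff_space ?C"
      by (rule Hausdorff_space_subtopology[OF Hausdorff_freudenthal])
    have "circle \<subseteq> topspace (freudenthal X)"
      using realization_Y_subset unfolding circle_def topspace_freudenthal by blast
    then show "?h ` topspace ?S = topspace ?C"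
      using surj by (simp add: topspace_subtopology Int_absorb1)
    show "inj_on ?h (topspace ?S)"
      using inj by simp
  qed (rule compact cont_h)+
  then show ?thesis
    using homeomorphic_map_imp_homeomorphic_space homeomorphic_space_sym by blast
qed

end

section \<open>Obstructions to being a circle\<close>

text \<open>\<open>f\<close> is the cross product that vanishes on the line through
  \<open>z1\<close> and \<open>z2\<close>. This line meets the circle nowhere else, and its distance
  from the centre is less than one, so its unit normals \<open>w\<close> and \<open>- w\<close> lie
  on different sides.\<close>

lemma sphere_cut:
  fixes z1 z2 :: complex
  assumes "z1 \<in> sphere 0 1" "z2 \<in> sphere 0 1" "z1 \<noteq> z2"
  obtains f :: "complex \<Rightarrow> real" where "continuous_on UNIV f"
    "\<And>z. z \<in> sphere 0 1 \<Longrightarrow> f z = 0 \<longleftrightarrow> z = z1 \<or> z = z2"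
    "\<exists>z\<in>sphere 0 1. f z > 0" "\<exists>z\<in>sphere 0 1. f z < 0"
proof -
  define a b c d where "a = Re z1" "b = Im z1" "c = Re z2" "d = Im z2"
  note abcd = a_b_c_d_def
  have sph: "z \<in> sphere 0 1 \<longleftrightarrow> (Re z)\<^sup>2 + (Im z)\<^sup>2 = 1" for z :: complex
    by (simp add: cmod_def)
  have ab: "a\<^sup>2 + b\<^sup>2 = 1" and cd: "c\<^sup>2 + d\<^sup>2 = 1"
    using assms unfolding sph abcd by auto
  define f where "f z = (Im z - b) * (c - a) - (Re z - a) * (d - b)" for z
  define q where "q = (c - a)\<^sup>2 + (d - b)\<^sup>2"
  have "c \<noteq> a \<or> d \<noteq> b"
    using assms(3) by (auto simp: abcd complex_eq_iff)
  then have q: "q > 0"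
    by (auto simp: q_def sum_power2_gt_zero_iff)
  \<comment> \<open>\<open>k\<close> is the inner product of the two points and \<open>q\<close> the
    squared length of the chord; the line has distance
    \<open>\<bar>a * d - b * c\<bar> / sqrt q\<close> from the centre.\<close>
  define k where "k = a * c + b * d"
  have qk: "q = 2 * (1 - k)"
    using ab cd by (simp add: q_def k_def power2_eq_square algebra_simps)
  have cross: "(a * d - b * c)\<^sup>2 = (1 - k) * (1 + k)"
  proof -
    have "(a * d - b * c)\<^sup>2 = (a\<^sup>2 + b\<^sup>2) * (c\<^sup>2 + d\<^sup>2) - k\<^sup>2"
      by (simp add: k_def power2_eq_square algebra_simps)
    also have "\<dots> = 1 - k\<^sup>2"
      by (simp only: ab cd mult_1)
    finally show ?thesis
      by (simp add: power2_eq_square algebra_simps)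
  qed
  have k1: "k < 1" using q qk by simp
  have "(1 - k) * (1 + k) < (1 - k) * 2"
    using k1 by (intro mult_strict_left_mono) auto
  then have small: "(a * d - b * c)\<^sup>2 < (sqrt q)\<^sup>2"
    using cross qk q by simp
  then have small: "\<bar>a * d - b * c\<bar> < sqrt q"
    using q by (metis abs_of_pos abs_le_square_iff linorder_not_less real_sqrt_gt_zero)
  define w where "w = Complex (- (d - b) / sqrt q) ((c - a) / sqrt q)"
  have sq: "sqrt q * sqrt q = q" "sqrt q > 0"
    using q by auto
  have w_sphere: "w \<in> sphere 0 1" "- w \<in> sphere 0 1"
    using q sq unfolding sph w_def by (simp_all add: power2_eq_square add_divide_distrib[symmetric])
      (simp_all add: q_def power2_eq_square algebra_simps)
  have inner: "Im w * (c - a) - Re w * (d - b) = sqrt q"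
  proof -
    have "Im w * (c - a) - Re w * (d - b) = q / sqrt q"
    proof -
      have "(c - a) / r * (c - a) - (- (d - b) / r) * (d - b) = ((c - a)\<^sup>2 + (d - b)\<^sup>2) / r" if "r \<noteq> 0" for r
        using that by (simp add: field_simps power2_eq_square)
      from this[of "sqrt q"] show ?thesis
        using sq(2) by (simp only: w_def complex.sel q_def[symmetric] less_irrefl simp_thms)
    qed
    then show ?thesis using q by (simp add: real_div_sqrt)
  qed
  have "f w = sqrt q + (a * d - b * c)" "f (- w) = - sqrt q + (a * d - b * c)"
    using inner by (simp_all add: f_def algebra_simps)
  then have "f w > 0" "f (- w) < 0"
    using small by linarith+
  moreover have "continuous_on UNIV f"
    unfolding f_def by (intro continuous_intros)
  moreover have "f z = 0 \<longleftrightarrow> z = z1 \<or> z = z2" if z: "z \<in> sphere 0 1" for z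
  proof
    assume "f z = 0"
    define l where "l = ((Re z - a) * (c - a) + (Im z - b) * (d - b)) / q"
    have "(Re z - a) * q = ((Re z - a) * (c - a) + (Im z - b) * (d - b)) * (c - a)"
      "(Im z - b) * q = ((Re z - a) * (c - a) + (Im z - b) * (d - b)) * (d - b)"
      using \<open>f z = 0\<close> unfolding f_def q_def power2_eq_square by algebra+
    then have l: "Re z = a + l * (c - a)" "Im z = b + l * (d - b)"
      using q by (simp_all add: l_def field_simps)
    have "(a + l * (c - a))\<^sup>2 + (b + l * (d - b))\<^sup>2 = 1"
      using z unfolding sph l .
    then have "l * (l - 1) * q = 0"
      using ab cd unfolding q_def power2_eq_square by algebra
    then have "l = 0 \<or> l = 1"
      using q by simp
    then show "z = z1 \<or> z = z2"
      using l by (auto simp: abcd complex_eq_iff)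
  qed (auto simp: f_def abcd algebra_simps)
  ultimately show thesis
    using that w_sphere by blast
qed

lemma circle_minus_two_points:
  assumes hom: "C homeomorphic_space top_of_set (sphere (0::complex) 1)"
    and p: "p \<in> topspace C" "q \<in> topspace C" "p \<noteq> q"
  obtains U V where "openin C U" "openin C V" "U \<union> V = topspace C - {p, q}" "U \<inter> V = {}" "U \<noteq> {}" "V \<noteq> {}"
proof -
  obtain h where h: "homeomorphic_map C (top_of_set (sphere (0::complex) 1)) h"
    using hom homeomorphic_space by blast
  have inj: "inj_on h (topspace C)" and img: "h ` topspace C = sphere 0 1"
    using homeomorphic_imp_injective_map[OF h] homeomorphic_imp_surjective_map[OF h] by auto
  have cont: "continuous_map C euclidean h"
    using homeomorphic_imp_continuous_map[OF h] by (simp add: continuous_map_in_subtopology)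
  obtain f where f: "continuous_on UNIV f" "\<And>z. z \<in> sphere 0 1 \<Longrightarrow> f z = 0 \<longleftrightarrow> z = h p \<or> z = h q"
    "\<exists>z\<in>sphere 0 1. f z > 0" "\<exists>z\<in>sphere 0 1. f z < (0::real)"
  proof -
    have "h p \<in> sphere 0 1" "h q \<in> sphere 0 1"
      using p img by blast+
    moreover have "h p \<noteq> h q"
      using p inj by (auto dest: inj_onD)
    ultimately show thesis
      by (rule sphere_cut) (rule that)
  qed
  have "continuous_map C euclideanreal (f \<circ> h)"
    using cont f(1) by (intro continuous_map_compose) auto
  then have op: "openin C {x \<in> topspace C. (f \<circ> h) x \<in> T}" if "open T" for T
    using openin_continuous_map_preimage that by force
  let ?U = "{x \<in> topspace C. f (h x) > 0}" and ?V = "{x \<in> topspace C. f (h x) < 0}"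
  have zero: "f (h x) = 0 \<longleftrightarrow> x = p \<or> x = q" if "x \<in> topspace C" for x
    using f(2)[of "h x"] that img inj p by (metis imageI inj_onD)
  show thesis
  proof (rule that[of ?U ?V])
    show "openin C ?U" "openin C ?V"
      using op[of "{0<..}"] op[of "{..<0}"] by simp_all
    show "?U \<union> ?V = topspace C - {p, q}"
      using zero p by (auto; force)
    show "?U \<noteq> {}" "?V \<noteq> {}"
      using f(3,4) img by (metis (mono_tags, lifting) Collect_empty_eq imageE)+
  qed auto
qed

lemma take_1_reduce_append:
  assumes "reduced u" "a \<notin> fst ` set v"
  shows "take 1 (reduce (u @ v)) = [(a, b)] \<longleftrightarrow> take 1 u = [(a, b)]"
  using assms
proof (induction v arbitrary: u)
  case Nil
  then show ?case by (simp add: reduce_reduced)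
next
  case (Cons x v)
  let ?u = "reduce (u @ [x])"
  have x: "fst x \<noteq> a"
    using Cons.prems(2) by auto
  have "take 1 ?u = [(a, b)] \<longleftrightarrow> take 1 u = [(a, b)]"
    unfolding reduce_snoc[OF Cons.prems(1)]
  proof (cases u)
    case (Cons y u')
    then show "take 1 (if u \<noteq> [] \<and> x = inv_letter (last u) then butlast u else u @ [x]) = [(a, b)] \<longleftrightarrow> take 1 u = [(a, b)]"
      using x by (cases u') auto
  qed (use x in auto)
  moreover have "reduce (u @ x # v) = reduce (?u @ v)"
    by simp
  ultimately show ?case
    using Cons.IH[of ?u] Cons.prems(2) by simp
qed

section \<open>A missing generator disconnects the closure\<close>

context free_cayley
begin

lemma circle_topspace: "topspace (subtopology (freudenthal X) circle) = circle"
  using realization_Y_subset unfolding circle_def by (simp add: topspace_freudenthal) blast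

lemma vertex_in_circle: "g \<in> carrier G \<Longrightarrow> Point (vertex_point g) \<in> circle"
  by (simp add: circle_def realization_def)

text \<open>Multiplication by \<open>s\<close> never changes whether a reduced word starts with
  \<open>a\<close>, so no line crosses between the shadow of \<open>a\<close> and its
  complement.\<close>

lemma missing_letter_not_circle:
  assumes a: "a \<in> A" "a \<notin> fst ` set (\<phi> s)"
  shows "\<not> hamiltonian_circle_subgraph Y X"
proof
  assume "hamiltonian_circle_subgraph Y X"
  moreover have "connectedin euclidean (sphere (0::complex) 1)"
    by (simp add: connected_sphere)
  then have "connected_space (top_of_set (sphere (0::complex) 1))"
    by (simp add: connectedin_def)
  ultimately have "connected_space (subtopology (freudenthal X) circle)"
    unfolding hamiltonian_circle_subgraph_iff using homeomorphic_connected_space by blast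
  moreover
  let ?B = "shadow [(a, True)]"
  have B: "finite (boundary ?B)" "finite (boundary (- ?B))"
    using finite_boundary_shadow by simp_all
  have inv: "g \<in> ?B \<longleftrightarrow> g \<otimes> s \<in> ?B" if "g \<in> carrier G" for g
    using take_1_reduce_append[OF \<phi>_carrier(1)[OF that] a(2), of True] that s_carrier
    by (simp add: shadow_def \<phi>_mult)
  have cover: "circle \<subseteq> region ?B \<union> region (- ?B)"
  proof
    fix p assume p: "p \<in> circle"
    show "p \<in> region ?B \<union> region (- ?B)"
    proof (cases p)
      case (Point q)
      then have "q \<in> realization X"
        using p realization_Y_subset by (auto simp: circle_def)
      then show ?thesis
        using realization_support(2)[of q] Point by auto
    next
      case (End \<omega>)
      then have "\<omega> \<in> ends X"
        using p by (auto simp: circle_def)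
      then show ?thesis
        using lives_in_Compl[OF _ B(1)] End by auto
    qed
  qed
  \<comment> \<open>The two regions overlap only in inner points of edges of \<open>X\<close>
    leaving \<open>?B\<close>, and no edge of \<open>Y\<close> leaves \<open>?B\<close>.\<close>
  have disj: "region ?B \<inter> region (- ?B) \<inter> circle = {}"
  proof -
    have False if "p \<in> realization Y" "p u > 0" "u \<in> ?B" "p v > 0" "v \<notin> ?B" for p u v
    proof -
      have "u = v \<or> adj Y u v"
        using that(1,2,4) adj_Y_iff[of u v] adj_Y_iff[of v u]
        by (auto simp: realization_def vertex_point_def edge_point_def of_bool_def split: if_splits)
      then show False
        using that(3,5) inv unfolding adj_Y_iff by metis
    qed
    moreover have False if "End \<omega> \<in> region ?B" "End \<omega> \<in> region (- ?B)" for \<omega>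
      using lives_in_Compl[OF _ B(1), of \<omega>] that by simp
    ultimately have False if "p \<in> region ?B" "p \<in> region (- ?B)" "p \<in> circle" for p
      using that by (cases p) (auto simp: circle_def)
    then show ?thesis
      by blast
  qed
  have "vtx [(a, True)] \<in> ?B"
    using vtx_in_shadow[of "[(a, True)]" "[]"] a(1) by (simp add: reduced_def)
  then have "Point (vertex_point (vtx [(a, True)])) \<in> region ?B \<inter> circle"
    using vertex_in_circle[of "vtx [(a, True)]"] realization_Y_subset
    by (auto simp: shadow_def vertex_point_def circle_def)
  moreover have "Point (vertex_point \<one>) \<in> region (- ?B) \<inter> circle"
    using vertex_in_circle[of \<one>] realization_Y_subset
    by (auto simp: shadow_def vertex_point_def circle_def)
  moreover have "openin (subtopology (freudenthal X) circle) (region ?B \<inter> circle)"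
    "openin (subtopology (freudenthal X) circle) (region (- ?B) \<inter> circle)"
    using openin_region[OF B(1)] openin_region[OF B(2)] by (auto intro: openin_subtopology_Int)
  ultimately show False
    using cover disj unfolding connected_space_def circle_topspace by blast
qed

end

section \<open>Lines of cyclically reduced words and colours along them\<close>

lemma reduced_append:
  "reduced (u @ v) \<longleftrightarrow> reduced u \<and> reduced v \<and> (u \<noteq> [] \<and> v \<noteq> [] \<longrightarrow> hd v \<noteq> inv_letter (last u))"
  by (auto simp: reduced_def successively_append_iff)

definition word_power :: "'a word \<Rightarrow> nat \<Rightarrow> 'a word" where
  "word_power t k = concat (replicate k t)"

lemma word_power_simps [simp]: "word_power t 0 = []" "word_power t (Suc k) = t @ word_power t k"
  "length (word_power t k) = k * length t" "set (word_power t k) \<subseteq> set t"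
  by (auto simp: word_power_def length_concat sum_list_replicate)

lemma word_power_Suc_right: "word_power t (Suc k) = word_power t k @ t"
  by (induction k) simp_all

lemma reduced_word_power:
  assumes "reduced t" "t \<noteq> []" "hd t \<noteq> inv_letter (last t)"
  shows "reduced (word_power t k)"
proof (induction k)
  case (Suc k)
  then show ?case
    using assms by (cases k) (auto simp: reduced_append)
qed simp

text \<open>Cyclic reducedness makes all powers of \<open>t\<close> reduced, so lines are spelled by
  two-sided infinite words without cancellation.\<close>

locale cyclic_cayley = free_cayley G A \<phi> S s
  for G :: "'g monoid" (structure) and A :: "'a set" and \<phi> :: "'g \<Rightarrow> 'a word" and S :: "'g set" and s :: 'g +
  assumes t_nonempty: "\<phi> s \<noteq> []" and t_cyclic: "hd (\<phi> s) \<noteq> inv_letter (last (\<phi> s))"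
begin

abbreviation t :: "'a word" where "t \<equiv> \<phi> s"
abbreviation L :: nat where "L \<equiv> length t"
abbreviation pnt :: "'g \<Rightarrow> 'g fpoint" where "pnt g \<equiv> Point (vertex_point g)"
abbreviation prev_letter :: "nat \<Rightarrow> 'a \<times> bool" where "prev_letter i \<equiv> inv_letter (t ! ((i + L - 1) mod L))"

lemma t: "reduced t" "fst ` set t \<subseteq> A" "L > 0"
  using \<phi>_carrier s_carrier t_nonempty by auto

lemma \<phi>_pow: "\<phi> (s [^] int k) = word_power t k"
proof (induction k)
  case (Suc k)
  have "s [^] int (Suc k) = s [^] int k \<otimes> s"
    using s_carrier by (simp add: int_pow_int del: of_nat_Suc)
  then show ?case
    using Suc reduced_word_power[OF t(1) t_nonempty t_cyclic, of "Suc k"] s_carrier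
    unfolding word_power_Suc_right by (simp add: \<phi>_mult int_pow_closed reduce_reduced)
qed (simp add: int_pow_int)

lemma mult_left_cancel: "x \<in> carrier G \<Longrightarrow> y \<in> carrier G \<Longrightarrow> z \<in> carrier G \<Longrightarrow> x \<otimes> y = x \<otimes> z \<Longrightarrow> y = z"
  by (metis inv_closed l_inv l_one m_assoc)

lemma pnt_eq_iff [simp]: "vertex_point u = vertex_point v \<longleftrightarrow> u = v" for u v :: 'g
proof
  assume "vertex_point u = vertex_point v"
  from fun_cong[OF this, of u] show "u = v"
    by (simp add: vertex_point_def of_bool_def split: if_splits)
qed simp

lemma pow_inj:
  assumes "s [^] (a::int) = s [^] b"
  shows "a = b"
proof -
  have *: "a \<le> b" if "s [^] (a::int) = s [^] b" for a b
  proof (rule ccontr)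
    assume "\<not> a \<le> b"
    then obtain k where k: "a = b + int (Suc k)"
      by (metis add_diff_cancel_left' linorder_not_le zless_iff_Suc_zadd)
    have "s [^] b \<otimes> s [^] int (Suc k) = s [^] b \<otimes> \<one>"
      using that s_carrier by (simp add: k int_pow_mult)
    then have "s [^] int (Suc k) = \<one>"
      using s_carrier by (meson int_pow_closed mult_left_cancel one_closed)
    then show False
      using \<phi>_pow[of "Suc k"] t_nonempty by simp
  qed
  show ?thesis using *[of a b] *[of b a] assms by simp
qed

lemma pow_step: "g \<in> carrier G \<Longrightarrow> g \<otimes> s [^] (k + 1 :: int) = (g \<otimes> s [^] k) \<otimes> s"
  using s_carrier by (simp add: int_pow_mult m_assoc int_pow_closed)

lemma adj_Y_pow: "g \<in> carrier G \<Longrightarrow> adj Y (g \<otimes> s [^] k) (g \<otimes> s [^] (k + 1 :: int))"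
  using pow_step[of g k] s_carrier by (simp add: adj_Y_iff int_pow_closed)

lemma adj_Y_sym: "adj Y u v \<Longrightarrow> adj Y v u"
  by (auto simp: adj_Y_iff)

lemma ray_Y_imp_X: "ray Y r \<Longrightarrow> ray X r"
  using adj_Y_imp_X by (auto simp: ray_def)

lemma ray_pow:
  assumes g: "g \<in> carrier G" and e: "e = 1 \<or> e = (- 1 :: int)"
  shows "ray Y (\<lambda>k. g \<otimes> s [^] (c + e * int k))"
  unfolding ray_def
proof (intro conjI allI)
  show "inj (\<lambda>k. g \<otimes> s [^] (c + e * int k))"
  proof (rule injI)
    fix j k assume "g \<otimes> s [^] (c + e * int j) = g \<otimes> s [^] (c + e * int k)"
    then have "s [^] (c + e * int j) = s [^] (c + e * int k)"
      using g s_carrier by (meson int_pow_closed mult_left_cancel)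
    then show "j = k"
      using pow_inj e by fastforce
  qed
  show "range (\<lambda>k. g \<otimes> s [^] (c + e * int k)) \<subseteq> verts Y"
    using g s_carrier by (auto simp: int_pow_closed)
  fix i
  show "adj Y (g \<otimes> s [^] (c + e * int i)) (g \<otimes> s [^] (c + e * int (Suc i)))"
    using e
  proof
    assume "e = 1"
    then show ?thesis using adj_Y_pow[OF g, of "c + int i"] by (simp add: algebra_simps)
  next
    assume "e = - 1"
    then show ?thesis using adj_Y_sym[OF adj_Y_pow[OF g, of "c - int i - 1"]] by (simp add: algebra_simps)
  qed
qed

text \<open>A separation of the closure without the vertices in \<open>N\<close>. The sets are open
  in the whole space and disjoint only inside the closure; membership in one of them serves as a
  colour.\<close>

definition splits :: "'g fpoint set \<Rightarrow> 'g fpoint set \<Rightarrow> 'g set \<Rightarrow> bool" where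
  "splits U V N \<longleftrightarrow> openin (freudenthal X) U \<and> openin (freudenthal X) V \<and>
     circle - pnt ` N \<subseteq> U \<union> V \<and> U \<inter> V \<inter> circle = {}"

lemma splits_sym: "splits U V N \<Longrightarrow> splits V U N"
  by (auto simp: splits_def)

lemma edge_point_in_circle: "adj Y u v \<Longrightarrow> \<tau> \<in> {0..1} \<Longrightarrow> Point (edge_point u v \<tau>) \<in> circle"
  unfolding circle_def realization_def by blast

lemma edge_point_ends: "edge_point u v 0 = vertex_point u" "edge_point u v 1 = vertex_point v"
  by (auto simp: edge_point_def vertex_point_def)

text \<open>The part of the edge from the given point to \<open>v\<close> is connected and avoids
  \<open>N\<close>, so it has a single colour.\<close>

lemma edge_color:
  assumes sp: "splits U V N" and uv: "adj Y u v" "u \<noteq> v" and v: "v \<notin> N" and \<rho>: "0 \<le> \<rho>" "\<rho> \<le> 1"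
    and q: "Point (edge_point u v \<rho>) \<notin> pnt ` N" "Point (edge_point u v \<rho>) \<in> V"
  shows "pnt v \<in> V"
proof (rule ccontr)
  let ?f = "\<lambda>\<tau>. Point (edge_point u v \<tau>)"
  let ?S = "?f ` {\<rho>..1}"
  assume "pnt v \<notin> V"
  have vp: "pnt w = pnt w' \<longleftrightarrow> w = w'" for w w' :: 'g
    by simp
  have "pnt v \<in> circle"
    using edge_point_in_circle[OF uv(1), of 1] by (simp add: edge_point_ends)
  moreover have "pnt v \<notin> pnt ` N"
    using v by auto
  ultimately have vU: "pnt v \<in> U"
    using sp \<open>pnt v \<notin> V\<close> unfolding splits_def by blast
  have avoid: "?f \<tau> \<notin> pnt ` N" if "\<tau> \<in> {\<rho>..1}" for \<tau>
  proof
    assume "?f \<tau> \<in> pnt ` N"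
    then obtain n where n: "edge_point u v \<tau> = vertex_point n" "n \<in> N" by auto
    have val: "edge_point u v \<tau> u = 1 - \<tau>" "vertex_point n u \<in> {0, 1}"
      using uv(2) by (auto simp: edge_point_def vertex_point_def)
    then have "\<tau> = 0 \<or> \<tau> = 1"
      using n(1) by auto
    then show False
    proof
      assume "\<tau> = 0"
      then show False using q(1) n that \<rho> by auto
    next
      assume "\<tau> = 1"
      then have "pnt v = pnt n" using n(1) by (simp add: edge_point_ends)
      then show False using n(2) v by simp
    qed
  qed
  have "connectedin (top_of_set {0..1}) {\<rho>..1}"
    using \<rho> by (simp add: connectedin_subtopology)
  then have conn: "connectedin (freudenthal X) ?S"
    by (rule connectedin_continuous_map_image[OF continuous_map_edge_point[OF adj_Y_imp_X[OF uv(1)]]])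
  have S: "?S \<subseteq> circle"
    using edge_point_in_circle[OF uv(1)] \<rho> by auto
  have "?S \<subseteq> U \<union> V"
    using S avoid sp unfolding splits_def by blast
  moreover have "U \<inter> V \<inter> ?S = {}"
    using S sp unfolding splits_def by blast
  moreover have "U \<inter> ?S \<noteq> {}"
    using vU \<rho> by (auto simp: edge_point_ends intro!: image_eqI[of _ _ 1])
  moreover have "V \<inter> ?S \<noteq> {}"
    using q(2) \<rho> by auto
  moreover have "openin (freudenthal X) U" "openin (freudenthal X) V"
    using sp by (auto simp: splits_def)
  ultimately show False
    using connectedinD[OF conn] by blast
qed

lemma vertex_color:
  assumes "splits U V N" "adj Y u v" "u \<noteq> v" "u \<notin> N" "v \<notin> N"
  shows "pnt u \<in> V \<longleftrightarrow> pnt v \<in> V"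
proof -
  have *: "pnt v \<in> V" if "pnt u \<in> V" "adj Y u v" "u \<noteq> v" "u \<notin> N" "v \<notin> N" for u v
  proof -
    have "pnt u \<notin> pnt ` N"
      using that(4) by auto
    then show ?thesis
      using edge_color[OF assms(1) that(2,3,5), of 0] that(1) by (simp add: edge_point_ends)
  qed
  show ?thesis
    using * assms adj_Y_sym by metis
qed

lemma end_color_ray:
  assumes "openin (freudenthal X) V" "\<omega> \<in> ends X" "End \<omega> \<in> V" "r \<in> \<omega>"
  shows "\<exists>k. pnt (r k) \<in> V"
proof -
  obtain B where B: "finite (boundary B)" "lives_in \<omega> B" "region B \<subseteq> V"
    using end_neighbourhood[OF assms(1,3,2)] by blast
  then obtain k where k: "r k \<in> B"
    using lives_in_ray[OF B(2) assms(2) B(1) assms(4)] by blast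
  have "r k \<in> carrier G"
    using end_ray[OF assms(2,4)] by (auto simp: ray_def)
  then have "pnt (r k) \<in> region B"
    using k by (auto simp: realization_def vertex_point_def)
  then show ?thesis
    using B(3) by blast
qed

lemma end_in_circle: "\<omega> \<in> ends X \<Longrightarrow> End \<omega> \<in> circle - pnt ` N"
  by (auto simp: circle_def)

text \<open>Consecutive vertices of the line have the same colour, and both ends of the line are
  limits of its vertices.\<close>

lemma line_color:
  assumes sp: "splits U V N" and g: "g \<in> carrier G" and avoid: "\<And>k::int. g \<otimes> s [^] k \<notin> N"
    and \<omega>: "\<omega> \<in> ends X" "(\<lambda>k. g \<otimes> s [^] (1 + 1 * int k)) \<in> \<omega>"
    and \<omega>': "\<omega>' \<in> ends X" "(\<lambda>k. g \<otimes> s [^] (- 1 + - 1 * int k)) \<in> \<omega>'"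
  shows "End \<omega> \<in> V \<longleftrightarrow> End \<omega>' \<in> V"
proof -
  have step: "pnt (g \<otimes> s [^] k) \<in> V \<longleftrightarrow> pnt (g \<otimes> s [^] (k + 1)) \<in> V" if "splits U V N" for U V and k :: int
  proof (rule vertex_color[OF that adj_Y_pow[OF g] _ avoid avoid])
    have "s [^] k \<noteq> s [^] (k + 1)"
      using pow_inj by force
    then show "g \<otimes> s [^] k \<noteq> g \<otimes> s [^] (k + 1)"
      using g s_carrier by (meson int_pow_closed mult_left_cancel)
  qed
  have all: "pnt (g \<otimes> s [^] k) \<in> V \<longleftrightarrow> pnt (g \<otimes> s [^] l) \<in> V" if "splits U V N" for U V and k l :: int
  proof -
    have "pnt (g \<otimes> s [^] k) \<in> V \<longleftrightarrow> pnt (g \<otimes> s [^] (0::int)) \<in> V" for k :: int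
    proof (induction k rule: int_induct[where k = 0])
      case (step2 i)
      then show ?case using step[OF that, of "i - 1"] by simp
    qed (use step[OF that] in auto)
    then show ?thesis by blast
  qed
  have side: "End \<omega>'' \<in> V \<longleftrightarrow> pnt (g \<otimes> s [^] (0::int)) \<in> V"
    if \<omega>'': "\<omega>'' \<in> ends X" "(\<lambda>k. g \<otimes> s [^] (c + e * int k)) \<in> \<omega>''" for \<omega>'' c e
  proof -
    have fwd: "pnt (g \<otimes> s [^] (0::int)) \<in> V" if "splits U V N" "End \<omega>'' \<in> V" for U V
      using end_color_ray[OF _ \<omega>''(1) that(2) \<omega>''(2)] that(1) all[OF that(1)] unfolding splits_def by blast
    have "End \<omega>'' \<in> U \<or> End \<omega>'' \<in> V"
      using sp end_in_circle[OF \<omega>''(1), of N] unfolding splits_def by blast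
    moreover have "pnt (g \<otimes> s [^] (0::int)) \<notin> U \<or> pnt (g \<otimes> s [^] (0::int)) \<notin> V"
      using sp vertex_in_circle[of "g \<otimes> s [^] (0::int)"] g unfolding splits_def by force
    ultimately show ?thesis
      using fwd[OF sp] fwd[OF splits_sym[OF sp]] by blast
  qed
  show ?thesis
    using side[OF \<omega>] side[OF \<omega>'] by blast
qed

text \<open>The colour of the starting point would travel along the ray, but the ray converges to an
  end on the side of \<open>U\<close>.\<close>

lemma ray_color:
  assumes sp: "splits U V N" and U: "\<And>\<omega>. \<omega> \<in> ends X \<Longrightarrow> End \<omega> \<in> U" and r: "ray Y r"
    and avoid: "\<And>k. r (Suc k) \<notin> N" and \<rho>: "0 \<le> \<rho>" "\<rho> \<le> 1"
    and q: "Point (edge_point (r 0) (r 1) \<rho>) \<notin> pnt ` N"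
  shows "Point (edge_point (r 0) (r 1) \<rho>) \<notin> V"
proof
  assume qV: "Point (edge_point (r 0) (r 1) \<rho>) \<in> V"
  have rY: "adj Y (r k) (r (Suc k))" "r k \<noteq> r (Suc k)" "r k \<in> carrier G" for k
    using r by (auto simp: ray_def dest: injD)
  have V: "pnt (r (Suc k)) \<in> V" for k
  proof (induction k)
    case 0
    show ?case
      using edge_color[OF sp rY(1,2)[of 0] avoid[of 0] \<rho>] q qV by simp
  next
    case (Suc k)
    then show ?case
      using vertex_color[OF sp rY(1,2)[of "Suc k"] avoid avoid] by simp
  qed
  let ?r = "\<lambda>k. r (Suc k)"
  have "ray X ?r"
    using ray_Y_imp_X[OF r] by (auto simp: ray_def inj_def)
  then obtain k where "pnt (r (Suc k)) \<in> U"
    using end_color_ray[of U "ray_equiv X `` {?r}" ?r] end_ray_class[of ?r] U sp unfolding splits_def by blast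
  then show False
    using V[of k] vertex_in_circle[OF rY(3)] sp unfolding splits_def by blast
qed

lemma reduced_pieces:
  "reduced (word_power t m @ take i t)" "reduced (drop i t @ word_power t m)"
proof -
  have r: "reduced (word_power t (Suc m))"
    by (rule reduced_word_power[OF t(1) t_nonempty t_cyclic])
  have "word_power t (Suc m) = (word_power t m @ take i t) @ drop i t"
    "word_power t (Suc m) = take i t @ (drop i t @ word_power t m)"
    unfolding word_power_Suc_right[of t m] by simp (simp add: word_power_Suc_right[symmetric])
  then show "reduced (word_power t m @ take i t)" "reduced (drop i t @ word_power t m)"
    using r reduced_append by metis+
qed

text \<open>The line through the vertex \<open>w\<close> of the tree at position \<open>i\<close> does not pass through the
  predecessor of \<open>w\<close>.\<close>

definition turns :: "'a word \<Rightarrow> nat \<Rightarrow> bool" where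
  "turns w i \<longleftrightarrow> reduced w \<and> fst ` set w \<subseteq> A \<and> i < L \<and>
     (w \<noteq> [] \<longrightarrow> t ! i \<noteq> inv_letter (last w) \<and> prev_letter i \<noteq> inv_letter (last w))"

text \<open>The start of the edge that passes \<open>w\<close> after \<open>i\<close> letters; it
  represents the coset forming the line.\<close>

abbreviation base :: "'a word \<Rightarrow> nat \<Rightarrow> 'g" where "base w i \<equiv> vtx (w @ winv (take i t))"

lemma winv_eq_Nil [simp]: "winv w = [] \<longleftrightarrow> w = []"
  by (simp add: winv_def)

lemma hd_winv: "w \<noteq> [] \<Longrightarrow> hd (winv w) = inv_letter (last w)"
  by (simp add: winv_def hd_rev last_map)

lemma base_carrier: "turns w i \<Longrightarrow> base w i \<in> carrier G"
proof -
  assume "turns w i"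
  then have w: "fst ` set w \<subseteq> A"
    by (simp add: turns_def)
  have "fst ` set (take i t) \<subseteq> A"
    using t(2) set_take_subset[of i t] by blast
  then show ?thesis
    using w by (intro vtx_carrier) (simp only: set_append image_Un fst_set_winv Un_subset_iff simp_thms)
qed

lemma last_power_take:
  assumes "i < L" "word_power t m @ take i t \<noteq> []"
  shows "last (word_power t m @ take i t) = t ! ((i + L - 1) mod L)"
proof (cases "i = 0")
  case True
  then obtain k where m: "m = Suc k"
    using assms(2) by (cases m) auto
  have "word_power t m @ take i t = word_power t k @ t"
    unfolding m word_power_Suc_right using True by simp
  then have "last (word_power t m @ take i t) = last t"
    using t_nonempty by simp
  then show ?thesis
    using True last_conv_nth[OF t_nonempty] t(3) by (simp add: mod_less)
next
  case False
  then have "(i + L - 1) mod L = i - 1"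
    using assms(1) by (metis Nat.add_diff_assoc2 One_nat_def Suc_leI diff_less less_trans mod_add_self2 mod_less neq0_conv zero_less_one)
  moreover have "last (take i t) = t ! (i - 1)"
    using False assms(1) last_conv_nth[of "take i t"] by (cases "take i t = []") (auto simp: min_def)
  ultimately show ?thesis
    using False t_nonempty by simp
qed

text \<open>\<open>turns\<close> rules out cancellation where the line leaves \<open>w\<close>, so
  both halves of the line consist of reduced words with prefix \<open>w\<close>.\<close>

lemma line_words:
  assumes "turns w i"
  shows "\<phi> (base w i \<otimes> s [^] (1 + int m)) = w @ drop i t @ word_power t m"
    "\<phi> (base w i \<otimes> s [^] (- int m)) = w @ winv (word_power t m @ take i t)"
proof -
  have w: "reduced w" "fst ` set w \<subseteq> A" "i < L"
    and top: "w \<noteq> [] \<Longrightarrow> t ! i \<noteq> inv_letter (last w)" "w \<noteq> [] \<Longrightarrow> prev_letter i \<noteq> inv_letter (last w)"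
    using assms by (auto simp: turns_def)
  have letters: "fst ` set (take i t) \<subseteq> A" "fst ` set (word_power t k) \<subseteq> A" for k
    using t(2) set_take_subset[of i t] word_power_simps(4)[of t k] by blast+
  have bl: "fst ` set (w @ winv (take i t)) \<subseteq> A"
    using w(2) letters(1) by (simp only: set_append image_Un fst_set_winv Un_subset_iff simp_thms)
  have \<phi>b: "\<phi> (base w i) = reduce (w @ winv (take i t))"
    by (rule \<phi>_vtx[OF bl])
  have "\<phi> (base w i \<otimes> s [^] int (Suc m)) = reduce ((w @ winv (take i t)) @ word_power t (Suc m))"
    using \<phi>_mult[OF base_carrier[OF assms] int_pow_closed[OF s_carrier]] \<phi>_pow[of "Suc m"] by (simp add: \<phi>b)
  also have "\<dots> = reduce (w @ winv (take i t) @ take i t @ (drop i t @ word_power t m))"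
  proof -
    have "word_power t (Suc m) = take i t @ (drop i t @ word_power t m)"
      by simp
    then show ?thesis by (simp only: append_assoc)
  qed
  also have "\<dots> = reduce (w @ drop i t @ word_power t m)"
    by (rule reduce_winv_cancel(1))
  also have "\<dots> = w @ drop i t @ word_power t m"
  proof (rule reduce_reduced)
    have "drop i t \<noteq> []" "hd (drop i t) = t ! i"
      using w(3) by (auto simp: hd_drop_conv_nth)
    then show "reduced (w @ drop i t @ word_power t m)"
      using w(1) reduced_pieces(2)[of i m] top(1) unfolding reduced_append[of w] by simp
  qed
  finally show "\<phi> (base w i \<otimes> s [^] (1 + int m)) = w @ drop i t @ word_power t m"
    by simp
  have "\<phi> (s [^] (- int m)) = winv (word_power t m)"
    using \<phi>_inv[of "s [^] int m"] s_carrier \<phi>_pow[of m] by (simp add: int_pow_neg)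
  then have "\<phi> (base w i \<otimes> s [^] (- int m)) = reduce ((w @ winv (take i t)) @ winv (word_power t m))"
    using \<phi>_mult[OF base_carrier[OF assms] int_pow_closed[OF s_carrier]] by (simp add: \<phi>b)
  also have "\<dots> = reduce (w @ winv (word_power t m @ take i t))"
    by simp
  also have "\<dots> = w @ winv (word_power t m @ take i t)"
  proof (rule reduce_reduced)
    let ?u = "word_power t m @ take i t"
    show "reduced (w @ winv ?u)"
      unfolding reduced_append[of w]
    proof (intro conjI impI)
      show "reduced (winv ?u)"
        by (rule reduced_winv[OF reduced_pieces(1)])
      assume "w \<noteq> [] \<and> winv ?u \<noteq> []"
      then show "hd (winv ?u) \<noteq> inv_letter (last w)"
        using top(2) last_power_take[OF w(3), of m] hd_winv[of ?u] by auto
    qed (fact w(1))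
  qed
  finally show "\<phi> (base w i \<otimes> s [^] (- int m)) = w @ winv (word_power t m @ take i t)" .
qed

lemma line_ends:
  assumes "turns w i"
  obtains \<omega> \<omega>' where "\<omega> \<in> ends X" "(\<lambda>k. base w i \<otimes> s [^] (1 + 1 * int k)) \<in> \<omega>" "lives_in \<omega> (shadow (w @ [t ! i]))"
    "\<omega>' \<in> ends X" "(\<lambda>k. base w i \<otimes> s [^] (- 1 + - 1 * int k)) \<in> \<omega>'" "lives_in \<omega>' (shadow (w @ [prev_letter i]))"
proof -
  let ?r = "\<lambda>k. base w i \<otimes> s [^] (1 + 1 * int k)" and ?r' = "\<lambda>k. base w i \<otimes> s [^] (- 1 + - 1 * int k)"
  have i: "i < L" using assms by (simp add: turns_def)
  have g: "base w i \<in> carrier G" by (rule base_carrier[OF assms])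
  have rays: "ray X ?r" "ray X ?r'"
    using ray_Y_imp_X[OF ray_pow[OF g]] by blast+
  have "?r k \<in> shadow (w @ [t ! i])" for k
  proof -
    have "drop i t = t ! i # drop (Suc i) t"
      using i by (simp add: Cons_nth_drop_Suc)
    then show ?thesis
      using line_words(1)[OF assms, of k] g s_carrier by (simp add: shadow_def int_pow_closed)
  qed
  moreover have "?r' k \<in> shadow (w @ [prev_letter i])" for k
  proof -
    let ?u = "word_power t (Suc k) @ take i t"
    have u: "?u \<noteq> []" using t_nonempty by simp
    then have "winv ?u = inv_letter (last ?u) # tl (winv ?u)"
      using hd_winv[OF u] by (metis list.collapse winv_eq_Nil)
    moreover have "take (Suc (length w)) (w @ x # xs) = w @ [x]" for x xs
      by simp
    ultimately have "take (Suc (length w)) (w @ winv ?u) = w @ [prev_letter i]"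
      unfolding last_power_take[OF i u] by metis
    moreover have "\<phi> (?r' k) = w @ winv ?u"
      using line_words(2)[OF assms, of "Suc k"] by simp
    ultimately show ?thesis
      using g s_carrier by (simp add: shadow_def int_pow_closed)
  qed
  ultimately have "lives_in (ray_equiv X `` {?r}) (shadow (w @ [t ! i]))"
    "lives_in (ray_equiv X `` {?r'}) (shadow (w @ [prev_letter i]))"
    unfolding lives_in_def
    by (intro bexI[OF _ end_ray_class(2)[OF rays(1)]] bexI[OF _ end_ray_class(2)[OF rays(2)]] exI[of _ 0]; simp)+
  then show thesis
    using that[OF end_ray_class[OF rays(1)] _ end_ray_class[OF rays(2)]] by blast
qed

text \<open>A positive power ends with the last letter of \<open>t\<close>, but the target with the
  inverse of its first letter, against cyclic reducedness. For the other powers comparing lengths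
  gives \<open>m = 0\<close>, and then either \<open>i = j\<close> or the line runs through the
  predecessor of \<open>w\<close>.\<close>

lemma line_avoids:
  assumes "turns w i" "j < L" "w \<noteq> [] \<or> i \<noteq> j"
  shows "base w i \<otimes> s [^] (k::int) \<noteq> base [] j"
proof
  assume eq: "base w i \<otimes> s [^] k = base [] j"
  have i: "i < L" using assms by (simp add: turns_def)
  have j: "turns [] j"
    using assms(2) by (simp add: turns_def)
  have \<phi>j: "\<phi> (base [] j) = winv (take j t)"
    using line_words(2)[OF j, of 0] base_carrier[OF j] by (simp add: int_pow_int)
  show False
  proof (cases "k > 0")
    case True
    then obtain m where k: "k = 1 + int m"
      by (metis zero_less_imp_eq_int of_nat_Suc add.commute gr0_implies_Suc of_nat_0_less_iff)
    have "w @ drop i t @ word_power t m = winv (take j t)"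
      using line_words(1)[OF assms(1), of m] eq \<phi>j by (simp add: k)
    moreover have "last (w @ drop i t @ word_power t m) = last t"
    proof (cases m)
      case (Suc m')
      have "word_power t m = word_power t m' @ t"
        unfolding Suc word_power_Suc_right ..
      then show ?thesis using t_nonempty by simp
    qed (use i in simp)
    moreover have "last (winv (take j t)) = inv_letter (hd t)" if "take j t \<noteq> []"
      using that by (auto simp: winv_def last_rev hd_map)
    moreover have "take j t \<noteq> []"
      using calculation(1) i by (metis Nil_is_append_conv drop_eq_Nil linorder_not_less winv_eq_Nil)
    ultimately have "last t = inv_letter (hd t)"
      by simp
    then show False
      using t_cyclic by (metis inv_letter_invol)
  next
    case False
    then obtain m where k: "k = - int m"
      by (metis add.inverse_inverse nonneg_int_cases not_less neg_0_le_iff_le)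
    have "w @ winv (word_power t m @ take i t) = winv (take j t)"
      using line_words(2)[OF assms(1), of m] eq \<phi>j by (simp add: k)
    from arg_cong[OF this, of winv] have *: "word_power t m @ take i t @ winv w = take j t"
      by simp
    have "m * L + i + length w = j"
      using arg_cong[OF *, of length] i assms(2) by simp
    then have m: "m = 0"
      using assms(2) by (cases m) auto
    then have eq': "take i t @ winv w = take j t"
      using * by simp
    show False
    proof (cases "w = []")
      case True
      then show False
        using \<open>m * L + i + length w = j\<close> m assms(3) by simp
    next
      case False
      have "i < j"
        using False \<open>m * L + i + length w = j\<close> by (cases w) (auto simp: m)
      have "(take i t @ winv w) ! i = hd (winv w)"
        using False i by (simp add: nth_append hd_conv_nth)
      then have "t ! i = inv_letter (last w)"
        using \<open>i < j\<close> by (simp add: eq' hd_winv[OF False])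
      then show False
        using assms(1) False by (simp add: turns_def)
    qed
  qed
qed

end

section \<open>Propagation of colours through the Whitehead graphs\<close>

context cyclic_cayley
begin

lemma no_loop: "i < L \<Longrightarrow> t ! i \<noteq> prev_letter i"
proof -
  assume i: "i < L"
  show ?thesis
  proof (cases i)
    case 0
    then show ?thesis
      using t_cyclic t_nonempty t(3) by (simp add: hd_conv_nth last_conv_nth mod_less)
  next
    case (Suc k)
    then have "(i + L - 1) mod L = k"
      using i by simp
    then show ?thesis
      using reduced_nth[OF t(1), of k] i Suc by simp
  qed
qed

lemma child_shadow:
  assumes "\<omega> \<in> ends X" "lives_in \<omega> (shadow w)"
  obtains x where "fst x \<in> A" "w \<noteq> [] \<Longrightarrow> x \<noteq> inv_letter (last w)" "lives_in \<omega> (shadow (w @ [x]))"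
proof -
  obtain \<xi> where \<xi>: "\<xi> \<in> boundary_words" "ends_at \<omega> \<xi>"
    using end_ends_at[OF assms(1)] by blast
  have w: "pre \<xi> (length w) = w"
    by (rule lives_in_shadow_unique[OF assms(1) _ assms(2)]) (use \<xi>(2) in \<open>auto simp: ends_at_def\<close>)
  let ?x = "\<xi> (length w)"
  have Suc: "pre \<xi> (Suc (length w)) = w @ [?x]"
    by (simp add: pre_Suc w)
  show thesis
  proof (rule that[of ?x])
    show "fst ?x \<in> A"
      using \<xi>(1) by (auto simp: boundary_words_def)
    show "w \<noteq> [] \<Longrightarrow> ?x \<noteq> inv_letter (last w)"
      using pre_reduced[OF \<xi>(1), of "Suc (length w)"] by (simp add: Suc reduced_append_single)
    show "lives_in \<omega> (shadow (w @ [?x]))"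
      using \<xi>(2) Suc unfolding ends_at_def by metis
  qed
qed

definition monochromatic :: "'g fpoint set \<Rightarrow> 'a word \<Rightarrow> bool" where
  "monochromatic U w \<longleftrightarrow> (\<exists>b. \<forall>\<omega>\<in>ends X. lives_in \<omega> (shadow w) \<longrightarrow> (End \<omega> \<in> U \<longleftrightarrow> b))"

definition child_color :: "'g fpoint set \<Rightarrow> 'a word \<Rightarrow> 'a \<times> bool \<Rightarrow> bool" where
  "child_color U w x \<longleftrightarrow> (\<exists>\<omega>\<in>ends X. lives_in \<omega> (shadow (w @ [x])) \<and> End \<omega> \<in> U)"

lemma child_color_eq:
  assumes "monochromatic U (w @ [x])" "\<omega> \<in> ends X" "lives_in \<omega> (shadow (w @ [x]))"
  shows "End \<omega> \<in> U \<longleftrightarrow> child_color U w x"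
  using assms unfolding monochromatic_def child_color_def by blast

text \<open>The line turning at \<open>w\<close> has one end behind each of the two letters, and
  these ends have the same colour.\<close>

lemma edge_child_color:
  assumes sp: "splits U V N" and w: "turns w i" and avoid: "\<And>k::int. base w i \<otimes> s [^] k \<notin> N"
    and mono: "monochromatic U (w @ [t ! i])" "monochromatic U (w @ [prev_letter i])"
  shows "child_color U w (prev_letter i) = child_color U w (t ! i)"
proof (rule line_ends[OF w])
  fix \<omega> \<omega>' assume *: "\<omega> \<in> ends X" "(\<lambda>k. base w i \<otimes> s [^] (1 + 1 * int k)) \<in> \<omega>" "lives_in \<omega> (shadow (w @ [t ! i]))"
    "\<omega>' \<in> ends X" "(\<lambda>k. base w i \<otimes> s [^] (- 1 + - 1 * int k)) \<in> \<omega>'" "lives_in \<omega>' (shadow (w @ [prev_letter i]))"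
  have "End \<omega> \<in> U \<longleftrightarrow> End \<omega>' \<in> U"
    by (rule line_color[OF splits_sym[OF sp] base_carrier[OF w] avoid *(1,2,4,5)])
  then show ?thesis
    using child_color_eq[OF mono(1) *(1,3)] child_color_eq[OF mono(2) *(4,6)] by simp
qed

text \<open>No vertex cuts the Whitehead graph of the cyclic word \<open>t\<close>. Connectedness is expressed by
  two-colourings that are constant along edges.\<close>

definition no_cut_vertex :: bool where
  "no_cut_vertex \<longleftrightarrow> (\<forall>z P. fst z \<in> A \<longrightarrow>
     (\<forall>i<L. prev_letter i \<noteq> z \<longrightarrow> t ! i \<noteq> z \<longrightarrow> P (prev_letter i) = P (t ! i)) \<longrightarrow>
     (\<forall>x y. fst x \<in> A \<longrightarrow> fst y \<in> A \<longrightarrow> x \<noteq> z \<longrightarrow> y \<noteq> z \<longrightarrow> P x = (P y :: bool)))"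

lemma no_cut_vertexD:
  assumes "no_cut_vertex" "fst z \<in> A" "\<And>i. i < L \<Longrightarrow> prev_letter i \<noteq> z \<Longrightarrow> t ! i \<noteq> z \<Longrightarrow> P (prev_letter i) = P (t ! i)"
    "fst x \<in> A" "fst y \<in> A" "x \<noteq> z" "y \<noteq> z"
  shows "P x = (P y :: bool)"
  using assms unfolding no_cut_vertex_def by blast

text \<open>In the link at \<open>w\<close> the letter \<open>inv_letter (last w)\<close> points to
  the predecessor. Deleting it leaves the directions of the children connected, and the lines
  joining them avoid the removed vertices, so all children share one colour.\<close>

lemma monochromatic_step:
  assumes ncv: no_cut_vertex and sp: "splits U V (base [] ` J)" and J: "J \<subseteq> {..<L}"
    and w: "reduced w" "fst ` set w \<subseteq> A" "w \<noteq> []"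
    and mono: "\<And>x. fst x \<in> A \<Longrightarrow> x \<noteq> inv_letter (last w) \<Longrightarrow> monochromatic U (w @ [x])"
  shows "monochromatic U w"
proof -
  let ?z = "inv_letter (last w)"
  have z: "fst ?z \<in> A"
    using w last_in_set[OF w(3)] by auto
  have letters: "fst (t ! i) \<in> A" "fst (prev_letter i) \<in> A" if "i < L" for i
    using t(2,3) that nth_mem[OF that] nth_mem[of "(i + L - 1) mod L" t] by auto
  have edge: "child_color U w (prev_letter i) = child_color U w (t ! i)"
    if i: "i < L" "prev_letter i \<noteq> ?z" "t ! i \<noteq> ?z" for i
  proof (rule edge_child_color[OF sp])
    show tw: "turns w i"
      using w i by (simp add: turns_def)
    show "base w i \<otimes> s [^] (k::int) \<notin> base [] ` J" for k
      using line_avoids[OF tw] J w(3) by blast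
  qed (use mono letters i in blast)+
  have const: "child_color U w x = child_color U w y" if "fst x \<in> A" "fst y \<in> A" "x \<noteq> ?z" "y \<noteq> ?z" for x y
    by (rule no_cut_vertexD[OF ncv z edge that])
  show ?thesis
  proof (cases "\<exists>x. fst x \<in> A \<and> x \<noteq> ?z")
    case True
    then obtain x0 where x0: "fst x0 \<in> A" "x0 \<noteq> ?z" by blast
    have "End \<omega> \<in> U \<longleftrightarrow> child_color U w x0" if \<omega>: "\<omega> \<in> ends X" "lives_in \<omega> (shadow w)" for \<omega>
    proof (rule child_shadow[OF \<omega>])
      fix x assume x: "fst x \<in> A" "w \<noteq> [] \<Longrightarrow> x \<noteq> ?z" "lives_in \<omega> (shadow (w @ [x]))"
      then show ?thesis
        using child_color_eq[OF mono \<omega>(1) x(3)] const[OF x(1) x0(1) _ x0(2)] w(3) by blast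
    qed
    then show ?thesis unfolding monochromatic_def by blast
  next
    case False
    have "False" if \<omega>: "\<omega> \<in> ends X" "lives_in \<omega> (shadow w)" for \<omega>
      by (rule child_shadow[OF \<omega>]) (use False w(3) in blast)
    then show ?thesis unfolding monochromatic_def by blast
  qed
qed

text \<open>Otherwise some child carries two colours again, and so on forever. The infinite word
  obtained determines an end, but the open set that gives this end its colour contains the region of
  a whole shadow.\<close>

lemma monochromatic_all:
  assumes ncv: no_cut_vertex and sp: "splits U V (base [] ` J)" and J: "J \<subseteq> {..<L}"
    and w0: "reduced w0" "fst ` set w0 \<subseteq> A" "w0 \<noteq> []"
  shows "monochromatic U w0"
proof (rule ccontr)
  assume bad: "\<not> monochromatic U w0"
  let ?Q = "\<lambda>w. reduced w \<and> fst ` set w \<subseteq> A \<and> w \<noteq> [] \<and> \<not> monochromatic U w"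
  have "\<exists>x. ?Q (w @ [x])" if Q: "?Q w" for w
  proof -
    obtain x where "fst x \<in> A" "x \<noteq> inv_letter (last w)" "\<not> monochromatic U (w @ [x])"
      using monochromatic_step[OF ncv sp J, of w] Q by blast
    then have "?Q (w @ [x])"
      using Q by (simp add: reduced_append_single)
    then show ?thesis ..
  qed
  then obtain f where f: "\<And>w. ?Q w \<Longrightarrow> ?Q (w @ [f w])"
    by metis
  define R where "R = rec_nat w0 (\<lambda>_ w. w @ [f w])"
  have R: "R 0 = w0" "\<And>k. R (Suc k) = R k @ [f (R k)]"
    by (simp_all add: R_def)
  have QR: "?Q (R k)" for k
  proof (induction k)
    case 0
    then show ?case using bad w0 by (simp add: R)
  next
    case (Suc k)
    then show ?case unfolding R by (rule f)
  qed
  have len: "length (R k) = length w0 + k" for k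
    by (induction k) (simp_all add: R)
  have nth: "R k ! i = R j ! i" if "j \<le> k" "i < length (R j)" for i j k
    using that(1)
  proof (induction rule: dec_induct)
    case (step n)
    then show ?case using that(2) by (simp add: R nth_append len)
  qed simp
  define \<xi> where "\<xi> i = R i ! i" for i
  have l0: "length w0 > 0" using w0(3) by simp
  have \<xi>_nth: "\<xi> i = R k ! i" if "i < length (R k)" for i k
    using nth[of i k i] nth[of k i i] that l0 len by (cases "i \<le> k") (auto simp: \<xi>_def)
  have \<xi>: "\<xi> \<in> boundary_words"
    unfolding boundary_words_def
  proof (intro CollectI allI conjI)
    fix i
    have i: "Suc i < length (R (Suc i))" using l0 by (simp add: len)
    then have "\<xi> i = R (Suc i) ! i" "\<xi> (Suc i) = R (Suc i) ! Suc i"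
      using \<xi>_nth[of i "Suc i"] \<xi>_nth[of "Suc i" "Suc i"] by auto
    moreover have "R (Suc i) ! i \<in> set (R (Suc i))"
      using i by (intro nth_mem) simp
    ultimately show "fst (\<xi> i) \<in> A" "\<xi> (Suc i) \<noteq> inv_letter (\<xi> i)"
      using QR[of "Suc i"] reduced_nth[of "R (Suc i)" i] i by auto
  qed
  have pre: "pre \<xi> (length w0 + k) = R k" for k
    by (rule nth_equalityI) (auto simp: len pre_def \<xi>_nth)
  obtain \<omega> where \<omega>: "\<omega> \<in> ends X" "ends_at \<omega> \<xi>"
    using ends_at_exists[OF \<xi>] by blast
  have mono: "\<exists>m. \<forall>\<omega>'\<in>ends X. lives_in \<omega>' (shadow (R m)) \<longrightarrow> End \<omega>' \<in> W"
    if W: "openin (freudenthal X) W" "End \<omega> \<in> W" for W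
  proof -
    obtain m where m: "region (shadow (pre \<xi> m)) \<subseteq> W"
      using end_shadow_neighbourhood[OF W \<omega>] by blast
    have sub: "shadow (R m) \<subseteq> shadow (pre \<xi> m)"
      using shadow_pre_antimono[of m "length w0 + m" \<xi>] by (simp add: pre)
    have "End \<omega>' \<in> W" if "\<omega>' \<in> ends X" "lives_in \<omega>' (shadow (R m))" for \<omega>'
      using m that lives_in_mono[OF that(2) sub] End_in_region by blast
    then show ?thesis by blast
  qed
  have sp': "openin (freudenthal X) U" "openin (freudenthal X) V" "\<And>\<omega>. \<omega> \<in> ends X \<Longrightarrow> End \<omega> \<in> U \<longleftrightarrow> End \<omega> \<notin> V"
    using sp end_in_circle[of _ "base [] ` J"] unfolding splits_def by blast+
  have "\<exists>m b. \<forall>\<omega>'\<in>ends X. lives_in \<omega>' (shadow (R m)) \<longrightarrow> (End \<omega>' \<in> U \<longleftrightarrow> b)"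
  proof (cases "End \<omega> \<in> U")
    case True
    from mono[OF sp'(1) this] show ?thesis by blast
  next
    case False
    then have "End \<omega> \<in> V" using sp'(3)[OF \<omega>(1)] by blast
    from mono[OF sp'(2) this] sp'(3) show ?thesis by blast
  qed
  then show False
    using QR unfolding monochromatic_def by blast
qed

text \<open>A point of \<open>V\<close> lies on some line, and by \<open>ray_color\<close> both
  directions from it must meet a removed vertex. The line would contain both removed vertices, but
  these belong to different lines through the root of the tree.\<close>

lemma ends_one_sided:
  assumes sp: "splits U V (base [] ` {i1, i2})" and i: "i1 < L" "i2 < L" "i1 \<noteq> i2"
    and U: "\<And>\<omega>. \<omega> \<in> ends X \<Longrightarrow> End \<omega> \<in> U"
    and q: "q \<in> V" "q \<in> circle" "q \<notin> pnt ` base [] ` {i1, i2}"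
  shows False
proof -
  let ?N = "base [] ` {i1, i2}"
  have T: "turns [] i1" "turns [] i2"
    using i by (auto simp: turns_def)
  have key: False if g: "g \<in> carrier G" and \<rho>: "0 \<le> \<rho>" "\<rho> \<le> 1" and qg: "q = Point (edge_point g (g \<otimes> s) \<rho>)" for g \<rho>
  proof -
    have one: "s [^] (1::int) = s" "s [^] (0::int) = \<one>"
      using s_carrier by (auto simp: int_pow_1)
    have swap: "edge_point (g \<otimes> s) g (1 - \<rho>) = edge_point g (g \<otimes> s) \<rho>"
      by (auto simp: edge_point_def)
    have "\<exists>k. g \<otimes> s [^] (0 + 1 * int (Suc k)) \<in> ?N"
    proof (rule ccontr)
      assume "\<not> ?thesis"
      then have "\<And>k. g \<otimes> s [^] (0 + 1 * int (Suc k)) \<notin> ?N" by blast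
      from ray_color[OF sp U ray_pow[OF g, of 1 0, OF disjI1[OF refl]] this \<rho>] show False
        using q qg g by (simp add: one)
    qed
    then obtain j where j: "g \<otimes> s [^] (0 + 1 * int (Suc j)) \<in> ?N"
      by blast
    define a where "a = 0 + 1 * int (Suc j)"
    have a: "a \<ge> 1" "g \<otimes> s [^] a \<in> ?N"
      using j unfolding a_def by simp_all
    have "\<exists>k. g \<otimes> s [^] (1 + - 1 * int (Suc k)) \<in> ?N"
    proof (rule ccontr)
      assume "\<not> ?thesis"
      then have "\<And>k. g \<otimes> s [^] (1 + - 1 * int (Suc k)) \<notin> ?N" by blast
      from ray_color[OF sp U ray_pow[OF g, of "- 1" 1, OF disjI2[OF refl]] this, of "1 - \<rho>"] show False
        using q qg g \<rho> by (simp add: one swap)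
    qed
    then obtain k where k: "g \<otimes> s [^] (1 + - 1 * int (Suc k)) \<in> ?N"
      by blast
    define b where "b = 1 + - 1 * int (Suc k)"
    have b: "b \<le> 0" "g \<otimes> s [^] b \<in> ?N"
      using k unfolding b_def by simp_all
    have shift: "(g \<otimes> s [^] c) \<otimes> s [^] (d - c) = g \<otimes> s [^] d" for c d :: int
      using g s_carrier by (simp add: m_assoc int_pow_closed int_pow_mult[symmetric])
    have "g \<otimes> s [^] a \<noteq> g \<otimes> s [^] b"
    proof
      assume "g \<otimes> s [^] a = g \<otimes> s [^] b"
      then have "s [^] a = s [^] b"
        using g s_carrier by (meson int_pow_closed mult_left_cancel)
      then show False using pow_inj a(1) b(1) by force
    qed
    then have "(g \<otimes> s [^] a = base [] i1 \<and> g \<otimes> s [^] b = base [] i2) \<or> (g \<otimes> s [^] a = base [] i2 \<and> g \<otimes> s [^] b = base [] i1)"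
      using a(2) b(2) by auto
    then show False
      using line_avoids[OF T(1) i(2), of "b - a"] line_avoids[OF T(2) i(1), of "b - a"] shift[of a b] i(3) by auto
  qed
  show False
  proof (cases q)
    case (End \<omega>)
    then have "\<omega> \<in> ends X" using q(2) by (auto simp: circle_def)
    then show False
      using U End q(1,2) sp unfolding splits_def by blast
  next
    case (Point p)
    then have "p \<in> realization Y" using q(2) by (auto simp: circle_def)
    then show False
      unfolding realization_def
    proof (elim UnE imageE CollectE exE conjE)
      fix v assume v: "p = vertex_point v" "v \<in> verts Y"
      show False
        by (rule key[of v 0]) (use v Point in \<open>auto simp: edge_point_ends\<close>)
    next
      fix u v \<tau> assume *: "p = edge_point u v \<tau>" "adj Y u v" "\<tau> \<in> {0..1}"
      have "u \<in> carrier G" "v \<in> carrier G" "v = u \<otimes> s \<or> u = v \<otimes> s"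
        using *(2) unfolding adj_Y_iff by auto
      moreover have "edge_point u v \<tau> = edge_point v u (1 - \<tau>)"
        by (auto simp: edge_point_def)
      ultimately show False
        using key[of u \<tau>] key[of v "1 - \<tau>"] *(1,3) Point by auto
    qed
  qed
qed

text \<open>The letter \<open>x\<close> at index \<open>k\<close> gives edge \<open>k\<close> of the
  Whitehead graph at \<open>x\<close>, and the inverse of \<open>x\<close> at \<open>k\<close> gives
  edge \<open>k + 1\<close> modulo \<open>L\<close>. Absence of loops makes this assignment
  injective.\<close>

lemma three_edges:
  assumes "letter_occ (fst x) t \<ge> 3"
  obtains i1 i2 i3 where "i1 < L" "i2 < L" "i3 < L" "i1 \<noteq> i2" "i3 \<noteq> i1" "i3 \<noteq> i2"
    "\<And>i. i \<in> {i1, i2, i3} \<Longrightarrow> t ! i = x \<or> prev_letter i = x"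
proof -
  let ?E = "{i. i < L \<and> (t ! i = x \<or> prev_letter i = x)}" and ?K = "{k. k < L \<and> fst (t ! k) = fst x}"
  define e where "e k = (if t ! k = x then k else Suc k mod L)" for k
  have prev: "(Suc k mod L + L - 1) mod L = k" if "k < L" for k
  proof (cases "Suc k = L")
    case False
    then show ?thesis using that by (simp add: mod_less)
  qed (use that in simp)
  have e: "e k \<in> ?E" if "k \<in> ?K" for k
    using that prev[of k] t(3) by (auto simp: e_def fst_eq_letter)
  have "inj_on e ?K"
  proof (rule inj_onI)
    have mixed: "k \<noteq> Suc k' mod L" if "k \<in> ?K" "k' \<in> ?K" "t ! k = x" "t ! k' \<noteq> x" for k k'
      using no_loop[of k] prev[of k'] that by (auto simp: fst_eq_letter)
    fix k k' assume k: "k \<in> ?K" "k' \<in> ?K" "e k = e k'"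
    have "k = k'" if "Suc k mod L = Suc k' mod L"
    proof -
      have "k < L" "k' < L" using k(1,2) by simp_all
      then show ?thesis using prev[of k] prev[of k'] unfolding that by linarith
    qed
    moreover have "t ! k \<noteq> x \<or> t ! k' = x"
    proof (rule ccontr)
      assume "\<not> ?thesis"
      then have h: "t ! k = x" "t ! k' \<noteq> x" by blast+
      show False using mixed[OF k(1,2) h] k(3) h unfolding e_def by presburger
    qed
    moreover have "t ! k' \<noteq> x \<or> t ! k = x"
    proof (rule ccontr)
      assume "\<not> ?thesis"
      then have h: "t ! k' = x" "t ! k \<noteq> x" by blast+
      show False using mixed[OF k(2,1) h] k(3) h unfolding e_def by presburger
    qed
    ultimately show "k = k'"
      using k(3) unfolding e_def by presburger
  qed
  then have "card ?K \<le> card ?E"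
    using e by (intro card_inj_on_le[of e]) auto
  then have card: "card ?E \<ge> 3"
    using assms by (simp add: letter_occ_card)
  have "\<exists>i\<in>?E. i \<notin> F" if "card F < 3" "finite F" for F
  proof (rule ccontr)
    assume "\<not> ?thesis"
    then have "?E \<subseteq> F" by blast
    then show False using card_mono[OF that(2), of ?E] card that(1) by linarith
  qed
  note pick = this
  obtain i1 where i1: "i1 \<in> ?E" using pick[of "{}"] by auto
  obtain i2 where i2: "i2 \<in> ?E" "i2 \<noteq> i1" using pick[of "{i1}"] by auto
  have "card {i1, i2} < 3" by (simp add: card_insert_if)
  then obtain i3 where "i3 \<in> ?E" "i3 \<noteq> i1" "i3 \<noteq> i2" using pick[of "{i1, i2}"] by auto
  then show thesis
    using that[of i1 i2 i3] i1 i2 by blast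
qed

theorem letter_occ_le_2:
  assumes ham: "hamiltonian_circle_subgraph Y X" and ncv: no_cut_vertex and a: "a \<in> A"
  shows "letter_occ a t \<le> 2"
proof (rule ccontr)
  assume "\<not> ?thesis"
  then have occ: "letter_occ (fst (a, True)) t \<ge> 3" by simp
  let ?x = "(a, True)"
  obtain i1 i2 i3 where i: "i1 < L" "i2 < L" "i3 < L" "i1 \<noteq> i2" "i3 \<noteq> i1" "i3 \<noteq> i2"
    and at: "\<And>i. i \<in> {i1, i2, i3} \<Longrightarrow> t ! i = ?x \<or> prev_letter i = ?x"
    by (rule three_edges[OF occ]) (rule that)
  let ?N = "base [] ` {i1, i2}"
  have T: "turns [] i" if "i < L" for i
    using that by (simp add: turns_def)
  have bc: "base [] i1 \<in> carrier G" "base [] i2 \<in> carrier G"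
    using base_carrier T i by blast+
  have "base [] i1 \<noteq> base [] i2"
    using line_avoids[OF T[OF i(1)] i(2), of 0] i(4) bc(1) by (simp add: int_pow_int)
  then have neq: "pnt (base [] i1) \<noteq> pnt (base [] i2)"
    by simp
  have top: "pnt (base [] i1) \<in> topspace (subtopology (freudenthal X) circle)"
    "pnt (base [] i2) \<in> topspace (subtopology (freudenthal X) circle)"
    unfolding circle_topspace using vertex_in_circle bc by auto
  obtain U' V' where UV: "openin (subtopology (freudenthal X) circle) U'" "openin (subtopology (freudenthal X) circle) V'"
    "U' \<union> V' = circle - {pnt (base [] i1), pnt (base [] i2)}" "U' \<inter> V' = {}" "U' \<noteq> {}" "V' \<noteq> {}"
    using circle_minus_two_points[OF ham[unfolded hamiltonian_circle_subgraph_iff] top neq] unfolding circle_topspace by metis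
  obtain U V where U: "openin (freudenthal X) U" "U' = U \<inter> circle" and V: "openin (freudenthal X) V" "V' = V \<inter> circle"
    using UV(1,2) unfolding openin_subtopology by blast
  have N: "pnt ` ?N = {pnt (base [] i1), pnt (base [] i2)}"
    by auto
  have sp: "splits U V ?N"
    unfolding splits_def N using U V UV(3,4) by blast
  have letters: "fst (t ! i) \<in> A" "fst (prev_letter i) \<in> A" if "i < L" for i
    using t(2,3) that nth_mem[OF that] nth_mem[of "(i + L - 1) mod L" t] by auto
  have mono: "monochromatic U ([] @ [x])" if "fst x \<in> A" for x
    using monochromatic_all[OF ncv sp, of "[x]"] i that by (simp add: reduced_def)
  have edge: "child_color U [] (prev_letter i) = child_color U [] (t ! i)" if "i < L" "i \<noteq> i1" "i \<noteq> i2" for i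
  proof (rule edge_child_color[OF sp T[OF that(1)]])
    show "base [] i \<otimes> s [^] (k::int) \<notin> ?N" for k
      using line_avoids[OF T[OF that(1)], of i1 k] line_avoids[OF T[OF that(1)], of i2 k] that i by auto
  qed (use mono letters that(1) in blast)+
  have const: "child_color U [] x = child_color U [] y" if "fst x \<in> A" "fst y \<in> A" "x \<noteq> ?x" "y \<noteq> ?x" for x y
  proof (rule no_cut_vertexD[OF ncv _ _ that])
    show "fst ?x \<in> A" using a by simp
    fix i assume "i < L" "prev_letter i \<noteq> ?x" "t ! i \<noteq> ?x"
    then show "child_color U [] (prev_letter i) = child_color U [] (t ! i)"
      using edge at by blast
  qed
  \<comment> \<open>The third edge at \<open>?x\<close> belongs to a line without removed vertices
    and ties the colour of \<open>?x\<close> to that of another letter.\<close>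
  obtain y where y: "fst y \<in> A" "y \<noteq> ?x" "child_color U [] ?x = child_color U [] y"
    using edge[OF i(3,5,6)] at[of i3] no_loop[OF i(3)] letters[OF i(3)] by (metis insertCI)
  have all: "End \<omega> \<in> U \<longleftrightarrow> child_color U [] y" if \<omega>: "\<omega> \<in> ends X" for \<omega>
  proof -
    have "lives_in \<omega> (shadow [])"
      using end_in_level[OF \<omega>, of 0] by simp
    then show ?thesis
    proof (rule child_shadow[OF \<omega>])
      fix x assume x: "fst x \<in> A" "lives_in \<omega> (shadow ([] @ [x]))"
      have "child_color U [] x = child_color U [] y"
        using const[OF x(1) y(1) _ y(2)] y(3) by (cases "x = ?x") auto
      then show ?thesis
        using child_color_eq[OF mono[OF x(1)] \<omega> x(2)] by simp
    qed
  qed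
  have sides: "End \<omega> \<in> U \<or> End \<omega> \<in> V" if "\<omega> \<in> ends X" for \<omega>
    using sp end_in_circle[OF that, of ?N] unfolding splits_def by blast
  show False
  proof (cases "child_color U [] y")
    case True
    obtain q where "q \<in> V" "q \<in> circle" "q \<notin> pnt ` ?N"
      using UV(3,6) V(2) N by blast
    then show False
      using ends_one_sided[OF sp i(1,2,4)] all True by blast
  next
    case False
    obtain q where "q \<in> U" "q \<in> circle" "q \<notin> pnt ` ?N"
      using UV(3,5) U(2) N by blast
    then show False
      using ends_one_sided[OF splits_sym[OF sp] i(1,2,4)] all False sides by blast
  qed
qed

end

section \<open>The standard words\<close>

lemma letter_occ_squares:
  "distinct (map fst cs) \<Longrightarrow> letter_occ a (squares cs) = (if a \<in> fst ` set cs then 2 else 0)"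
  by (induction cs) auto

lemma letter_occ_commutators:
  "distinct (map fst (pair_letters ps)) \<Longrightarrow>
     letter_occ a (commutators ps) = (if a \<in> fst ` set (pair_letters ps) then 2 else 0)"
proof (induction ps)
  case (Cons p ps)
  then show ?case by (cases p) auto
qed simp

lemma hd_fst_neq: "fst x \<notin> fst ` set w \<Longrightarrow> w \<noteq> [] \<Longrightarrow> hd w \<noteq> inv_letter x"
  by (metis fst_inv_letter hd_in_set image_eqI)

lemma reduced_squares: "distinct (map fst cs) \<Longrightarrow> reduced (squares cs)"
proof (induction cs)
  case (Cons p cs)
  then show ?case
    using hd_fst_neq[of p "squares cs"] by (auto simp: reduced_Cons)
qed simp

lemma reduced_commutators: "distinct (map fst (pair_letters ps)) \<Longrightarrow> reduced (commutators ps)"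
proof (induction ps)
  case (Cons pq ps)
  obtain p q where pq: "pq = (p, q)" by (cases pq)
  have neq: "fst p \<noteq> fst q" "fst q \<notin> fst ` set (pair_letters ps)"
    using Cons.prems by (auto simp: pq)
  have "commutators ps = [] \<or> hd (commutators ps) \<noteq> q"
    using hd_fst_neq[of "inv_letter q" "commutators ps"] neq(2) by auto
  then show ?case
    using Cons neq(1) by (auto simp: pq reduced_Cons)
qed simp

text \<open>Each square links a letter to its inverse and, through it, to the next square, so
  \<open>B\<close> contains all of these letters or none.\<close>

lemma linked_squares:
  assumes "successively (\<lambda>x y. y \<in> B \<longleftrightarrow> inv_letter x \<in> B) (squares (p # cs))"
    and "fst x \<in> fst ` set (p # cs)"
  shows "x \<in> B \<longleftrightarrow> p \<in> B"
  using assms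
proof (induction cs arbitrary: p)
  case Nil
  then show ?case by (auto simp: fst_eq_letter)
next
  case (Cons q cs)
  have pq: "p \<in> B \<longleftrightarrow> inv_letter p \<in> B" "q \<in> B \<longleftrightarrow> inv_letter p \<in> B"
    and tail: "successively (\<lambda>x y. y \<in> B \<longleftrightarrow> inv_letter x \<in> B) (squares (q # cs))"
    using Cons.prems(1) by auto
  show ?case
  proof (cases "fst x = fst p")
    case True
    then show ?thesis using pq(1) by (auto simp: fst_eq_letter)
  next
    case False
    then show ?thesis using Cons.IH[OF tail] Cons.prems(2) pq by auto
  qed
qed

text \<open>Within one commutator the consecutive pairs link \<open>p\<close>, \<open>q\<close> and
  their inverses except for one closing edge, which the next commutator supplies: its first letter
  is linked to \<open>q\<close>.\<close>

lemma linked_commutators: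
  assumes "successively (\<lambda>x y. y \<in> B \<longleftrightarrow> inv_letter x \<in> B) (commutators ((p, q) # ps))"
    and "fst x \<in> fst ` set (pair_letters ((p, q) # ps))"
  shows "x \<in> B \<longleftrightarrow> p \<in> B"
  using assms
proof (induction ps arbitrary: p q)
  case Nil
  then show ?case by (auto simp: fst_eq_letter)
next
  case (Cons r ps)
  obtain p' q' where r: "r = (p', q')" by (cases r)
  have pq: "q \<in> B \<longleftrightarrow> inv_letter p \<in> B" "inv_letter p \<in> B \<longleftrightarrow> inv_letter q \<in> B"
    "inv_letter q \<in> B \<longleftrightarrow> p \<in> B" "p' \<in> B \<longleftrightarrow> q \<in> B"
    and tail: "successively (\<lambda>x y. y \<in> B \<longleftrightarrow> inv_letter x \<in> B) (commutators ((p', q') # ps))"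
    using Cons.prems(1) by (auto simp: r)
  show ?case
  proof (cases "fst x = fst p \<or> fst x = fst q")
    case True
    then show ?thesis using pq by (auto simp: fst_eq_letter)
  next
    case False
    then have "fst x \<in> fst ` set (pair_letters ((p', q') # ps))"
      using Cons.prems(2) by (auto simp: r)
    then show ?thesis using Cons.IH[OF tail] pq by blast
  qed
qed

lemma (in free_cayley) hamiltonian_if_linked:
  assumes "A \<noteq> {}" "\<And>a. a \<in> A \<Longrightarrow> letter_occ a (\<phi> s) = 2"
    and "\<And>B x. successively (\<lambda>x y. y \<in> B \<longleftrightarrow> inv_letter x \<in> B) (\<phi> s) \<Longrightarrow> fst x \<in> A \<Longrightarrow> x \<in> B \<longleftrightarrow> p \<in> B"
  shows "hamiltonian_circle_subgraph Y X"
proof -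
  interpret free_circle G A \<phi> S s
  proof (unfold_locales, fact assms(2), fact assms(1))
    fix B assume B: "B \<subseteq> {x. fst x \<in> A}" "B \<noteq> {}"
      "\<And>i. i < length (\<phi> s) \<Longrightarrow> \<phi> s ! (Suc i mod length (\<phi> s)) \<in> B \<longleftrightarrow> inv_letter (\<phi> s ! i) \<in> B"
    have "successively (\<lambda>x y. y \<in> B \<longleftrightarrow> inv_letter x \<in> B) (\<phi> s)"
      unfolding successively_conv_nth
    proof (intro allI impI)
      fix i assume "Suc i < length (\<phi> s)"
      then show "\<phi> s ! Suc i \<in> B \<longleftrightarrow> inv_letter (\<phi> s ! i) \<in> B"
        using B(3)[of i] by simp
    qed
    from assms(3)[OF this] show "B = {x. fst x \<in> A}"
      using B(1,2) by blast
  qed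
  show ?thesis
    unfolding hamiltonian_circle_subgraph_iff by (rule circle_homeomorphic_sphere)
qed

lemma (in free_cayley) hamiltonian_squares:
  assumes "\<phi> s = reduce (squares cs)" "cs \<noteq> []" "distinct (map fst cs)" "fst ` set cs = A"
  shows "hamiltonian_circle_subgraph Y X"
proof (rule hamiltonian_if_linked[of "hd cs"])
  have \<phi>: "\<phi> s = squares (hd cs # tl cs)"
    using assms by (simp add: reduced_squares reduce_reduced del: squares_simps)
  show "A \<noteq> {}" "\<And>a. a \<in> A \<Longrightarrow> letter_occ a (\<phi> s) = 2"
    using assms by (auto simp: reduced_squares reduce_reduced letter_occ_squares)
  fix B and x :: "'a \<times> bool" assume "successively (\<lambda>x y. y \<in> B \<longleftrightarrow> inv_letter x \<in> B) (\<phi> s)" "fst x \<in> A"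
  then show "x \<in> B \<longleftrightarrow> hd cs \<in> B"
    using linked_squares[of B "hd cs" "tl cs" x] assms(2,4) unfolding \<phi> by simp
qed

lemma (in free_cayley) hamiltonian_commutators:
  assumes "\<phi> s = reduce (commutators ps)" "ps \<noteq> []" "distinct (map fst (pair_letters ps))"
    "fst ` set (pair_letters ps) = A"
  shows "hamiltonian_circle_subgraph Y X"
proof -
  obtain p q qs where ps: "ps = (p, q) # qs"
    using assms(2) by (cases ps) auto
  have \<phi>: "\<phi> s = commutators ps"
    using assms by (simp add: reduced_commutators reduce_reduced)
  show ?thesis
  proof (rule hamiltonian_if_linked[of p])
    show "A \<noteq> {}"
      using assms(4) by (auto simp: ps)
    show "\<And>a. a \<in> A \<Longrightarrow> letter_occ a (\<phi> s) = 2"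
      using assms by (simp add: \<phi> letter_occ_commutators)
    fix B and x :: "'a \<times> bool" assume "successively (\<lambda>x y. y \<in> B \<longleftrightarrow> inv_letter x \<in> B) (\<phi> s)" "fst x \<in> A"
    then show "x \<in> B \<longleftrightarrow> p \<in> B"
      unfolding \<phi> ps using linked_commutators[of B p q qs x] assms(4)[unfolded ps] by blast
  qed
qed

section \<open>Words of minimal length in rank two\<close>

lemma length_reduce: "length (reduce w) \<le> length w"
proof (induction w)
  case (Cons x w)
  then show ?case by (cases "reduce w") (auto simp: reduce_Cons)
qed simp

lemma length_reduce_Cons: "length (reduce (x # w)) \<le> Suc (length (reduce w))"
  by (cases "reduce w") (auto simp: reduce_Cons)

text \<open>Minimality of length has to be exploited for the cyclic word; conjugation provides
  cyclic reduction and rotation.\<close>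

lemma conjugation_iso:
  assumes p: "fst ` set p \<subseteq> A"
  shows "(\<lambda>w. reduce (winv p @ w @ p)) \<in> iso (free_group A) (free_group A)"
proof -
  have carrier: "reduce (winv u @ w @ u) \<in> carrier (free_group A)"
    if "w \<in> carrier (free_group A)" "fst ` set u \<subseteq> A" for u w
    using that by (intro reduce_in_carrier) (auto simp: carrier_free_group image_Un)
  have inv: "reduce (winv (winv u) @ reduce (winv u @ w @ u) @ winv u) = w" if "w \<in> carrier (free_group A)" for u w
  proof -
    have "reduce (u @ reduce (winv u @ w @ u) @ winv u) = reduce (reduce (u @ reduce (winv u @ w @ u)) @ winv u)"
      by (simp only: reduce_append_left append_assoc)
    also have "reduce (u @ reduce (winv u @ w @ u)) = reduce (w @ u)"
      by (simp only: reduce_append_right reduce_winv_cancel append_assoc)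
    also have "reduce (reduce (w @ u) @ winv u) = reduce w"
      by (simp only: reduce_append_left append_assoc reduce_winv_cancel)
    finally show ?thesis
      using that by (simp add: carrier_free_group reduce_reduced)
  qed
  show ?thesis
    unfolding iso_def
  proof (intro CollectI conjI homI)
    fix u v assume "u \<in> carrier (free_group A)" "v \<in> carrier (free_group A)"
    have "reduce (reduce (winv p @ u @ p) @ reduce (winv p @ v @ p)) = reduce ((winv p @ u) @ p @ winv p @ (v @ p))"
      by (simp only: reduce_append_left reduce_append_right append_assoc)
    also have "\<dots> = reduce (winv p @ (u @ v) @ p)"
      unfolding reduce_winv_cancel by simp
    also have "\<dots> = reduce (winv p @ reduce (reduce (u @ v) @ p))"
      by (simp only: reduce_append_left reduce_append_right)
    finally show "reduce (winv p @ (u \<otimes>\<^bsub>free_group A\<^esub> v) @ p) =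
        reduce (winv p @ u @ p) \<otimes>\<^bsub>free_group A\<^esub> reduce (winv p @ v @ p)"
      by (simp only: mult_free_group reduce_append_right)
  next
    show "bij_betw (\<lambda>w. reduce (winv p @ w @ p)) (carrier (free_group A)) (carrier (free_group A))"
    proof (rule bij_betw_byWitness[where f' = "\<lambda>w. reduce (p @ w @ winv p)"]; intro ballI image_subsetI)
      fix w assume w: "w \<in> carrier (free_group A)"
      show "reduce (p @ reduce (winv p @ w @ p) @ winv p) = w"
        by (rule inv[OF w, of p, unfolded winv_winv])
      show "reduce (winv p @ reduce (p @ w @ winv p) @ p) = w"
        by (rule inv[OF w, of "winv p", unfolded winv_winv])
      show "reduce (winv p @ w @ p) \<in> carrier (free_group A)"
        by (rule carrier[OF w p])
      show "reduce (p @ w @ winv p) \<in> carrier (free_group A)"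
        by (rule carrier[OF w, of "winv p", unfolded winv_winv]) (use p in simp)
    qed
  qed (use carrier p in blast)
qed

text \<open>If every edge at \<open>y\<close> leads to \<open>z\<close>, then \<open>y \<mapsto> z y\<close> cancels at each occurrence of \<open>y\<close>.\<close>

lemma length_reduce_subst:
  assumes "fst y \<noteq> fst z"
    and "successively (\<lambda>c d. (d = y \<longrightarrow> c = inv_letter z) \<and> (c = inv_letter y \<longrightarrow> d = z)) u"
    and "u \<noteq> [] \<Longrightarrow> hd u \<noteq> y \<and> last u \<noteq> inv_letter y"
  shows "length (reduce (subst (lsub y [z] []) u)) + letter_occ (fst y) u \<le> length u"
  using assms(2,3)
proof (induction u rule: length_induct)
  case (1 u)
  let ?h = "lsub y [z] []"
  note IH = 1(1)[rule_format]
  have neq: "y \<noteq> z" "y \<noteq> inv_letter z" "z \<noteq> inv_letter y" "inv_letter z \<noteq> inv_letter y" "inv_letter y \<noteq> inv_letter z"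
    using assms(1) by (auto simp: fst_eq_letter)
  show ?case
  proof (cases u)
    case (Cons c v)
    have c: "c \<noteq> y" using 1(3) Cons by simp
    show ?thesis
    proof (cases "c = inv_letter y")
      \<comment> \<open>The pair \<open>inv_letter y\<close>, \<open>z\<close> is consumed together,
        since its image reduces to \<open>inv_letter y\<close>; below, the pair
        \<open>inv_letter z\<close>, \<open>y\<close> is likewise reduced to
        \<open>y\<close>.\<close>
      case True
      then obtain v' where v: "v = z # v'"
        using 1(2,3) Cons by (cases v) auto
      have "length (reduce (subst ?h v')) + letter_occ (fst y) v' \<le> length v'"
        using 1(2,3) neq by (intro IH) (auto simp: Cons v successively_Cons)
      moreover have "reduce (subst ?h u) = reduce (inv_letter y # subst ?h v')"
        using neq reduce_winv_cancel(1)[of "[inv_letter y]" "[z]" "subst ?h v'"]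
        by (simp add: Cons v True subst_Cons lsub_def)
      ultimately show ?thesis
        using length_reduce_Cons[of "inv_letter y" "subst ?h v'"] assms(1) by (simp add: Cons v True)
    next
      case False
      then have hc: "?h c = [c]" "fst c \<noteq> fst y"
        using c by (auto simp: lsub_def fst_eq_letter)
      show ?thesis
      proof (cases "\<exists>v'. v = y # v'")
        case True
        then obtain v' where v: "v = y # v'" ..
        have cz: "c = inv_letter z" using 1(2) by (simp add: Cons v)
        have "length (reduce (subst ?h v')) + letter_occ (fst y) v' \<le> length v'"
          using 1(2,3) neq by (intro IH) (auto simp: Cons v successively_Cons)
        moreover have "reduce (subst ?h u) = reduce (y # subst ?h v')"
          using hc reduce_winv_cancel(1)[of "[]" "[z]" "y # subst ?h v'"]
          by (simp add: Cons v cz subst_Cons lsub_def)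
        ultimately show ?thesis
          using length_reduce_Cons[of y "subst ?h v'"] hc(2) by (simp add: Cons v)
      next
        case no: False
        have "length (reduce (subst ?h v)) + letter_occ (fst y) v \<le> length v"
          using 1(2,3) no by (intro IH) (auto simp: Cons successively_Cons neq_Nil_conv)
        then show ?thesis
          using length_reduce_Cons[of c "subst ?h v"] hc by (simp add: Cons subst_Cons)
      qed
    qed
  qed simp
qed

lemma cyclic_closed:
  assumes "\<And>i. i < L \<Longrightarrow> P i \<Longrightarrow> P (Suc i mod L)" "i < L" "P i" "j < L"
  shows "P (j :: nat)"
proof -
  have "P ((i + k) mod L)" for k
  proof (induction k)
    case (Suc k)
    have "(i + k) mod L < L" using assms(2) by simp
    from assms(1)[OF this Suc] show ?case
      by (simp add: mod_Suc_eq)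
  qed (use assms(2,3) in simp)
  from this[of "L - i + j"] show ?thesis
    using assms(2,4) by simp
qed

text \<open>\<open>edge p q\<close> describes the adjacencies of the cyclic word \<open>t\<close>, that is, its Whitehead graph.\<close>

locale minimal_word =
  fixes A :: "'a set" and t :: "'a word"
  assumes t_carrier: "t \<in> carrier (free_group A)" and letters: "fst ` set t = A" and A_nonempty: "A \<noteq> {}"
    and minimal: "\<psi> \<in> iso (free_group A) (free_group A) \<Longrightarrow> length t \<le> length (\<psi> t)"
begin

abbreviation L :: nat where "L \<equiv> length t"

definition edge :: "'a \<times> bool \<Rightarrow> 'a \<times> bool \<Rightarrow> bool" where
  "edge p q \<longleftrightarrow> (\<exists>i<L. (inv_letter (t ! i) = p \<and> t ! (Suc i mod L) = q) \<or>
     (inv_letter (t ! i) = q \<and> t ! (Suc i mod L) = p))"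

lemma t_nonempty: "t \<noteq> []"
  using letters A_nonempty by auto

lemma t_reduced: "reduced t" "reduce t = t"
  using t_carrier by (auto simp: carrier_free_group reduce_reduced)

text \<open>Otherwise conjugation by the first letter would shorten \<open>t\<close> by two.\<close>

lemma cyclically_reduced: "hd t \<noteq> inv_letter (last t)"
proof
  assume eq: "hd t = inv_letter (last t)"
  have "tl t \<noteq> []"
    using eq t_nonempty by (cases t) auto
  then obtain v where t: "t = hd t # v @ [last t]"
    using t_nonempty by (metis append_butlast_last_id last_tl list.collapse)
  have "length t \<le> length (reduce (winv [hd t] @ t @ [hd t]))"
    by (rule minimal[OF conjugation_iso]) (use t_nonempty letters in auto)
  also have "winv [hd t] @ t @ [hd t] = winv [hd t] @ [hd t] @ (v @ [last t] @ [hd t])"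
    by (subst (2) t) simp
  also have "reduce \<dots> = reduce (v @ [last t] @ [hd t])"
    by (rule reduce_winv_cancel)
  also have "v @ [last t] @ [hd t] = v @ winv [hd t] @ [hd t]"
    using eq by simp
  also have "reduce \<dots> = reduce v"
    by (rule reduce_winv_cancel)
  also have "length (reduce v) \<le> length v"
    by (rule length_reduce)
  finally show False
    by (subst (asm) t) simp
qed

lemma no_loop: "i < L \<Longrightarrow> t ! (Suc i mod L) \<noteq> inv_letter (t ! i)"
proof (cases "Suc i = L")
  case True
  then show ?thesis
    using cyclically_reduced t_nonempty by (metis diff_Suc_1 hd_conv_nth last_conv_nth mod_self)
next
  case False
  then show "i < L \<Longrightarrow> ?thesis"
    using reduced_nth[OF t_reduced(1), of i] by simp
qed

lemma edge_neq: "edge p q \<Longrightarrow> p \<noteq> q"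
  using no_loop unfolding edge_def by metis

lemma edge_letter: "edge p q \<Longrightarrow> fst p \<in> A \<and> fst q \<in> A"
proof -
  have *: "fst (t ! i) \<in> A" if "i < L" for i
    using nth_mem[OF that] letters by blast
  have "Suc i mod L < L" for i
    using t_nonempty by simp
  note ** = *[OF this]
  assume "edge p q"
  then obtain i where "i < L" "inv_letter (t ! i) = p \<and> t ! (Suc i mod L) = q \<or>
     inv_letter (t ! i) = q \<and> t ! (Suc i mod L) = p"
    unfolding edge_def by blast
  then show "fst p \<in> A \<and> fst q \<in> A"
    using *[of i] **[of i] by auto
qed

text \<open>A rotation is a conjugate of \<open>t\<close>, so rotating and then substituting is an
  automorphism to which minimality applies.\<close>

lemma length_rotate:
  assumes "\<And>x. h (inv_letter x) = winv (h x)"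
    and "(\<lambda>w. reduce (subst h w)) \<in> iso (free_group A) (free_group A)"
  shows "length t \<le> length (reduce (subst h (rotate j t)))"
proof -
  let ?u = "take (j mod L) t" and ?v = "drop (j mod L) t"
  have "fst ` set ?u \<subseteq> A"
    using image_mono[OF set_take_subset[of "j mod L" t], of fst] letters by simp
  from iso_set_trans[OF conjugation_iso[OF this] assms(2)]
  have "length t \<le> length (reduce (subst h (reduce (winv ?u @ t @ ?u))))"
    using minimal by force
  also have "winv ?u @ t @ ?u = winv ?u @ ?u @ (?v @ ?u)"
    by (metis append_assoc append_take_drop_id)
  also have "reduce \<dots> = reduce (?v @ ?u)"
    by (rule reduce_winv_cancel)
  also have "?v @ ?u = rotate j t"
    by (simp add: rotate_drop_take)
  finally show ?thesis
    by (simp add: reduce_subst_reduce assms(1))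
qed

text \<open>Otherwise all edges at \<open>y\<close> lead to \<open>z\<close>, and the Whitehead move
  of \<open>length_reduce_subst\<close> would shorten a rotation of \<open>t\<close>.\<close>

lemma edge_avoiding:
  assumes y: "fst y \<in> A" "fst z \<in> A" "fst y \<noteq> fst z"
  obtains q where "edge y q" "q \<noteq> z"
proof (rule ccontr)
  assume "\<not> thesis"
  then have only: "q = z" if "edge y q" for q
    using that(1) \<open>\<And>q. edge y q \<Longrightarrow> q \<noteq> z \<Longrightarrow> thesis\<close> that by blast
  have pred: "t ! i = inv_letter z" if "i < L" "t ! (Suc i mod L) = y" for i
    using only[of "inv_letter (t ! i)"] that unfolding edge_def by (metis inv_letter_invol)
  have succ: "t ! (Suc i mod L) = z" if "i < L" "t ! i = inv_letter y" for i
    using only[of "t ! (Suc i mod L)"] that unfolding edge_def by (metis inv_letter_invol)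
  have neq: "z \<noteq> inv_letter y" "inv_letter z \<noteq> inv_letter y" "inv_letter z \<noteq> y"
    using y(3) by (auto simp: fst_eq_letter)
  have "fst y \<in> fst ` set t" using y(1) letters by simp
  then obtain c where "c \<in> set t" "fst c = fst y"
    by (metis imageE)
  then obtain k where k: "k < L" "t ! k = y \<or> t ! k = inv_letter y"
    unfolding in_set_conv_nth fst_eq_letter by blast
  \<comment> \<open>Starting the rotation at such a letter prevents a cancelling pair from being
    split between the last and the first position.\<close>
  obtain j where j: "j < L" "t ! j = inv_letter z \<or> t ! j = inv_letter y"
  proof (cases "t ! k = y")
    case True
    define i where "i = (k + L - 1) mod L"
    have "Suc i mod L = k" "i < L"
      using k(1) by (cases k; auto simp: i_def)+
    then show thesis
      using pred[of i] True that[of i] by simp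
  qed (use k that in blast)
  let ?u = "rotate j t"
  have nth: "?u ! i = t ! ((j + i) mod L)" if "i < L" for i
    using that by (simp add: nth_rotate)
  have hd: "hd ?u = t ! j"
    using nth[of 0] j(1) t_nonempty by (simp add: hd_conv_nth)
  have "Suc ((j + (L - 1)) mod L) mod L = j"
  proof -
    have "Suc (j + (L - 1)) = j + L"
      using j(1) by arith
    then show ?thesis
      using j(1) by (simp only: mod_Suc_eq mod_add_self2 mod_less)
  qed
  moreover have "last ?u = t ! ((j + (L - 1)) mod L)"
    using nth[of "L - 1"] j(1) t_nonempty by (simp add: last_conv_nth)
  ultimately have last: "last ?u \<noteq> inv_letter y"
    using succ[of "(j + (L - 1)) mod L"] j neq t_nonempty by (auto simp: mod_less_divisor)
  have "length (reduce (subst (lsub y [z] []) ?u)) + letter_occ (fst y) ?u \<le> length ?u"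
  proof (rule length_reduce_subst[OF y(3)])
    show "successively (\<lambda>c d. (d = y \<longrightarrow> c = inv_letter z) \<and> (c = inv_letter y \<longrightarrow> d = z)) ?u"
      unfolding successively_conv_nth
    proof (intro allI impI)
      fix i assume "Suc i < length ?u"
      then have "?u ! i = t ! ((j + i) mod L)" "?u ! Suc i = t ! (Suc ((j + i) mod L) mod L)" "(j + i) mod L < L"
        using nth[of i] nth[of "Suc i"] t_nonempty by (auto simp: mod_Suc_eq)
      then show "(?u ! Suc i = y \<longrightarrow> ?u ! i = inv_letter z) \<and> (?u ! i = inv_letter y \<longrightarrow> ?u ! Suc i = z)"
        using pred succ by metis
    qed
    show "hd ?u \<noteq> y \<and> last ?u \<noteq> inv_letter y"
      using hd last j(2) neq by auto
  qed
  moreover have "length t \<le> length (reduce (subst (lsub y [z] []) ?u))"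
    using y by (intro length_rotate lsub_inv lsub_iso) auto
  moreover have "letter_occ (fst y) ?u \<noteq> 0"
    using y(1) letters by (simp add: letter_occ_eq_0_iff)
  ultimately show False
    by simp
qed

text \<open>Otherwise \<open>x\<close> would be preceded only by \<open>x\<close> and its inverse
  followed only by its inverse; going around the cyclic word leaves no place for
  \<open>b\<close>.\<close>

lemma edge_other_letter:
  assumes "fst x \<in> A" "b \<in> A" "b \<noteq> fst x"
  obtains q where "edge x q" "fst q \<noteq> fst x"
proof (rule ccontr)
  assume "\<not> thesis"
  then have only: "q = inv_letter x" if "edge x q" for q
    using edge_neq[OF that] that \<open>\<And>q. edge x q \<Longrightarrow> fst q \<noteq> fst x \<Longrightarrow> thesis\<close> fst_eq_letter[of q x] by blast
  have fwd: "t ! (Suc i mod L) = inv_letter x" if "i < L" "t ! i = inv_letter x" for i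
    using only[of "t ! (Suc i mod L)"] that unfolding edge_def by (metis inv_letter_invol)
  have bwd: "t ! i = x" if "i < L" "t ! (Suc i mod L) = x" for i
    using only[of "inv_letter (t ! i)"] that unfolding edge_def by (metis inv_letter_invol)
  have "b \<in> fst ` set t" "fst x \<in> fst ` set t"
    using assms letters by auto
  then obtain j k where j: "j < L" "fst (t ! j) = b" and k: "k < L" "fst (t ! k) = fst x"
    by (auto simp: in_set_conv_nth)
  have "t ! k \<noteq> x"
    by (rule cyclic_closed[where P = "\<lambda>i. t ! i \<noteq> x", OF _ j(1) _ k(1)]) (use bwd j assms(3) in auto)
  then have "t ! k = inv_letter x"
    using k(2) by (simp add: fst_eq_letter)
  then have "t ! j = inv_letter x"
    using cyclic_closed[where P = "\<lambda>i. t ! i = inv_letter x", OF fwd k(1) _ j(1)] by blast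
  then show False
    using j(2) assms(3) by simp
qed

text \<open>In rank two only \<open>inv_letter z\<close> and the letters \<open>y\<close>,
  \<open>inv_letter y\<close> of the other generator remain beside \<open>z\<close>. One edge joins
  \<open>inv_letter z\<close> to \<open>y\<close> by \<open>edge_other_letter\<close>, and
  \<open>edge_avoiding\<close> yields an edge from \<open>inv_letter y\<close> to one of these
  two.\<close>

lemma edge_connected:
  assumes A: "card A = 2" and z: "fst z \<in> A"
    and P: "\<And>p q. edge p q \<Longrightarrow> p \<noteq> z \<Longrightarrow> q \<noteq> z \<Longrightarrow> P p = P q"
    and x: "fst x \<in> A" "x \<noteq> z"
  shows "P x = (P (inv_letter z) :: bool)"
proof -
  have two: "c = a" if "a \<in> A" "c \<in> A" "a \<noteq> fst z" "c \<noteq> fst z" for a c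
    using A z that by (metis card_2_iff')
  obtain b where b: "b \<in> A" "b \<noteq> fst z"
    using A z by (metis card_2_iff')
  obtain y where y: "edge (inv_letter z) y" "fst y \<noteq> fst z"
    using edge_other_letter[of "inv_letter z" b] z b by auto
  have yA: "fst y \<in> A" using edge_letter[OF y(1)] by simp
  have Py: "P y = P (inv_letter z)"
    using P[OF y(1)] y(2) by force
  obtain q where q: "edge (inv_letter y) q" "q \<noteq> z"
    using edge_avoiding[of "inv_letter y" z] yA z y(2) by auto
  have "q = y \<or> q = inv_letter z"
    using edge_letter[OF q(1)] edge_neq[OF q(1)] q(2) two[OF yA, of "fst q"] y(2) by (metis fst_eq_letter)
  moreover have "P (inv_letter y) = P q"
    using P[OF q(1) _ q(2)] y(2) by (metis fst_inv_letter)
  ultimately have "P (inv_letter y) = P (inv_letter z)"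
    using Py by auto
  moreover have "x = inv_letter z \<or> x = y \<or> x = inv_letter y"
    using two[OF yA x(1) y(2)] x(2) by (metis fst_eq_letter)
  ultimately show ?thesis using Py by auto
qed

text \<open>The vertex \<open>?y\<close> has two different neighbours, and the two edges come from
  different occurrences of the generator.\<close>

lemma letter_occ_ge_2:
  assumes A: "card A = 2" and a: "a \<in> A"
  shows "letter_occ a t \<ge> 2"
proof (rule ccontr)
  assume "\<not> ?thesis"
  then have "card {k. k < L \<and> fst (t ! k) = a} \<le> 1"
    by (simp add: letter_occ_card)
  then have one: "k = k'" if "k < L" "fst (t ! k) = a" "k' < L" "fst (t ! k') = a" for k k'
    using that card_le_Suc0_iff_eq[of "{k. k < L \<and> fst (t ! k) = a}"] by auto
  let ?y = "(a, True)"
  obtain b where b: "b \<in> A" "b \<noteq> a"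
    using A a by (metis card_2_iff')
  obtain z where z: "edge ?y z" "fst z \<noteq> a"
    using edge_other_letter[of ?y b] a b by auto
  obtain q where q: "edge ?y q" "q \<noteq> z"
    using edge_avoiding[of ?y z] edge_letter[OF z(1)] z(2) by auto
  obtain i where i: "i < L" "inv_letter (t ! i) = ?y \<and> t ! (Suc i mod L) = z \<or> inv_letter (t ! i) = z \<and> t ! (Suc i mod L) = ?y"
    using z(1) unfolding edge_def by blast
  obtain j where j: "j < L" "inv_letter (t ! j) = ?y \<and> t ! (Suc j mod L) = q \<or> inv_letter (t ! j) = q \<and> t ! (Suc j mod L) = ?y"
    using q(1) unfolding edge_def by blast
  have fy: "fst (t ! k) = a" if "inv_letter (t ! k) = ?y" for k
    using that by (metis fst_conv fst_inv_letter)
  have lt: "Suc k mod L < L" for k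
    using t_nonempty by simp
  have inj: "k = k'" if "Suc k mod L = Suc k' mod L" "k < L" "k' < L" for k k'
    using that by (auto simp: mod_Suc split: if_splits)
  show False
    using i(2)
  proof
    assume *: "inv_letter (t ! i) = ?y \<and> t ! (Suc i mod L) = z"
    show False
      using j(2)
    proof
      assume "inv_letter (t ! j) = ?y \<and> t ! (Suc j mod L) = q"
      then show False
        using one[OF i(1) _ j(1)] * fy q(2) by metis
    next
      assume **: "inv_letter (t ! j) = q \<and> t ! (Suc j mod L) = ?y"
      then have "i = Suc j mod L"
        using one[OF i(1) fy lt] * by simp
      then show False
        using * ** inv_letter_neq(1)[of ?y] by simp
    qed
  next
    assume *: "inv_letter (t ! i) = z \<and> t ! (Suc i mod L) = ?y"
    show False
      using j(2)
    proof
      assume **: "inv_letter (t ! j) = ?y \<and> t ! (Suc j mod L) = q"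
      then have "j = Suc i mod L"
        using one[OF j(1) fy lt] * by simp
      then show False
        using * ** inv_letter_neq(1)[of ?y] by simp
    next
      assume **: "inv_letter (t ! j) = q \<and> t ! (Suc j mod L) = ?y"
      then have "Suc i mod L = Suc j mod L"
        using one[OF lt _ lt] * by simp
      then show False
        using inj[OF _ i(1) j(1)] * ** q(2) by metis
    qed
  qed
qed

end

lemma (in free_cayley) hamiltonian_minimal_quadratic:
  assumes ham: "hamiltonian_circle_subgraph Y X" and A: "card A = 2" and a: "a \<in> A"
    and min: "\<And>\<psi>. \<psi> \<in> iso (free_group A) (free_group A) \<Longrightarrow> length (\<phi> s) \<le> length (\<psi> (\<phi> s))"
  shows "letter_occ a (\<phi> s) = 2"
proof -
  have s: "s \<in> carrier G" using s_in S_carrier by blast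
  have t: "\<phi> s \<in> carrier (free_group A)"
    using \<phi>_iso s by (auto simp: iso_def hom_def)
  have letters: "fst ` set (\<phi> s) = A"
    using missing_letter_not_circle ham t by (auto simp: carrier_free_group)
  interpret W: minimal_word A "\<phi> s"
    by unfold_locales (use t letters a min in auto)
  interpret C: cyclic_cayley G A \<phi> S s
    by unfold_locales (use W.t_nonempty W.cyclically_reduced in auto)
  have "C.no_cut_vertex"
    unfolding C.no_cut_vertex_def
  proof (intro allI impI)
    fix z x y and P :: "'a \<times> bool \<Rightarrow> bool"
    assume z: "fst z \<in> A" and P: "\<forall>i<W.L. C.prev_letter i \<noteq> z \<longrightarrow> \<phi> s ! i \<noteq> z \<longrightarrow> P (C.prev_letter i) = P (\<phi> s ! i)"
      and xy: "fst x \<in> A" "fst y \<in> A" "x \<noteq> z" "y \<noteq> z"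
    have step: "P (inv_letter (\<phi> s ! i)) = P (\<phi> s ! (Suc i mod W.L))"
      if i: "i < W.L" "inv_letter (\<phi> s ! i) \<noteq> z" "\<phi> s ! (Suc i mod W.L) \<noteq> z" for i
    proof -
      \<comment> \<open>The two locales index an edge of the Whitehead graph by the second and by
        the first of its two letters, hence the shift.\<close>
      have "(Suc i mod W.L + W.L - 1) mod W.L = i"
        using i(1) by (cases "Suc i = W.L") auto
      then show ?thesis
        using P[rule_format, of "Suc i mod W.L"] i W.t_nonempty by simp
    qed
    have edge: "P p = P q" if "W.edge p q" "p \<noteq> z" "q \<noteq> z" for p q
      using that step unfolding W.edge_def by metis
    show "P x = P y"
      using W.edge_connected[where P = P, OF A z edge] xy by blast
  qed
  then show ?thesis
    using C.letter_occ_le_2[OF ham _ a] W.letter_occ_ge_2[OF A a] by simp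
qed

theorem theorem1p21:
  fixes n :: nat and S :: "nat word set" and s :: "nat word"
  defines "F \<equiv> free_group {1..n}"
  assumes "n \<ge> 2"
    and "finite S" and "S \<subseteq> carrier F" and "\<forall>x\<in>S. inv\<^bsub>F\<^esub> x \<in> S"
    and "generate F S = carrier F"
    and "s \<in> S"
    and "(\<forall>a\<in>{1..n}. letter_occ a s = 2) \<or> n = 2"
  shows "hamiltonian_circle_subgraph (cayley_graph F {s, inv\<^bsub>F\<^esub> s}) (cayley_graph F S) \<longleftrightarrow>
    (\<exists>\<phi>\<in>iso F F.
       \<phi> s = list_product F (map (\<lambda>i. free_gen i [^]\<^bsub>F\<^esub> (2::nat)) [1..<Suc n]) \<or>
       (even n \<and>
        \<phi> s = list_product F
          (map (\<lambda>k. commutator F (free_gen (2 * k + 1)) (free_gen (2 * k + 2))) [0..<n div 2])))"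
proof -
  have G: "group F"
    unfolding F_def by (rule group_free_group)
  have sF: "s \<in> carrier F"
    using assms(4,7) by blast
  have cayley: "free_cayley F {1..n} \<phi> S s" if "\<phi> \<in> iso F F" for \<phi>
    using assms(3-7) that G unfolding free_cayley_def free_cayley_axioms_def F_def by simp
  have g: "2 * (n div 2) \<le> n"
    by simp
  let ?ham = "hamiltonian_circle_subgraph (cayley_graph F {s, inv\<^bsub>F\<^esub> s}) (cayley_graph F S)"
  let ?std = "\<lambda>w. w = reduce (standard_squares n) \<or> even n \<and> w = reduce (standard_commutators (n div 2))"
  have "?ham \<longleftrightarrow> (\<exists>\<phi>\<in>iso F F. ?std (\<phi> s))"
  proof
    assume "\<exists>\<phi>\<in>iso F F. ?std (\<phi> s)"
    then obtain \<phi> where \<phi>: "\<phi> \<in> iso F F" "?std (\<phi> s)"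
      by blast
    interpret free_cayley F "{1..n}" \<phi> S s
      by (rule cayley[OF \<phi>(1)])
    from \<phi>(2) show ?ham
    proof (elim disjE conjE)
      assume "\<phi> s = reduce (standard_squares n)"
      then show ?ham
        unfolding standard_squares_def
        by (rule hamiltonian_squares) (use assms(2) in \<open>auto simp: comp_def image_image simp del: upt_Suc\<close>)
    next
      assume n: "even n" and \<phi>: "\<phi> s = reduce (standard_commutators (n div 2))"
      have n2: "2 * (n div 2) = n"
        using n by simp
      show ?ham
        by (rule hamiltonian_commutators[OF \<phi>[unfolded standard_commutators_def]], unfold pair_letters_standard n2)
          (use assms(2) in \<open>auto simp: comp_def image_image simp del: upt_Suc\<close>)
    qed
  next
    assume ham: ?ham
    obtain \<phi> where \<phi>: "\<phi> \<in> iso F F" "\<forall>a\<in>{1..n}. letter_occ a (\<phi> s) = 2"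
    proof (cases "\<forall>a\<in>{1..n}. letter_occ a s = 2")
      case True
      then show thesis
        using that[of "\<lambda>w. w"] by (auto simp: iso_def hom_def bij_betw_def)
    next
      case False
      then have n: "n = 2"
        using assms(8) by blast
      have "(\<lambda>w. w) \<in> iso F F"
        by (auto simp: iso_def hom_def bij_betw_def)
      from ex_has_least_nat[where P = "\<lambda>\<phi>. \<phi> \<in> iso F F" and m = "\<lambda>\<phi>. length (\<phi> s)", OF this]
      obtain \<phi> where \<phi>: "\<phi> \<in> iso F F" "\<And>\<psi>. \<psi> \<in> iso F F \<Longrightarrow> length (\<phi> s) \<le> length (\<psi> s)"
        by blast
      interpret free_cayley F "{1..n}" \<phi> S s
        by (rule cayley[OF \<phi>(1)])
      have min: "length (\<phi> s) \<le> length (\<psi> (\<phi> s))" if "\<psi> \<in> iso (free_group {1..n}) (free_group {1..n})" for \<psi>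
        using \<phi>(2)[OF iso_set_trans[OF \<phi>(1), of \<psi> F]] that by (simp add: F_def)
      have card: "card {1..n} = 2"
        by (simp add: n)
      have "letter_occ a (\<phi> s) = 2" if "a \<in> {1..n}" for a
        by (rule hamiltonian_minimal_quadratic[OF ham card that]) (rule min)
      then show thesis
        using that[OF \<phi>(1)] by blast
    qed
    have "\<phi> s \<in> carrier (free_group {1..n})"
      using \<phi>(1) sF by (auto simp: F_def iso_def hom_def)
    from quadratic_cases[OF this \<phi>(2)] obtain \<psi> where \<psi>: "\<psi> \<in> iso F F"
      "?std (\<psi> (\<phi> s)) \<or> (\<exists>a\<in>{1..n}. a \<notin> fst ` set (\<psi> (\<phi> s)))"
      unfolding F_def by metis
    have iso: "\<psi> \<circ> \<phi> \<in> iso F F"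
      by (rule iso_set_trans[OF \<phi>(1) \<psi>(1)])
    interpret free_cayley F "{1..n}" "\<psi> \<circ> \<phi>" S s
      by (rule cayley[OF iso])
    have "\<not> (\<exists>a\<in>{1..n}. a \<notin> fst ` set (\<psi> (\<phi> s)))"
      using missing_letter_not_circle ham by (auto simp del: atLeastAtMost_iff)
    then show "\<exists>\<phi>\<in>iso F F. ?std (\<phi> s)"
      using \<psi>(2) by (intro bexI[OF _ iso]) simp
  qed
  then show ?thesis
    unfolding F_def list_product_squares list_product_commutators[OF g] .
qed

end
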